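(* Let $\mathcal{A}^*$ be a simply connected Poincaré DGCA over $\mathbb{K}$ endowed with a Hodge homotopy. The Harrison cohomology class $[\mu_3]\in\mathrm{HHarr}^{3,-1}(H^*(\mathcal{A}),H^*(\mathcal{A}))$ is the first obstruction to the formality of $\mathcal{A}^*$.
   Context: $\mathbb{K}$ is a field of characteristic zero. A DGCA is a unital differential graded commutative algebra with differential $d$ of degree $+1$. A Poincaré DGCA of degree $n$ is a DGCA $(\mathcal{A}^*=\bigoplus_{k=0}^n\mathcal{A}^k,d)$ with finite-dimensional cohomology $H^*(\mathcal{A})$ and a linear functional (fundamental class) $\int: H^n(\mathcal{A})\to\mathbb{K}$ such that the pairing on $H^*(\mathcal{A})$ given on homogeneous elements by $\langle a,b\rangle=\int a\cdot b$ if $\deg a+\deg b=n$ and $0$ otherwise is non-degenerate. It induces a pairing on $\mathcal{A}^*$: $\langle\alpha,\beta\rangle=\int[\alpha\cdot\beta]$ if $\deg\alpha+\deg\beta=n$, and $0$ otherwise. Simply connected means $H^0(\mathcal{A})=\mathbb{K}$ and $H^1(\mathcal{A})=0$. $\mathcal{A}^*$ is formal if it is connected to $(H^*(\mathcal{A}),0)$ by a zig-zag of quasi-isomorphisms of DGCAs. A Hodge homotopy is a linear operator $d^-:\mathcal{A}^*\to\mathcal{A}^{*-1}$ with $d^-d^-=0$, $d^-dd^-=d^-$, $dd^-d=d$, $\langle \mathrm{Im}(d^-),\mathrm{Im}(d^-)\rangle=0$ and $\langle\mathrm{Im}(\pi_{\mathcal{H}}),\mathrm{Im}(d^-)\rangle=0$,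 where $\pi_{\mathcal{H}}:=\mathrm{id}_{\mathcal{A}^*}-(dd^-+d^-d)$ (a projection). The harmonic subspace is $\mathcal{H}^*:=\mathrm{Im}(\pi_{\mathcal{H}})$; it consists of closed elements and $\mathcal{H}^*\to H^*(\mathcal{A})$, $\alpha\mapsto[\alpha]$, is an isomorphism, with inverse denoted $\iota:H^*(\mathcal{A})\to\mathcal{H}^*\subseteq\mathcal{A}^*$. Harrison cohomology: for a graded commutative algebra $B$, $\mathrm{CHoch}^{p,q}(B,B)$ is the space of linear maps $f:B^{\otimes p}\to B$ of degree $q$, with differential $\mathrm{CHoch}^{p,q}\to\mathrm{CHoch}^{p+1,q}$ $$(d_{\mathrm{Hoch}}f)(a_1,\dots,a_{p+1})=(-1)^{q\deg a_1}a_1f(a_2,\dots,a_{p+1})+\sum_{i=1}^p(-1)^if(a_1,\dots,a_ia_{i+1},\dots,a_{p+1})+(-1)^{p+1}f(a_1,\dots,a_p)a_{p+1}.$$ $\mathrm{CHarr}^{p,q}(B,B)$ is the subcomplex of cochains vanishing on signed shuffles (for $0<i<p$, the sum over $(i,p-i)$-shuffles of $f$ applied to the shuffled arguments, with sign the product of the sign of the permutation and the Koszul sign, is zero), with differential denoted $d_{\mathrm{Harr}}$; $\mathrm{HHarr}^{p,q}(B,B)$ is its cohomology. The class $[\mu_3]$: homotopy transfer along a Hodge homotopy $d^-$ on $\mathcal{A}^*$ gives a minimal unital $C_\infty$-structure $(H^*(\mathcal{A}),\cdot,\mu_3,\mu_4,\dots)$, with binary operation the cohomology product and ternary operation $$\mu_3(a,b,c)=\big[\pi_{\mathcal{H}}\big(d^-(\iota(a)\cdot\iota(b))\cdot\iota(c)-(-1)^{\deg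 a}\iota(a)\cdot d^-(\iota(b)\cdot\iota(c))\big)\big].$$ It is a Harrison cocycle of bidegree $(3,-1)$ whose class does not depend on the choice of Hodge homotopy. "First obstruction" is meant in the usual sense of obstruction theory, for the problem of finding a $C_\infty$-isomorphism between $(H^*(\mathcal{A}),\cdot,\mu_3,\mu_4,\dots)$ and $(H^*(\mathcal{A}),\cdot)$ with all higher operations zero. The bidegree $(2,-1)$ component $\phi_2$ of such an isomorphism must satisfy $d_{\mathrm{Harr}}\phi_2=\mu_3$. When $[\mu_3]=0$, a Harrison cochain $\phi_2$ with $d_{\mathrm{Harr}}\phi_2=\mu_3$ can be used to define a $C_\infty$-isomorphism to a structure $(H^*(\mathcal{A}),\cdot,0,\tilde\mu_4,\tilde\mu_5,\dots)$ with zero ternary operation, and the class $[\tilde\mu_4]\in\mathrm{HHarr}^{4,-2}(H^*(\mathcal{A}),H^*(\mathcal{A}))$, which depends on the choice of $\phi_2$, is then the secondary obstruction. So $[\mu_3]$ is generally not the only obstruction. *)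

theory Defs
  imports Complex_Main
begin

section \<open>Graded vector spaces and DGCAs\<close>

text \<open>
  The spaces are subspaces of an ambient vector space, so that several algebras can share a type.
  The underlying space is \<open>total_space V\<close>, the internal direct sum of the \<open>gr V k\<close>;
  operations are only constrained there.
\<close>

record ('k, 'a) gspace_data =
  smul :: "'k \<Rightarrow> 'a \<Rightarrow> 'a"
  gr   :: "int \<Rightarrow> 'a set"

record ('k, 'a) gca_data = "('k, 'a) gspace_data" +
  gmul :: "'a \<Rightarrow> 'a \<Rightarrow> 'a"
  gone :: "'a"

record ('k, 'a) dgca_data = "('k, 'a) gca_data" +
  dif  :: "'a \<Rightarrow> 'a"

definition total_space :: "('k::field, 'a::ab_group_add, 'm) gspace_data_scheme \<Rightarrow> 'a set" where
  "total_space V = module.span (smul V) (\<Union>k. gr V k)"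

definition graded_linear ::
  "('k::field, 'a::ab_group_add, 'm) gspace_data_scheme \<Rightarrow>
   ('k, 'b::ab_group_add, 'n) gspace_data_scheme \<Rightarrow> int \<Rightarrow> ('a \<Rightarrow> 'b) \<Rightarrow> bool" where
  "graded_linear V W q f \<longleftrightarrow>
     (\<forall>x\<in>total_space V. \<forall>y\<in>total_space V. f (x + y) = f x + f y) \<and>
     (\<forall>c. \<forall>x\<in>total_space V. f (smul V c x) = smul W c (f x)) \<and>
     (\<forall>k. \<forall>x\<in>gr V k. f x \<in> gr W (k + q))"

locale graded_space = vector_space "smul V"
  for V :: "('k::field, 'a::ab_group_add, 'm) gspace_data_scheme" +
  assumes gr_subspace: "subspace (gr V k)"
    and gr_independent:
      "finite S \<Longrightarrow> (\<And>k. k \<in> S \<Longrightarrow> c k \<in> gr V k) \<Longrightarrow> (\<Sum>k\<in>S. c k) = 0 \<Longrightarrow> k \<in> S \<Longrightarrow> c k = 0"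

locale gca = graded_space B
  for B :: "('k::field, 'a::ab_group_add, 'm) gca_data_scheme" +
  assumes mul_add_left: "\<lbrakk>x \<in> total_space B; y \<in> total_space B; z \<in> total_space B\<rbrakk>
      \<Longrightarrow> gmul B (x + y) z = gmul B x z + gmul B y z"
    and mul_add_right: "\<lbrakk>x \<in> total_space B; y \<in> total_space B; z \<in> total_space B\<rbrakk>
      \<Longrightarrow> gmul B x (y + z) = gmul B x y + gmul B x z"
    and mul_smul_left: "\<lbrakk>x \<in> total_space B; y \<in> total_space B\<rbrakk>
      \<Longrightarrow> gmul B (smul B a x) y = smul B a (gmul B x y)"
    and mul_smul_right: "\<lbrakk>x \<in> total_space B; y \<in> total_space B\<rbrakk>
      \<Longrightarrow> gmul B x (smul B a y) = smul B a (gmul B x y)"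
    and mul_gr: "\<lbrakk>x \<in> gr B i; y \<in> gr B j\<rbrakk> \<Longrightarrow> gmul B x y \<in> gr B (i + j)"
    and mul_assoc: "\<lbrakk>x \<in> total_space B; y \<in> total_space B; z \<in> total_space B\<rbrakk>
      \<Longrightarrow> gmul B (gmul B x y) z = gmul B x (gmul B y z)"
    and one_gr: "gone B \<in> gr B 0"
    and mul_one_left: "x \<in> total_space B \<Longrightarrow> gmul B (gone B) x = x"
    and mul_one_right: "x \<in> total_space B \<Longrightarrow> gmul B x (gone B) = x"
    and mul_comm: "\<lbrakk>x \<in> gr B i; y \<in> gr B j\<rbrakk>
      \<Longrightarrow> gmul B x y = smul B ((-1) powi (i * j)) (gmul B y x)"

locale dgca = gca A
  for A :: "('k::field, 'a::ab_group_add, 'm) dgca_data_scheme" +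
  assumes dif_linear: "graded_linear A A 1 (dif A)"
    and dif_dif: "x \<in> total_space A \<Longrightarrow> dif A (dif A x) = 0"
    and leibniz: "\<lbrakk>x \<in> gr A i; y \<in> total_space A\<rbrakk>
      \<Longrightarrow> dif A (gmul A x y) = gmul A (dif A x) y + smul A ((-1) powi i) (gmul A x (dif A y))"

definition component ::
  "('k::field, 'a::ab_group_add, 'm) gspace_data_scheme \<Rightarrow> int \<Rightarrow> 'a \<Rightarrow> 'a" where
  "component V k x =
     (THE c. (\<forall>i. c i \<in> gr V i) \<and> finite {i. c i \<noteq> 0} \<and> (\<Sum>i | c i \<noteq> 0. c i) = x) k"

text \<open>
  The linear operator that is multiplication by \<open>(-1)\<^bsup>q k\<^esup>\<close> in degree \<open>k\<close>:
  the effect on an argument of moving an operation of degree \<open>q\<close> past it.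
\<close>

definition koszul ::
  "('k::field, 'a::ab_group_add, 'm) gspace_data_scheme \<Rightarrow> int \<Rightarrow> 'a \<Rightarrow> 'a" where
  "koszul V q x =
     (\<Sum>k | component V k x \<noteq> 0. smul V ((-1) powi (q * k)) (component V k x))"


section \<open>Cohomology and formality\<close>

definition cocycles :: "('k::field, 'a::ab_group_add, 'm) dgca_data_scheme \<Rightarrow> 'a set" where
  "cocycles A = {x \<in> total_space A. dif A x = 0}"

definition coboundaries :: "('k::field, 'a::ab_group_add, 'm) dgca_data_scheme \<Rightarrow> 'a set" where
  "coboundaries A = dif A ` total_space A"

text \<open>
  A cohomology algebra of \<open>A\<close> is a graded algebra \<open>H\<close> with the quotient map
  \<open>cls\<close> from cocycles to classes: surjective in each degree, compatible with all operations,
  and with the coboundaries as kernel.  So \<open>H\<close> is the quotient of cocycles by coboundaries;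
  leaving its type open lets classes be elements of a type with group operations.
\<close>

locale cohomology = dgca A + H: gca H
  for A :: "('k::field, 'a::ab_group_add) dgca_data"
    and H :: "('k, 'h::ab_group_add) gca_data"
    and cls :: "'a \<Rightarrow> 'h" +
  assumes cls_add: "\<lbrakk>x \<in> cocycles A; y \<in> cocycles A\<rbrakk> \<Longrightarrow> cls (x + y) = cls x + cls y"
    and cls_smul: "x \<in> cocycles A \<Longrightarrow> cls (smul A c x) = smul H c (cls x)"
    and cls_gr: "cls ` (cocycles A \<inter> gr A k) = gr H k"
    and cls_kernel: "x \<in> cocycles A \<Longrightarrow> cls x = 0 \<longleftrightarrow> x \<in> coboundaries A"
    and cls_mul: "\<lbrakk>x \<in> cocycles A; y \<in> cocycles A\<rbrakk> \<Longrightarrow> cls (gmul A x y) = gmul H (cls x) (cls y)"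
    and cls_one: "cls (gone A) = gone H"

definition quasi_iso ::
  "('k::field, 'a::ab_group_add) dgca_data \<Rightarrow> ('k, 'b::ab_group_add) dgca_data
   \<Rightarrow> ('a \<Rightarrow> 'b) \<Rightarrow> bool" where
  "quasi_iso A B f \<longleftrightarrow>
     dgca A \<and> dgca B \<and> graded_linear A B 0 f \<and>
     (\<forall>x\<in>total_space A. \<forall>y\<in>total_space A. f (gmul A x y) = gmul B (f x) (f y)) \<and>
     f (gone A) = gone B \<and>
     (\<forall>x\<in>total_space A. f (dif A x) = dif B (f x)) \<and>
     (\<forall>x\<in>cocycles A. f x \<in> coboundaries B \<longrightarrow> x \<in> coboundaries A) \<and>
     (\<forall>y\<in>cocycles B. \<exists>x\<in>cocycles A. y - f x \<in> coboundaries B)"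

definition qi_link ::
  "('k::field, 'a::ab_group_add) dgca_data \<Rightarrow> ('k, 'b::ab_group_add) dgca_data \<Rightarrow> bool" where
  "qi_link A B \<longleftrightarrow> (\<exists>f. quasi_iso A B f) \<or> (\<exists>g. quasi_iso B A g)"

definition zero_dif :: "('k::field, 'h::ab_group_add) gca_data \<Rightarrow> ('k, 'h) dgca_data" where
  "zero_dif H = \<lparr>smul = smul H, gr = gr H, gmul = gmul H, gone = gone H, dif = (\<lambda>_. 0)\<rparr>"

text \<open>
  Zig-zags whose intermediate algebras live in the type \<open>'b\<close>.  Any given finite zig-zag embeds
  in one such type (a direct sum), so formality as a hypothesis is expressed by leaving
  \<open>'b\<close> arbitrary.
\<close>

definition formal ::
  "'b::ab_group_add itself \<Rightarrow> ('k::field, 'a::ab_group_add) dgca_data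
   \<Rightarrow> ('k, 'h::ab_group_add) gca_data \<Rightarrow> bool" where
  "formal (T :: 'b itself) A H \<longleftrightarrow>
     (\<exists>C D :: ('k, 'b) dgca_data. qi_link A C \<and> qi_link\<^sup>*\<^sup>* C D \<and> qi_link D (zero_dif H))"


section \<open>Poincare DGCAs and Hodge homotopies\<close>

text \<open>
  Taking the component of degree \<open>n\<close> extends the pairings bilinearly from homogeneous elements,
  with value 0 when the degrees do not add up to \<open>n\<close>.
\<close>

definition coh_pairing ::
  "nat \<Rightarrow> ('k::field, 'h::ab_group_add) gca_data \<Rightarrow> ('h \<Rightarrow> 'k) \<Rightarrow> 'h \<Rightarrow> 'h \<Rightarrow> 'k" where
  "coh_pairing n H I a b = I (component H (int n) (gmul H a b))"

definition pairing ::
  "nat \<Rightarrow> ('k::field, 'a::ab_group_add) dgca_data \<Rightarrow> ('a \<Rightarrow> 'h) \<Rightarrow> ('h \<Rightarrow> 'k) \<Rightarrow> 'a \<Rightarrow> 'a \<Rightarrow> 'k" where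
  "pairing n A cls I x y = I (cls (component A (int n) (gmul A x y)))"

locale poincare_dgca = cohomology A H cls
  for n :: nat
    and A :: "('k::field, 'a::ab_group_add) dgca_data"
    and H :: "('k, 'h::ab_group_add) gca_data"
    and cls :: "'a \<Rightarrow> 'h"
    and I :: "'h \<Rightarrow> 'k" +
  assumes degrees: "k < 0 \<or> k > int n \<Longrightarrow> gr A k = {0}"
    and finite_dimensional: "\<exists>S. finite S \<and> S \<subseteq> total_space H \<and> total_space H = module.span (smul H) S"
    and integral_add: "\<lbrakk>a \<in> gr H (int n); b \<in> gr H (int n)\<rbrakk> \<Longrightarrow> I (a + b) = I a + I b"
    and integral_smul: "a \<in> gr H (int n) \<Longrightarrow> I (smul H c a) = c * I a"
    and nondegenerate_left:
      "\<lbrakk>a \<in> total_space H; \<And>b. b \<in> total_space H \<Longrightarrow> coh_pairing n H I a b = 0\<rbrakk> \<Longrightarrow> a = 0"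
    and nondegenerate_right:
      "\<lbrakk>b \<in> total_space H; \<And>a. a \<in> total_space H \<Longrightarrow> coh_pairing n H I a b = 0\<rbrakk> \<Longrightarrow> b = 0"

definition simply_connected :: "('k::field, 'h::ab_group_add) gca_data \<Rightarrow> bool" where
  "simply_connected H \<longleftrightarrow>
     gone H \<noteq> 0 \<and> gr H 0 = range (\<lambda>c. smul H c (gone H)) \<and> gr H 1 = {0}"

definition harm_proj ::
  "('k::field, 'a::ab_group_add) dgca_data \<Rightarrow> ('a \<Rightarrow> 'a) \<Rightarrow> 'a \<Rightarrow> 'a" where
  "harm_proj A h x = x - (dif A (h x) + h (dif A x))"

definition harmonic ::
  "('k::field, 'a::ab_group_add) dgca_data \<Rightarrow> ('a \<Rightarrow> 'a) \<Rightarrow> 'a set" where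
  "harmonic A h = harm_proj A h ` total_space A"

definition hodge_homotopy ::
  "nat \<Rightarrow> ('k::field, 'a::ab_group_add) dgca_data \<Rightarrow> ('a \<Rightarrow> 'h) \<Rightarrow> ('h \<Rightarrow> 'k)
   \<Rightarrow> ('a \<Rightarrow> 'a) \<Rightarrow> bool" where
  "hodge_homotopy n A cls I h \<longleftrightarrow>
     graded_linear A A (-1) h \<and>
     (\<forall>x\<in>total_space A. h (h x) = 0) \<and>
     (\<forall>x\<in>total_space A. h (dif A (h x)) = h x) \<and>
     (\<forall>x\<in>total_space A. dif A (h (dif A x)) = dif A x) \<and>
     (\<forall>x\<in>total_space A. \<forall>y\<in>total_space A. pairing n A cls I (h x) (h y) = 0) \<and>
     (\<forall>x\<in>total_space A. \<forall>y\<in>total_space A. pairing n A cls I (harm_proj A h x) (h y) = 0)"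

definition harm_rep ::
  "('k::field, 'a::ab_group_add) dgca_data \<Rightarrow> ('a \<Rightarrow> 'h) \<Rightarrow> ('a \<Rightarrow> 'a) \<Rightarrow> 'h \<Rightarrow> 'a" where
  "harm_rep A cls h = inv_into (harmonic A h) cls"


section \<open>Hochschild and Harrison cochains\<close>

text \<open>
  A linear map on the \<open>p\<close>-th tensor power is a multilinear function of lists of length \<open>p\<close>,
  made unique by the value 0 on all other lists.
\<close>

definition tensors ::
  "('k::field, 'a::ab_group_add, 'm) gspace_data_scheme \<Rightarrow> nat \<Rightarrow> 'a list set" where
  "tensors V p = {xs. length xs = p \<and> set xs \<subseteq> total_space V}"

definition on_tensors ::
  "('k::field, 'a::ab_group_add, 'm) gspace_data_scheme \<Rightarrow> nat \<Rightarrow> ('a list \<Rightarrow> 'b::zero)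
   \<Rightarrow> 'a list \<Rightarrow> 'b" where
  "on_tensors V p F xs = (if xs \<in> tensors V p then F xs else 0)"

definition hoch_maps ::
  "('k::field, 'a::ab_group_add, 'm) gspace_data_scheme
   \<Rightarrow> ('k, 'b::ab_group_add, 'n) gspace_data_scheme \<Rightarrow> nat \<Rightarrow> int \<Rightarrow> ('a list \<Rightarrow> 'b) set" where
  "hoch_maps V W p q = {f.
     (\<forall>xs. xs \<notin> tensors V p \<longrightarrow> f xs = 0) \<and>
     (\<forall>xs\<in>tensors V p. \<forall>i<p. \<forall>x\<in>total_space V. \<forall>y\<in>total_space V.
        f (xs[i := x + y]) = f (xs[i := x]) + f (xs[i := y])) \<and>
     (\<forall>xs\<in>tensors V p. \<forall>i<p. \<forall>c. \<forall>x\<in>total_space V.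
        f (xs[i := smul V c x]) = smul W c (f (xs[i := x]))) \<and>
     (\<forall>ks xs. length ks = p \<and> list_all2 (\<lambda>k x. x \<in> gr V k) ks xs \<longrightarrow>
        f xs \<in> gr W (sum_list ks + q))}"

text \<open>
  \<open>js\<close> lists the positions \<open>0, ..., p - 1\<close> in shuffled order and \<open>ks\<close> the degrees of the
  unshuffled arguments; each inversion contributes to the sign of the permutation and
  to the Koszul sign.
\<close>

definition shuffle_sign :: "int list \<Rightarrow> nat list \<Rightarrow> 'k::field" where
  "shuffle_sign ks js =
     (\<Prod>(r, s) \<in> {(r, s). r < s \<and> s < length js \<and> js ! s < js ! r}.
        (-1) powi (1 + ks ! (js ! r) * ks ! (js ! s)))"

definition harr_maps ::
  "('k::field, 'a::ab_group_add, 'm) gspace_data_scheme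
   \<Rightarrow> ('k, 'b::ab_group_add, 'n) gspace_data_scheme \<Rightarrow> nat \<Rightarrow> int \<Rightarrow> ('a list \<Rightarrow> 'b) set" where
  "harr_maps V W p q = {f \<in> hoch_maps V W p q.
     \<forall>i ks xs. 0 < i \<and> i < p \<and> length ks = p \<and> list_all2 (\<lambda>k x. x \<in> gr V k) ks xs \<longrightarrow>
       (\<Sum>js \<in> shuffles [0..<i] [i..<p].
          smul W (shuffle_sign ks js) (f (map (\<lambda>j. xs ! j) js))) = 0}"

abbreviation CHarr ::
  "('k::field, 'a::ab_group_add, 'm) gca_data_scheme \<Rightarrow> nat \<Rightarrow> int \<Rightarrow> ('a list \<Rightarrow> 'a) set" where
  "CHarr B p q \<equiv> harr_maps B B p q"

text \<open>The differential on cochains of bidegree \<open>(p, q)\<close>; list positions start at 0.\<close>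

definition hoch_d ::
  "('k::field, 'a::ab_group_add, 'm) gca_data_scheme \<Rightarrow> nat \<Rightarrow> int \<Rightarrow> ('a list \<Rightarrow> 'a)
   \<Rightarrow> 'a list \<Rightarrow> 'a" where
  "hoch_d B p q f = on_tensors B (p + 1) (\<lambda>xs.
     gmul B (koszul B q (hd xs)) (f (tl xs))
     + (\<Sum>i=1..p. smul B ((-1) ^ i)
          (f (take (i - 1) xs @ [gmul B (xs ! (i - 1)) (xs ! i)] @ drop (i + 1) xs)))
     + smul B ((-1) ^ (p + 1)) (gmul B (f (take p xs)) (last xs)))"

definition harr_cocycles ::
  "('k::field, 'a::ab_group_add, 'm) gca_data_scheme \<Rightarrow> nat \<Rightarrow> int \<Rightarrow> ('a list \<Rightarrow> 'a) set" where
  "harr_cocycles B p q = {f \<in> CHarr B p q. hoch_d B p q f = (\<lambda>_. 0)}"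

definition harr_coboundaries ::
  "('k::field, 'a::ab_group_add, 'm) gca_data_scheme \<Rightarrow> nat \<Rightarrow> int \<Rightarrow> ('a list \<Rightarrow> 'a) set" where
  "harr_coboundaries B p q =
     (if p = 0 then {\<lambda>_. 0} else hoch_d B (p - 1) q ` CHarr B (p - 1) q)"

definition harr_rel ::
  "('k::field, 'a::ab_group_add, 'm) gca_data_scheme \<Rightarrow> nat \<Rightarrow> int
   \<Rightarrow> (('a list \<Rightarrow> 'a) \<times> ('a list \<Rightarrow> 'a)) set" where
  "harr_rel B p q = {(f, g). f \<in> harr_cocycles B p q \<and> g \<in> harr_cocycles B p q \<and>
     (\<lambda>xs. f xs - g xs) \<in> harr_coboundaries B p q}"

definition HHarr ::
  "('k::field, 'a::ab_group_add, 'm) gca_data_scheme \<Rightarrow> nat \<Rightarrow> int \<Rightarrow> ('a list \<Rightarrow> 'a) set set" where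
  "HHarr B p q = harr_cocycles B p q // harr_rel B p q"

definition harr_class ::
  "('k::field, 'a::ab_group_add, 'm) gca_data_scheme \<Rightarrow> nat \<Rightarrow> int \<Rightarrow> ('a list \<Rightarrow> 'a)
   \<Rightarrow> ('a list \<Rightarrow> 'a) set" where
  "harr_class B p q f = harr_rel B p q `` {f}"

definition mul_cochain ::
  "('k::field, 'a::ab_group_add, 'm) gca_data_scheme \<Rightarrow> 'a list \<Rightarrow> 'a" where
  "mul_cochain B = on_tensors B 2 (\<lambda>xs. gmul B (xs ! 0) (xs ! 1))"


section \<open>Minimal C-infinity algebras\<close>

text \<open>
  A structure is a family \<open>m n\<close>, \<open>n \<ge> 2\<close>, of operations of degree \<open>2 - n\<close>;
  the unary operation is zero and \<open>m 0\<close>, \<open>m 1\<close> are ignored.  Signs: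
  \<open>\<Sum> (-1)\<^bsup>r + s t\<^esup> m\<^bsub>r+1+t\<^esub> (1\<^bsup>r\<^esup> \<otimes> m\<^bsub>s\<^esub> \<otimes> 1\<^bsup>t\<^esup>) = 0\<close> over \<open>r + s + t = n\<close>, with the Koszul rule.
\<close>

definition insert_op ::
  "('k::field, 'a::ab_group_add, 'm) gspace_data_scheme
   \<Rightarrow> ('k, 'b::ab_group_add, 'n) gspace_data_scheme
   \<Rightarrow> (nat \<Rightarrow> 'a list \<Rightarrow> 'b) \<Rightarrow> (nat \<Rightarrow> 'a list \<Rightarrow> 'a) \<Rightarrow> nat \<Rightarrow> nat \<Rightarrow> 'a list \<Rightarrow> 'b" where
  "insert_op V W f m r s xs =
     (let n = length xs; t = n - r - s in
      smul W ((-1) ^ (r + s * t))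
        (f (r + 1 + t)
          (map (koszul V (2 - int s)) (take r xs) @ [m s (take s (drop r xs))] @ drop (r + s) xs)))"

definition cinf_algebra ::
  "('k::field, 'a::ab_group_add, 'm) gspace_data_scheme \<Rightarrow> (nat \<Rightarrow> 'a list \<Rightarrow> 'a) \<Rightarrow> bool" where
  "cinf_algebra V m \<longleftrightarrow>
     (\<forall>n\<ge>2. m n \<in> harr_maps V V n (2 - int n)) \<and>
     (\<forall>n\<ge>3. \<forall>xs\<in>tensors V n.
        (\<Sum>s=2..n-1. \<Sum>r=0..n-s. insert_op V V m m r s xs) = 0)"

definition cinf_unital ::
  "('k::field, 'a::ab_group_add, 'm) gca_data_scheme \<Rightarrow> (nat \<Rightarrow> 'a list \<Rightarrow> 'a) \<Rightarrow> bool" where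
  "cinf_unital B m \<longleftrightarrow>
     (\<forall>x\<in>total_space B. m 2 [gone B, x] = x \<and> m 2 [x, gone B] = x) \<and>
     (\<forall>n\<ge>3. \<forall>xs\<in>tensors B n. gone B \<in> set xs \<longrightarrow> m n xs = 0)"

definition strict_cinf ::
  "('k::field, 'a::ab_group_add, 'm) gca_data_scheme \<Rightarrow> nat \<Rightarrow> 'a list \<Rightarrow> 'a" where
  "strict_cinf B n = (if n = 2 then mul_cochain B else (\<lambda>_. 0))"

text \<open>
  \<open>tensor_apply V \<phi> [i\<^sub>1, ..., i\<^sub>r]\<close> is \<open>\<phi>\<^bsub>i1\<^esub> \<otimes> \<dots> \<otimes> \<phi>\<^bsub>ir\<^esub>\<close>, where \<open>\<phi>\<^bsub>i\<^esub>\<close> has degree \<open>1 - i\<close>: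
  every argument picks up the Koszul sign of the maps standing to the right of its block.
\<close>

fun tensor_apply ::
  "('k::field, 'a::ab_group_add, 'm) gspace_data_scheme \<Rightarrow> (nat \<Rightarrow> 'a list \<Rightarrow> 'b)
   \<Rightarrow> nat list \<Rightarrow> 'a list \<Rightarrow> 'b list" where
  "tensor_apply V \<phi> [] xs = []"
| "tensor_apply V \<phi> (i # js) xs =
     \<phi> i (map (koszul V (\<Sum>j\<leftarrow>js. 1 - int j)) (take i xs)) # tensor_apply V \<phi> js (drop i xs)"

text \<open>The exponent \<open>(r - 1)(i\<^sub>1 - 1) + (r - 2)(i\<^sub>2 - 1) + \<dots> + (i\<^bsub>r-1\<^esub> - 1)\<close>.\<close>

fun block_exponent :: "nat list \<Rightarrow> nat" where
  "block_exponent [] = 0"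
| "block_exponent (i # js) = length js * (i - 1) + block_exponent js"

definition cinf_morphism ::
  "('k::field, 'a::ab_group_add, 'm) gspace_data_scheme \<Rightarrow> (nat \<Rightarrow> 'a list \<Rightarrow> 'a)
   \<Rightarrow> ('k, 'b::ab_group_add, 'n) gspace_data_scheme \<Rightarrow> (nat \<Rightarrow> 'b list \<Rightarrow> 'b)
   \<Rightarrow> (nat \<Rightarrow> 'a list \<Rightarrow> 'b) \<Rightarrow> bool" where
  "cinf_morphism V m W m' \<phi> \<longleftrightarrow>
     (\<forall>n\<ge>1. \<phi> n \<in> harr_maps V W n (1 - int n)) \<and>
     (\<forall>n\<ge>2. \<forall>xs\<in>tensors V n.
        (\<Sum>s=2..n. \<Sum>r=0..n-s. insert_op V W \<phi> m r s xs) =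
        (\<Sum>js | sum_list js = n \<and> 0 \<notin> set js \<and> 2 \<le> length js.
           smul W ((-1) ^ block_exponent js) (m' (length js) (tensor_apply V \<phi> js xs))))"

definition cinf_isomorphism ::
  "('k::field, 'a::ab_group_add, 'm) gspace_data_scheme \<Rightarrow> (nat \<Rightarrow> 'a list \<Rightarrow> 'a)
   \<Rightarrow> ('k, 'b::ab_group_add, 'n) gspace_data_scheme \<Rightarrow> (nat \<Rightarrow> 'b list \<Rightarrow> 'b)
   \<Rightarrow> (nat \<Rightarrow> 'a list \<Rightarrow> 'b) \<Rightarrow> bool" where
  "cinf_isomorphism V m W m' \<phi> \<longleftrightarrow>
     cinf_morphism V m W m' \<phi> \<and> bij_betw (\<lambda>x. \<phi> 1 [x]) (total_space V) (total_space W)"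


section \<open>Homotopy transfer\<close>

text \<open>
  The sum over planar binary trees, organised by the two subtrees at the root.
  \<open>transfer_q\<close> is the component (of degree \<open>1 - n\<close> on \<open>n\<close> arguments) of the resulting
  morphism from cohomology to \<open>A\<close>; a tree with root product \<open>transfer_p\<close> continues with \<open>- h\<close>
  on an internal edge and with the harmonic projection at the root.
\<close>

function transfer_q ::
  "('k::field, 'a::ab_group_add) dgca_data \<Rightarrow> ('k, 'h::ab_group_add) gca_data \<Rightarrow> ('a \<Rightarrow> 'h)
   \<Rightarrow> ('a \<Rightarrow> 'a) \<Rightarrow> 'h list \<Rightarrow> 'a" where
  "transfer_q A H cls h xs =
     (if length xs \<le> 1 then harm_rep A cls h (hd xs)
      else - h (\<Sum>k=1..<length xs. smul A ((-1) ^ (k - 1))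
             (gmul A
               (transfer_q A H cls h
                  (map (koszul H (1 - int (length xs - k))) (take k xs)))
               (transfer_q A H cls h (drop k xs)))))"
  by pat_completeness auto
termination
  by (relation "measure (\<lambda>(A, H, cls, h, xs). length xs)") auto

declare transfer_q.simps [simp del]

definition transfer_p ::
  "('k::field, 'a::ab_group_add) dgca_data \<Rightarrow> ('k, 'h::ab_group_add) gca_data \<Rightarrow> ('a \<Rightarrow> 'h)
   \<Rightarrow> ('a \<Rightarrow> 'a) \<Rightarrow> 'h list \<Rightarrow> 'a" where
  "transfer_p A H cls h xs =
     (\<Sum>k=1..<length xs. smul A ((-1) ^ (k - 1))
        (gmul A
          (transfer_q A H cls h (map (koszul H (1 - int (length xs - k))) (take k xs)))
          (transfer_q A H cls h (drop k xs))))"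

definition transferred ::
  "('k::field, 'a::ab_group_add) dgca_data \<Rightarrow> ('k, 'h::ab_group_add) gca_data \<Rightarrow> ('a \<Rightarrow> 'h)
   \<Rightarrow> ('a \<Rightarrow> 'a) \<Rightarrow> nat \<Rightarrow> 'h list \<Rightarrow> 'h" where
  "transferred A H cls h n =
     on_tensors H n (\<lambda>xs. cls (harm_proj A h (transfer_p A H cls h xs)))"

definition mu3 ::
  "('k::field, 'a::ab_group_add) dgca_data \<Rightarrow> ('k, 'h::ab_group_add) gca_data \<Rightarrow> ('a \<Rightarrow> 'h)
   \<Rightarrow> ('a \<Rightarrow> 'a) \<Rightarrow> 'h list \<Rightarrow> 'h" where
  "mu3 A H cls h = on_tensors H 3 (\<lambda>xs.
     (let a = xs ! 0; b = xs ! 1; c = xs ! 2; \<iota> = harm_rep A cls h in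
      cls (harm_proj A h
        (gmul A (h (gmul A (\<iota> a) (\<iota> b))) (\<iota> c)
         - gmul A (\<iota> (koszul H 1 a)) (h (gmul A (\<iota> b) (\<iota> c)))))))"

end

theory Submission
  imports Defs "HOL-Library.Product_Plus"
begin

text \<open>
  After suspension all structures live on the shuffle bialgebra of words in \<open>H\<close>:
  a \<open>C\<^bsub>\<infinity>\<^esub>\<close>-structure is a coderivation of square zero that is also a derivation of the shuffle
  product, and a \<open>C\<^bsub>\<infinity>\<^esub>\<close>-morphism to a DGCA \<open>C\<close> is a Maurer-Cartan element in the convolution
  algebra of \<open>C\<close>-valued functions on words that vanishes on shuffles.  The transferred structure comes
  with such an element for \<open>A\<close>.  Maurer-Cartan elements are pushed forward along DGCA morphisms and,
  up to gauge transformations, lifted along quasi-isomorphisms by obstruction theory.  Carrying the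
  element for \<open>A\<close> along a zig-zag to \<open>(H, 0)\<close> therefore produces a \<open>C\<^bsub>\<infinity>\<^esub>\<close>-isomorphism from the
  transferred structure to the strict one; its equations in low arities say that \<open>\<mu>\<^sub>3\<close> is a coboundary.
  Conversely, a cochain \<open>\<phi>\<^sub>2\<close> with coboundary \<open>\<mu>\<^sub>3\<close> gives the automorphism \<open>(id, \<phi>\<^sub>2, 0, \<dots>)\<close> of the
  word coalgebra, and conjugation by it yields the structure without ternary operation.
\<close>

text \<open>What the overview leaves open is how signs and the Harrison condition stay under
  control. Each letter carries its degree, so Koszul signs are explicit functions of words, and the
  word coalgebra itself is never built: coderivations, coalgebra morphisms and shuffle products are
  given by their action on arbitrary functions of words. Suspension turns an operation of degree
  \<open>2 - n\<close> into a component of degree one; \<open>del\<close> accounts for the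
  difference in signs. The obstacle is that every construction must keep functions multilinear and
  vanishing on shuffles. In the obstruction theory this forces the choices of preimages to be linear
  maps, because these commute with shuffle sums. Gauge transformations must be by multiplicative
  functions; the exponential that produces one from a primitive function divides by word lengths,
  hence characteristic zero. Finally, the algebras are subspaces of ambient types while the word
  calculus wants laws without membership conditions; linear projections onto the subspaces bridge
  this gap.\<close>

definition sg :: "int \<Rightarrow> 'a::ab_group_add \<Rightarrow> 'a" where
  "sg n x = (if even n then x else - x)"

lemma sg_even [simp]: "even n \<Longrightarrow> sg n x = x"
  by (simp add: sg_def)

lemma sg_odd: "odd n \<Longrightarrow> sg n x = - x"
  by (simp add: sg_def)

lemma sg_0 [simp]: "sg 0 x = x" and sg_1 [simp]: "sg 1 x = - x"
  by (simp_all add: sg_def)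

lemma sg_zero [simp]: "sg n 0 = 0"
  by (simp add: sg_def)

lemma sg_eq_0_iff [simp]: "sg n x = 0 \<longleftrightarrow> x = 0"
  by (simp add: sg_def)

lemma sg_sg [simp]: "sg m (sg n x) = sg (m + n) x"
  by (simp add: sg_def)

lemma sg_add: "sg n (x + y) = sg n x + sg n y"
  by (simp add: sg_def)

lemma sg_minus: "sg n (- x) = - sg n x"
  by (simp add: sg_def)

lemma sg_diff: "sg n (x - y) = sg n x - sg n y"
  by (simp add: sg_def)

lemma sg_sum: "sg n (sum f S) = (\<Sum>i\<in>S. sg n (f i))"
  by (simp add: sg_def sum_negf)

lemma sg_cong: "even m \<longleftrightarrow> even n \<Longrightarrow> sg m x = sg n x"
  by (simp add: sg_def)

lemma sg_plus1: "sg (n + 1) x = - sg n x"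
  by (simp add: sg_def)

lemma sg_hom:
  fixes f :: "'a::ab_group_add \<Rightarrow> 'b::ab_group_add"
  assumes "\<And>x y. f (x + y) = f x + f y"
  shows "f (sg n x) = sg n (f x)"
proof -
  interpret additive f by (rule additive.intro, rule assms)
  show ?thesis by (simp add: sg_def minus)
qed

section \<open>Words, deconcatenation and coderivations\<close>

text \<open>Letters store their degree before suspension, whereas signs are computed with the degree
  after it; hence the \<open>- 1\<close>.\<close>

primrec deg :: "(int \<times> 'h) list \<Rightarrow> int" where
  "deg [] = 0"
| "deg (a # w) = fst a - 1 + deg w"

lemma deg_append [simp]: "deg (u @ v) = deg u + deg v"
  by (induction u) auto

text \<open>The transpose of the deconcatenation coproduct; \<open>dec_assoc\<close> is its
  coassociativity. Empty pieces are included, so reduced versions have to exclude them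
  explicitly.\<close>

primrec dec :: "('x list \<Rightarrow> 'x list \<Rightarrow> 'b::ab_group_add) \<Rightarrow> 'x list \<Rightarrow> 'b" where
  "dec H [] = H [] []"
| "dec H (a # w) = H [] (a # w) + dec (\<lambda>u v. H (a # u) v) w"

lemma dec_cong:
  "(\<And>u v. w = u @ v \<Longrightarrow> H u v = K u v) \<Longrightarrow> dec H w = dec K w"
proof (induction w arbitrary: H K)
  case (Cons a w)
  have "dec (\<lambda>u v. H (a # u) v) w = dec (\<lambda>u v. K (a # u) v) w"
    by (rule Cons.IH) (simp add: Cons.prems)
  then show ?case using Cons.prems[of "[]"] by simp
qed simp

lemma dec_add: "dec (\<lambda>u v. H u v + K u v) w = dec H w + dec K w"
  by (induction w arbitrary: H K) (auto simp: algebra_simps)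

lemma dec_hom:
  fixes f :: "'a::ab_group_add \<Rightarrow> 'b::ab_group_add"
  assumes "\<And>x y. f (x + y) = f x + f y"
  shows "f (dec H w) = dec (\<lambda>u v. f (H u v)) w"
  by (induction w arbitrary: H) (auto simp: assms)

lemma dec_sg: "dec (\<lambda>u v. sg n (H u v)) w = sg n (dec H w)"
  by (rule dec_hom[symmetric]) (rule sg_add)

lemma dec_minus: "dec (\<lambda>u v. - H u v) w = - dec H w"
  by (rule dec_hom[symmetric]) simp

lemma dec_0 [simp]: "dec (\<lambda>u v. 0) w = 0"
  by (induction w) auto

lemma dec_0I: "(\<And>u v. w = u @ v \<Longrightarrow> H u v = 0) \<Longrightarrow> dec H w = 0"
  using dec_cong[of w H "\<lambda>u v. 0"] by simp

lemma dec_assoc: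
  "dec (\<lambda>u v. dec (H u) v) w = dec (\<lambda>u v. dec (\<lambda>x y. H x y v) u) w"
proof (induction w arbitrary: H)
  case (Cons a w)
  then show ?case by (simp add: dec_add)
qed simp

lemma dec_sum: "dec H w = (\<Sum>i\<le>length w. H (take i w) (drop i w))"
proof (induction w arbitrary: H)
  case (Cons a w)
  show ?case
    by (simp add: Cons sum.atMost_Suc_shift del: sum.atMost_Suc)
qed simp

lemma dec_split_Nil: "dec H w = H [] w + dec (\<lambda>u v. if u = [] then 0 else H u v) w"
  by (cases w) auto

lemma dec_split_last: "dec H w = H w [] + dec (\<lambda>u v. if v = [] then 0 else H u v) w"
proof (induction w arbitrary: H)
  case (Cons a w)
  show ?case using Cons[of "\<lambda>u. H (a # u)"] by (simp add: algebra_simps)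
qed simp

lemma dec_mem:
  assumes "\<And>x y. x \<in> S \<Longrightarrow> y \<in> S \<Longrightarrow> x + y \<in> S" "\<And>u v. w = u @ v \<Longrightarrow> H u v \<in> S"
  shows "dec H w \<in> S"
  using assms(2)
proof (induction w arbitrary: H)
  case (Cons a w)
  have "dec (\<lambda>u v. H (a # u) v) w \<in> S"
    by (rule Cons.IH) (simp add: Cons.prems)
  then show ?case using Cons.prems[of "[]"] by (simp add: assms(1))
qed simp

text \<open>
  \<open>ins e l F\<close> is \<open>F\<close> composed with the coderivation of degree \<open>e\<close> that replaces a subword
  \<open>v\<close> by the letter \<open>l v\<close>.
\<close>

primrec ins :: "int \<Rightarrow> ((int \<times> 'h) list \<Rightarrow> int \<times> 'h) \<Rightarrow> ((int \<times> 'h) list \<Rightarrow> 'b::ab_group_add)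
    \<Rightarrow> (int \<times> 'h) list \<Rightarrow> 'b" where
  "ins e l F [] = F [l []]"
| "ins e l F (a # w) =
     dec (\<lambda>v z. F (l v # z)) (a # w) + sg (e * (fst a - 1)) (ins e l (\<lambda>w. F (a # w)) w)"

text \<open>The offset \<open>c\<close> encodes the degree of the operation that produces the
  letter: suspended degree \<open>c - 1\<close>. Thus \<open>lt 2\<close> belongs to structures of
  degree one and \<open>lt 3\<close> to their squares.\<close>

definition lt :: "int \<Rightarrow> ((int \<times> 'h) list \<Rightarrow> 'h) \<Rightarrow> (int \<times> 'h) list \<Rightarrow> int \<times> 'h" where
  "lt c f v = (deg v + c, f v)"

lemma fst_lt [simp]: "fst (lt c f v) = deg v + c"
  by (simp add: lt_def)

definition Dop :: "((int \<times> 'h) list \<Rightarrow> 'h) \<Rightarrow> ((int \<times> 'h) list \<Rightarrow> 'b::ab_group_add)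
    \<Rightarrow> (int \<times> 'h) list \<Rightarrow> 'b" where
  "Dop b = ins 1 (lt 2 b)"

lemma Dop_Nil: "Dop b F [] = F [lt 2 b []]"
  by (simp add: Dop_def)

lemma Dop_Cons: "Dop b F (a # w) =
    dec (\<lambda>v z. F (lt 2 b v # z)) (a # w) + sg (fst a - 1) (Dop b (\<lambda>w. F (a # w)) w)"
  by (simp add: Dop_def del: dec.simps)

lemma ins_dec:
  "ins e l F w = dec (\<lambda>u w. dec (\<lambda>v z. sg (e * deg u) (F (u @ l v # z))) w) w"
proof (induction w arbitrary: F)
  case (Cons a w)
  have "dec (\<lambda>u w. dec (\<lambda>v z. sg (e * deg (a # u)) (F (a # u @ l v # z))) w) w
      = sg (e * (fst a - 1)) (dec (\<lambda>u w. dec (\<lambda>v z. sg (e * deg u) (F (a # u @ l v # z))) w) w)"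
    by (simp add: dec_sg[symmetric] algebra_simps)
  then show ?case by (simp add: Cons[of "\<lambda>w. F (a # w)"] algebra_simps)
qed simp

lemma Dop_add: "Dop b (\<lambda>w. F w + G w) w = Dop b F w + Dop b G w"
  by (simp add: Dop_def ins_dec sg_add dec_add)

lemma Dop_hom:
  fixes f :: "'a::ab_group_add \<Rightarrow> 'b::ab_group_add"
  assumes "\<And>x y. f (x + y) = f x + f y"
  shows "f (Dop b F w) = Dop b (\<lambda>w. f (F w)) w"
proof -
  have "\<And>n x. f (sg n x) = sg n (f x)" using assms by (rule sg_hom)
  then show ?thesis by (simp add: Dop_def ins_dec dec_hom[of f] assms)
qed

lemma Dop_sg: "Dop b (\<lambda>w. sg n (F w)) w = sg n (Dop b F w)"
  by (rule Dop_hom[symmetric]) (rule sg_add)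

lemma Dop_minus: "Dop b (\<lambda>w. - F w) w = - Dop b F w"
  by (rule Dop_hom[symmetric]) simp

lemma Dop_0 [simp]: "Dop b (\<lambda>w. 0) w = 0"
  by (simp add: Dop_def ins_dec)

lemma Dop_cong:
  assumes "\<And>w'. deg w' = deg w + 1 \<Longrightarrow> w' \<noteq> [] \<Longrightarrow> F w' = G w'"
  shows "Dop b F w = Dop b G w"
  unfolding Dop_def ins_dec by (intro dec_cong arg_cong[of _ _ "sg _"] assms) auto

text \<open>The coderivation property in transposed form: a cut of a word with an inserted letter
  leaves that letter on one side, and if it is the right side, the odd operator has passed
  \<open>u\<close>.\<close>

lemma Dop_dec:
  "Dop b (dec H) w = dec (\<lambda>u v. Dop b (\<lambda>u'. H u' v) u + sg (deg u) (Dop b (H u) v)) w"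
proof (induction w arbitrary: H)
  case Nil
  show ?case by (simp add: Dop_Nil)
next
  case (Cons a w)
  let ?K = "\<lambda>F. dec (\<lambda>v z. F (lt 2 b v # z))"
  have "?K (dec H) (a # w)
      = dec (\<lambda>v z. H [] (lt 2 b v # z) + dec (\<lambda>z1. H (lt 2 b v # z1)) z) (a # w)"
    by (rule dec_cong) simp
  then have K: "?K (dec H) (a # w)
      = ?K (H []) (a # w) + dec (\<lambda>u v. ?K (\<lambda>u'. H u' v) u) (a # w)"
    by (simp only: dec_add dec_assoc[of "\<lambda>v z1. H (lt 2 b v # z1)"])
  have T: "Dop b (\<lambda>w. dec H (a # w)) w
      = Dop b (\<lambda>w. H [] (a # w)) w
        + dec (\<lambda>u v. Dop b (\<lambda>u'. H (a # u') v) u + sg (deg u) (Dop b (H (a # u)) v)) w"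
    by (simp add: Dop_add Cons.IH)
  show ?case
    unfolding Dop_Cons K T
    by (simp add: Dop_Nil Dop_Cons dec_add sg_add dec_sg[symmetric] algebra_simps)
qed

section \<open>Multilinear functions on words\<close>

text \<open>Linearity is asked in the whole ambient type and for every label \<open>k\<close>; a
  letter need not lie in the degree that its label names. This avoids side conditions in the word
  calculus.\<close>

definition mlin :: "('k::field \<Rightarrow> 'h::ab_group_add \<Rightarrow> 'h) \<Rightarrow> ('k \<Rightarrow> 'b::ab_group_add \<Rightarrow> 'b)
    \<Rightarrow> ((int \<times> 'h) list \<Rightarrow> 'b) \<Rightarrow> bool" where
  "mlin s t F \<longleftrightarrow>
     (\<forall>u k v x y. F (u @ (k, x + y) # v) = F (u @ (k, x) # v) + F (u @ (k, y) # v)) \<and>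
     (\<forall>u k v c x. F (u @ (k, s c x) # v) = t c (F (u @ (k, x) # v)))"

lemma mlin_add: "mlin s t F \<Longrightarrow> F (u @ (k, x + y) # v) = F (u @ (k, x) # v) + F (u @ (k, y) # v)"
  and mlin_scale: "mlin s t F \<Longrightarrow> F (u @ (k, s c x) # v) = t c (F (u @ (k, x) # v))"
  by (simp_all add: mlin_def)

lemma mlin_add_hd: "mlin s t F \<Longrightarrow> F ((k, x + y) # v) = F ((k, x) # v) + F ((k, y) # v)"
  and mlin_scale_hd: "mlin s t F \<Longrightarrow> F ((k, s c x) # v) = t c (F ((k, x) # v))"
  using mlin_add[of s t F "[]"] mlin_scale[of s t F "[]"] by auto

lemma mlin_zero: "mlin s t F \<Longrightarrow> F (u @ (k, 0) # v) = 0"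
  using mlin_add[of s t F u k 0 0 v] by simp

lemma mlin_zero_hd: "mlin s t F \<Longrightarrow> F ((k, 0) # v) = 0"
  using mlin_zero[of s t F "[]"] by simp

lemma mlin_Cons: "mlin s t F \<Longrightarrow> mlin s t (\<lambda>w. F (a # w))"
  unfolding mlin_def using append_Cons[of a] by metis

lemma mlin_append: "mlin s t F \<Longrightarrow> mlin s t (\<lambda>w. F (u @ w))"
  by (induction u arbitrary: F) (auto dest: mlin_Cons)

lemma mlin_append_right:
  assumes "mlin s t F" shows "mlin s t (\<lambda>w. F (w @ v))"
  using assms unfolding mlin_def append_assoc append_Cons by blast

text \<open>Components see at least two letters, so inserting one shortens the word; shorter inputs
  of \<open>b\<close> give a zero letter, which multilinearity kills. All inductions on word length
  rest on this.\<close>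

lemma Dop_cong_short:
  assumes b: "\<And>w. length w < 2 \<Longrightarrow> b w = 0" and "mlin s t F" "mlin s t G"
    and "\<And>w'. length w' < length w \<Longrightarrow> w' \<noteq> [] \<Longrightarrow> F w' = G w'"
  shows "Dop b F w = Dop b G w"
  using assms(2-4)
proof (induction w arbitrary: F G)
  case Nil
  then show ?case by (simp add: Dop_Nil lt_def b mlin_zero_hd)
next
  case (Cons a w)
  have "F (lt 2 b v # z) = G (lt 2 b v # z)" if "a # w = v @ z" for v z
  proof (cases "length v < 2")
    case True
    then show ?thesis by (simp add: lt_def b mlin_zero_hd[OF Cons.prems(1)] mlin_zero_hd[OF Cons.prems(2)])
  next
    case False
    have "length (a # w) = length v + length z" by (simp only: that length_append)
    with False show ?thesis by (intro Cons.prems(3)) auto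
  qed
  then have "dec (\<lambda>v z. F (lt 2 b v # z)) (a # w) = dec (\<lambda>v z. G (lt 2 b v # z)) (a # w)"
    by (intro dec_cong)
  moreover have "Dop b (\<lambda>w. F (a # w)) w = Dop b (\<lambda>w. G (a # w)) w"
    using Cons.prems by (intro Cons.IH mlin_Cons) auto
  ultimately show ?case by (simp add: Dop_Cons del: dec.simps)
qed

lemma Dop_fst:
  assumes "mlin s t F"
  shows "Dop b (\<lambda>u'. F ((deg u' + c, f u') # v)) u = F ((deg u + 1 + c, Dop b f u) # v)"
proof -
  have "Dop b (\<lambda>u'. F ((deg u' + c, f u') # v)) u = Dop b (\<lambda>u'. F ((deg u + 1 + c, f u') # v)) u"
    by (rule Dop_cong) simp
  also have "\<dots> = F ((deg u + 1 + c, Dop b f u) # v)"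
    by (rule Dop_hom[symmetric]) (rule mlin_add_hd[OF assms])
  finally show ?thesis .
qed

text \<open>Insertions at disjoint places occur in both orders and cancel because the operator is
  odd. Nested insertions remain, and they form the coderivation with components
  \<open>Dop b b\<close>.\<close>

lemma Dop_Dop:
  assumes "mlin s t F"
  shows "Dop b (Dop b F) w = ins 0 (lt 3 (Dop b b)) F w"
  using assms
proof (induction w arbitrary: F)
  case Nil
  show ?case by (simp add: Dop_Nil Dop_Cons) (simp add: lt_def Dop_Nil sg_odd)
next
  case (Cons a w)
  let ?K = "\<lambda>F. dec (\<lambda>v z. F (lt 2 b v # z))"
  have hd: "Dop b F (c # w) = ?K F (c # w) + sg (fst c - 1) (Dop b (\<lambda>w. F (c # w)) w)" for c w
    by (simp add: Dop_Cons del: dec.simps)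
  have "Dop b (Dop b F) (a # w) =
      ?K (Dop b F) (a # w) + sg (fst a - 1) (Dop b (\<lambda>w. Dop b F (a # w)) w)"
    by (rule Dop_Cons)
  also have "Dop b (\<lambda>w. Dop b F (a # w)) w =
      Dop b (\<lambda>w. ?K F (a # w)) w + sg (fst a - 1) (Dop b (Dop b (\<lambda>w. F (a # w))) w)"
    unfolding hd by (simp only: Dop_add Dop_sg)
  also have "Dop b (Dop b (\<lambda>w. F (a # w))) w = ins 0 (lt 3 (Dop b b)) (\<lambda>w. F (a # w)) w"
    by (rule Cons.IH[OF mlin_Cons[OF Cons.prems]])
  also have "?K (Dop b F) (a # w) =
      ?K (?K F) (a # w) + dec (\<lambda>v z. sg (deg v + 1) (Dop b (\<lambda>w. F (lt 2 b v # w)) z)) (a # w)"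
    unfolding hd dec_add by simp
  finally have 1: "Dop b (Dop b F) (a # w) =
      Dop b (?K F) (a # w)
      + dec (\<lambda>v z. sg (deg v + 1) (Dop b (\<lambda>w. F (lt 2 b v # w)) z)) (a # w)
      + ins 0 (lt 3 (Dop b b)) (\<lambda>w. F (a # w)) w"
    by (simp add: Dop_Cons sg_add add_ac del: dec.simps)
  have "Dop b (\<lambda>u'. F (lt 2 b u' # v)) u = F (lt 3 (Dop b b) u # v)" for u v
    using Dop_fst[OF Cons.prems, of b 2 b v u] by (simp add: lt_def add.commute)
  then have "Dop b (?K F) (a # w) = dec (\<lambda>u v. F (lt 3 (Dop b b) u # v)) (a # w)
      + dec (\<lambda>u v. sg (deg u) (Dop b (\<lambda>w. F (lt 2 b u # w)) v)) (a # w)"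
    by (simp only: Dop_dec dec_add)
  \<comment> \<open>A new letter has suspended degree one more than the block it replaces; this
    extra sign produces the cancellation.\<close>
  moreover have "dec (\<lambda>v z. sg (deg v + 1) (Dop b (\<lambda>w. F (lt 2 b v # w)) z)) (a # w) =
      - dec (\<lambda>u v. sg (deg u) (Dop b (\<lambda>w. F (lt 2 b u # w)) v)) (a # w)"
    by (simp only: sg_plus1 dec_minus)
  ultimately show ?case
    unfolding 1 by (simp del: dec.simps)
qed

section \<open>Shuffles\<close>

text \<open>\<open>sh F x y\<close> is \<open>F\<close> evaluated on the signed shuffle product of \<open>x\<close> and \<open>y\<close>.\<close>

fun sh :: "((int \<times> 'h) list \<Rightarrow> 'b::ab_group_add) \<Rightarrow> (int \<times> 'h) list \<Rightarrow> (int \<times> 'h) list \<Rightarrow> 'b" where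
  "sh F [] y = F y"
| "sh F (a # x) [] = F (a # x)"
| "sh F (a # x) (b # y) = sh (\<lambda>w. F (a # w)) x (b # y)
     + sg ((fst b - 1) * deg (a # x)) (sh (\<lambda>w. F (b # w)) (a # x) y)"

lemma sh_Nil2 [simp]: "sh F x [] = F x"
  by (cases x) auto

lemma sh_cong:
  "(\<And>w. deg w = deg x + deg y \<Longrightarrow> length w = length x + length y \<Longrightarrow> F w = G w)
   \<Longrightarrow> sh F x y = sh G x y"
proof (induction F x y arbitrary: G rule: sh.induct)
  case (3 F a x b y)
  have "sh (\<lambda>w. F (a # w)) x (b # y) = sh (\<lambda>w. G (a # w)) x (b # y)"
    by (rule "3.IH") (auto intro: "3.prems")
  moreover have "sh (\<lambda>w. F (b # w)) (a # x) y = sh (\<lambda>w. G (b # w)) (a # x) y"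
    by (rule "3.IH") (auto intro: "3.prems")
  ultimately show ?case by simp
qed auto

lemma sh_add: "sh (\<lambda>w. F w + G w) x y = sh F x y + sh G x y"
proof (induction F x y arbitrary: G rule: sh.induct)
  case (3 F a x b y)
  show ?case unfolding sh.simps(3) "3.IH" sg_add by (simp add: add_ac)
qed auto

lemma sh_hom:
  fixes f :: "'a::ab_group_add \<Rightarrow> 'b::ab_group_add"
  assumes "\<And>x y. f (x + y) = f x + f y"
  shows "f (sh F x y) = sh (\<lambda>w. f (F w)) x y"
proof -
  have "\<And>n x. f (sg n x) = sg n (f x)" using assms by (rule sg_hom)
  then show ?thesis
    by (induction F x y rule: sh.induct) (auto simp: assms)
qed

lemma sh_sg: "sh (\<lambda>w. sg n (F w)) x y = sg n (sh F x y)"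
  by (rule sh_hom[symmetric]) (rule sg_add)

lemma sh_minus: "sh (\<lambda>w. - F w) x y = - sh F x y"
  by (rule sh_hom[symmetric]) simp

lemma sh_diff: "sh (\<lambda>w. F w - G w) x y = sh F x y - sh G x y"
  using sh_add[of F "\<lambda>w. - G w"] by (simp add: sh_minus)

lemma sh_0 [simp]: "sh (\<lambda>w. 0) x y = 0"
  using sh_diff[of "\<lambda>w. 0" "\<lambda>w. 0" x y] by simp

lemma sh_mem:
  assumes "\<And>x y. x \<in> S \<Longrightarrow> y \<in> S \<Longrightarrow> x + y \<in> S" "\<And>x. x \<in> S \<Longrightarrow> - x \<in> S"
    and "\<And>w. deg w = deg x + deg y \<Longrightarrow> length w = length x + length y \<Longrightarrow> F w \<in> S"
  shows "sh F x y \<in> S"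
  using assms(3)
proof (induction F x y rule: sh.induct)
  case (3 F a x b y)
  have "sh (\<lambda>w. F (a # w)) x (b # y) \<in> S"
    by (rule "3.IH") (auto intro: "3.prems")
  moreover have "sh (\<lambda>w. F (b # w)) (a # x) y \<in> S"
    by (rule "3.IH") (auto intro: "3.prems")
  ultimately show ?case by (simp add: sg_def assms)
qed auto

text \<open>Shuffle product and deconcatenation form a bialgebra.\<close>

lemma sh_dec:
  "sh (dec H) x y =
     dec (\<lambda>x1 x2. dec (\<lambda>y1 y2. sg (deg x2 * deg y1) (sh (\<lambda>u. sh (H u) x2 y2) x1 y1)) y) x"
proof (induction "length x + length y" arbitrary: H x y rule: less_induct)
  case less
  show ?case
  proof (cases x)
    case x: Nil
    then show ?thesis by simp
  next
    case x: (Cons a x')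
    show ?thesis
    proof (cases y)
      case Nil
      then show ?thesis by simp
    next
      case y: (Cons b y')
      let ?R = "\<lambda>H x y. dec (\<lambda>x1 x2. dec (\<lambda>y1 y2.
        sg (deg x2 * deg y1) (sh (\<lambda>u. sh (H u) x2 y2) x1 y1)) y) x"
      have dC: "dec H (c # w) = H [] (c # w) + dec (\<lambda>u. H (c # u)) w" for c w
        by simp
      have "sh (dec H) x y = sh (\<lambda>w. H [] (a # w)) x' (b # y')
          + sh (dec (\<lambda>u. H (a # u))) x' (b # y')
          + sg ((fst b - 1) * deg (a # x')) (sh (\<lambda>w. H [] (b # w)) (a # x') y'
             + sh (dec (\<lambda>u. H (b # u))) (a # x') y')"
        unfolding x y sh.simps(3) dC sh_add by simp
      also have "sh (dec (\<lambda>u. H (a # u))) x' (b # y') = ?R (\<lambda>u. H (a # u)) x' (b # y')"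
        by (rule less.hyps) (simp add: x y)
      also have "sh (dec (\<lambda>u. H (b # u))) (a # x') y' = ?R (\<lambda>u. H (b # u)) (a # x') y'"
        by (rule less.hyps) (simp add: x y)
      finally have L: "sh (dec H) x y = sh (H []) x y
          + dec (\<lambda>x1 x2. sh (H (a # x1)) x2 (b # y')) x'
          + dec (\<lambda>x1 x2. dec (\<lambda>y1 y2. sg (deg x2 * deg (b # y1))
              (sh (\<lambda>u. sh (H (a # u)) x2 y2) x1 (b # y1))) y') x'
          + sg ((fst b - 1) * deg (a # x')) (
              dec (\<lambda>y1 y2. sg (deg (a # x') * deg y1) (sh (H (b # y1)) (a # x') y2)) y'
            + dec (\<lambda>x1 x2. dec (\<lambda>y1 y2. sg (deg x2 * deg y1)
              (sh (\<lambda>u. sh (H (b # u)) x2 y2) (a # x1) y1)) y') x')"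
        by (simp add: x y sg_add dec_add algebra_simps)
      have "?R H x y = sh (H []) x y
          + dec (\<lambda>y1 y2. sg (deg (a # x') * deg (b # y1)) (sh (H (b # y1)) (a # x') y2)) y'
          + dec (\<lambda>x1 x2. sh (H (a # x1)) x2 (b # y')) x'
          + dec (\<lambda>x1 x2. dec (\<lambda>y1 y2. sg (deg x2 * deg (b # y1))
              (sh (\<lambda>u. sh (H (a # u)) x2 y2) x1 (b # y1))) y') x'
          + dec (\<lambda>x1 x2. dec (\<lambda>y1 y2. sg (deg x2 * deg (b # y1) + (fst b - 1) * deg (a # x1))
              (sh (\<lambda>u. sh (H (b # u)) x2 y2) (a # x1) y1)) y') x'"
        by (simp add: x y sg_add dec_add algebra_simps)
      also have "dec (\<lambda>y1 y2. sg (deg (a # x') * deg (b # y1)) (sh (H (b # y1)) (a # x') y2)) y'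
         = sg ((fst b - 1) * deg (a # x')) (
              dec (\<lambda>y1 y2. sg (deg (a # x') * deg y1) (sh (H (b # y1)) (a # x') y2)) y')"
        by (simp add: dec_sg[symmetric] algebra_simps)
      also have "dec (\<lambda>x1 x2. dec (\<lambda>y1 y2. sg (deg x2 * deg (b # y1) + (fst b - 1) * deg (a # x1))
              (sh (\<lambda>u. sh (H (b # u)) x2 y2) (a # x1) y1)) y') x'
         = sg ((fst b - 1) * deg (a # x')) (dec (\<lambda>x1 x2. dec (\<lambda>y1 y2. sg (deg x2 * deg y1)
              (sh (\<lambda>u. sh (H (b # u)) x2 y2) (a # x1) y1)) y') x')"
        unfolding dec_sg[symmetric] sg_sg
        by (intro dec_cong sg_cong) (auto simp: algebra_simps)
      finally show ?thesis unfolding L by (simp add: sg_add)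
    qed
  qed
qed

text \<open>Infinitesimal characters of the shuffle algebra: they vanish on the unit and on products
  of nonempty words. For the suspension of a family of multilinear maps this becomes the Harrison
  condition.\<close>

definition prim :: "((int \<times> 'h) list \<Rightarrow> 'b::ab_group_add) \<Rightarrow> bool" where
  "prim F \<longleftrightarrow> F [] = 0 \<and> (\<forall>x y. x \<noteq> [] \<longrightarrow> y \<noteq> [] \<longrightarrow> sh F x y = 0)"

lemma prim_Nil: "prim F \<Longrightarrow> F [] = 0"
  by (simp add: prim_def)

lemma prim_sh: "prim F \<Longrightarrow> sh F x y = (if x = [] then F y else if y = [] then F x else 0)"
  by (auto simp: prim_def)

text \<open>Used after \<open>sh_dec\<close>: a primitive factor vanishes on shuffles that mix
  \<open>x1\<close> and \<open>y1\<close>, so the double sum reduces to its two edges.\<close>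

lemma dec_dec_prim:
  assumes "\<And>x1 x2 y1 y2. x1 \<noteq> [] \<Longrightarrow> y1 \<noteq> [] \<Longrightarrow> H x1 x2 y1 y2 = 0" "\<And>x2 y2. H [] x2 [] y2 = 0"
  shows "dec (\<lambda>x1 x2. dec (\<lambda>y1 y2. H x1 x2 y1 y2) y) x =
    dec (\<lambda>x1 x2. H x1 x2 [] y) x + dec (\<lambda>y1 y2. H [] x y1 y2) y"
proof -
  have "dec (\<lambda>x1 x2. dec (\<lambda>y1 y2. H x1 x2 y1 y2) y) x =
      dec (\<lambda>y1 y2. H [] x y1 y2) y
      + dec (\<lambda>x1 x2. if x1 = [] then 0 else dec (\<lambda>y1 y2. H x1 x2 y1 y2) y) x"
    by (rule dec_split_Nil)
  also have "dec (\<lambda>x1 x2. if x1 = [] then 0 else dec (\<lambda>y1 y2. H x1 x2 y1 y2) y) x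
      = dec (\<lambda>x1 x2. H x1 x2 [] y) x"
  proof (rule dec_cong)
    fix x1 x2
    have "dec (\<lambda>y1 y2. if y1 = [] then 0 else H x1 x2 y1 y2) y = 0" if "x1 \<noteq> []"
      by (rule dec_0I) (use that assms(1) in auto)
    then show "(if x1 = [] then 0 else dec (\<lambda>y1 y2. H x1 x2 y1 y2) y) = H x1 x2 [] y"
      using assms(2) dec_split_Nil[of "\<lambda>y1 y2. H x1 x2 y1 y2" y] by auto
  qed
  finally show ?thesis by (simp add: add.commute)
qed

lemma sh_lt:
  assumes "mlin s t F"
  shows "sh (\<lambda>v. F (lt c f v # z)) x y = F ((deg x + deg y + c, sh f x y) # z)"
proof -
  have "sh (\<lambda>v. F (lt c f v # z)) x y = sh (\<lambda>v. F ((deg x + deg y + c, f v) # z)) x y"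
    by (rule sh_cong) (simp add: lt_def)
  also have "\<dots> = F ((deg x + deg y + c, sh f x y) # z)"
    by (rule sh_hom[symmetric]) (rule mlin_add_hd[OF assms])
  finally show ?thesis .
qed

lemma sh_linear_fst:
  assumes "mlin s t F"
  shows "sh (\<lambda>v. sh (\<lambda>z. F (lt c f v # z)) x2 y2) x1 y1
    = sh (\<lambda>z. F ((deg x1 + deg y1 + c, sh f x1 y1) # z)) x2 y2"
proof -
  have "sh (\<lambda>v. sh (\<lambda>z. F (lt c f v # z)) x2 y2) x1 y1
      = sh (\<lambda>v. sh (\<lambda>z. F ((deg x1 + deg y1 + c, f v) # z)) x2 y2) x1 y1"
    by (rule sh_cong) (simp add: lt_def)
  also have "\<dots> = sh (\<lambda>z. F ((deg x1 + deg y1 + c, sh f x1 y1) # z)) x2 y2"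
    by (rule sh_hom[symmetric]) (simp add: mlin_add_hd[OF assms] sh_add)
  finally show ?thesis .
qed

lemma sh_dec_lt:
  assumes F: "mlin s t F" and f: "prim f"
  shows "sh (dec (\<lambda>v z. F (lt c f v # z))) x y =
    dec (\<lambda>x1 x2. sh (\<lambda>z. F (lt c f x1 # z)) x2 y) x
    + dec (\<lambda>y1 y2. sg (deg x * deg y1) (sh (\<lambda>z. F (lt c f y1 # z)) x y2)) y"
proof -
  have z: "F ((k, 0) # w) = 0" for k w by (rule mlin_zero_hd[OF F])
  let ?H = "\<lambda>x1 x2 y1 y2. sg (deg x2 * deg y1)
    (sh (\<lambda>z. F ((deg x1 + deg y1 + c, sh f x1 y1) # z)) x2 y2)"
  have "sh (dec (\<lambda>v z. F (lt c f v # z))) x y = dec (\<lambda>x1 x2. dec (\<lambda>y1 y2. ?H x1 x2 y1 y2) y) x"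
    by (simp add: sh_dec sh_linear_fst[OF F])
  also have "\<dots> = dec (\<lambda>x1 x2. ?H x1 x2 [] y) x + dec (\<lambda>y1 y2. ?H [] x y1 y2) y"
    by (rule dec_dec_prim) (simp_all add: prim_sh[OF f] prim_Nil[OF f] z)
  finally show ?thesis by (simp add: lt_def)
qed

lemma mlin_zero_mem: "mlin s t F \<Longrightarrow> 0 \<in> snd ` set w \<Longrightarrow> F w = 0"
  by (auto simp: in_set_conv_decomp mlin_zero)

lemma sh_zero:
  assumes "\<And>w. 0 \<in> snd ` set w \<Longrightarrow> F w = 0" "0 \<in> snd ` set x \<or> 0 \<in> snd ` set y"
  shows "sh F x y = 0"
  using assms
proof (induction F x y rule: sh.induct)
  case (3 F a x b y)
  have "sh (\<lambda>w. F (a # w)) x (b # y) = 0"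
  proof (cases "snd a = 0")
    case True
    then show ?thesis using "3.prems"(1) by simp
  next
    case False
    show ?thesis by (rule "3.IH") (use "3.prems" False in auto)
  qed
  moreover have "sh (\<lambda>w. F (b # w)) (a # x) y = 0"
  proof (cases "snd b = 0")
    case True
    then show ?thesis using "3.prems"(1) by simp
  next
    case False
    show ?thesis by (rule "3.IH") (use "3.prems" False in auto)
  qed
  ultimately show ?case by simp
qed auto

text \<open>A coderivation with primitive components is a derivation of the shuffle product.\<close>

lemma sh_Dop:
  assumes "mlin s t F" and b: "prim b"
  shows "sh (Dop b F) x y =
    Dop b (\<lambda>x'. sh F x' y) x + sg (deg x) (Dop b (\<lambda>y'. sh F x y') y)"
  using assms(1)
proof (induction "length x + length y" arbitrary: F x y rule: less_induct)
  case less
  note F = less.prems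
  have z: "sh F x y = 0" if "0 \<in> snd ` set x \<or> 0 \<in> snd ` set y" for x y
    by (rule sh_zero) (use mlin_zero_mem[OF F] that in auto)
  have l0: "lt 2 b [] = (2, 0)" by (simp add: lt_def prim_Nil[OF b])
  show ?case
  proof (cases x)
    case x: Nil
    have "sh F [] = F" by (rule ext) simp
    then show ?thesis using z[of "[lt 2 b []]" y] by (simp add: x Dop_Nil l0)
  next
    case x: (Cons a x')
    show ?thesis
    proof (cases y)
      case y: Nil
      show ?thesis using z[of x "[lt 2 b []]"] by (simp add: y Dop_Nil l0)
    next
      case y: (Cons c y')
      let ?K = "\<lambda>F. dec (\<lambda>v z. F (lt 2 b v # z))"
      let ?Fa = "\<lambda>w. F (a # w)" and ?Fc = "\<lambda>w. F (c # w)"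
      let ?a = "fst a - 1" and ?c = "fst c - 1"
      have Ky: "sh (\<lambda>w. F (lt 2 b v # w)) z y = sh F (lt 2 b v # z) y
          - sg (?c * deg (lt 2 b v # z)) (sh ?Fc (lt 2 b v # z) y')" for v z
        by (simp add: y)
      \<comment> \<open>The three terms collect the words that begin with the inserted letter, with
        \<open>a\<close> and with \<open>c\<close>. The right-hand side is brought into the same
        form below.\<close>
      have "sh (Dop b F) x y = sh (?K F) x y + sg ?a (sh (Dop b ?Fa) x' y)
          + sg (?c * deg x + ?c) (sh (Dop b ?Fc) x y')"
        unfolding x y sh.simps(3) Dop_Cons sh_add sh_sg sg_add sg_sg by (simp only: add_ac)
      also have "sh (Dop b ?Fa) x' y
          = Dop b (\<lambda>u. sh ?Fa u y) x' + sg (deg x') (Dop b (sh ?Fa x') y)"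
        by (rule less.hyps[OF _ mlin_Cons[OF F]]) (simp add: x)
      also have "sh (Dop b ?Fc) x y'
          = Dop b (\<lambda>u. sh ?Fc u y') x + sg (deg x) (Dop b (sh ?Fc x) y')"
        by (rule less.hyps[OF _ mlin_Cons[OF F]]) (simp add: y)
      finally have L: "sh (Dop b F) x y =
          dec (\<lambda>x1 x2. sh (\<lambda>z. F (lt 2 b x1 # z)) x2 y) x
          + dec (\<lambda>y1 y2. sg (deg x * deg y1) (sh (\<lambda>z. F (lt 2 b y1 # z)) x y2)) y
          + sg ?a (Dop b (\<lambda>u. sh ?Fa u y) x') + sg (?a + deg x') (Dop b (sh ?Fa x') y)
          + sg (?c * deg x + ?c) (Dop b (\<lambda>u. sh ?Fc u y') x)
          + sg (?c * deg x + ?c + deg x) (Dop b (sh ?Fc x) y')"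
        by (simp only: sh_dec_lt[OF F b] sg_add sg_sg add_ac)
      have "Dop b (\<lambda>u. sh F u y) x =
          dec (\<lambda>v z. sh F (lt 2 b v # z) y) x + sg ?a (Dop b (\<lambda>w. sh F (a # w) y) x')"
        unfolding x by (rule Dop_Cons)
      also have "dec (\<lambda>v z. sh F (lt 2 b v # z) y) x =
          dec (\<lambda>v z. sh (\<lambda>w. F (lt 2 b v # w)) z y
            + sg (?c * (deg x + 1)) (sh ?Fc (lt 2 b v # z) y')) x"
        by (rule dec_cong) (simp add: y algebra_simps)
      also have "Dop b (\<lambda>w. sh F (a # w) y) x' =
          Dop b (\<lambda>w. sh ?Fa w y + sg (?c * (deg x + 1)) (sh ?Fc (a # w) y')) x'"
        by (rule Dop_cong) (simp add: x y algebra_simps)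
      finally have R1: "Dop b (\<lambda>u. sh F u y) x =
          dec (\<lambda>v z. sh (\<lambda>w. F (lt 2 b v # w)) z y) x + sg ?a (Dop b (\<lambda>w. sh ?Fa w y) x')
          + sg (?c * (deg x + 1)) (Dop b (\<lambda>u. sh ?Fc u y') x)"
        unfolding x Dop_Cons[of b "\<lambda>u. sh ?Fc u y'"] dec_add dec_sg Dop_add Dop_sg sg_add sg_sg
        by (simp only: add_ac)
      have "Dop b (sh F x) y =
          dec (\<lambda>v z. sh F x (lt 2 b v # z)) y + sg ?c (Dop b (\<lambda>w. sh F x (c # w)) y')"
        unfolding y by (rule Dop_Cons)
      also have "dec (\<lambda>v z. sh F x (lt 2 b v # z)) y =
          dec (\<lambda>v z. sh ?Fa x' (lt 2 b v # z)
            + sg ((deg v + 1) * deg x) (sh (\<lambda>w. F (lt 2 b v # w)) x z)) y"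
        by (rule dec_cong) (simp add: x add.commute)
      also have "(\<lambda>w. sh F x (c # w)) = (\<lambda>w. sh ?Fa x' (c # w) + sg (?c * deg x) (sh ?Fc x w))"
        by (simp add: x)
      finally have R2: "Dop b (sh F x) y = Dop b (sh ?Fa x') y
          + dec (\<lambda>v z. sg ((deg v + 1) * deg x) (sh (\<lambda>w. F (lt 2 b v # w)) x z)) y
          + sg (?c + ?c * deg x) (Dop b (sh ?Fc x) y')"
        unfolding y Dop_Cons[of b "sh ?Fa x'"] dec_add Dop_add Dop_sg sg_add sg_sg
        by (simp only: add_ac)
      have e1: "sg (deg x) (dec (\<lambda>v z. sg ((deg v + 1) * deg x) (sh (\<lambda>w. F (lt 2 b v # w)) x z)) y)
          = dec (\<lambda>y1 y2. sg (deg x * deg y1) (sh (\<lambda>z. F (lt 2 b y1 # z)) x y2)) y"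
        unfolding dec_sg[symmetric] sg_sg by (intro dec_cong sg_cong) auto
      have e2: "deg x = ?a + deg x'" by (simp add: x)
      show ?thesis
        unfolding L R1 R2 sg_add sg_sg e1 e2[symmetric]
        by (simp add: algebra_simps)
    qed
  qed
qed

section \<open>Coalgebra morphisms\<close>

definition comps :: "nat \<Rightarrow> nat list set" where
  "comps n = {js. sum_list js = n \<and> 0 \<notin> set js}"

lemma comps_0 [simp]: "comps 0 = {[]}"
  by (auto simp: comps_def) (metis list.set_intros(1) neq_Nil_conv sum_list_eq_0_iff)

lemma comps_pos: "n > 0 \<Longrightarrow> comps n = (\<Union>i\<in>{1..n}. (#) i ` comps (n - i))"
proof (intro set_eqI iffI)
  fix js assume "n > 0" "js \<in> comps n"
  then show "js \<in> (\<Union>i\<in>{1..n}. (#) i ` comps (n - i))"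
    by (cases js) (auto simp: comps_def intro!: bexI[of _ "hd js"])
qed (auto simp: comps_def)

lemma finite_comps [simp]: "finite (comps n)"
proof (induction n rule: less_induct)
  case (less n)
  then show ?case by (cases "n = 0") (auto simp: comps_pos)
qed

lemma sum_comps:
  "n > 0 \<Longrightarrow> (\<Sum>js\<in>comps n. f js) = (\<Sum>i=1..n. \<Sum>js\<in>comps (n - i). f (i # js))"
  by (subst comps_pos, simp, subst sum.UNION_disjoint) (auto simp: sum.reindex)

text \<open>Components of a morphism have degree zero after suspension, so the new letter stores the
  suspended degree of its block plus one.\<close>

fun blocks :: "((int \<times> 'h) list \<Rightarrow> 'g) \<Rightarrow> nat list \<Rightarrow> (int \<times> 'h) list \<Rightarrow> (int \<times> 'g) list" where
  "blocks \<phi> [] w = []"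
| "blocks \<phi> (i # js) w = (deg (take i w) + 1, \<phi> (take i w)) # blocks \<phi> js (drop i w)"

lemma deg_blocks: "sum_list js = length w \<Longrightarrow> deg (blocks \<phi> js w) = deg w"
proof (induction js arbitrary: w)
  case (Cons i js)
  have "deg (take i w) + deg (drop i w) = deg w"
    by (metis append_take_drop_id deg_append)
  then show ?case using Cons by simp
qed simp

lemma length_blocks [simp]: "length (blocks \<phi> js w) = length js"
  by (induction js arbitrary: w) auto

text \<open>\<open>Pop \<phi> G\<close> is \<open>G\<close> composed with the coalgebra morphism with components \<open>\<phi>\<close>.\<close>

definition Pop :: "((int \<times> 'h) list \<Rightarrow> 'g) \<Rightarrow> ((int \<times> 'g) list \<Rightarrow> 'b::ab_group_add)
    \<Rightarrow> (int \<times> 'h) list \<Rightarrow> 'b" where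
  "Pop \<phi> G w = (\<Sum>js\<in>comps (length w). G (blocks \<phi> js w))"

lemma Pop_Nil [simp]: "Pop \<phi> G [] = G []"
  by (simp add: Pop_def)

text \<open>Splitting off the first block. Blocks are nonempty, whereas \<open>dec\<close> also
  offers the empty prefix; hence the case distinction.\<close>

lemma Pop_rec:
  "w \<noteq> [] \<Longrightarrow> Pop \<phi> G w =
     dec (\<lambda>u v. if u = [] then 0 else Pop \<phi> (\<lambda>z. G ((deg u + 1, \<phi> u) # z)) v) w"
proof -
  assume w: "w \<noteq> []"
  have "Pop \<phi> G w = (\<Sum>i=1..length w. Pop \<phi> (\<lambda>z. G ((deg (take i w) + 1, \<phi> (take i w)) # z)) (drop i w))"
    using w by (simp add: Pop_def sum_comps)
  also have "\<dots> = (\<Sum>i\<le>length w. if take i w = [] then 0 else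
      Pop \<phi> (\<lambda>z. G ((deg (take i w) + 1, \<phi> (take i w)) # z)) (drop i w))"
    using w by (intro sum.mono_neutral_cong_left) auto
  finally show ?thesis by (simp add: dec_sum)
qed

lemma Pop_add: "Pop \<phi> (\<lambda>w. F w + G w) w = Pop \<phi> F w + Pop \<phi> G w"
  by (simp add: Pop_def sum.distrib)

lemma Pop_hom:
  fixes f :: "'a::ab_group_add \<Rightarrow> 'b::ab_group_add"
  assumes "\<And>x y. f (x + y) = f x + f y"
  shows "f (Pop \<phi> F w) = Pop \<phi> (\<lambda>w. f (F w)) w"
proof -
  interpret additive f by (rule additive.intro, rule assms)
  show ?thesis by (simp add: Pop_def sum)
qed

lemma Pop_sg: "Pop \<phi> (\<lambda>w. sg n (F w)) w = sg n (Pop \<phi> F w)"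
  by (rule Pop_hom[symmetric]) (rule sg_add)

lemma Pop_cong:
  assumes "\<And>z. deg z = deg w \<Longrightarrow> length z \<le> length w \<Longrightarrow> (w \<noteq> [] \<longrightarrow> z \<noteq> []) \<Longrightarrow> F z = G z"
  shows "Pop \<phi> F w = Pop \<phi> G w"
  unfolding Pop_def
proof (rule sum.cong)
  fix js assume "js \<in> comps (length w)"
  then have js: "sum_list js = length w" "0 \<notin> set js" by (auto simp: comps_def)
  have "0 \<notin> set js \<Longrightarrow> length js \<le> sum_list js" by (induction js) auto
  with js have l: "length js \<le> length w" by simp
  show "F (blocks \<phi> js w) = G (blocks \<phi> js w)"
  proof (rule assms)
    show "deg (blocks \<phi> js w) = deg w" by (rule deg_blocks) (rule js(1))
    show "length (blocks \<phi> js w) \<le> length w" using l by simp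
    show "w \<noteq> [] \<longrightarrow> blocks \<phi> js w \<noteq> []" using js(1) by (cases js) auto
  qed
qed simp

lemma Pop_swap:
  "Pop \<phi> (\<lambda>x'. Pop \<psi> (\<lambda>y'. H x' y') y) x = Pop \<psi> (\<lambda>y'. Pop \<phi> (\<lambda>x'. H x' y') x) y"
  unfolding Pop_def by (rule sum.swap)

text \<open>Compatibility with the coproduct: each cut of a word of blocks comes from a cut of
  \<open>w\<close> at a block boundary.\<close>

lemma Pop_dec:
  "Pop \<phi> (dec H) w = dec (\<lambda>u v. Pop \<phi> (\<lambda>u'. Pop \<phi> (H u') v) u) w"
proof (induction "length w" arbitrary: H w rule: less_induct)
  case less
  show ?case
  proof (cases "w = []")
    case False
    let ?l = "\<lambda>u. (deg u + 1, \<phi> u)"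
    have "Pop \<phi> (dec H) w = dec (\<lambda>u v. if u = [] then 0 else Pop \<phi> (\<lambda>z. dec H (?l u # z)) v) w"
      by (rule Pop_rec[OF False])
    also have "\<dots> = dec (\<lambda>u v. (if u = [] then 0 else Pop \<phi> (\<lambda>z. H [] (?l u # z)) v)
        + dec (\<lambda>v1 v2. if u = [] then 0 else
            Pop \<phi> (\<lambda>z. Pop \<phi> (H (?l u # z)) v2) v1) v) w"
    proof (rule dec_cong)
      fix u v assume "w = u @ v"
      then show "(if u = [] then 0 else Pop \<phi> (\<lambda>z. dec H (?l u # z)) v) =
        (if u = [] then 0 else Pop \<phi> (\<lambda>z. H [] (?l u # z)) v)
        + dec (\<lambda>v1 v2. if u = [] then 0 else Pop \<phi> (\<lambda>z. Pop \<phi> (H (?l u # z)) v2) v1) v"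
        using less[of v "\<lambda>z. H (?l u # z)"] by (cases "u = []") (auto simp: Pop_add)
    qed
    also have "\<dots> = Pop \<phi> (H []) w + dec (\<lambda>u v. dec (\<lambda>u1 u2. if u1 = [] then 0 else
        Pop \<phi> (\<lambda>z. Pop \<phi> (H (?l u1 # z)) v) u2) u) w"
      unfolding dec_add Pop_rec[OF False, symmetric] by (subst dec_assoc) (rule refl)
    also have "dec (\<lambda>u v. dec (\<lambda>u1 u2. if u1 = [] then 0 else
        Pop \<phi> (\<lambda>z. Pop \<phi> (H (?l u1 # z)) v) u2) u) w
        = dec (\<lambda>u v. if u = [] then 0 else Pop \<phi> (\<lambda>u'. Pop \<phi> (H u') v) u) w"
    proof (rule dec_cong)
      fix u v
      show "dec (\<lambda>u1 u2. if u1 = [] then 0 else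
          Pop \<phi> (\<lambda>z. Pop \<phi> (H (?l u1 # z)) v) u2) u
        = (if u = [] then 0 else Pop \<phi> (\<lambda>u'. Pop \<phi> (H u') v) u)"
        using Pop_rec[of u \<phi> "\<lambda>u'. Pop \<phi> (H u') v"] by (cases "u = []") simp_all
    qed
    finally show ?thesis
      using dec_split_Nil[of "\<lambda>u v. Pop \<phi> (\<lambda>u'. Pop \<phi> (H u') v) u" w] by simp
  qed simp
qed

lemma Pop_fst:
  assumes "mlin s t G"
  shows "Pop \<phi> (\<lambda>u'. G ((deg u' + c, f u') # v)) u = G ((deg u + c, Pop \<phi> f u) # v)"
proof -
  have "Pop \<phi> (\<lambda>u'. G ((deg u' + c, f u') # v)) u = Pop \<phi> (\<lambda>u'. G ((deg u + c, f u') # v)) u"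
    by (rule Pop_cong) simp
  also have "\<dots> = G ((deg u + c, Pop \<phi> f u) # v)"
    by (rule Pop_hom[symmetric]) (rule mlin_add_hd[OF assms])
  finally show ?thesis .
qed

text \<open>A coalgebra morphism intertwines two coderivations as soon as it does so after
  projection to the cogenerators, which is the assumption on \<open>\<phi>\<close>. The induction
  splits off the first block.\<close>

lemma Pop_Dop:
  fixes G :: "(int \<times> 'g::ab_group_add) list \<Rightarrow> 'b::ab_group_add"
  assumes "mlin s t G" and \<phi>: "\<And>w. Dop b \<phi> w = Pop \<phi> b' w"
  shows "Pop \<phi> (Dop b' G) w = Dop b (Pop \<phi> G) w"
  using assms(1)
proof (induction "length w" arbitrary: G w rule: less_induct)
  case less
  note G = less.prems
  show ?case
  proof (cases "w = []")
    case True
    then show ?thesis using \<phi>[of "[]"]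
      by (simp add: Dop_Nil Pop_def[of _ _ "[_]"] sum_comps) (simp add: lt_def)
  next
    case False
    let ?G = "\<lambda>u z. G ((deg u + 1, \<phi> u) # z)"
    have "Pop \<phi> (Dop b' G) w = Pop \<phi> (\<lambda>z. dec (\<lambda>u v. G (lt 2 b' u # v)) z
        + (if z = [] then 0 else sg (fst (hd z) - 1) (Dop b' (\<lambda>v. G (hd z # v)) (tl z)))) w"
    proof (rule Pop_cong)
      fix z :: "(int \<times> 'g) list" assume "w \<noteq> [] \<longrightarrow> z \<noteq> []"
      with False show "Dop b' G z = dec (\<lambda>u v. G (lt 2 b' u # v)) z
        + (if z = [] then 0 else sg (fst (hd z) - 1) (Dop b' (\<lambda>v. G (hd z # v)) (tl z)))"
        by (cases z) (simp_all add: Dop_Cons)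
    qed
    also have "\<dots> = dec (\<lambda>u v. Pop \<phi> (\<lambda>v'. G ((deg u + 2, Pop \<phi> b' u) # v')) v) w
        + dec (\<lambda>u v. if u = [] then 0 else sg (deg u) (Pop \<phi> (Dop b' (?G u)) v)) w"
    proof -
      have "Pop \<phi> (dec (\<lambda>u v. G (lt 2 b' u # v))) w
          = dec (\<lambda>u v. Pop \<phi> (\<lambda>u'. Pop \<phi> (\<lambda>v'. G (lt 2 b' u' # v')) v) u) w"
        by (rule Pop_dec)
      also have "\<dots> = dec (\<lambda>u v. Pop \<phi> (\<lambda>v'. G ((deg u + 2, Pop \<phi> b' u) # v')) v) w"
        by (subst Pop_swap) (simp add: lt_def Pop_fst[OF G])
      finally show ?thesis
        by (subst Pop_add, subst (2) Pop_rec[OF False]) (simp add: Pop_sg cong: if_cong)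
    qed
    also have "dec (\<lambda>u v. if u = [] then 0 else sg (deg u) (Pop \<phi> (Dop b' (?G u)) v)) w
        = dec (\<lambda>u v. if u = [] then 0 else sg (deg u) (Dop b (Pop \<phi> (?G u)) v)) w"
      by (rule dec_cong) (auto simp: less.hyps[OF _ mlin_Cons[OF G]])
    finally have L: "Pop \<phi> (Dop b' G) w = dec (\<lambda>u v. Pop \<phi> (\<lambda>v'. G ((deg u + 2, Dop b \<phi> u) # v')) v) w
        + dec (\<lambda>u v. if u = [] then 0 else sg (deg u) (Dop b (Pop \<phi> (?G u)) v)) w"
      by (simp add: \<phi>)
    have "Dop b (Pop \<phi> G) w = Dop b (dec (\<lambda>u v. if u = [] then 0 else Pop \<phi> (?G u) v)) w"
      by (rule Dop_cong) (rule Pop_rec)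
    also have "\<dots> = dec (\<lambda>u v. Dop b (\<lambda>u'. if u' = [] then 0 else Pop \<phi> (?G u') v) u) w
        + dec (\<lambda>u v. if u = [] then 0 else sg (deg u) (Dop b (Pop \<phi> (?G u)) v)) w"
      unfolding Dop_dec dec_add by (intro arg_cong2[of _ _ _ _ "(+)"] dec_cong refl) simp
    also have "dec (\<lambda>u v. Dop b (\<lambda>u'. if u' = [] then 0 else Pop \<phi> (?G u') v) u) w
        = dec (\<lambda>u v. Pop \<phi> (\<lambda>v'. G ((deg u + 2, Dop b \<phi> u) # v')) v) w"
    proof (rule dec_cong)
      fix u v
      have "Dop b (\<lambda>u'. if u' = [] then 0 else Pop \<phi> (?G u') v) u
          = Dop b (\<lambda>u'. Pop \<phi> (\<lambda>v'. G ((deg u + 2, \<phi> u') # v')) v) u"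
        by (rule Dop_cong) (simp add: add.commute)
      also have "\<dots> = Pop \<phi> (\<lambda>v'. G ((deg u + 2, Dop b \<phi> u) # v')) v"
        by (rule Dop_hom[symmetric]) (simp add: mlin_add_hd[OF G] Pop_add)
      finally show "Dop b (\<lambda>u'. if u' = [] then 0 else Pop \<phi> (?G u') v) u
          = Pop \<phi> (\<lambda>v'. G ((deg u + 2, Dop b \<phi> u) # v')) v" .
    qed
    finally show ?thesis using L by simp
  qed
qed

text \<open>Primitive components vanish on shuffles of nonempty pieces, so the blocks mixing letters
  of \<open>x\<close> and \<open>y\<close> cancel in total. What is left is the shuffle product of
  the two images: the coalgebra morphism is multiplicative.\<close>

lemma sh_Pop:
  fixes G :: "(int \<times> 'g::ab_group_add) list \<Rightarrow> 'b::ab_group_add"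
  assumes "mlin s t G" and \<phi>: "prim \<phi>"
  shows "sh (Pop \<phi> G) x y = Pop \<phi> (\<lambda>x'. Pop \<phi> (sh G x') y) x"
  using assms(1)
proof (induction "length x + length y" arbitrary: G x y rule: less_induct)
  case less
  note G = less.prems
  show ?case
  proof (cases "x = [] \<or> y = []")
    case True
    have "sh G [] = G" by (rule ext) simp
    with True show ?thesis by auto
  next
    case False
    then have xy: "x \<noteq> []" "y \<noteq> []" by auto
    let ?G = "\<lambda>u z. G ((deg u + 1, \<phi> u) # z)"
    let ?H = "\<lambda>x1 x2 y1 y2. sg (deg x2 * deg y1)
      (sh (Pop \<phi> (\<lambda>z. G ((deg x1 + deg y1 + 1, sh \<phi> x1 y1) # z))) x2 y2)"
    have G0: "Pop \<phi> (\<lambda>z. G ((k, 0) # z)) w = 0" for k w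
      by (simp add: mlin_zero_hd[OF G] Pop_def)
    then have G0': "Pop \<phi> (\<lambda>z. G ((k, 0) # z)) = (\<lambda>w. 0)" for k by (rule ext)
    have "sh (Pop \<phi> G) x y = sh (dec (\<lambda>u v. if u = [] then 0 else Pop \<phi> (?G u) v)) x y"
      by (rule sh_cong, rule Pop_rec) (use xy in auto)
    also have "\<dots> = sh (dec (\<lambda>u. Pop \<phi> (?G u))) x y"
      by (rule arg_cong[of _ _ "\<lambda>F. sh F x y"]) (auto intro!: ext dec_cong simp: prim_Nil[OF \<phi>] G0)
    also have "\<dots> = dec (\<lambda>x1 x2. dec (\<lambda>y1 y2. ?H x1 x2 y1 y2) y) x"
    proof -
      have "sh (\<lambda>u. sh (Pop \<phi> (?G u)) x2 y2) x1 y1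
          = sh (Pop \<phi> (\<lambda>z. G ((deg x1 + deg y1 + 1, sh \<phi> x1 y1) # z))) x2 y2" for x1 x2 y1 y2
      proof -
        have "sh (\<lambda>u. sh (Pop \<phi> (?G u)) x2 y2) x1 y1
            = sh (\<lambda>u. sh (Pop \<phi> (\<lambda>z. G ((deg x1 + deg y1 + 1, \<phi> u) # z))) x2 y2) x1 y1"
          by (rule sh_cong) simp
        also have "\<dots> = sh (Pop \<phi> (\<lambda>z. G ((deg x1 + deg y1 + 1, sh \<phi> x1 y1) # z))) x2 y2"
          by (rule sh_hom[symmetric]) (simp add: mlin_add_hd[OF G] Pop_add sh_add)
        finally show ?thesis .
      qed
      then show ?thesis by (simp add: sh_dec)
    qed
    also have "\<dots> = dec (\<lambda>x1 x2. ?H x1 x2 [] y) x + dec (\<lambda>y1 y2. ?H [] x y1 y2) y"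
      by (rule dec_dec_prim) (simp_all add: prim_sh[OF \<phi>] prim_Nil[OF \<phi>] G0')
    also have "\<dots> = dec (\<lambda>x1 x2. if x1 = [] then 0 else sh (Pop \<phi> (?G x1)) x2 y) x
      + dec (\<lambda>y1 y2. if y1 = [] then 0 else sg (deg x * deg y1) (sh (Pop \<phi> (?G y1)) x y2)) y"
      by (intro arg_cong2[of _ _ _ _ "(+)"] dec_cong) (auto simp: prim_Nil[OF \<phi>] G0')
    also have "\<dots> = dec (\<lambda>x1 x2. if x1 = [] then 0 else Pop \<phi> (\<lambda>x'. Pop \<phi> (sh (?G x1) x') y) x2) x
      + dec (\<lambda>y1 y2. if y1 = [] then 0 else
          sg (deg x * deg y1) (Pop \<phi> (\<lambda>x'. Pop \<phi> (sh (?G y1) x') y2) x)) y"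
      by (intro arg_cong2[of _ _ _ _ "(+)"] dec_cong) (auto simp: less.hyps[OF _ mlin_Cons[OF G]])
    finally have L: "sh (Pop \<phi> G) x y = \<dots>" .
    \<comment> \<open>On the other side, shuffles of the image words are sorted by whether their
      first letter, that is the first block, stems from \<open>x\<close> or from
      \<open>y\<close>.\<close>
    let ?A = "\<lambda>x' y'. case x' of [] \<Rightarrow> 0 | c # x'' \<Rightarrow> sh (\<lambda>w. G (c # w)) x'' y'"
    let ?B = "\<lambda>x' y'. case y' of [] \<Rightarrow> 0 | c # y'' \<Rightarrow>
      sg ((fst c - 1) * deg x') (sh (\<lambda>w. G (c # w)) x' y'')"
    have "Pop \<phi> (\<lambda>x'. Pop \<phi> (sh G x') y) x = Pop \<phi> (\<lambda>x'. Pop \<phi> (\<lambda>y'. ?A x' y' + ?B x' y') y) x"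
    proof (intro Pop_cong)
      fix x' y' :: "(int \<times> 'g) list" assume "x \<noteq> [] \<longrightarrow> x' \<noteq> []" "y \<noteq> [] \<longrightarrow> y' \<noteq> []"
      with xy show "sh G x' y' = ?A x' y' + ?B x' y'" by (cases x'; cases y') auto
    qed
    also have "\<dots> = Pop \<phi> (\<lambda>x'. Pop \<phi> (?A x') y) x + Pop \<phi> (\<lambda>y'. Pop \<phi> (\<lambda>x'. ?B x' y') x) y"
      unfolding Pop_add by (subst (2) Pop_swap) simp
    also have "Pop \<phi> (\<lambda>x'. Pop \<phi> (?A x') y) x
      = dec (\<lambda>x1 x2. if x1 = [] then 0 else Pop \<phi> (\<lambda>x'. Pop \<phi> (sh (?G x1) x') y) x2) x"
      by (subst Pop_rec[OF xy(1)]) (simp cong: if_cong)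
    also have "Pop \<phi> (\<lambda>y'. Pop \<phi> (\<lambda>x'. ?B x' y') x) y
      = Pop \<phi> (\<lambda>y'. case y' of [] \<Rightarrow> 0 | c # y'' \<Rightarrow>
          sg ((fst c - 1) * deg x) (Pop \<phi> (\<lambda>x'. sh (\<lambda>w. G (c # w)) x' y'') x)) y"
    proof (rule Pop_cong)
      fix y' :: "(int \<times> 'g) list" assume "y \<noteq> [] \<longrightarrow> y' \<noteq> []"
      then obtain c y'' where y': "y' = c # y''" using xy by (cases y') auto
      have "Pop \<phi> (\<lambda>x'. sg ((fst c - 1) * deg x') (sh (\<lambda>w. G (c # w)) x' y'')) x
          = Pop \<phi> (\<lambda>x'. sg ((fst c - 1) * deg x) (sh (\<lambda>w. G (c # w)) x' y'')) x"
        by (rule Pop_cong) simp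
      then show "Pop \<phi> (\<lambda>x'. ?B x' y') x = (case y' of [] \<Rightarrow> 0 | c # y'' \<Rightarrow>
          sg ((fst c - 1) * deg x) (Pop \<phi> (\<lambda>x'. sh (\<lambda>w. G (c # w)) x' y'') x))"
        by (simp add: y' Pop_sg)
    qed
    also have "\<dots> = dec (\<lambda>y1 y2. if y1 = [] then 0 else
          sg (deg x * deg y1) (Pop \<phi> (\<lambda>x'. Pop \<phi> (sh (?G y1) x') y2) x)) y"
      by (subst Pop_rec[OF xy(2)], rule dec_cong)
        (simp add: Pop_sg mult.commute Pop_swap[of _ _ _ x])
    finally show ?thesis using L by simp
  qed
qed

lemma blocks_replicate:
  assumes "\<And>a. \<phi> [a] = snd a"
  shows "blocks \<phi> (replicate (length w) 1) w = w"
  by (induction w) (auto simp: assms)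

lemma comps_length:
  assumes "js \<in> comps n" "js \<noteq> replicate n 1"
  shows "length js < n"
proof -
  have "0 \<notin> set js \<Longrightarrow> js \<noteq> replicate (sum_list js) 1 \<Longrightarrow> length js < sum_list js" for js :: "nat list"
  proof (induction js)
    case (Cons i js)
    have "length js \<le> sum_list js" if "0 \<notin> set js" for js :: "nat list"
      using that by (induction js) auto
    then show ?case using Cons by (cases "i = 1") force+
  qed simp
  then show ?thesis using assms by (auto simp: comps_def)
qed

text \<open>If the linear part is the identity, the composition into ones contributes
  \<open>G w\<close> itself; all other compositions have fewer blocks by
  \<open>comps_length\<close>. So \<open>Pop \<phi>\<close> can be inverted by induction on word
  length.\<close>

lemma Pop_top:
  assumes "\<And>a. \<phi> [a] = snd a"
  shows "Pop \<phi> G w = G w + (\<Sum>js\<in>comps (length w) - {replicate (length w) 1}. G (blocks \<phi> js w))"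
proof -
  have "replicate (length w) 1 \<in> comps (length w)" by (simp add: comps_def sum_list_replicate)
  then show ?thesis
    by (simp add: Pop_def sum.remove blocks_replicate[OF assms, simplified])
qed

lemma Pop_eq_0:
  assumes "\<And>a. \<phi> [a] = snd a" "\<And>w. Pop \<phi> G w = 0"
  shows "G w = 0"
proof (induction "length w" arbitrary: w rule: less_induct)
  case less
  have "(\<Sum>js\<in>comps (length w) - {replicate (length w) 1}. G (blocks \<phi> js w)) = 0"
    by (rule sum.neutral) (auto intro!: less comps_length)
  then show ?case using Pop_top[OF assms(1), of G w] assms(2)[of w] by simp
qed


text \<open>Uniqueness for primitive elements: \<open>Pop\<close> is unitriangular for the word length.\<close>

lemma prim_if_Pop:
  assumes \<phi>: "\<And>a. \<phi> [a] = snd a" and G: "G [] = 0"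
    and 0: "\<And>x y. x \<noteq> [] \<Longrightarrow> y \<noteq> [] \<Longrightarrow> Pop \<phi> (\<lambda>x'. Pop \<phi> (sh G x') y) x = 0"
  shows "prim G"
proof -
  have "sh G x y = 0" if "x \<noteq> []" "y \<noteq> []" for x y
    using that
  proof (induction "length x + length y" arbitrary: x y rule: less_induct)
    case less
    let ?C = "\<lambda>w. comps (length w) - {replicate (length w) 1}"
    have ne: "blocks \<phi> js w \<noteq> []" if "js \<in> comps (length w)" "w \<noteq> []" for js and w :: "(int \<times> 'a) list"
      using that by (cases js) (auto simp: comps_def)
    have "(\<Sum>js\<in>?C x. Pop \<phi> (sh G (blocks \<phi> js x)) y) = 0"
    proof (intro sum.neutral ballI)
      fix js assume js: "js \<in> ?C x"
      have "sh G (blocks \<phi> js x) (blocks \<phi> ks y) = 0" if "ks \<in> comps (length y)" for ks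
      proof (rule less.hyps)
        have "length ks \<le> length y"
          using comps_length[OF that] by (cases "ks = replicate (length y) 1") auto
        with comps_length[of js "length x"] js
        show "length (blocks \<phi> js x) + length (blocks \<phi> ks y) < length x + length y" by simp
      qed (use js that ne less.prems in auto)
      then show "Pop \<phi> (sh G (blocks \<phi> js x)) y = 0" by (simp add: Pop_def)
    qed
    then have "Pop \<phi> (sh G x) y = 0"
      using 0[OF less.prems] Pop_top[OF \<phi>, of "\<lambda>x'. Pop \<phi> (sh G x') y" x] by simp
    moreover have "(\<Sum>ks\<in>?C y. sh G x (blocks \<phi> ks y)) = 0"
      by (intro sum.neutral ballI less.hyps) (use ne less.prems in \<open>auto intro!: comps_length\<close>)
    ultimately show ?case using Pop_top[OF \<phi>, of "sh G x" y] by simp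
  qed
  with G show ?thesis by (auto simp: prim_def)
qed

section \<open>Closure of multilinear functions under the operations on words\<close>

lemma mlinI:
  assumes "\<And>u k v x y. F (u @ (k, x + y) # v) = F (u @ (k, x) # v) + F (u @ (k, y) # v)"
    "\<And>u k v c x. F (u @ (k, s c x) # v) = t c (F (u @ (k, x) # v))"
  shows "mlin s t F"
  using assms by (simp add: mlin_def)

context
  fixes s :: "'k::field \<Rightarrow> 'h::ab_group_add \<Rightarrow> 'h" and t :: "'k \<Rightarrow> 'b::ab_group_add \<Rightarrow> 'b"
  assumes t: "vector_space t"
begin

interpretation t: vector_space t by (rule t)

lemma mlin_add_fun: "mlin s t F \<Longrightarrow> mlin s t G \<Longrightarrow> mlin s t (\<lambda>w. F w + G w)"
  unfolding mlin_def by (simp add: t.scale_right_distrib)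

lemma scale_sg: "t c (sg n x) = sg n (t c x)"
  by (simp add: sg_def t.scale_minus_right)

lemma mlin_sg: "mlin s t F \<Longrightarrow> mlin s t (\<lambda>w. sg n (F w))"
  unfolding mlin_def by (simp add: scale_sg sg_add)

lemma mlin_sg_deg: "mlin s t F \<Longrightarrow> mlin s t (\<lambda>w. sg (n * deg w) (F w))"
  unfolding mlin_def by (simp add: scale_sg sg_add)

lemma mlin_minus: "mlin s t F \<Longrightarrow> mlin s t (\<lambda>w. - F w)"
  using mlin_sg[of F 1] by simp

lemma mlin_diff: "mlin s t F \<Longrightarrow> mlin s t G \<Longrightarrow> mlin s t (\<lambda>w. F w - G w)"
  using mlin_add_fun[OF _ mlin_minus] by simp

lemma mlin_0 [simp]: "mlin s t (\<lambda>w. 0)"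
  by (simp add: mlin_def t.scale_zero_right)

lemma mlin_dec:
  assumes "\<And>v. mlin s t (\<lambda>u. H u v)" "\<And>u. mlin s t (H u)"
  shows "mlin s t (dec H)"
proof (rule mlinI)
  have mem: "mlin s t (\<lambda>u. H (a # u) v)" for a v by (rule mlin_Cons[OF assms(1)])
  show "dec H (u @ (k, x + y) # v) = dec H (u @ (k, x) # v) + dec H (u @ (k, y) # v)" for u k v x y
    using assms
  proof (induction u arbitrary: H)
    case Nil
    show ?case by (simp add: mlin_add_hd[OF Nil(2)] mlin_add_hd[OF Nil(1)] dec_add)
  next
    case (Cons a u)
    show ?case using Cons.IH[of "\<lambda>u. H (a # u)"] mlin_Cons[OF Cons.prems(1), of a] Cons.prems(2)
      using mlin_add[OF Cons.prems(2), of "[]" "a # u"] by simp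
  qed
  show "dec H (u @ (k, s c x) # v) = t c (dec H (u @ (k, x) # v))" for u k v c x
    using assms
  proof (induction u arbitrary: H)
    case Nil
    show ?case
      by (simp add: mlin_scale_hd[OF Nil(2)] mlin_scale_hd[OF Nil(1)] t.scale_right_distrib
        dec_hom[of "t c", OF t.scale_right_distrib])
  next
    case (Cons a u)
    show ?case using Cons.IH[of "\<lambda>u. H (a # u)"] mlin_Cons[OF Cons.prems(1), of a] Cons.prems(2)
      using mlin_scale[OF Cons.prems(2), of "[]" "a # u"] by (simp add: t.scale_right_distrib)
  qed
qed

lemma mlin_dec_family: "(\<And>u v. mlin s t (F u v)) \<Longrightarrow> mlin s t (\<lambda>w. dec (\<lambda>u v. F u v w) z)"
proof (induction z arbitrary: F)
  case (Cons a z)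
  then show ?case by (auto intro!: mlin_add_fun Cons.IH)
qed simp

lemma mlin_lt:
  fixes s' :: "'k \<Rightarrow> 'g::ab_group_add \<Rightarrow> 'g"
  assumes "mlin s' t F" "mlin s s' f"
  shows "mlin s t (\<lambda>v. F (u @ (deg v + c, f v) # z))"
  by (rule mlinI) (simp_all add: mlin_add[OF assms(1)] mlin_add[OF assms(2)]
    mlin_scale[OF assms(1)] mlin_scale[OF assms(2)])

lemma mlin_ins:
  assumes "mlin s t F" "mlin s s f"
  shows "mlin s t (ins e (lt c f) F)"
  unfolding ins_dec[abs_def] lt_def
proof (intro mlin_dec)
  have 1: "mlin s t (\<lambda>u. F (u @ (k, x) # z))" for k x z
    by (rule mlin_append_right) (rule assms(1))
  show "mlin s t (\<lambda>u. dec (\<lambda>v z. sg (e * deg u) (F (u @ (deg v + c, f v) # z))) w)" for w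
    by (intro mlin_dec_family mlin_sg_deg 1)
  show "mlin s t (\<lambda>v. sg (e * deg u) (F (u @ (deg v + c, f v) # z)))" for u z
    by (intro mlin_sg mlin_lt[OF assms])
  show "mlin s t (\<lambda>z. sg (e * deg u) (F (u @ (deg v + c, f v) # z)))" for u v
    using mlin_append[OF assms(1), of "u @ [(deg v + c, f v)]"] by (intro mlin_sg) simp
qed

lemma mlin_Dop: "mlin s t F \<Longrightarrow> mlin s s b \<Longrightarrow> mlin s t (Dop b F)"
  unfolding Dop_def by (rule mlin_ins)

text \<open>The varied letter lies in exactly one block, because the block lengths add up to the
  length of the word.\<close>

lemma mlin_blocks:
  fixes s' :: "'k \<Rightarrow> 'g::ab_group_add \<Rightarrow> 'g"
  assumes "mlin s' t G" "mlin s s' \<phi>" "sum_list js = length u + length v + 1"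
  shows "G (blocks \<phi> js (u @ (k, x + y) # v)) =
      G (blocks \<phi> js (u @ (k, x) # v)) + G (blocks \<phi> js (u @ (k, y) # v))"
    and "G (blocks \<phi> js (u @ (k, s c x) # v)) = t c (G (blocks \<phi> js (u @ (k, x) # v)))"
proof -
  have "G (blocks \<phi> js (u @ (k, x + y) # v)) =
      G (blocks \<phi> js (u @ (k, x) # v)) + G (blocks \<phi> js (u @ (k, y) # v)) \<and>
      G (blocks \<phi> js (u @ (k, s c x) # v)) = t c (G (blocks \<phi> js (u @ (k, x) # v)))"
    using assms(1,3)
  proof (induction js arbitrary: G u)
    case Nil
    then show ?case by simp
  next
    case (Cons i js)
    show ?case
    proof (cases "i \<le> length u")
      case True
      let ?l = "(deg (take i u) + 1, \<phi> (take i u))"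
      show ?thesis
        using Cons.IH[of "\<lambda>z. G (?l # z)" "drop i u"] mlin_Cons[OF Cons.prems(1), of ?l] Cons.prems(2) True
        by simp
    next
      case False
      then have "take i (u @ (k, x) # v) = u @ (k, x) # take (i - length u - 1) v"
        "drop i (u @ (k, x) # v) = drop (i - length u - 1) v" for x
        by (simp_all add: take_Cons' drop_Cons')
      then show ?thesis
        by (simp add: mlin_add[OF assms(2)] mlin_scale[OF assms(2)]
          mlin_add_hd[OF Cons.prems(1)] mlin_scale_hd[OF Cons.prems(1)])
    qed
  qed
  then show "G (blocks \<phi> js (u @ (k, x + y) # v)) =
      G (blocks \<phi> js (u @ (k, x) # v)) + G (blocks \<phi> js (u @ (k, y) # v))"
    "G (blocks \<phi> js (u @ (k, s c x) # v)) = t c (G (blocks \<phi> js (u @ (k, x) # v)))" by auto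
qed

end

lemma linear_add_gen: "Vector_Spaces.linear s t f \<Longrightarrow> f (x + y) = f x + f y"
  and linear_scale_gen: "Vector_Spaces.linear s t f \<Longrightarrow> f (s c x) = t c (f x)"
  by (simp_all add: Vector_Spaces.linear_iff)

text \<open>The linear map may depend on the degree of the word; in this form the degreewise
  sections of a quasi-isomorphism are applied to functions of words.\<close>

lemma mlin_comp:
  assumes "mlin s t F" "\<And>k. Vector_Spaces.linear t r (f k)"
  shows "mlin s r (\<lambda>w. f (deg w) (F w))"
  by (rule mlinI) (simp_all add: mlin_add[OF assms(1)] mlin_scale[OF assms(1)]
    linear_add_gen[OF assms(2)] linear_scale_gen[OF assms(2)])

lemma mlin_length:
  assumes "vector_space t" "mlin s t F"
  shows "mlin s t (\<lambda>w. if P (length w) then F w else 0)"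
  using mlin_0[OF assms(1), of s] assms(2) by (auto simp: mlin_def)

lemma mlin_length_scale:
  assumes "vector_space t" "mlin s t F"
  shows "mlin s t (\<lambda>w. t (c (length w)) (F w))"
proof -
  interpret vector_space t by (rule assms(1))
  show ?thesis using assms(2)
    by (auto simp: mlin_def scale_right_distrib mult.commute)
qed

section \<open>The convolution algebra\<close>

text \<open>Additivity, scaling and associativity are required on the whole type, so that
  convolutions can be computed without membership conditions. A DGCA meets these requirements after
  its operations are composed with a projection onto the total space, see
  \<open>dgca_galg\<close>.\<close>

locale galg = vector_space sc
  for sc :: "'k::field_char_0 \<Rightarrow> 'a::ab_group_add \<Rightarrow> 'a" +
  fixes G :: "int \<Rightarrow> 'a set" and mul :: "'a \<Rightarrow> 'a \<Rightarrow> 'a" (infixl "\<odot>" 70)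
    and one :: 'a and d :: "'a \<Rightarrow> 'a"
  assumes G_subspace: "subspace (G k)"
    and mul_add_l: "(x + y) \<odot> z = x \<odot> z + y \<odot> z"
    and mul_add_r: "x \<odot> (y + z) = x \<odot> y + x \<odot> z"
    and mul_sc_l: "sc c x \<odot> y = sc c (x \<odot> y)"
    and mul_sc_r: "x \<odot> sc c y = sc c (x \<odot> y)"
    and mul_assoc: "x \<odot> y \<odot> z = x \<odot> (y \<odot> z)"
    and mul_G: "x \<in> G i \<Longrightarrow> y \<in> G j \<Longrightarrow> x \<odot> y \<in> G (i + j)"
    and mul_comm: "x \<in> G i \<Longrightarrow> y \<in> G j \<Longrightarrow> x \<odot> y = sg (i * j) (y \<odot> x)"
    and one_G: "one \<in> G 0"
    and one_l: "x \<in> G k \<Longrightarrow> one \<odot> x = x"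
    and one_r: "x \<in> G k \<Longrightarrow> x \<odot> one = x"
    and d_linear: "Vector_Spaces.linear sc sc d"
    and d_G: "x \<in> G k \<Longrightarrow> d x \<in> G (k + 1)"
    and d_d: "d (d x) = 0"
    and leibniz: "x \<in> G i \<Longrightarrow> d (x \<odot> y) = d x \<odot> y + sg i (x \<odot> d y)"
begin

lemma G_add: "x \<in> G k \<Longrightarrow> y \<in> G k \<Longrightarrow> x + y \<in> G k"
  and G_0: "0 \<in> G k"
  and G_scale: "x \<in> G k \<Longrightarrow> sc c x \<in> G k"
  and G_minus: "x \<in> G k \<Longrightarrow> - x \<in> G k"
  and G_diff: "x \<in> G k \<Longrightarrow> y \<in> G k \<Longrightarrow> x - y \<in> G k"
  using G_subspace[of k]
  by (auto intro: subspace_add subspace_0 subspace_scale subspace_neg subspace_diff)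

lemma G_sg: "x \<in> G k \<Longrightarrow> sg n x \<in> G k"
  by (simp add: sg_def G_minus)

lemma d_add: "d (x + y) = d x + d y"
  by (rule linear_add_gen[OF d_linear])

lemma d_minus: "d (- x) = - d x" and d_diff: "d (x - y) = d x - d y" and d_0 [simp]: "d 0 = 0"
proof -
  interpret additive d by (rule additive.intro) (rule d_add)
  show "d (- x) = - d x" "d (x - y) = d x - d y" "d 0 = 0" by (rule minus diff zero)+
qed

lemma d_sg: "d (sg n x) = sg n (d x)"
  by (rule sg_hom) (rule d_add)

lemma d_one [simp]: "d one = 0"
proof -
  have "d (one \<odot> one) = d one \<odot> one + sg 0 (one \<odot> d one)" by (rule leibniz[OF one_G])
  then show ?thesis by (simp add: one_r[OF one_G] one_r[OF d_G[OF one_G]] one_l[OF d_G[OF one_G]])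
qed

lemma mul_0 [simp]: "0 \<odot> x = 0" "x \<odot> 0 = 0"
  using mul_add_l[of 0 0 x] mul_add_r[of x 0 0] by simp_all

lemma mul_sg_l: "sg n x \<odot> y = sg n (x \<odot> y)"
  by (rule sg_hom) (rule mul_add_l)

lemma mul_sg_r: "x \<odot> sg n y = sg n (x \<odot> y)"
  by (rule sg_hom) (rule mul_add_r)

lemma mul_minus_l: "- x \<odot> y = - (x \<odot> y)" and mul_minus_r: "x \<odot> - y = - (x \<odot> y)"
  using mul_sg_l[of 1 x y] mul_sg_r[of x 1 y] by simp_all

lemma mul_diff_l: "(x - y) \<odot> z = x \<odot> z - y \<odot> z" and mul_diff_r: "x \<odot> (y - z) = x \<odot> y - x \<odot> z"
  using mul_add_l[of x "- y" z] mul_add_r[of x y "- z"] by (simp_all add: mul_minus_l mul_minus_r)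

lemma dec_mul_l: "dec (\<lambda>u v. H u v \<odot> x) w = dec H w \<odot> x"
  by (rule dec_hom[symmetric]) (rule mul_add_l)

lemma dec_mul_r: "dec (\<lambda>u v. x \<odot> H u v) w = x \<odot> dec H w"
  by (rule dec_hom[symmetric]) (rule mul_add_r)

text \<open>The convolution product. Its sign comes from moving the second factor, of degree
  \<open>g\<close>, past the first piece; \<open>g\<close> is a parameter because a function of
  words does not determine its degree.\<close>

definition cv :: "int \<Rightarrow> ((int \<times> 'h) list \<Rightarrow> 'a) \<Rightarrow> ((int \<times> 'h) list \<Rightarrow> 'a) \<Rightarrow> (int \<times> 'h) list \<Rightarrow> 'a"
  where "cv g F K w = dec (\<lambda>u v. sg (g * deg u) (F u \<odot> K v)) w"

lemma cv_assoc: "cv h (cv g F K) L = cv (g + h) F (cv h K L)"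
proof
  fix w
  have "cv h (cv g F K) L w
    = dec (\<lambda>u v. dec (\<lambda>x y. sg (g * deg x + h * deg u) (F x \<odot> K y \<odot> L v)) u) w"
    unfolding cv_def dec_mul_l[symmetric] dec_sg[symmetric] mul_sg_l
    by (simp add: algebra_simps)
  also have "\<dots> = dec (\<lambda>u v. dec (\<lambda>x y. sg (g * deg x + h * (deg x + deg y)) (F x \<odot> K y \<odot> L v)) u) w"
    by (intro dec_cong) simp
  also have "\<dots> = dec (\<lambda>x v. dec (\<lambda>y v. sg (g * deg x + h * (deg x + deg y)) (F x \<odot> K y \<odot> L v)) v) w"
    by (rule dec_assoc[symmetric])
  also have "\<dots> = cv (g + h) F (cv h K L) w"
    unfolding cv_def dec_mul_r[symmetric] dec_sg[symmetric] mul_sg_r mul_assoc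
    by (simp add: algebra_simps)
  finally show "cv h (cv g F K) L w = cv (g + h) F (cv h K L) w" .
qed

lemma cv_add_l: "cv g (\<lambda>w. F w + F' w) K w = cv g F K w + cv g F' K w"
  and cv_add_r: "cv g F (\<lambda>w. K w + K' w) w = cv g F K w + cv g F K' w"
  by (simp_all add: cv_def mul_add_l mul_add_r sg_add dec_add)

lemma cv_sg_l: "cv g (\<lambda>w. sg n (F w)) K w = sg n (cv g F K w)"
  and cv_sg_r: "cv g F (\<lambda>w. sg n (K w)) w = sg n (cv g F K w)"
  by (simp_all add: cv_def mul_sg_l mul_sg_r add.commute dec_sg[symmetric])

lemma cv_minus_l: "cv g (\<lambda>w. - F w) K w = - cv g F K w"
  and cv_minus_r: "cv g F (\<lambda>w. - K w) w = - cv g F K w"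
  using cv_sg_l[of g 1 F K w] cv_sg_r[of g F 1 K w] by simp_all

lemma cv_diff_l: "cv g (\<lambda>w. F w - F' w) K w = cv g F K w - cv g F' K w"
  and cv_diff_r: "cv g F (\<lambda>w. K w - K' w) w = cv g F K w - cv g F K' w"
  using cv_add_l[of g F "\<lambda>w. - F' w" K w] cv_add_r[of g F K "\<lambda>w. - K' w" w]
  by (simp_all add: cv_minus_l cv_minus_r)

lemma cv_0 [simp]: "cv g (\<lambda>w. 0) K w = 0" "cv g F (\<lambda>w. 0) w = 0"
  by (simp_all add: cv_def)

lemma cv_cong:
  assumes "\<And>u v. w = u @ v \<Longrightarrow> F u \<odot> K v = F' u \<odot> K' v"
  shows "cv g F K w = cv g F' K' w"
  unfolding cv_def by (rule dec_cong) (simp add: assms)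

lemma cv_split_r:
  assumes "K [] = one" "F w \<in> G k"
  shows "cv 0 F K w = F w + dec (\<lambda>u v. if v = [] then 0 else F u \<odot> K v) w"
  unfolding cv_def using dec_split_last[of "\<lambda>u v. F u \<odot> K v" w] assms by (simp add: one_r)

lemma cv_cong_short:
  assumes "F [] = 0" "K [] = 0" "F' [] = 0" "K' [] = 0"
    and "\<And>u. length u < length w \<Longrightarrow> F u = F' u" "\<And>u. length u < length w \<Longrightarrow> K u = K' u"
  shows "cv g F K w = cv g F' K' w"
proof (rule cv_cong)
  fix u v assume w: "w = u @ v"
  show "F u \<odot> K v = F' u \<odot> K' v"
  proof (cases "u = [] \<or> v = []")
    case True
    then show ?thesis using assms(1-4) by auto
  next
    case False
    then show ?thesis using assms(5)[of u] assms(6)[of v] w by simp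
  qed
qed

lemma Dop_cv: "Dop b (cv g F K) w = sg g (cv g (Dop b F) K w) + cv (g + 1) F (Dop b K) w"
proof -
  have 1: "Dop b (\<lambda>u'. sg (g * deg u') (F u' \<odot> K v)) u = sg (g * deg u + g) (Dop b F u \<odot> K v)" for u v
  proof -
    have "Dop b (\<lambda>u'. sg (g * deg u') (F u' \<odot> K v)) u = Dop b (\<lambda>u'. sg (g * deg u + g) (F u' \<odot> K v)) u"
      by (rule Dop_cong) (simp add: algebra_simps)
    also have "\<dots> = sg (g * deg u + g) (Dop b F u \<odot> K v)"
      by (rule Dop_hom[symmetric, of "\<lambda>x. sg (g * deg u + g) (x \<odot> K v)"]) (simp add: mul_add_l sg_add)
    finally show ?thesis .
  qed
  have 2: "Dop b (\<lambda>v. sg (g * deg u) (F u \<odot> K v)) v = sg (g * deg u) (F u \<odot> Dop b K v)" for u v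
    by (rule Dop_hom[symmetric, of "\<lambda>x. sg (g * deg u) (F u \<odot> x)"]) (simp add: mul_add_r sg_add)
  show ?thesis
    unfolding cv_def[abs_def] Dop_dec 1 2 sg_sg dec_add dec_sg[symmetric]
    by (simp add: algebra_simps)
qed

lemma sh_cv:
  "sh (cv g F K) x y = dec (\<lambda>x1 x2. dec (\<lambda>y1 y2.
     sg (deg x2 * deg y1 + g * (deg x1 + deg y1)) (sh F x1 y1 \<odot> sh K x2 y2)) y) x"
proof -
  have "sh (\<lambda>u. sh (\<lambda>v. sg (g * deg u) (F u \<odot> K v)) x2 y2) x1 y1
      = sg (g * (deg x1 + deg y1)) (sh F x1 y1 \<odot> sh K x2 y2)" for x1 x2 y1 y2
  proof -
    have "sh (\<lambda>v. sg (g * deg u) (F u \<odot> K v)) x2 y2 = sg (g * deg u) (F u \<odot> sh K x2 y2)" for u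
      by (rule sh_hom[symmetric, of "\<lambda>x. sg (g * deg u) (F u \<odot> x)"]) (simp add: mul_add_r sg_add)
    then have "sh (\<lambda>u. sh (\<lambda>v. sg (g * deg u) (F u \<odot> K v)) x2 y2) x1 y1
        = sh (\<lambda>u. sg (g * deg u) (F u \<odot> sh K x2 y2)) x1 y1" by simp
    also have "\<dots> = sh (\<lambda>u. sg (g * (deg x1 + deg y1)) (F u \<odot> sh K x2 y2)) x1 y1"
      by (rule sh_cong) simp
    also have "\<dots> = sg (g * (deg x1 + deg y1)) (sh F x1 y1 \<odot> sh K x2 y2)"
      by (rule sh_hom[symmetric, of "\<lambda>x. sg (g * (deg x1 + deg y1)) (x \<odot> sh K x2 y2)"])
        (simp add: mul_add_l sg_add)
    finally show ?thesis .
  qed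
  then show ?thesis unfolding cv_def[abs_def] sh_dec by simp
qed

lemma sh_cv_prim_l:
  assumes "prim F"
  shows "sh (cv g F K) x y = dec (\<lambda>x1 x2. sg (g * deg x1) (F x1 \<odot> sh K x2 y)) x
    + dec (\<lambda>y1 y2. sg ((deg x + g) * deg y1) (F y1 \<odot> sh K x y2)) y"
proof -
  let ?H = "\<lambda>x1 x2 y1 y2. sg (deg x2 * deg y1 + g * (deg x1 + deg y1)) (sh F x1 y1 \<odot> sh K x2 y2)"
  have "sh (cv g F K) x y = dec (\<lambda>x1 x2. dec (\<lambda>y1 y2. ?H x1 x2 y1 y2) y) x"
    by (rule sh_cv)
  also have "\<dots> = dec (\<lambda>x1 x2. ?H x1 x2 [] y) x + dec (\<lambda>y1 y2. ?H [] x y1 y2) y"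
    by (rule dec_dec_prim) (simp_all add: prim_sh[OF assms] prim_Nil[OF assms])
  finally show ?thesis by (simp add: algebra_simps)
qed

lemma sh_cv_prim_r:
  assumes "prim K"
  shows "sh (cv g F K) x y
    = dec (\<lambda>x1 x2. sg (deg x2 * deg y + g * (deg x1 + deg y)) (sh F x1 y \<odot> K x2)) x
    + dec (\<lambda>y1 y2. sg (g * (deg x + deg y1)) (sh F x y1 \<odot> K y2)) y"
proof -
  let ?H = "\<lambda>x1 x2 y1 y2. sg (deg x2 * deg y1 + g * (deg x1 + deg y1)) (sh F x1 y1 \<odot> sh K x2 y2)"
  have y2: "?H x1 x2 y1 y2 = 0" if "x2 \<noteq> []" "y2 \<noteq> []" for x1 x2 y1 y2
    using that by (simp add: prim_sh[OF assms])
  have "dec (\<lambda>y1 y2. ?H x1 x2 y1 y2) y = (if x2 = [] then dec (\<lambda>y1 y2. ?H x [] y1 y2) y else ?H x1 x2 y [])"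
    if "x = x1 @ x2" for x1 x2
  proof (cases "x2 = []")
    case False
    have "dec (\<lambda>u v. if v = [] then 0 else ?H x1 x2 u v) y = 0"
      by (rule dec_0I) (use False y2 in auto)
    then show ?thesis using False dec_split_last[of "\<lambda>y1 y2. ?H x1 x2 y1 y2" y] by simp
  qed (use that in simp)
  then have "sh (cv g F K) x y
      = dec (\<lambda>x1 x2. if x2 = [] then dec (\<lambda>y1 y2. ?H x [] y1 y2) y else ?H x1 x2 y []) x"
    unfolding sh_cv by (intro dec_cong)
  also have "\<dots> = dec (\<lambda>y1 y2. ?H x [] y1 y2) y + dec (\<lambda>x1 x2. if x2 = [] then 0 else ?H x1 x2 y []) x"
    by (subst dec_split_last) (simp cong: if_cong)
  also have "dec (\<lambda>x1 x2. if x2 = [] then 0 else ?H x1 x2 y []) x = dec (\<lambda>x1 x2. ?H x1 x2 y []) x"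
    by (rule dec_cong) (simp add: prim_Nil[OF assms])
  finally show ?thesis by (simp add: add.commute)
qed

end

section \<open>Recursion and limits with respect to word length\<close>

definition trunc :: "nat \<Rightarrow> ('x list \<Rightarrow> 'a::zero) \<Rightarrow> 'x list \<Rightarrow> 'a" where
  "trunc n F w = (if length w < n then F w else 0)"

text \<open>Values are defined by recursion on word length, but properties such as multilinearity
  relate values on different words and cannot be carried along word by word. They are propagated
  through truncations instead: one application of \<Phi> to the truncation at \<open>n\<close>
  determines the truncation at \<open>n + 1\<close>.\<close>

lemma word_recursion:
  assumes local: "\<And>F F' w. (\<And>v. length v < length w \<Longrightarrow> F v = F' v) \<Longrightarrow> \<Phi> F w = \<Phi> F' w"
    and zero: "P (\<lambda>w. 0)" and step: "\<And>F. P F \<Longrightarrow> P (\<Phi> F)"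
    and tr: "\<And>n F. P F \<Longrightarrow> P (trunc n F)" and lim: "\<And>F. (\<And>n. P (trunc n F)) \<Longrightarrow> P F"
  shows "\<exists>F. P F \<and> (\<forall>w. F w = \<Phi> F w)"
proof -
  let ?F = "wfrec (measure length) \<Phi>"
  have "adm_wf (measure length) \<Phi>" by (auto simp: adm_wf_def intro: local)
  then have F: "?F = \<Phi> ?F" by (intro wfrec_fixpoint) auto
  have "P (trunc n ?F)" for n
  proof (induction n)
    case 0
    then show ?case using zero by (simp add: trunc_def)
  next
    case (Suc n)
    have "trunc (Suc n) ?F w = trunc (Suc n) (\<Phi> (trunc n ?F)) w" for w
      using local[of w ?F "trunc n ?F"] fun_cong[OF F, of w] by (simp add: trunc_def)
    with step[OF Suc] tr[of "\<Phi> (trunc n ?F)" "Suc n"] show ?case by presburger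
  qed
  then have "P ?F" by (rule lim)
  with F show ?thesis by metis
qed

lemma mlin_limit:
  fixes F :: "(int \<times> 'h::ab_group_add) list \<Rightarrow> 'b::ab_group_add"
  assumes "\<And>n. mlin s t (trunc n F)"
  shows "mlin s t F"
proof (rule mlinI)
  fix u v :: "(int \<times> 'h) list" and k x y c
  from mlin_add[OF assms, of "Suc (length u + Suc (length v))" u k x y v]
    mlin_scale[OF assms, of "Suc (length u + Suc (length v))" u k c x v]
  show "F (u @ (k, x + y) # v) = F (u @ (k, x) # v) + F (u @ (k, y) # v)"
    "F (u @ (k, s c x) # v) = t c (F (u @ (k, x) # v))" by (simp_all add: trunc_def)
qed

lemma prim_trunc:
  fixes F :: "(int \<times> 'h) list \<Rightarrow> 'a::ab_group_add"
  assumes "F [] = 0" "\<And>x y. x \<noteq> [] \<Longrightarrow> y \<noteq> [] \<Longrightarrow> length x + length y < n \<Longrightarrow> sh F x y = 0"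
  shows "prim (trunc n F)"
  unfolding prim_def
proof (intro conjI allI impI)
  fix x y :: "(int \<times> 'h) list" assume xy: "x \<noteq> []" "y \<noteq> []"
  have "sh (trunc n F) x y = sh (\<lambda>w. if length x + length y < n then F w else 0) x y"
    by (rule sh_cong) (simp add: trunc_def)
  then show "sh (trunc n F) x y = 0" using assms(2)[OF xy] by (cases "length x + length y < n") auto
qed (simp add: trunc_def assms)

locale galg_words = galg sc G mul one d + H: vector_space hs
  for sc :: "'k::field_char_0 \<Rightarrow> 'a::ab_group_add \<Rightarrow> 'a" and G
    and mul (infixl "\<odot>" 70) and one and d
    and hs :: "'k \<Rightarrow> 'h::ab_group_add \<Rightarrow> 'h" +
  fixes b :: "(int \<times> 'h) list \<Rightarrow> 'h"
  assumes b_mlin: "mlin hs hs b" and b_short: "length w < 2 \<Longrightarrow> b w = 0"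
begin

lemma vsA: "vector_space sc" ..

definition hom :: "int \<Rightarrow> ((int \<times> 'h) list \<Rightarrow> 'a) \<Rightarrow> bool" where
  "hom f F \<longleftrightarrow> mlin hs sc F \<and> (\<forall>w. F w \<in> G (deg w + f))"

lemma hom_mlin: "hom f F \<Longrightarrow> mlin hs sc F"
  and hom_G: "hom f F \<Longrightarrow> F w \<in> G (deg w + f)"
  by (auto simp: hom_def)

lemma hom_add: "hom f F \<Longrightarrow> hom f K \<Longrightarrow> hom f (\<lambda>w. F w + K w)"
  by (auto simp: hom_def intro: mlin_add_fun[OF vsA] G_add)

lemma hom_minus: "hom f F \<Longrightarrow> hom f (\<lambda>w. - F w)"
  by (auto simp: hom_def intro: mlin_minus[OF vsA] G_minus)

lemma hom_sg: "hom f F \<Longrightarrow> hom f (\<lambda>w. sg n (F w))"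
  by (auto simp: hom_def intro: mlin_sg[OF vsA] G_sg)

lemma hom_diff: "hom f F \<Longrightarrow> hom f K \<Longrightarrow> hom f (\<lambda>w. F w - K w)"
  by (auto simp: hom_def intro: mlin_diff[OF vsA] G_diff)

lemma hom_0: "hom f (\<lambda>w. 0)"
  by (auto simp: hom_def mlin_0[OF vsA] G_0)

lemma hom_length: "hom f F \<Longrightarrow> hom f (\<lambda>w. if P (length w) then F w else 0)"
  by (auto simp: hom_def intro: mlin_length[OF vsA] G_0)

lemma hom_length_scale: "hom f F \<Longrightarrow> hom f (\<lambda>w. sc (c (length w)) (F w))"
  by (auto simp: hom_def intro: mlin_length_scale[OF vsA] G_scale)

lemma hom_trunc: "hom f F \<Longrightarrow> hom f (trunc n F)"
  unfolding trunc_def by (rule hom_length)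

lemma hom_limit: "(\<And>n. hom f (trunc n F)) \<Longrightarrow> hom f F"
  unfolding hom_def
proof (intro conjI allI)
  assume *: "\<And>n. mlin hs sc (trunc n F) \<and> (\<forall>w. trunc n F w \<in> G (deg w + f))"
  then show "mlin hs sc F" by (blast intro: mlin_limit)
  show "F w \<in> G (deg w + f)" for w
    using *[of "Suc (length w)"] by (auto simp: trunc_def dest: spec[of _ w])
qed

lemma hom_comp:
  assumes "hom f F" "\<And>k. Vector_Spaces.linear sc sc (T k)" "\<And>w. T (deg w) (F w) \<in> G (deg w + f')"
  shows "hom f' (\<lambda>w. T (deg w) (F w))"
  using mlin_comp[OF hom_mlin[OF assms(1)] assms(2)] assms(3) by (simp add: hom_def)

lemma hom_d: "hom f F \<Longrightarrow> f' = f + 1 \<Longrightarrow> hom f' (\<lambda>w. d (F w))"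
  using d_G by (intro hom_comp[where T = "\<lambda>_. d"] d_linear) (auto dest: hom_G simp: add.assoc[symmetric])

lemma hom_cv: "hom f F \<Longrightarrow> hom g K \<Longrightarrow> f' = f + g \<Longrightarrow> hom f' (cv g' F K)"
  unfolding hom_def
proof (intro conjI allI)
  assume F: "mlin hs sc F \<and> (\<forall>w. F w \<in> G (deg w + f))" and K: "mlin hs sc K \<and> (\<forall>w. K w \<in> G (deg w + g))"
    and f': "f' = f + g"
  have "mlin hs sc (\<lambda>u. F u \<odot> K v)" for v
    using F by (auto simp: mlin_def mul_add_l mul_sc_l)
  moreover have "mlin hs sc (\<lambda>v. F u \<odot> K v)" for u
    using K by (auto simp: mlin_def mul_add_r mul_sc_r)
  ultimately show "mlin hs sc (cv g' F K)"
    unfolding cv_def[abs_def] by (intro mlin_dec[OF vsA] mlin_sg[OF vsA] mlin_sg_deg[OF vsA])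
  show "cv g' F K w \<in> G (deg w + f')" for w
    unfolding cv_def
  proof (rule dec_mem)
    fix u v assume "w = u @ v"
    then show "sg (g' * deg u) (F u \<odot> K v) \<in> G (deg w + f')"
      using mul_G[of "F u" "deg u + f" "K v" "deg v + g"] F K f'
      by (intro G_sg) (simp add: algebra_simps)
  qed (rule G_add)
qed

lemma hom_Dop: "hom f F \<Longrightarrow> f' = f + 1 \<Longrightarrow> hom f' (Dop b F)"
  unfolding hom_def
proof (intro conjI allI)
  assume F: "mlin hs sc F \<and> (\<forall>w. F w \<in> G (deg w + f))" and f': "f' = f + 1"
  then show "mlin hs sc (Dop b F)" by (blast intro: mlin_Dop[OF vsA] b_mlin)
  show "Dop b F w \<in> G (deg w + f')" for w
    unfolding Dop_def ins_dec
  proof (intro dec_mem G_add G_sg; assumption?)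
    fix u v w' z assume "w = u @ v" "v = w' @ z"
    moreover have "F (u @ lt 2 b w' # z) \<in> G (deg (u @ lt 2 b w' # z) + f)"
      using F by blast
    ultimately show "F (u @ lt 2 b w' # z) \<in> G (deg w + f')" by (simp add: f' algebra_simps)
  qed
qed

lemma d_cv:
  assumes "hom f F"
  shows "d (cv g F K w) = cv g (\<lambda>w. d (F w)) K w + sg f (cv (g + 1) F (\<lambda>w. d (K w)) w)"
proof -
  have "d (sg (g * deg u) (F u \<odot> K v)) = sg (g * deg u) (d (F u) \<odot> K v)
      + sg f (sg ((g + 1) * deg u) (F u \<odot> d (K v)))" for u v
    by (simp add: d_sg leibniz[OF hom_G[OF assms]] sg_add algebra_simps)
  then show ?thesis
    by (simp add: cv_def dec_hom[of d] d_add dec_add dec_sg[symmetric])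
qed

text \<open>The differential of the convolution algebra on functions of degree \<open>f\<close>. In
  degree one it is the differential minus the coderivation term, so the Maurer-Cartan equation reads
  d F + F * F = D F, with D the operator \<open>Dop b\<close>.\<close>

definition pd :: "int \<Rightarrow> ((int \<times> 'h) list \<Rightarrow> 'a) \<Rightarrow> (int \<times> 'h) list \<Rightarrow> 'a" where
  "pd f F w = d (F w) + sg f (Dop b F w)"

lemma hom_pd: "hom f F \<Longrightarrow> f' = f + 1 \<Longrightarrow> hom f' (pd f F)"
  unfolding pd_def[abs_def] by (intro hom_add hom_d hom_sg hom_Dop)

lemma pd_cv:
  assumes "hom f F" "e = f + g" "g' = g + 1"
  shows "pd e (cv g F K) w = cv g (pd f F) K w + sg f (cv g' F (pd g K) w)"
  by (simp add: pd_def[abs_def] assms(2,3) d_cv[OF assms(1)] Dop_cv cv_add_l cv_add_r cv_sg_l cv_sg_r sg_add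
      algebra_simps) (simp add: sg_def)

lemma Dop_mono:
  assumes "mlin hs sc F" "mlin hs sc F'"
    "\<And>w'. w' \<noteq> [] \<Longrightarrow> length w' < length w \<Longrightarrow> F w' = F' w'"
  shows "Dop b F w = Dop b F' w"
  by (rule Dop_cong_short[OF b_short assms(1,2)]) (use assms(3) in auto)

lemma Dop_vanish:
  assumes "mlin hs sc F" "\<And>w'. w' \<noteq> [] \<Longrightarrow> length w' < length w \<Longrightarrow> F w' = 0"
  shows "Dop b F w = 0"
  using Dop_mono[OF assms(1) mlin_0[OF vsA], of w] assms(2) by simp

lemma Dop_short:
  assumes "mlin hs sc F" "length w < 2" shows "Dop b F w = 0"
proof (rule Dop_vanish[OF assms(1)])
  fix w' :: "(int \<times> 'h) list" assume "w' \<noteq> []" "length w' < length w"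
  with assms(2) show "F w' = 0" by (cases w') auto
qed

definition curv :: "((int \<times> 'h) list \<Rightarrow> 'a) \<Rightarrow> (int \<times> 'h) list \<Rightarrow> 'a" where
  "curv F w = pd 1 F w + cv 1 F F w"

lemma curv_eq: "curv F w = d (F w) - Dop b F w + cv 1 F F w"
  by (simp add: curv_def pd_def)

lemma hom_curv: "hom 1 F \<Longrightarrow> hom 2 (curv F)"
  unfolding curv_def[abs_def] by (intro hom_add hom_pd hom_cv) auto

text \<open>Substituting \<open>pd 1 F = curv F - cv 1 F F\<close> into the Leibniz rule makes the
  two cubic terms cancel by associativity. The square of the coderivation does not enter, so the
  identity is available before that square is known to vanish.\<close>

lemma pd_cv_curv:
  assumes "hom 1 F"
  shows "pd 2 (cv 1 F F) w = cv 1 (curv F) F w - cv 2 F (curv F) w"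
proof -
  have 1: "pd 1 F = (\<lambda>w. curv F w - cv 1 F F w)" by (rule ext) (simp add: curv_def)
  have "pd 2 (cv 1 F F) w = cv 1 (pd 1 F) F w + sg 1 (cv 2 F (pd 1 F) w)"
    by (rule pd_cv[OF assms]) auto
  also have "\<dots> = cv 1 (curv F) F w - cv 1 (cv 1 F F) F w - (cv 2 F (curv F) w - cv 2 F (cv 1 F F) w)"
    unfolding 1 cv_diff_l cv_diff_r sg_1 by (simp only: diff_conv_add_uminus)
  also have "cv 1 (cv 1 F F) F = cv 2 F (cv 1 F F)"
    using cv_assoc[of 1 1 F F F] by simp
  finally show ?thesis by (simp add: algebra_simps)
qed

text \<open>On a shuffle of nonempty words only the products of \<open>F x\<close> and
  \<open>F y\<close> in both orders survive, and graded commutativity makes them cancel as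
  \<open>F\<close> has degree one. This is how commutativity of the algebra turns into the Harrison
  condition.\<close>

lemma prim_cv:
  assumes "hom 1 F" "prim F"
  shows "prim (cv 1 F F)"
  unfolding prim_def
proof (intro conjI allI impI)
  show "cv 1 F F [] = 0" by (simp add: cv_def prim_Nil[OF assms(2)])
next
  fix x y :: "(int \<times> 'h) list" assume xy: "x \<noteq> []" "y \<noteq> []"
  have 1: "dec (\<lambda>x1 x2. sg (1 * deg x1) (F x1 \<odot> sh F x2 y)) x = sg (deg x) (F x \<odot> F y)" if "y \<noteq> []" for x y
    using dec_split_last[of "\<lambda>x1 x2. sg (1 * deg x1) (F x1 \<odot> sh F x2 y)" x] that
    by (simp add: prim_sh[OF assms(2)] cong: if_cong)
  have 2: "dec (\<lambda>y1 y2. sg ((deg x + 1) * deg y1) (F y1 \<odot> sh F x y2)) y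
      = sg ((deg x + 1) * deg y) (F y \<odot> F x)"
    using dec_split_last[of "\<lambda>y1 y2. sg ((deg x + 1) * deg y1) (F y1 \<odot> sh F x y2)" y] xy
    by (simp add: prim_sh[OF assms(2)] cong: if_cong)
  have "F y \<odot> F x = sg ((deg y + 1) * (deg x + 1)) (F x \<odot> F y)"
    by (rule mul_comm) (rule hom_G[OF assms(1)])+
  then show "sh (cv 1 F F) x y = 0"
    unfolding sh_cv_prim_l[OF assms(2)] 1[OF xy(2)] 2 by (simp add: sg_def)
qed

end

lemma sg_mem: "x \<in> S \<Longrightarrow> (\<And>x. x \<in> S \<Longrightarrow> - x \<in> S) \<Longrightarrow> sg n x \<in> S"
  by (simp add: sg_def)

lemma Dop_mem:
  assumes "\<And>x y. x \<in> S \<Longrightarrow> y \<in> S \<Longrightarrow> x + y \<in> S" "\<And>x. x \<in> S \<Longrightarrow> - x \<in> S"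
    and "\<And>w'. deg w' = deg w + 1 \<Longrightarrow> F w' \<in> S"
  shows "Dop b F w \<in> S"
  unfolding Dop_def ins_dec
  by (intro dec_mem sg_mem assms(1); (rule assms(2))?; assumption?; rule assms(3)) auto

lemma ins_top:
  assumes "mlin s t F" "\<And>v. length v < length w \<Longrightarrow> c v = 0"
  shows "ins e (lt k c) F w = F [lt k c w]"
  using assms
proof (induction w arbitrary: F)
  case (Cons a w)
  have "dec (\<lambda>v z. F (lt k c v # z)) (a # w) = F [lt k c (a # w)]
      + dec (\<lambda>v z. if z = [] then 0 else F (lt k c v # z)) (a # w)"
    by (rule dec_split_last)
  also have "dec (\<lambda>v z. if z = [] then 0 else F (lt k c v # z)) (a # w) = 0"
  proof (rule dec_0I)
    fix v z assume "a # w = v @ z"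
    then have "length (a # w) = length v + length z" by simp
    then show "(if z = [] then 0 else F (lt k c v # z)) = 0"
      using Cons.prems(2)[of v] by (auto simp: lt_def mlin_zero_hd[OF Cons.prems(1)])
  qed
  moreover have "ins e (lt k c) (\<lambda>w. F (a # w)) w = F [a, lt k c w]"
    using Cons.prems by (intro Cons.IH mlin_Cons) auto
  then have "ins e (lt k c) (\<lambda>w. F (a # w)) w = 0"
    using Cons.prems(2)[of w] mlin_zero[OF Cons.prems(1), of "[a]"] by (simp add: lt_def)
  ultimately show ?case by (simp del: dec.simps)
qed simp

lemma Dop_single:
  assumes "\<And>w. length w \<noteq> 1 \<Longrightarrow> F w = 0"
  shows "Dop b F w = F [lt 2 b w]"
proof (cases w)
  case (Cons a w')
  have "dec (\<lambda>v z. F (lt 2 b v # z)) w = F [lt 2 b w]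
      + dec (\<lambda>v z. if z = [] then 0 else F (lt 2 b v # z)) w"
    by (rule dec_split_last)
  also have "dec (\<lambda>v z. if z = [] then 0 else F (lt 2 b v # z)) w = 0"
    by (rule dec_0I) (simp add: assms)
  moreover have "Dop b (\<lambda>w. F (a # w)) w' = Dop b (\<lambda>w. 0) w'"
    by (rule Dop_cong) (simp add: assms)
  ultimately show ?thesis by (simp add: Cons Dop_Cons del: dec.simps)
qed (simp add: Dop_Nil)

section \<open>Homotopy transfer\<close>

context galg_words
begin

lemma cv_short: "F [] = 0 \<Longrightarrow> K [] = 0 \<Longrightarrow> length w < 2 \<Longrightarrow> cv g F K w = 0"
  by (cases w; cases "tl w") (auto simp: cv_def)

text \<open>Abstract transfer. The function \<open>\<tau>\<close> is the tree sum, determined by its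
  values on letters and a fixed-point equation, and \<open>b\<close> is read off from the harmonic
  part of its convolution square. Neither a Maurer-Cartan equation nor square zero nor any shuffle
  condition is assumed; all of them are derived.\<close>

context
  fixes GH :: "int \<Rightarrow> 'h set" and h :: "'a \<Rightarrow> 'a" and \<tau> :: "(int \<times> 'h) list \<Rightarrow> 'a"
  assumes GH: "H.subspace (GH k)" and b_GH: "b w \<in> GH (deg w + 2)"
    and \<tau>: "hom 1 \<tau>" "\<tau> [] = 0" and \<tau>1: "d (\<tau> [a]) = 0" "x \<in> GH k \<Longrightarrow> \<tau> [(k, x)] = 0 \<Longrightarrow> x = 0"
    and h: "Vector_Spaces.linear sc sc h"
    and \<tau>_rec: "2 \<le> length w \<Longrightarrow> \<tau> w = - h (cv 1 \<tau> \<tau> w)"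
    and \<tau>_b: "2 \<le> length w \<Longrightarrow>
      cv 1 \<tau> \<tau> w - (d (h (cv 1 \<tau> \<tau> w)) + h (d (cv 1 \<tau> \<tau> w))) = \<tau> [(deg w + 2, b w)]"
begin

interpretation h: additive h by (rule additive.intro) (rule linear_add_gen[OF h])

lemma \<tau>_short: "length w < 2 \<Longrightarrow> cv 1 \<tau> \<tau> w = 0"
  by (rule cv_short) (simp_all add: \<tau>(2))

text \<open>The function \<tau> + h (\<tau> * \<tau>) is supported on single letters, which makes
  its coderivation term explicit. With \<open>\<tau>_b\<close> the curvature then collapses to
  \<open>h\<close> applied to \<open>pd 2\<close> of the convolution square, and by
  \<open>pd_cv_curv\<close> this involves the curvature on shorter words only.\<close>

lemma transfer_curv: "curv \<tau> w = 0"
proof (induction "length w" arbitrary: w rule: less_induct)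
  case less
  let ?T = "cv 1 \<tau> \<tau>"
  have T: "hom 2 ?T" by (rule hom_cv[OF \<tau>(1) \<tau>(1)]) simp
  show ?case
  proof (cases "length w < 2")
    case True
    then have "d (\<tau> w) = 0" using \<tau>(2) \<tau>1(1) by (cases w; cases "tl w") auto
    with True show ?thesis
      by (simp add: curv_eq Dop_short[OF hom_mlin[OF \<tau>(1)]] \<tau>_short)
  next
    case False
    let ?\<rho> = "\<lambda>v. \<tau> v + h (?T v)"
    have "Dop b ?\<rho> w = ?\<rho> [lt 2 b w]"
    proof (rule Dop_single)
      fix v :: "(int \<times> 'h) list" assume "length v \<noteq> 1"
      then consider "v = []" | "2 \<le> length v" by (cases v; cases "tl v") auto
      then show "\<tau> v + h (?T v) = 0"
        by cases (simp_all add: \<tau>(2) \<tau>_rec \<tau>_short h.zero)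
    qed
    also have "\<dots> = \<tau> [(deg w + 2, b w)]"
      by (simp add: \<tau>_short h.zero lt_def)
    finally have "Dop b \<tau> w = \<tau> [(deg w + 2, b w)] - h (Dop b ?T w)"
      by (simp add: Dop_add Dop_hom[OF h.add] eq_diff_eq)
    moreover have "d (\<tau> w) = \<tau> [(deg w + 2, b w)] - ?T w + h (d (?T w))"
      using False \<tau>_b[of w] by (simp add: \<tau>_rec d_minus algebra_simps)
    ultimately have "curv \<tau> w = h (pd 2 ?T w)"
      by (simp add: curv_eq pd_def h.add)
    also have "pd 2 ?T w = cv 1 (curv \<tau>) \<tau> w - cv 2 \<tau> (curv \<tau>) w"
      by (rule pd_cv_curv[OF \<tau>(1)])
    also have "cv 1 (curv \<tau>) \<tau> w = cv 1 (\<lambda>w. 0) \<tau> w"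
    proof (rule cv_cong)
      fix u v assume "w = u @ v"
      then show "curv \<tau> u \<odot> \<tau> v = 0 \<odot> \<tau> v" using less[of u] \<tau>(2) by (cases "v = []") auto
    qed
    also have "cv 2 \<tau> (curv \<tau>) w = cv 2 \<tau> (\<lambda>w. 0) w"
    proof (rule cv_cong)
      fix u v assume "w = u @ v"
      then show "\<tau> u \<odot> curv \<tau> v = \<tau> u \<odot> 0" using less[of v] \<tau>(2) by (cases "u = []") auto
    qed
    finally show ?thesis by (simp add: h.zero)
  qed
qed

text \<open>By flatness, applying the coderivation twice to \<open>\<tau>\<close> gives
  \<open>pd 2\<close> of its convolution square, which is zero. Inductively only the insertion of
  the complete word remains on the other side, and \<open>\<tau>\<close> is injective on homogeneous
  letters.\<close>

lemma transfer_square: "Dop b b w = 0"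
proof (induction "length w" arbitrary: w rule: less_induct)
  case less
  let ?T = "cv 1 \<tau> \<tau>"
  have D: "Dop b \<tau> = (\<lambda>w. d (\<tau> w) + ?T w)"
  proof
    fix w show "Dop b \<tau> w = d (\<tau> w) + ?T w"
      using transfer_curv[of w] by (simp add: curv_eq algebra_simps)
  qed
  have "Dop b (Dop b \<tau>) w = d (Dop b \<tau> w) + Dop b ?T w"
    by (subst (1) D) (simp add: Dop_add Dop_hom[OF d_add])
  also have "\<dots> = pd 2 ?T w"
    by (simp add: D d_add d_d pd_def)
  also have "\<dots> = 0"
    using transfer_curv by (simp add: pd_cv_curv[OF \<tau>(1)] cv_def)
  finally have "ins 0 (lt 3 (Dop b b)) \<tau> w = 0"
    by (simp add: Dop_Dop[OF hom_mlin[OF \<tau>(1)]])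
  then have "\<tau> [(deg w + 3, Dop b b w)] = 0"
    using ins_top[OF hom_mlin[OF \<tau>(1)], of w "Dop b b" 0 3] less by (simp add: lt_def)
  moreover have "Dop b b w \<in> GH (deg w + 3)"
  proof (rule Dop_mem)
    fix w' :: "(int \<times> 'h) list" assume "deg w' = deg w + 1"
    then show "b w' \<in> GH (deg w + 3)" using b_GH[of w'] by (simp add: algebra_simps)
  qed (auto intro: H.subspace_add[OF GH] H.subspace_neg[OF GH])
  ultimately show ?case by (intro \<tau>1(2))
qed

text \<open>The convolution square on a word involves \<open>\<tau>\<close> on strictly shorter
  words only, where the induction hypothesis says that a truncation is primitive;
  \<open>prim_cv\<close> then applies and \<open>h\<close> is linear.\<close>

lemma transfer_prim: "prim \<tau>"
proof -
  have "sh \<tau> x y = 0" if "x \<noteq> []" "y \<noteq> []" for x y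
    using that
  proof (induction "length x + length y" arbitrary: x y rule: less_induct)
    case less
    let ?\<tau> = "trunc (length x + length y) \<tau>"
    have p: "prim ?\<tau>" by (rule prim_trunc[where F = \<tau>, OF \<tau>(2)]) (rule less.hyps)
    have "sh \<tau> x y = sh (\<lambda>w. - h (cv 1 ?\<tau> ?\<tau> w)) x y"
    proof (rule sh_cong)
      fix w :: "(int \<times> 'h) list" assume w: "length w = length x + length y"
      have "cv 1 \<tau> \<tau> w = cv 1 ?\<tau> ?\<tau> w"
        by (rule cv_cong_short) (auto simp: trunc_def \<tau>(2) w)
      moreover have "2 \<le> length w" using less.prems w by (cases x; cases y) auto
      ultimately show "\<tau> w = - h (cv 1 ?\<tau> ?\<tau> w)" by (simp add: \<tau>_rec)
    qed
    also have "\<dots> = - h (sh (cv 1 ?\<tau> ?\<tau>) x y)"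
      by (simp add: sh_minus sh_hom[OF h.add])
    also have "sh (cv 1 ?\<tau> ?\<tau>) x y = 0"
      using prim_cv[OF hom_trunc[OF \<tau>(1)] p] less.prems by (simp add: prim_def)
    finally show ?case by (simp add: h.zero)
  qed
  then show ?thesis by (simp add: prim_def \<tau>(2))
qed

text \<open>The convolution square of \<open>\<tau>\<close> vanishes on shuffles, and so does its
  harmonic part, by linearity. Injectivity of \<open>\<tau>\<close> on letters transfers this to
  \<open>b\<close>.\<close>

lemma transfer_b_prim: "prim b"
  unfolding prim_def
proof (intro conjI allI impI)
  show "b [] = 0" by (simp add: b_short)
  fix x y :: "(int \<times> 'h) list" assume xy: "x \<noteq> []" "y \<noteq> []"
  let ?T = "cv 1 \<tau> \<tau>"
  have T: "sh ?T x y = 0"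
    using prim_cv[OF \<tau>(1) transfer_prim] xy by (simp add: prim_def)
  have add: "?T w + - (d (h (?T w)) + h (d (?T w))) = ?T w - (d (h (?T w)) + h (d (?T w)))" for w
    by simp
  have "sh (\<lambda>w. \<tau> [lt 2 b w]) x y = sh (\<lambda>w. ?T w - (d (h (?T w)) + h (d (?T w)))) x y"
  proof (rule sh_cong)
    fix w :: "(int \<times> 'h) list" assume w: "length w = length x + length y"
    have "2 \<le> length w" using xy w by (cases x; cases y) auto
    then show "\<tau> [lt 2 b w] = ?T w - (d (h (?T w)) + h (d (?T w)))" by (simp add: \<tau>_b lt_def)
  qed
  also have "\<dots> = sh ?T x y - (d (h (sh ?T x y)) + h (d (sh ?T x y)))"
    by (simp add: sh_diff sh_add sh_hom[OF d_add] sh_hom[OF h.add])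
  finally have "\<tau> [(deg x + deg y + 2, sh b x y)] = 0"
    using sh_lt[OF hom_mlin[OF \<tau>(1)], of 2 b "[]" x y] T by (simp add: h.zero)
  moreover have "sh b x y \<in> GH (deg x + deg y + 2)"
  proof (rule sh_mem)
    fix w' :: "(int \<times> 'h) list" assume "deg w' = deg x + deg y"
    then show "b w' \<in> GH (deg x + deg y + 2)" using b_GH[of w'] by simp
  qed (auto intro: H.subspace_add[OF GH] H.subspace_neg[OF GH])
  ultimately show "sh b x y = 0" by (intro \<tau>1(2))
qed

end

end

section \<open>Gauge transformations\<close>

locale mc_words = galg_words sc G mul one d hs b
  for sc :: "'k::field_char_0 \<Rightarrow> 'a::ab_group_add \<Rightarrow> 'a" and G
    and mul (infixl "\<odot>" 70) and one and d
    and hs :: "'k \<Rightarrow> 'h::ab_group_add \<Rightarrow> 'h" and b +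
  assumes b_prim: "prim b" and b_square: "Dop b b w = 0"
begin

lemma Dop_Dop_0:
  assumes "mlin hs sc F" shows "Dop b (Dop b F) w = 0"
proof -
  have "ins 0 (lt 3 (Dop b b)) F w = 0"
    by (simp add: ins_dec lt_def b_square mlin_zero[OF assms])
  then show ?thesis by (simp add: Dop_Dop[OF assms])
qed

lemma pd_pd:
  assumes "hom f F" "e = f + 1" shows "pd e (pd f F) w = 0"
proof -
  have "pd e (pd f F) w = sg f (d (Dop b F w)) + sg e (Dop b (\<lambda>w. d (F w)) w)
      + sg (e + f) (Dop b (Dop b F) w)"
    by (simp add: pd_def[abs_def] d_add d_d d_sg Dop_add Dop_sg sg_add)
  also have "\<dots> = 0"
    using assms(2) Dop_hom[OF d_add, of b F w]
    by (simp add: Dop_Dop_0[OF hom_mlin[OF assms(1)]] sg_plus1)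
  finally show ?thesis .
qed

definition MC :: "((int \<times> 'h) list \<Rightarrow> 'a) \<Rightarrow> bool" where
  "MC F \<longleftrightarrow> hom 1 F \<and> prim F \<and> (\<forall>w. curv F w = 0)"

lemma prim_pd:
  assumes "hom f F" "prim F" shows "prim (pd g F)"
  unfolding prim_def
proof (intro conjI allI impI)
  note F = hom_mlin[OF assms(1)]
  show "pd g F [] = 0" by (simp add: pd_def prim_Nil[OF assms(2)] Dop_short[OF F])
  fix x y :: "(int \<times> 'h) list" assume xy: "x \<noteq> []" "y \<noteq> []"
  have "Dop b (\<lambda>x'. sh F x' y) x = Dop b (\<lambda>x'. 0) x"
    by (rule Dop_cong) (simp add: prim_sh[OF assms(2)] xy)
  moreover have "Dop b (\<lambda>y'. sh F x y') y = Dop b (\<lambda>y'. 0) y"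
    by (rule Dop_cong) (simp add: prim_sh[OF assms(2)] xy)
  ultimately have "sh (Dop b F) x y = 0"
    by (simp add: sh_Dop[OF F b_prim])
  then show "sh (pd g F) x y = 0"
    by (simp add: pd_def[abs_def] sh_add sh_sg sh_hom[OF d_add, symmetric] prim_sh[OF assms(2)] xy)
qed

lemma prim_curv:
  assumes "hom 1 F" "prim F" shows "prim (curv F)"
  using prim_pd[OF assms] prim_cv[OF assms]
  by (simp add: prim_def curv_def[abs_def] sh_add)

lemma bianchi:
  assumes "hom 1 F"
  shows "pd 2 (curv F) w = cv 1 (curv F) F w - cv 2 F (curv F) w"
proof -
  have "pd 2 (curv F) w = pd 2 (pd 1 F) w + pd 2 (cv 1 F F) w"
    by (simp add: curv_def[abs_def] pd_def[of 2] d_add Dop_add)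
  then show ?thesis by (simp add: pd_pd[OF assms] pd_cv_curv[OF assms])
qed

text \<open>
  The exponential \<open>\<Sum>\<^sub>j x\<^bsup>j\<^esup> / j!\<close> of \<open>x\<close> in word length \<open>N\<close>, computed from the
  Euler operator: \<open>length w * u w = N * (x u) w\<close>.
\<close>

lemma exp_exists:
  assumes x: "hom 0 x" "prim x" and N: "N > 0" and supp: "\<And>w. length w \<noteq> N \<Longrightarrow> x w = 0"
  obtains u where "hom 0 u" "u [] = one" "\<And>y z. sh u y z = u y \<odot> u z"
    "\<And>w. w \<noteq> [] \<Longrightarrow> length w < N \<Longrightarrow> u w = 0" "\<And>w. length w = N \<Longrightarrow> u w = x w"
proof -
  let ?y = "\<lambda>w. sc (of_nat N) (x w)"
  let ?\<Phi> = "\<lambda>F w. if w = [] then one else sc (1 / of_nat (length w)) (cv 0 ?y F w)"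
  note x0 = prim_Nil[OF x(2)]
  have y: "hom 0 ?y" using hom_length_scale[OF x(1), of "\<lambda>_. of_nat N"] by simp
  have yp: "prim ?y"
    using x(2) sh_hom[of "sc (of_nat N)" x, OF scale_right_distrib, symmetric]
    by (auto simp: prim_def)
  have "\<exists>u. hom 0 u \<and> (\<forall>w. u w = ?\<Phi> u w)"
  proof (rule word_recursion)
    fix F F' :: "(int \<times> 'h) list \<Rightarrow> 'a" and w :: "(int \<times> 'h) list"
    assume F: "\<And>v. length v < length w \<Longrightarrow> F v = F' v"
    have "cv 0 ?y F w = cv 0 ?y F' w"
    proof (rule cv_cong)
      fix u v assume "w = u @ v"
      then show "?y u \<odot> F v = ?y u \<odot> F' v" using F[of v] by (cases "u = []") (auto simp: x0)
    qed
    then show "?\<Phi> F w = ?\<Phi> F' w" by simp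
  next
    fix F assume F: "hom 0 F"
    have "hom 0 (\<lambda>w. sc (1 / of_nat (length w)) (cv 0 ?y F w))"
      by (rule hom_length_scale, rule hom_cv[OF y F]) simp
    then show "hom 0 (?\<Phi> F)"
      unfolding hom_def mlin_def by (auto simp: one_G)
  qed (rule hom_0 hom_trunc hom_limit; assumption)+
  then obtain u where u: "hom 0 u" and rec: "\<And>w. u w = ?\<Phi> u w" by blast
  have u0: "u [] = one" by (subst rec) simp
  have euler: "cv 0 ?y u w = sc (of_nat (length w)) (u w)" for w
    by (cases "w = []") (simp_all add: rec[of w] cv_def x0)
  have mult: "sh u y z = u y \<odot> u z" for y z
  proof (induction "length y + length z" arbitrary: y z rule: less_induct)
    case less
    show ?case
    proof (cases "y = [] \<or> z = []")
      case True
      then show ?thesis using one_l[OF hom_G[OF u]] one_r[OF hom_G[OF u]] by (auto simp: u0)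
    next
      case False
      let ?n = "length y + length z"
      \<comment> \<open>The factor 1 / length is constant on the shuffles of \<open>y\<close> and
        \<open>z\<close>. Convolution with a primitive function acts on shuffles as a derivation,
        and \<open>euler\<close> turns its two parts into the lengths of \<open>y\<close> and
        \<open>z\<close>, whose sum cancels the denominator.\<close>
      have "sh u y z = sh (\<lambda>w. sc (1 / of_nat ?n) (cv 0 ?y u w)) y z"
        by (rule sh_cong, subst rec) (use False in auto)
      also have "\<dots> = sc (1 / of_nat ?n) (sh (cv 0 ?y u) y z)"
        by (rule sh_hom[symmetric]) (rule scale_right_distrib)
      also have "sh (cv 0 ?y u) y z = dec (\<lambda>y1 y2. ?y y1 \<odot> sh u y2 z) y
          + dec (\<lambda>z1 z2. sg (deg y * deg z1) (?y z1 \<odot> sh u y z2)) z"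
        by (simp add: sh_cv_prim_l[OF yp])
      also have "dec (\<lambda>y1 y2. ?y y1 \<odot> sh u y2 z) y = dec (\<lambda>y1 y2. ?y y1 \<odot> u y2 \<odot> u z) y"
      proof (rule dec_cong)
        fix y1 y2 assume "y = y1 @ y2"
        then show "?y y1 \<odot> sh u y2 z = ?y y1 \<odot> u y2 \<odot> u z"
          using less[of y2 z] by (cases "y1 = []") (auto simp: x0 mul_assoc)
      qed
      also have "\<dots> = cv 0 ?y u y \<odot> u z"
        by (simp add: cv_def dec_mul_l)
      also have "dec (\<lambda>z1 z2. sg (deg y * deg z1) (?y z1 \<odot> sh u y z2)) z
          = dec (\<lambda>z1 z2. u y \<odot> (?y z1 \<odot> u z2)) z"
      proof (rule dec_cong)
        fix z1 z2 assume z: "z = z1 @ z2"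
        have "?y z1 \<odot> u y = sg (deg z1 * deg y) (u y \<odot> ?y z1)"
          by (rule mul_comm) (use hom_G[OF y, of z1] hom_G[OF u, of y] in simp_all)
        then have "sg (deg y * deg z1) (?y z1 \<odot> u y) = u y \<odot> ?y z1"
          by (simp add: mult.commute)
        then show "sg (deg y * deg z1) (?y z1 \<odot> sh u y z2) = u y \<odot> (?y z1 \<odot> u z2)"
          using less[of y z2] z
          by (cases "z1 = []") (auto simp: x0 mul_assoc[symmetric] mul_sg_l[symmetric])
      qed
      also have "\<dots> = u y \<odot> cv 0 ?y u z"
        by (simp add: cv_def dec_mul_r)
      finally have "sh u y z = sc (1 / of_nat ?n * of_nat ?n) (u y \<odot> u z)"
        by (simp add: euler mul_sc_l mul_sc_r scale_right_distrib scale_left_distrib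
          add_divide_distrib distrib_left del: times_divide_eq_left)
      then show ?thesis using False by (auto simp: of_nat_add[symmetric] simp del: of_nat_add)
    qed
  qed
  have low: "u w = (if length w = N then x w else 0)" if "w \<noteq> []" "length w \<le> N" for w
  proof -
    have "cv 0 ?y u w = ?y w + dec (\<lambda>u' v. if v = [] then 0 else ?y u' \<odot> u v) w"
      using hom_G[OF y] by (intro cv_split_r u0)
    also have "dec (\<lambda>u' v. if v = [] then 0 else ?y u' \<odot> u v) w = 0"
    proof (rule dec_0I)
      fix u' v assume "w = u' @ v"
      then show "(if v = [] then 0 else ?y u' \<odot> u v) = 0"
        using that supp[of u'] by (cases v) auto
    qed
    finally show ?thesis using that N by (subst rec) (auto simp: supp)
  qed
  show ?thesis
    by (rule that[of u]) (use u u0 mult low N in auto)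
qed

text \<open>With \<open>u\<close> the exponential of \<open>x\<close>, the new element is u \<alpha>
  u^-1 - (pd u) u^-1. Instead of inverting \<open>u\<close>, the equation
  \<open>cv 0 F u = cv 1 u \<alpha> - pd 0 u\<close> is solved by recursion on word length, which
  works as \<open>u [] = one\<close>. Up to length \<open>N\<close> the only other part of
  \<open>u\<close> is \<open>x\<close> in length \<open>N\<close>, so only \<open>d (x w)\<close>
  changes there.\<close>

lemma gauge:
  assumes \<alpha>: "MC \<alpha>" and x: "hom 0 x" "prim x" and N: "N > 0"
    and supp: "\<And>w. length w \<noteq> N \<Longrightarrow> x w = 0"
  obtains \<alpha>' where "MC \<alpha>'" "\<And>w. length w \<le> N \<Longrightarrow> \<alpha>' w = \<alpha> w - d (x w)"
proof -
  obtain u where u: "hom 0 u" "u [] = one" "\<And>y z. sh u y z = u y \<odot> u z"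
    and low: "\<And>w. w \<noteq> [] \<Longrightarrow> length w < N \<Longrightarrow> u w = 0" "\<And>w. length w = N \<Longrightarrow> u w = x w"
    using exp_exists[OF x N supp] by blast
  have \<alpha>h: "hom 1 \<alpha>" and \<alpha>p: "prim \<alpha>" and \<alpha>c: "\<And>w. curv \<alpha> w = 0" using \<alpha> by (auto simp: MC_def)
  let ?R = "\<lambda>w. cv 1 u \<alpha> w - pd 0 u w"
  let ?\<Phi> = "\<lambda>F w. ?R w - dec (\<lambda>v1 v2. if v2 = [] then 0 else F v1 \<odot> u v2) w"
  have Rh: "hom 1 ?R" by (intro hom_diff hom_cv[OF u(1) \<alpha>h] hom_pd[OF u(1)]) auto
  have \<Phi>: "?\<Phi> F w = ?R w + F w - cv 0 F u w" if "hom 1 F" for F w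
    using cv_split_r[where F = F and K = u and w = w and k = "deg w + 1", OF u(2)] hom_G[OF that, of w]
    by (simp add: algebra_simps)
  have "\<exists>F. hom 1 F \<and> (\<forall>w. F w = ?\<Phi> F w)"
  proof (rule word_recursion)
    fix F F' :: "(int \<times> 'h) list \<Rightarrow> 'a" and w :: "(int \<times> 'h) list"
    assume F: "\<And>v. length v < length w \<Longrightarrow> F v = F' v"
    have "dec (\<lambda>v1 v2. if v2 = [] then 0 else F v1 \<odot> u v2) w
        = dec (\<lambda>v1 v2. if v2 = [] then 0 else F' v1 \<odot> u v2) w"
      by (rule dec_cong) (auto simp: F)
    then show "?\<Phi> F w = ?\<Phi> F' w" by simp
  next
    fix F assume F: "hom 1 F"
    have "hom 1 (\<lambda>w. ?R w + F w - cv 0 F u w)"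
      by (intro hom_diff hom_add Rh F hom_cv[OF F u(1)]) auto
    then show "hom 1 (?\<Phi> F)" by (simp only: \<Phi>[OF F])
  qed (rule hom_0 hom_trunc hom_limit; assumption)+
  then obtain F where F: "hom 1 F" and rec: "\<And>w. F w = ?\<Phi> F w" by blast
  have conj: "cv 0 F u w = ?R w" for w
    using rec[of w] by (simp add: \<Phi>[OF F])
  have um: "mlin hs sc u" by (rule hom_mlin[OF u(1)])
  have F0: "F [] = 0"
    by (subst rec) (simp add: cv_def prim_Nil[OF \<alpha>p] pd_def u(2) Dop_short[OF um])
  have curv: "curv F w = 0" for w
  proof -
    have cvR: "cv 0 F u = ?R" by (rule ext) (rule conj)
    have p1: "pd 1 \<alpha> = (\<lambda>w. - cv 1 \<alpha> \<alpha> w)"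
    proof
      fix w show "pd 1 \<alpha> w = - cv 1 \<alpha> \<alpha> w" using \<alpha>c[of w] by (simp add: curv_def eq_neg_iff_add_eq_0)
    qed
    have 1: "cv 0 (pd 1 F) u w = cv 1 F (pd 0 u) w + cv 1 (pd 0 u) \<alpha> w - cv 2 u (cv 1 \<alpha> \<alpha>) w" for w
    proof -
      have "pd 1 (cv 0 F u) w = cv 0 (pd 1 F) u w - cv 1 F (pd 0 u) w"
        using pd_cv[OF F, of 1 0 1 u w] by simp
      moreover have "pd 1 (cv 0 F u) w = pd 1 (cv 1 u \<alpha>) w - pd 1 (pd 0 u) w"
        by (simp add: cvR pd_def[of 1] d_diff Dop_add[of b "cv 1 u \<alpha>" "\<lambda>w. - pd 0 u w", simplified] Dop_minus)
      moreover have "pd 1 (cv 1 u \<alpha>) w = cv 1 (pd 0 u) \<alpha> w - cv 2 u (cv 1 \<alpha> \<alpha>) w"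
        using pd_cv[OF u(1), of 1 1 2 \<alpha> w] by (simp add: p1 cv_minus_r)
      ultimately show ?thesis using pd_pd[OF u(1), of 1 w] by (simp add: algebra_simps)
    qed
    have 2: "cv 0 (cv 1 F F) u w = cv 2 u (cv 1 \<alpha> \<alpha>) w - cv 1 (pd 0 u) \<alpha> w - cv 1 F (pd 0 u) w" for w
    proof -
      have "cv 0 (cv 1 F F) u w = cv 1 F (cv 0 F u) w" by (simp add: cv_assoc)
      also have "\<dots> = cv 1 F (cv 1 u \<alpha>) w - cv 1 F (pd 0 u) w" by (simp add: cvR cv_diff_r)
      also have "cv 1 F (cv 1 u \<alpha>) = cv 1 (cv 0 F u) \<alpha>" by (simp add: cv_assoc)
      also have "cv 1 (cv 0 F u) \<alpha> w = cv 1 (cv 1 u \<alpha>) \<alpha> w - cv 1 (pd 0 u) \<alpha> w"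
        by (simp add: cvR cv_diff_l)
      also have "cv 1 (cv 1 u \<alpha>) \<alpha> = cv 2 u (cv 1 \<alpha> \<alpha>)" using cv_assoc[of 1 1 u \<alpha> \<alpha>] by simp
      finally show ?thesis .
    qed
    \<comment> \<open>Gauge covariance: in the sum of the two identities everything cancels because
      \<alpha> is flat. The factor \<open>u\<close> is removed by induction afterwards, since it
      starts with the unit.\<close>
    have E: "cv 0 (curv F) u w = 0" for w
      unfolding curv_def[abs_def] cv_add_l 1 2 by simp
    show "curv F w = 0"
    proof (induction "length w" arbitrary: w rule: less_induct)
      case less
      have "cv 0 (curv F) u w = curv F w + dec (\<lambda>v1 v2. if v2 = [] then 0 else curv F v1 \<odot> u v2) w"
        using hom_G[OF hom_curv[OF F]] by (intro cv_split_r u(2))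
      also have "dec (\<lambda>v1 v2. if v2 = [] then 0 else curv F v1 \<odot> u v2) w = 0"
        by (rule dec_0I) (auto simp: less)
      finally show ?case by (simp add: E)
    qed
  qed
  have comm: "sg (deg x * (deg y1 + f)) (a \<odot> u x) = u x \<odot> a" if "a \<in> G (deg y1 + f)" for a x y1 f
    using mul_comm[OF that hom_G[OF u(1), of x]] by (simp add: mult.commute)
  \<comment> \<open>As \<open>u\<close> is multiplicative and \<alpha> primitive, \<open>?R\<close>
    is a derivation relative to \<open>u\<close>. The part of \<open>cv 0 F u\<close> already known
    to come from a primitive function obeys the same rule, and the difference is exactly
    \<open>sh F y z\<close>.\<close>
  have Rsh: "sh ?R y z = ?R y \<odot> u z + sg (deg y) (u y \<odot> ?R z)" for y z
  proof -
    have "sh (Dop b u) y z = Dop b (\<lambda>y'. u y' \<odot> u z) y + sg (deg y) (Dop b (\<lambda>z'. u y \<odot> u z') z)"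
      by (simp add: sh_Dop[OF um b_prim] u(3))
    also have "\<dots> = Dop b u y \<odot> u z + sg (deg y) (u y \<odot> Dop b u z)"
      using Dop_hom[of "\<lambda>x. x \<odot> u z" b u y] Dop_hom[of "\<lambda>x. u y \<odot> x" b u z]
      by (simp add: mul_add_l mul_add_r)
    finally have D: "sh (Dop b u) y z = \<dots>" .
    have d: "sh (\<lambda>w. d (u w)) y z = d (u y) \<odot> u z + sg (deg y) (u y \<odot> d (u z))"
      using leibniz[OF hom_G[OF u(1), of y], of "u z"] by (simp add: sh_hom[OF d_add, symmetric] u(3))
    have p: "sh (pd 0 u) y z = pd 0 u y \<odot> u z + sg (deg y) (u y \<odot> pd 0 u z)"
      by (simp add: pd_def[abs_def] sh_add D d mul_add_l mul_add_r sg_add)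
    have "sh (cv 1 u \<alpha>) y z
        = dec (\<lambda>y1 y2. sg (deg y2 * deg z + (deg y1 + deg z)) (u y1 \<odot> u z \<odot> \<alpha> y2)) y
          + dec (\<lambda>z1 z2. sg (deg y + deg z1) (u y \<odot> u z1 \<odot> \<alpha> z2)) z"
      by (simp add: sh_cv_prim_r[OF \<alpha>p] u(3))
    also have "dec (\<lambda>y1 y2. sg (deg y2 * deg z + (deg y1 + deg z)) (u y1 \<odot> u z \<odot> \<alpha> y2)) y
        = dec (\<lambda>y1 y2. sg (deg y1) (u y1 \<odot> \<alpha> y2) \<odot> u z) y"
    proof (rule dec_cong)
      fix y1 y2
      have "u z \<odot> \<alpha> y2 = sg (deg z * (deg y2 + 1)) (\<alpha> y2 \<odot> u z)"
        using comm[OF hom_G[OF \<alpha>h, of y2], of z] by simp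
      then show "sg (deg y2 * deg z + (deg y1 + deg z)) (u y1 \<odot> u z \<odot> \<alpha> y2) = sg (deg y1) (u y1 \<odot> \<alpha> y2) \<odot> u z"
        by (simp only: mul_assoc mul_sg_r mul_sg_l sg_sg) (rule sg_cong, auto)
    qed
    also have "\<dots> = cv 1 u \<alpha> y \<odot> u z" by (simp add: cv_def dec_mul_l)
    also have "dec (\<lambda>z1 z2. sg (deg y + deg z1) (u y \<odot> u z1 \<odot> \<alpha> z2)) z = sg (deg y) (u y \<odot> cv 1 u \<alpha> z)"
      by (simp add: cv_def dec_mul_r[symmetric] dec_sg[symmetric] mul_sg_r mul_assoc)
    finally show ?thesis
      by (simp add: sh_diff p mul_diff_l mul_diff_r sg_diff algebra_simps)
  qed
  have "sh F y z = 0" if "y \<noteq> []" "z \<noteq> []" for y z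
    using that
  proof (induction "length y + length z" arbitrary: y z rule: less_induct)
    case less
    let ?F = "trunc (length y + length z) F"
    have p: "prim ?F" by (rule prim_trunc[where F = F, OF F0]) (rule less.hyps)
    have "sh ?R y z = sh (\<lambda>w. F w + cv 0 ?F u w) y z"
    proof (rule sh_cong)
      fix w :: "(int \<times> 'h) list" assume w: "length w = length y + length z"
      have "cv 0 F u w = F w + dec (\<lambda>v1 v2. if v2 = [] then 0 else F v1 \<odot> u v2) w"
        using hom_G[OF F] by (intro cv_split_r u(2))
      also have "dec (\<lambda>v1 v2. if v2 = [] then 0 else F v1 \<odot> u v2) w = cv 0 ?F u w"
        unfolding cv_def by (rule dec_cong) (auto simp: trunc_def w[symmetric])
      finally show "?R w = F w + cv 0 ?F u w" by (simp add: conj)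
    qed
    also have "\<dots> = sh F y z + (dec (\<lambda>y1 y2. ?F y1 \<odot> u y2 \<odot> u z) y
        + dec (\<lambda>z1 z2. sg (deg y * deg z1) (?F z1 \<odot> u y \<odot> u z2)) z)"
      by (simp add: sh_add sh_cv_prim_l[OF p] u(3) mul_assoc)
    also have "dec (\<lambda>y1 y2. ?F y1 \<odot> u y2 \<odot> u z) y = cv 0 F u y \<odot> u z"
      unfolding dec_mul_l cv_def
      by (intro arg_cong2[of _ _ _ _ "(\<odot>)"] dec_cong) (use less.prems in \<open>auto simp: trunc_def\<close>)
    also have "dec (\<lambda>z1 z2. sg (deg y * deg z1) (?F z1 \<odot> u y \<odot> u z2)) z
        = dec (\<lambda>z1 z2. sg (deg y) (u y \<odot> (F z1 \<odot> u z2))) z"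
    proof (rule dec_cong)
      fix z1 z2 assume z: "z = z1 @ z2"
      have "sg (deg y * deg z1) (F z1 \<odot> u y) = sg (deg y) (sg (deg y * (deg z1 + 1)) (F z1 \<odot> u y))"
        by (simp add: sg_def)
      also have "\<dots> = sg (deg y) (u y \<odot> F z1)" by (simp only: comm[OF hom_G[OF F]])
      finally show "sg (deg y * deg z1) (?F z1 \<odot> u y \<odot> u z2) = sg (deg y) (u y \<odot> (F z1 \<odot> u z2))"
        using z less.prems by (simp add: trunc_def mul_sg_l[symmetric] mul_assoc[symmetric])
    qed
    also have "\<dots> = sg (deg y) (u y \<odot> cv 0 F u z)"
      by (simp add: dec_sg dec_mul_r cv_def)
    finally show ?case by (simp add: conj Rsh)
  qed
  then have "MC F" using F F0 curv by (simp add: MC_def prim_def)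
  moreover have "F w = \<alpha> w - d (x w)" if "length w \<le> N" for w
  proof (cases "w = []")
    case False
    have u_low: "u v = 0" if "v \<noteq> []" "length v < length w" for v
      using that low(1)[of v] \<open>length w \<le> N\<close> by simp
    have "cv 1 u \<alpha> w = \<alpha> w + dec (\<lambda>v1 v2. if v1 = [] then 0 else sg (deg v1) (u v1 \<odot> \<alpha> v2)) w"
      unfolding cv_def using one_l[OF hom_G[OF \<alpha>h, of w]]
      by (subst dec_split_Nil) (simp add: u(2) cong: if_cong)
    also have "dec (\<lambda>v1 v2. if v1 = [] then 0 else sg (deg v1) (u v1 \<odot> \<alpha> v2)) w = 0"
    proof (rule dec_0I)
      fix v1 v2 assume "w = v1 @ v2"
      then show "(if v1 = [] then 0 else sg (deg v1) (u v1 \<odot> \<alpha> v2)) = 0"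
        using u_low[of v1] prim_Nil[OF \<alpha>p] by (cases "v2 = []") auto
    qed
    moreover have "Dop b u w = 0" by (rule Dop_vanish[OF um]) (rule u_low)
    moreover have "u w = x w" using that False low supp by (cases "length w = N") auto
    moreover have "dec (\<lambda>v1 v2. if v2 = [] then 0 else F v1 \<odot> u v2) w = 0"
    proof (rule dec_0I)
      fix v1 v2 assume "w = v1 @ v2"
      then show "(if v2 = [] then 0 else F v1 \<odot> u v2) = 0"
        using u_low[of v2] F0 by (cases "v1 = []") auto
    qed
    ultimately show ?thesis by (subst rec) (simp add: pd_def)
  qed (use N supp[of "[]"] in \<open>simp add: F0 prim_Nil[OF \<alpha>p]\<close>)
  ultimately show ?thesis by (rule that)
qed

end

section \<open>Lifting Maurer-Cartan elements along quasi-isomorphisms\<close>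

lemma linear_section:
  assumes "vector_space s" "vector_space t" "Vector_Spaces.linear s t T" "module.subspace s S"
  obtains \<sigma> where "Vector_Spaces.linear t s \<sigma>" "\<And>v. \<sigma> v \<in> S" "\<And>v. v \<in> T ` S \<Longrightarrow> T (\<sigma> v) = v"
proof -
  interpret vector_space_pair s t using assms(1,2) by (simp add: vector_space_pair_def)
  show ?thesis
    using linear_exists_right_inverse_on[OF assms(3,4)] that by (metis UNIV_I image_subset_iff)
qed

lemma vector_space_prod:
  assumes "vector_space s" "vector_space t"
  shows "vector_space (\<lambda>c (x, y). (s c x, t c y))"
proof -
  interpret s: vector_space s by (rule assms(1))
  interpret t: vector_space t by (rule assms(2))
  show ?thesis
    by unfold_locales (auto simp: s.scale_right_distrib t.scale_right_distrib
      s.scale_left_distrib t.scale_left_distrib)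
qed

section \<open>Morphisms and quasi-isomorphisms acting on Maurer-Cartan elements\<close>

locale mc_map = A: mc_words sA GA mulA oneA dA hs b + B: mc_words sB GB mulB oneB dB hs b
  for sA :: "'k::field_char_0 \<Rightarrow> 'a::ab_group_add \<Rightarrow> 'a" and GA mulA oneA dA
    and sB :: "'k \<Rightarrow> 'b::ab_group_add \<Rightarrow> 'b" and GB mulB oneB dB
    and hs :: "'k \<Rightarrow> 'h::ab_group_add \<Rightarrow> 'h" and b +
  fixes g :: "'b \<Rightarrow> 'a"
  assumes g_linear: "Vector_Spaces.linear sB sA g"
    and g_G: "x \<in> GB k \<Longrightarrow> g x \<in> GA k"
    and g_mul: "x \<in> GB i \<Longrightarrow> y \<in> GB j \<Longrightarrow> g (mulB x y) = mulA (g x) (g y)"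
    and g_d: "x \<in> GB k \<Longrightarrow> g (dB x) = dA (g x)"
begin

lemma g_add: "g (x + y) = g x + g y"
  by (rule linear_add_gen[OF g_linear])

lemma g_minus: "g (- x) = - g x" and g_diff: "g (x - y) = g x - g y" and g_0: "g 0 = 0"
proof -
  interpret additive g by (rule additive.intro) (rule g_add)
  show "g (- x) = - g x" "g (x - y) = g x - g y" "g 0 = 0" by (rule minus diff zero)+
qed

lemma hom_g: "B.hom f F \<Longrightarrow> A.hom f (\<lambda>w. g (F w))"
  using mlin_comp[of hs sB F sA "\<lambda>_. g"] g_linear by (auto simp: A.hom_def B.hom_def intro: g_G)

lemma g_curv:
  assumes F: "B.hom 1 F"
  shows "g (B.curv F w) = A.curv (\<lambda>w. g (F w)) w"
proof -
  have "g (B.cv 1 F F w) = A.cv 1 (\<lambda>w. g (F w)) (\<lambda>w. g (F w)) w"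
    unfolding B.cv_def A.cv_def dec_hom[of g, OF g_add]
    by (rule dec_cong) (simp add: sg_hom[of g, OF g_add] g_mul[OF B.hom_G[OF F] B.hom_G[OF F]])
  then show ?thesis
    by (simp add: A.curv_eq B.curv_eq g_add g_diff g_d[OF B.hom_G[OF F]] Dop_hom[of g, OF g_add])
qed

lemma MC_g:
  assumes "B.MC F"
  shows "A.MC (\<lambda>w. g (F w))"
proof -
  have F: "B.hom 1 F" "prim F" "\<And>w. B.curv F w = 0" using assms by (auto simp: B.MC_def)
  then have "prim (\<lambda>w. g (F w))"
    by (simp add: prim_def sh_hom[of g, OF g_add, symmetric] g_0)
  with F show ?thesis by (simp add: A.MC_def hom_g g_curv[symmetric] g_0)
qed

end

locale mc_quasi_iso = mc_map sA GA mulA oneA dA sB GB mulB oneB dB hs b g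
  for sA :: "'k::field_char_0 \<Rightarrow> 'a::ab_group_add \<Rightarrow> 'a" and GA mulA oneA dA
    and sB :: "'k \<Rightarrow> 'b::ab_group_add \<Rightarrow> 'b" and GB mulB oneB dB
    and hs :: "'k \<Rightarrow> 'h::ab_group_add \<Rightarrow> 'h" and b g +
  assumes g_inj: "x \<in> GB k \<Longrightarrow> dB x = 0 \<Longrightarrow> z \<in> GA (k - 1) \<Longrightarrow> g x = dA z
      \<Longrightarrow> \<exists>y\<in>GB (k - 1). x = dB y"
    and g_surj: "y \<in> GA k \<Longrightarrow> dA y = 0
      \<Longrightarrow> \<exists>x\<in>GB k. \<exists>z\<in>GA (k - 1). dB x = 0 \<and> y = g x + dA z"
begin

text \<open>All choices of the obstruction theory are made here once and linearly in each degree, so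
  that applying them preserves multilinearity and vanishing on shuffles. The pair \<open>s\<close>,
  \<open>t\<close> consists of the components of one section of the map sending (x, z) to
  \<open>g x + dA z\<close>, restricted to pairs with \<open>x\<close> closed.\<close>

lemma sections:
  obtains r s t where
    "\<And>k. Vector_Spaces.linear sB sB (r k)" "\<And>k z. r k z \<in> GB k"
    "\<And>k z. z \<in> dB ` GB k \<Longrightarrow> dB (r k z) = z"
    "\<And>k. Vector_Spaces.linear sA sB (s k)" "\<And>k. Vector_Spaces.linear sA sA (t k)"
    "\<And>k y. s k y \<in> GB k" "\<And>k y. dB (s k y) = 0" "\<And>k y. t k y \<in> GA (k - 1)"
    "\<And>k y. y \<in> GA k \<Longrightarrow> dA y = 0 \<Longrightarrow> y = g (s k y) + dA (t k y)"
proof -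
  have "\<exists>\<rho>. Vector_Spaces.linear sB sB \<rho> \<and> (\<forall>z. \<rho> z \<in> GB k) \<and> (\<forall>z. z \<in> dB ` GB k \<longrightarrow> dB (\<rho> z) = z)" for k
    using linear_section[OF B.vsA B.vsA B.d_linear B.G_subspace[of k]] by metis
  then obtain r where r: "\<And>k. Vector_Spaces.linear sB sB (r k)" "\<And>k z. r k z \<in> GB k"
    "\<And>k z. z \<in> dB ` GB k \<Longrightarrow> dB (r k z) = z" by metis
  let ?p = "\<lambda>c (x, y). (sB c x, sA c y)"
  let ?T = "\<lambda>(x, z). g x + dA z"
  let ?S = "\<lambda>k. {(x, z). x \<in> GB k \<and> dB x = 0 \<and> z \<in> GA (k - 1)}"
  interpret p: vector_space ?p by (rule vector_space_prod[OF B.vsA A.vsA])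
  have T: "Vector_Spaces.linear ?p sA ?T"
    using linear_scale_gen[OF g_linear] linear_scale_gen[OF A.d_linear]
    by (auto simp: Vector_Spaces.linear_iff p.vector_space_axioms A.vsA g_add A.d_add A.scale_right_distrib)
  have S: "p.subspace (?S k)" for k
    unfolding p.subspace_def
    using linear_scale_gen[OF B.d_linear]
    by (auto simp: A.G_0 B.G_0 B.d_add zero_prod_def intro: A.G_add B.G_add A.G_scale B.G_scale)
  have "\<exists>\<sigma>. Vector_Spaces.linear sA ?p \<sigma> \<and> (\<forall>v. \<sigma> v \<in> ?S k) \<and> (\<forall>v. v \<in> ?T ` ?S k \<longrightarrow> ?T (\<sigma> v) = v)" for k
    by (rule linear_section[OF p.vector_space_axioms A.vsA T S[of k]]) blast
  then have "\<forall>k. \<exists>\<sigma>. Vector_Spaces.linear sA ?p \<sigma> \<and> (\<forall>v. \<sigma> v \<in> ?S k) \<and>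
      (\<forall>v. v \<in> ?T ` ?S k \<longrightarrow> ?T (\<sigma> v) = v)" ..
  from choice[OF this] obtain \<sigma> where \<sigma>: "\<forall>k. Vector_Spaces.linear sA ?p (\<sigma> k) \<and>
      (\<forall>v. \<sigma> k v \<in> ?S k) \<and> (\<forall>v. v \<in> ?T ` ?S k \<longrightarrow> ?T (\<sigma> k v) = v)" ..
  note \<sigma>1 = \<sigma>[rule_format, THEN conjunct1]
    and \<sigma>2 = \<sigma>[rule_format, THEN conjunct2, THEN conjunct1, rule_format]
    and \<sigma>3 = \<sigma>[THEN spec, THEN conjunct2, THEN conjunct2, THEN spec, THEN mp]
  have 1: "Vector_Spaces.linear sA sB (\<lambda>v. fst (\<sigma> k v))" "Vector_Spaces.linear sA sA (\<lambda>v. snd (\<sigma> k v))" for k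
    using \<sigma>1[of k] A.vsA B.vsA by (auto simp: Vector_Spaces.linear_iff split: prod.splits)
  have 2: "fst (\<sigma> k y) \<in> GB k" "dB (fst (\<sigma> k y)) = 0" "snd (\<sigma> k y) \<in> GA (k - 1)" for k y
    using \<sigma>2[of k y] by auto
  have 3: "y = g (fst (\<sigma> k y)) + dA (snd (\<sigma> k y))" if y: "y \<in> GA k" "dA y = 0" for k y
  proof -
    obtain x z where "x \<in> GB k" "dB x = 0" "z \<in> GA (k - 1)" "y = g x + dA z"
      using g_surj[OF y] by blast
    then have "y \<in> ?T ` ?S k" by (intro image_eqI[of _ _ "(x, z)"]) auto
    from \<sigma>3[OF this] show ?thesis by (simp add: case_prod_unfold)
  qed
  show ?thesis
    by (rule that[of r "\<lambda>k v. fst (\<sigma> k v)" "\<lambda>k v. snd (\<sigma> k v)"]) (fact r 1 2 3)+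
qed

text \<open>
  State of the obstruction theory: \<open>\<beta>\<close> solves the Maurer-Cartan equation up to word length \<open>n\<close>
  and lifts there a gauge transform \<open>\<alpha>'\<close> of \<open>\<alpha>\<close>.
\<close>

definition lifted :: "((int \<times> 'h) list \<Rightarrow> 'a) \<Rightarrow> nat \<Rightarrow>
    ((int \<times> 'h) list \<Rightarrow> 'a) \<times> ((int \<times> 'h) list \<Rightarrow> 'b) \<Rightarrow> bool" where
  "lifted \<alpha> n = (\<lambda>(\<alpha>', \<beta>). A.MC \<alpha>' \<and> B.hom 1 \<beta> \<and> prim \<beta> \<and> (\<forall>w. length w > n \<longrightarrow> \<beta> w = 0) \<and>
     (\<forall>w. length w \<le> n \<longrightarrow> B.curv \<beta> w = 0 \<and> g (\<beta> w) = \<alpha>' w) \<and>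
     (\<forall>a. \<exists>z\<in>GA (fst a - 1). \<alpha> [a] = \<alpha>' [a] + dA z))"

text \<open>Apart from the linear term \<open>dB (F w)\<close>, the curvature at \<open>w\<close>
  depends on \<open>F\<close> on shorter words only. A correction in the top word length therefore
  changes the curvature there by its differential alone.\<close>

lemma curv_eq_short:
  assumes "B.hom 1 F" "B.hom 1 F'" "F [] = 0" "F' [] = 0"
    and "\<And>v. length v < length w \<Longrightarrow> F v = F' v"
  shows "B.curv F w - dB (F w) = B.curv F' w - dB (F' w)"
proof -
  have "Dop b F w = Dop b F' w"
    by (rule B.Dop_mono[OF B.hom_mlin[OF assms(1)] B.hom_mlin[OF assms(2)]]) (rule assms(5))
  moreover have "B.cv 1 F F w = B.cv 1 F' F' w"
    by (rule B.cv_cong_short) (use assms in auto)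
  ultimately show ?thesis by (simp add: B.curv_eq)
qed

lemma curvA_eq_short:
  assumes "A.hom 1 F" "A.hom 1 F'" "F [] = 0" "F' [] = 0"
    and "\<And>v. length v < length w \<Longrightarrow> F v = F' v"
  shows "A.curv F w - dA (F w) = A.curv F' w - dA (F' w)"
proof -
  have "Dop b F w = Dop b F' w"
    by (rule A.Dop_mono[OF A.hom_mlin[OF assms(1)] A.hom_mlin[OF assms(2)]]) (rule assms(5))
  moreover have "A.cv 1 F F w = A.cv 1 F' F' w"
    by (rule A.cv_cong_short) (use assms in auto)
  ultimately show ?thesis by (simp add: A.curv_eq)
qed

text \<open>In word length \<open>n + 1\<close> the curvature of \<beta> is closed by the Bianchi
  identity and becomes exact under \<open>g\<close>, hence is exact; the correction
  \<open>c0\<close> removes it. The difference \<open>z\<close> between \<alpha>' and the image of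
  the corrected lift is then closed. Surjectivity on cohomology splits \<open>z\<close> into a part
  absorbed by \<beta> through \<open>c1\<close> and a coboundary absorbed by a gauge transformation
  of \<alpha>' by \<open>x\<close>.\<close>

lemma lift_step:
  assumes "lifted \<alpha> n (\<alpha>', \<beta>)"
  obtains \<alpha>'' \<beta>' where "lifted \<alpha> (Suc n) (\<alpha>'', \<beta>')" "\<And>w. length w \<le> n \<Longrightarrow> \<beta>' w = \<beta> w"
proof -
  have \<alpha>': "A.MC \<alpha>'" and \<beta>: "B.hom 1 \<beta>" "prim \<beta>" and high: "\<And>w. length w > n \<Longrightarrow> \<beta> w = 0"
    and low: "\<And>w. length w \<le> n \<Longrightarrow> B.curv \<beta> w = 0" "\<And>w. length w \<le> n \<Longrightarrow> g (\<beta> w) = \<alpha>' w"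
    and \<alpha>: "\<And>a. \<exists>z\<in>GA (fst a - 1). \<alpha> [a] = \<alpha>' [a] + dA z"
    using assms by (auto simp: lifted_def)
  have \<alpha>'h: "A.hom 1 \<alpha>'" "prim \<alpha>'" "\<And>w. A.curv \<alpha>' w = 0" using \<alpha>' by (auto simp: A.MC_def)
  note \<beta>0 = prim_Nil[OF \<beta>(2)] and \<alpha>0 = prim_Nil[OF \<alpha>'h(2)]
  obtain r s t where r: "\<And>k. Vector_Spaces.linear sB sB (r k)" "\<And>k z. r k z \<in> GB k"
    "\<And>k z. z \<in> dB ` GB k \<Longrightarrow> dB (r k z) = z"
    and st: "\<And>k. Vector_Spaces.linear sA sB (s k)" "\<And>k. Vector_Spaces.linear sA sA (t k)"
    "\<And>k y. s k y \<in> GB k" "\<And>k y. dB (s k y) = 0" "\<And>k y. t k y \<in> GA (k - 1)"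
    "\<And>k y. y \<in> GA k \<Longrightarrow> dA y = 0 \<Longrightarrow> y = g (s k y) + dA (t k y)"
    using sections by blast
  let ?E = "B.curv \<beta>"
  have E: "B.hom 2 ?E" "prim ?E" using B.hom_curv[OF \<beta>(1)] B.prim_curv[OF \<beta>] by auto
  \<comment> \<open>Here it matters that \<beta> is zero beyond word length \<open>n\<close>: the
    term \<open>dB (\<beta> w)\<close> drops out, and the curvature consists of contributions of
    shorter words, where \<open>g\<close> maps \<beta> to \<alpha>'.\<close>
  have gE: "g (?E w) = - dA (\<alpha>' w)" and dE: "dB (?E w) = 0" if w: "length w = Suc n" for w
  proof -
    have "A.curv (\<lambda>w. g (\<beta> w)) w - dA (g (\<beta> w)) = A.curv \<alpha>' w - dA (\<alpha>' w)"
      by (rule curvA_eq_short[OF hom_g[OF \<beta>(1)] \<alpha>'h(1)]) (use low(2) w in \<open>auto simp: \<beta>0 \<alpha>0 g_0\<close>)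
    then show "g (?E w) = - dA (\<alpha>' w)"
      using high[of w] w by (simp add: g_curv[OF \<beta>(1)] \<alpha>'h(3) g_0)
    have "B.cv 1 ?E \<beta> w = B.cv 1 (\<lambda>w. 0) (\<lambda>w. 0) w"
    proof (rule B.cv_cong)
      fix u v assume "w = u @ v"
      then show "mulB (?E u) (\<beta> v) = mulB 0 0" using low(1)[of u] w by (cases v) (auto simp: \<beta>0)
    qed
    moreover have "B.cv 2 \<beta> ?E w = B.cv 2 (\<lambda>w. 0) (\<lambda>w. 0) w"
    proof (rule B.cv_cong)
      fix u v assume "w = u @ v"
      then show "mulB (\<beta> u) (?E v) = mulB 0 0" using low(1)[of v] w by (cases u) (auto simp: \<beta>0)
    qed
    moreover have "Dop b ?E w = 0"
      by (rule B.Dop_vanish[OF B.hom_mlin[OF E(1)]]) (use low(1) w in auto)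
    ultimately show "dB (?E w) = 0"
      using B.bianchi[OF \<beta>(1), of w] by (simp add: B.pd_def)
  qed
  define c0 where "c0 w = (if length w = Suc n then - r (deg w + 1) (?E w) else 0)" for w
  have r_add: "r k (x + y) = r k x + r k y" for k x y by (rule linear_add_gen[OF r(1)])
  have s_add: "s k (x + y) = s k x + s k y" for k x y by (rule linear_add_gen[OF st(1)])
  have t_add: "t k (x + y) = t k x + t k y" for k x y by (rule linear_add_gen[OF st(2)])
  have r0: "r k 0 = 0" and s0: "s k 0 = 0" and t0: "t k 0 = 0" for k
    using r_add[of k 0 0] s_add[of k 0 0] t_add[of k 0 0] by simp_all
  have c0h: "B.hom 1 c0"
  proof -
    have "B.hom 1 (\<lambda>w. r (deg w + 1) (?E w))"
      using B.hom_comp[OF E(1), of "\<lambda>k. r (k + 1)"] r by simp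
    then show ?thesis unfolding c0_def by (intro B.hom_length B.hom_minus)
  qed
  have dc0: "dB (c0 w) = - ?E w" if w: "length w = Suc n" for w
  proof -
    have "?E w \<in> GB (deg w + 2)" by (rule B.hom_G[OF E(1)])
    moreover have e: "deg w + 2 - 1 = deg w + 1" by simp
    moreover have "- \<alpha>' w \<in> GA (deg w + 2 - 1)"
      unfolding e by (rule A.G_minus[OF A.hom_G[OF \<alpha>'h(1)]])
    moreover have "g (?E w) = dA (- \<alpha>' w)" by (simp add: gE[OF w] A.d_minus)
    ultimately have "\<exists>y\<in>GB (deg w + 2 - 1). ?E w = dB y" using g_inj dE[OF w] by blast
    then have "?E w \<in> dB ` GB (deg w + 1)" unfolding e by blast
    then show ?thesis by (simp add: c0_def w B.d_minus r(3))
  qed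
  define z where "z w = (if length w = Suc n then \<alpha>' w - g (c0 w) else 0)" for w
  have zh: "A.hom 1 z"
    unfolding z_def by (intro A.hom_length A.hom_diff \<alpha>'h(1) hom_g c0h)
  have dz: "dA (z w) = 0" for w
  proof (cases "length w = Suc n")
    case True
    have "dA (g (c0 w)) = g (dB (c0 w))" by (rule g_d[OF B.hom_G[OF c0h], symmetric])
    then show ?thesis using True by (simp add: z_def A.d_diff dc0 g_minus gE)
  qed (simp add: z_def)
  define c1 where "c1 w = s (deg w + 1) (z w)" for w
  define x where "x w = t (deg w + 1) (z w)" for w
  have c1h: "B.hom 1 c1"
    unfolding c1_def using mlin_comp[OF A.hom_mlin[OF zh], of sB "\<lambda>k. s (k + 1)"] st(1,3)
    by (simp add: B.hom_def)
  have xh: "A.hom 0 x"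
    unfolding x_def using mlin_comp[OF A.hom_mlin[OF zh], of sA "\<lambda>k. t (k + 1)"] st(2) st(5)[of "_ + 1"]
    by (simp add: A.hom_def)
  have zx: "z w = g (c1 w) + dA (x w)" for w
    unfolding c1_def x_def by (rule st(6)[OF A.hom_G[OF zh] dz])
  have c0p: "prim c0"
    unfolding prim_def
  proof (intro conjI allI impI)
    fix x y :: "(int \<times> 'h) list" assume xy: "x \<noteq> []" "y \<noteq> []"
    let ?k = "deg x + deg y + 1"
    have "sh c0 x y = sh (\<lambda>w. if length x + length y = Suc n then - r ?k (?E w) else 0) x y"
      by (rule sh_cong) (simp add: c0_def)
    also have "\<dots> = (if length x + length y = Suc n then - r ?k (sh ?E x y) else 0)"
      by (simp add: sh_minus sh_hom[of "r ?k", OF r_add])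
    finally show "sh c0 x y = 0" using E(2) xy by (simp add: prim_def r0)
  qed (simp add: c0_def)
  have zp: "prim z"
    unfolding prim_def
  proof (intro conjI allI impI)
    fix x y :: "(int \<times> 'h) list" assume xy: "x \<noteq> []" "y \<noteq> []"
    have "sh z x y = sh (\<lambda>w. if length x + length y = Suc n then \<alpha>' w - g (c0 w) else 0) x y"
      by (rule sh_cong) (simp add: z_def)
    also have "\<dots> = (if length x + length y = Suc n then sh \<alpha>' x y - g (sh c0 x y) else 0)"
      by (simp add: sh_diff sh_hom[of g, OF g_add])
    finally show "sh z x y = 0" using \<alpha>'h(2) c0p xy by (simp add: prim_def g_0)
  qed (simp add: z_def)
  have c1p: "prim c1"
    unfolding prim_def
  proof (intro conjI allI impI)
    fix x y :: "(int \<times> 'h) list" assume xy: "x \<noteq> []" "y \<noteq> []"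
    have "sh c1 x y = sh (\<lambda>w. s (deg x + deg y + 1) (z w)) x y"
      by (rule sh_cong) (simp add: c1_def)
    then show "sh c1 x y = 0" using zp xy
      by (simp add: prim_def sh_hom[of "s _", OF s_add, symmetric] s0)
  qed (simp add: c1_def z_def s0)
  have xp: "prim x"
    unfolding prim_def
  proof (intro conjI allI impI)
    fix y y' :: "(int \<times> 'h) list" assume xy: "y \<noteq> []" "y' \<noteq> []"
    have "sh x y y' = sh (\<lambda>w. t (deg y + deg y' + 1) (z w)) y y'"
      by (rule sh_cong) (simp add: x_def)
    then show "sh x y y' = 0" using zp xy
      by (simp add: prim_def sh_hom[of "t _", OF t_add, symmetric] t0)
  qed (simp add: x_def z_def t0)
  have supp: "c0 w = 0" "c1 w = 0" "x w = 0" if "length w \<noteq> Suc n" for w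
    using that by (simp_all add: c0_def c1_def x_def z_def s0 t0)
  obtain \<alpha>'' where \<alpha>'': "A.MC \<alpha>''" "\<And>w. length w \<le> Suc n \<Longrightarrow> \<alpha>'' w = \<alpha>' w - dA (x w)"
    using A.gauge[OF \<alpha>' xh xp, of "Suc n"] supp(3) by blast
  define \<beta>' where "\<beta>' w = \<beta> w + (c0 w + c1 w)" for w
  have \<beta>'h: "B.hom 1 \<beta>'"
    unfolding \<beta>'_def by (intro B.hom_add \<beta>(1) c0h c1h)
  have \<beta>'p: "prim \<beta>'"
    using \<beta>(2) c0p c1p by (simp add: prim_def \<beta>'_def[abs_def] sh_add)
  have same: "\<beta>' w = \<beta> w" if "length w \<le> n" for w
    using that by (simp add: \<beta>'_def supp)
  have "lifted \<alpha> (Suc n) (\<alpha>'', \<beta>')"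
    unfolding lifted_def prod.case
  proof (intro conjI allI impI \<alpha>''(1) \<beta>'h \<beta>'p)
    fix w :: "(int \<times> 'h) list" assume "length w > Suc n"
    then show "\<beta>' w = 0" by (simp add: \<beta>'_def supp high)
  next
    fix w :: "(int \<times> 'h) list" assume w: "length w \<le> Suc n"
    have c: "B.curv \<beta>' w - dB (\<beta>' w) = ?E w - dB (\<beta> w)"
      by (rule curv_eq_short[OF \<beta>'h \<beta>(1)]) (use w in \<open>auto simp: same \<beta>0\<close>)
    show "B.curv \<beta>' w = 0"
    proof (cases "length w \<le> n")
      case True
      then show ?thesis using c low(1) by (simp add: same)
    next
      case False
      then have l: "length w = Suc n" using w by simp
      have "dB (\<beta>' w) = - ?E w" using high[of w] l
        by (simp add: \<beta>'_def B.d_add dc0 c1_def st(4))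
      then show ?thesis using c high[of w] l by simp
    qed
    show "g (\<beta>' w) = \<alpha>'' w"
    proof (cases "length w \<le> n")
      case True
      then show ?thesis using low(2) w by (simp add: same \<alpha>''(2) supp)
    next
      case False
      then have l: "length w = Suc n" using w by simp
      have "g (c1 w) = \<alpha>' w - g (c0 w) - dA (x w)"
        using zx[of w] l by (simp add: z_def)
      then show ?thesis using high[of w] l by (simp add: \<beta>'_def g_add \<alpha>''(2))
    qed
  next
    fix a :: "int \<times> 'h"
    obtain y where y: "y \<in> GA (fst a - 1)" "\<alpha> [a] = \<alpha>' [a] + dA y" using \<alpha>[of a] by blast
    have "\<alpha> [a] = \<alpha>'' [a] + dA (y + x [a])" using y(2) by (simp add: \<alpha>''(2) A.d_add algebra_simps)
    moreover have "y + x [a] \<in> GA (fst a - 1)"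
      using A.hom_G[OF xh, of "[a]"] by (intro A.G_add y(1)) simp
    ultimately show "\<exists>z\<in>GA (fst a - 1). \<alpha> [a] = \<alpha>'' [a] + dA z" by blast
  qed
  then show ?thesis using same by (rule that)
qed

text \<open>Each step changes \<beta> only in the new word length, so the values stabilise and a
  diagonal limit exists. The gauge transforms of \<alpha> need no limit: only their values on single
  letters matter, and these are taken at stage one.\<close>

theorem MC_lift:
  assumes \<alpha>: "A.MC \<alpha>"
  obtains \<beta> where "B.MC \<beta>" "\<And>a. \<exists>z\<in>GA (fst a - 1). \<alpha> [a] = g (\<beta> [a]) + dA z"
proof -
  have \<alpha>h: "A.hom 1 \<alpha>" "prim \<alpha>" using \<alpha> by (auto simp: A.MC_def)
  have "\<exists>f. \<forall>n. lifted \<alpha> n (f n) \<and> (\<forall>w. length w \<le> n \<longrightarrow> snd (f (Suc n)) w = snd (f n) w)"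
  proof (rule dependent_nat_choice)
    have "lifted \<alpha> 0 (\<alpha>, \<lambda>w. 0)"
      using \<alpha> by (auto simp: lifted_def B.hom_0 prim_def B.curv_eq B.cv_def g_0 prim_Nil[OF \<alpha>h(2)]
        intro!: bexI[of _ 0] A.G_0)
    then show "\<exists>p. lifted \<alpha> 0 p" ..
    fix p n assume "lifted \<alpha> n p"
    then obtain \<alpha>'' \<beta>' where "lifted \<alpha> (Suc n) (\<alpha>'', \<beta>')" "\<And>w. length w \<le> n \<Longrightarrow> \<beta>' w = snd p w"
      using lift_step[of \<alpha> n "fst p" "snd p"] by auto
    then show "\<exists>q. lifted \<alpha> (Suc n) q \<and> (\<forall>w. length w \<le> n \<longrightarrow> snd q w = snd p w)" by auto
  qed
  then obtain f where f: "\<And>n. lifted \<alpha> n (f n)"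
    "\<And>n w. length w \<le> n \<Longrightarrow> snd (f (Suc n)) w = snd (f n) w" by blast
  define \<beta> where "\<beta> w = snd (f (length w)) w" for w
  have stable: "snd (f n) w = \<beta> w" if "length w \<le> n" for n w
    using that by (induction n rule: dec_induct) (simp_all add: \<beta>_def f(2))
  have fn: "A.MC (fst (f n))" "B.hom 1 (snd (f n))" "prim (snd (f n))"
    "\<And>w. length w \<le> n \<Longrightarrow> B.curv (snd (f n)) w = 0"
    "\<And>w. length w \<le> n \<Longrightarrow> g (snd (f n) w) = fst (f n) w"
    "\<And>a. \<exists>z\<in>GA (fst a - 1). \<alpha> [a] = fst (f n) [a] + dA z" for n
    using f(1)[of n] by (auto simp: lifted_def case_prod_unfold)
  have \<beta>h: "B.hom 1 \<beta>"
  proof (rule B.hom_limit)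
    fix n
    have "trunc n \<beta> = trunc n (snd (f n))" by (auto simp: trunc_def stable)
    then show "B.hom 1 (trunc n \<beta>)" using B.hom_trunc[OF fn(2)] by simp
  qed
  have \<beta>p: "prim \<beta>"
    unfolding prim_def
  proof (intro conjI allI impI)
    show "\<beta> [] = 0" using prim_Nil[OF fn(3)] by (simp add: \<beta>_def)
    fix x y :: "(int \<times> 'h) list" assume xy: "x \<noteq> []" "y \<noteq> []"
    have "sh \<beta> x y = sh (snd (f (length x + length y))) x y"
      by (rule sh_cong) (simp add: stable)
    then show "sh \<beta> x y = 0" using fn(3) xy by (simp add: prim_def)
  qed
  have "B.curv \<beta> w = 0" for w
  proof -
    have "B.curv \<beta> w - dB (\<beta> w) = B.curv (snd (f (length w))) w - dB (snd (f (length w)) w)"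
      by (rule curv_eq_short[OF \<beta>h fn(2)]) (simp_all add: stable prim_Nil[OF \<beta>p] prim_Nil[OF fn(3)])
    then show ?thesis using fn(4)[of w "length w"] by (simp add: stable)
  qed
  moreover have "\<exists>z\<in>GA (fst a - 1). \<alpha> [a] = g (\<beta> [a]) + dA z" for a
    using fn(6)[of a 1] fn(5)[of "[a]" 1] stable[of "[a]" 1] by simp
  ultimately show ?thesis using \<beta>h \<beta>p by (intro that[of \<beta>]) (auto simp: B.MC_def)
qed

end

section \<open>Graded spaces and homogeneous components\<close>

lemma (in vector_space) scale_powi_sign: "scale ((-1) powi n) x = sg n x"
proof (cases "even n")
  case True
  then show ?thesis by (simp add: power_int_minus_left)
next
  case False
  then show ?thesis by (simp add: power_int_minus_left sg_odd)
qed

lemma (in vector_space) scale_power_sign: "scale ((-1) ^ n) x = sg (int n) x"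
  by (cases "even n") (simp_all add: sg_odd)

text \<open>An arbitrary linear projection of the ambient type onto one degree, as opposed to
  \<open>component\<close>, whose linearity is tied to the total space. Together with
  \<open>tproj\<close> it extends maps given on subspaces to linear maps on the whole type.\<close>

definition prj :: "('k::field, 'a::ab_group_add, 'm) gspace_data_scheme \<Rightarrow> int \<Rightarrow> 'a \<Rightarrow> 'a" where
  "prj V k = (SOME p. Vector_Spaces.linear (smul V) (smul V) p \<and> (\<forall>x. p x \<in> gr V k) \<and>
     (\<forall>x\<in>gr V k. p x = x))"

definition tproj :: "('k::field, 'a::ab_group_add, 'm) gspace_data_scheme \<Rightarrow> 'a \<Rightarrow> 'a" where
  "tproj V = (SOME p. Vector_Spaces.linear (smul V) (smul V) p \<and> (\<forall>x. p x \<in> total_space V) \<and>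
     (\<forall>x\<in>total_space V. p x = x))"

definition valid :: "('k, 'a, 'm) gspace_data_scheme \<Rightarrow> (int \<times> 'a) list \<Rightarrow> bool" where
  "valid V w \<longleftrightarrow> (\<forall>(k, x)\<in>set w. x \<in> gr V k)"

lemma valid_simps [simp]:
  "valid V []" "valid V (a # w) \<longleftrightarrow> snd a \<in> gr V (fst a) \<and> valid V w"
  "valid V (u @ w) \<longleftrightarrow> valid V u \<and> valid V w"
  by (auto simp: valid_def)

lemma list_all2_valid:
  "list_all2 (\<lambda>k x. x \<in> gr V k) ks xs \<longleftrightarrow> (\<exists>w. valid V w \<and> ks = map fst w \<and> xs = map snd w)"
proof
  assume "list_all2 (\<lambda>k x. x \<in> gr V k) ks xs"
  then show "\<exists>w. valid V w \<and> ks = map fst w \<and> xs = map snd w"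
    by (intro exI[of _ "zip ks xs"]) (auto simp: list_all2_iff valid_def)
next
  assume "\<exists>w. valid V w \<and> ks = map fst w \<and> xs = map snd w"
  then obtain w where "valid V w" "ks = map fst w" "xs = map snd w" by blast
  then show "list_all2 (\<lambda>k x. x \<in> gr V k) ks xs"
    by (induction w arbitrary: ks xs) auto
qed

context graded_space
begin

lemma vs: "vector_space (smul V)" ..

lemma linear_projection:
  assumes "subspace S"
  shows "\<exists>p. Vector_Spaces.linear (smul V) (smul V) p \<and> (\<forall>x. p x \<in> S) \<and> (\<forall>x\<in>S. p x = x)"
proof -
  have "Vector_Spaces.linear (smul V) (smul V) (\<lambda>x. x)"
    by (simp add: Vector_Spaces.linear_iff vs)
  from linear_section[OF vs vs this assms] show ?thesis by (metis image_eqI)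
qed

lemma prj: "Vector_Spaces.linear (smul V) (smul V) (prj V k)" "prj V k x \<in> gr V k"
  "x \<in> gr V k \<Longrightarrow> prj V k x = x"
  using someI_ex[OF linear_projection[OF gr_subspace[of k]]] by (auto simp: prj_def)

lemma total_subspace: "subspace (total_space V)"
  by (simp add: total_space_def)

lemma tproj: "Vector_Spaces.linear (smul V) (smul V) (tproj V)" "tproj V x \<in> total_space V"
  "x \<in> total_space V \<Longrightarrow> tproj V x = x"
  using someI_ex[OF linear_projection[OF total_subspace]] by (auto simp: tproj_def)

lemma gr_total: "x \<in> gr V k \<Longrightarrow> x \<in> total_space V"
  unfolding total_space_def by (rule span_base) auto

lemma total_add: "x \<in> total_space V \<Longrightarrow> y \<in> total_space V \<Longrightarrow> x + y \<in> total_space V"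
  and total_smul: "x \<in> total_space V \<Longrightarrow> smul V c x \<in> total_space V"
  and total_0: "0 \<in> total_space V"
  and total_minus: "x \<in> total_space V \<Longrightarrow> - x \<in> total_space V"
  and total_diff: "x \<in> total_space V \<Longrightarrow> y \<in> total_space V \<Longrightarrow> x - y \<in> total_space V"
  using total_subspace by (auto intro: subspace_add subspace_scale subspace_0 subspace_neg subspace_diff)

lemma gr_add: "x \<in> gr V k \<Longrightarrow> y \<in> gr V k \<Longrightarrow> x + y \<in> gr V k"
  and gr_smul: "x \<in> gr V k \<Longrightarrow> smul V c x \<in> gr V k"
  and gr_0: "0 \<in> gr V k"
  and gr_minus: "x \<in> gr V k \<Longrightarrow> - x \<in> gr V k"
  and gr_diff: "x \<in> gr V k \<Longrightarrow> y \<in> gr V k \<Longrightarrow> x - y \<in> gr V k"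
  using gr_subspace by (auto intro: subspace_add subspace_scale subspace_0 subspace_neg subspace_diff)

lemma gr_sg: "x \<in> gr V k \<Longrightarrow> sg n x \<in> gr V k"
  by (simp add: sg_def gr_minus)

lemma total_sg: "x \<in> total_space V \<Longrightarrow> sg n x \<in> total_space V"
  by (simp add: sg_def total_minus)

lemma smul_sg: "smul V c (sg n x) = sg n (smul V c x)"
  by (simp add: sg_def)

definition decomposes :: "(int \<Rightarrow> 'a) \<Rightarrow> 'a \<Rightarrow> bool" where
  "decomposes c x \<longleftrightarrow> (\<forall>i. c i \<in> gr V i) \<and> finite {i. c i \<noteq> 0} \<and> (\<Sum>i | c i \<noteq> 0. c i) = x"

lemma decomposesI:
  assumes "\<And>i. c i \<in> gr V i" "finite S" "\<And>i. i \<notin> S \<Longrightarrow> c i = 0" "(\<Sum>i\<in>S. c i) = x"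
  shows "decomposes c x"
proof -
  have sub: "{i. c i \<noteq> 0} \<subseteq> S" using assms(3) by auto
  have "(\<Sum>i | c i \<noteq> 0. c i) = (\<Sum>i\<in>S. c i)"
    by (rule sum.mono_neutral_left[OF assms(2) sub]) auto
  with sub assms show ?thesis by (auto simp: decomposes_def intro: finite_subset)
qed

lemma decomposes_sum:
  assumes "decomposes c x" "finite S" "\<And>i. i \<notin> S \<Longrightarrow> c i = 0"
  shows "(\<Sum>i\<in>S. c i) = x"
proof -
  have "(\<Sum>i | c i \<noteq> 0. c i) = (\<Sum>i\<in>S. c i)"
    by (rule sum.mono_neutral_left[OF assms(2)]) (use assms(3) in auto)
  with assms(1) show ?thesis by (simp add: decomposes_def)
qed

lemma decomposes_add:
  assumes "decomposes c x" "decomposes c' y"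
  shows "decomposes (\<lambda>i. c i + c' i) (x + y)"
proof -
  let ?S = "{i. c i \<noteq> 0} \<union> {i. c' i \<noteq> 0}"
  have fin: "finite ?S" using assms by (simp add: decomposes_def)
  have "(\<Sum>i\<in>?S. c i) = x" by (rule decomposes_sum[OF assms(1) fin]) simp
  moreover have "(\<Sum>i\<in>?S. c' i) = y" by (rule decomposes_sum[OF assms(2) fin]) simp
  moreover have "c i + c' i \<in> gr V i" for i
    using assms by (simp add: decomposes_def gr_add)
  ultimately show ?thesis
    by (intro decomposesI[OF _ fin]) (simp_all add: sum.distrib)
qed

lemma decomposes_smul:
  assumes "decomposes c x"
  shows "decomposes (\<lambda>i. smul V a (c i)) (smul V a x)"
proof (rule decomposesI)
  let ?S = "{i. c i \<noteq> 0}"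
  show "finite ?S" using assms by (auto simp: decomposes_def)
  show "(\<Sum>i\<in>?S. smul V a (c i)) = smul V a x"
    using assms by (simp add: decomposes_def scale_sum_right[symmetric])
qed (use assms in \<open>auto simp: decomposes_def intro: gr_smul\<close>)

lemma decomposes_gr:
  assumes "x \<in> gr V k" shows "decomposes (\<lambda>i. if i = k then x else 0) x"
  by (rule decomposesI[of _ "{k}"]) (use assms in \<open>auto intro: gr_0\<close>)

lemma decomposes_unique:
  assumes "decomposes c x" "decomposes c' x" shows "c = c'"
proof
  fix k
  let ?S = "insert k ({i. c i \<noteq> 0} \<union> {i. c' i \<noteq> 0})"
  have fin: "finite ?S" using assms by (auto simp: decomposes_def)
  have "(\<Sum>i\<in>?S. c i - c' i) = 0"
    using decomposes_sum[OF assms(1) fin] decomposes_sum[OF assms(2) fin]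
    unfolding sum_subtractf by simp
  moreover have "c i - c' i \<in> gr V i" for i
    using assms by (auto simp: decomposes_def intro: gr_diff)
  ultimately have "c k - c' k = 0"
    using gr_independent[OF fin, of "\<lambda>i. c i - c' i" k] by simp
  then show "c k = c' k" by simp
qed

lemma decomposes_exists:
  assumes "x \<in> total_space V" shows "\<exists>c. decomposes c x"
  using assms unfolding total_space_def
proof (induction rule: span_induct_alt)
  case base
  show ?case using decomposes_gr[OF gr_0] by blast
next
  case (step a x y)
  then obtain k c where "x \<in> gr V k" "decomposes c y" by blast
  then show ?case using decomposes_add[OF decomposes_smul[OF decomposes_gr]] by blast
qed

lemma component_eq: "decomposes c x \<Longrightarrow> component V k x = c k"
  unfolding component_def
  by (rule arg_cong[of _ _ "\<lambda>c. c k"], rule the_equality)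
    (auto simp: decomposes_def[symmetric] dest: decomposes_unique)

lemma decomposes_component: "x \<in> total_space V \<Longrightarrow> decomposes (\<lambda>k. component V k x) x"
  using decomposes_exists component_eq by (metis ext)

lemma component_gr: "x \<in> total_space V \<Longrightarrow> component V k x \<in> gr V k"
  and finite_component: "x \<in> total_space V \<Longrightarrow> finite {k. component V k x \<noteq> 0}"
  and sum_component: "x \<in> total_space V \<Longrightarrow> (\<Sum>k | component V k x \<noteq> 0. component V k x) = x"
  using decomposes_component[of x] by (auto simp: decomposes_def)

lemma component_add: "x \<in> total_space V \<Longrightarrow> y \<in> total_space V \<Longrightarrow>
    component V k (x + y) = component V k x + component V k y"
  by (rule component_eq) (intro decomposes_add decomposes_component)

lemma component_smul: "x \<in> total_space V \<Longrightarrow> component V k (smul V a x) = smul V a (component V k x)"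
  by (rule component_eq) (intro decomposes_smul decomposes_component)

lemma component_homogeneous: "x \<in> gr V j \<Longrightarrow> component V k x = (if k = j then x else 0)"
  by (rule component_eq[OF decomposes_gr])

lemma koszul_eq:
  assumes "x \<in> total_space V" "finite S" "\<And>k. k \<notin> S \<Longrightarrow> component V k x = 0"
  shows "koszul V q x = (\<Sum>k\<in>S. sg (q * k) (component V k x))"
  unfolding koszul_def scale_powi_sign
  by (rule sum.mono_neutral_left[OF assms(2)]) (use assms(3) in auto)

lemma koszul_homogeneous: "x \<in> gr V k \<Longrightarrow> koszul V q x = sg (q * k) x"
  by (subst koszul_eq[of _ "{k}"]) (auto simp: gr_total component_homogeneous)

lemma koszul_add:
  assumes "x \<in> total_space V" "y \<in> total_space V"
  shows "koszul V q (x + y) = koszul V q x + koszul V q y"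
proof -
  let ?S = "{k. component V k x \<noteq> 0} \<union> {k. component V k y \<noteq> 0}"
  have fin: "finite ?S" using assms by (simp add: finite_component)
  have "koszul V q x = (\<Sum>k\<in>?S. sg (q * k) (component V k x))"
    by (rule koszul_eq[OF assms(1) fin]) simp
  moreover have "koszul V q y = (\<Sum>k\<in>?S. sg (q * k) (component V k y))"
    by (rule koszul_eq[OF assms(2) fin]) simp
  moreover have "koszul V q (x + y) = (\<Sum>k\<in>?S. sg (q * k) (component V k (x + y)))"
    by (rule koszul_eq[OF total_add[OF assms] fin]) (simp add: component_add assms)
  ultimately show ?thesis
    by (simp only: component_add[OF assms] sum.distrib sg_add)
qed

lemma koszul_smul:
  assumes "x \<in> total_space V"
  shows "koszul V q (smul V a x) = smul V a (koszul V q x)"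
proof -
  let ?S = "{k. component V k x \<noteq> 0}"
  have fin: "finite ?S" using assms by (simp add: finite_component)
  have "koszul V q x = (\<Sum>k\<in>?S. sg (q * k) (component V k x))"
    by (rule koszul_eq[OF assms fin]) simp
  moreover have "koszul V q (smul V a x) = (\<Sum>k\<in>?S. sg (q * k) (component V k (smul V a x)))"
    by (rule koszul_eq[OF total_smul[OF assms] fin]) (simp add: component_smul assms)
  ultimately show ?thesis
    by (simp only: component_smul[OF assms] smul_sg[symmetric] scale_sum_right)
qed

lemma koszul_total: "x \<in> total_space V \<Longrightarrow> koszul V q x \<in> total_space V"
  unfolding koszul_def scale_powi_sign
  by (rule subspace_sum[OF total_subspace]) (rule total_sg, rule gr_total, erule component_gr)

lemma koszul_even: "x \<in> total_space V \<Longrightarrow> even q \<Longrightarrow> koszul V q x = x"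
  using sum_component[of x] by (simp add: koszul_def scale_powi_sign)

lemma koszul_parity: "even q \<longleftrightarrow> even q' \<Longrightarrow> koszul V q x = koszul V q' x"
  unfolding koszul_def scale_powi_sign by (intro sum.cong sg_cong) auto

lemma tensors_iff: "xs \<in> tensors V n \<longleftrightarrow> length xs = n \<and> (\<forall>x\<in>set xs. x \<in> total_space V)"
  by (auto simp: tensors_def)

lemma valid_total: "valid V w \<Longrightarrow> a \<in> set w \<Longrightarrow> snd a \<in> total_space V"
  by (cases a) (auto simp: valid_def intro: gr_total)

lemma valid_tensors: "valid V w \<Longrightarrow> n = length w \<Longrightarrow> map snd w \<in> tensors V n"
  using valid_total[of w] by (auto simp: tensors_iff)

lemma map_prj: "valid V w \<Longrightarrow> map (\<lambda>(k, x). prj V k x) w = map snd w"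
  by (induction w) (auto simp: prj(3))

lemma valid_prj: "valid V (map (\<lambda>(k, x). (k, prj V k x)) w)"
  by (induction w) (auto simp: prj(2))

text \<open>Additivity in every slot reduces the claim to homogeneous arguments: from left to right,
  each entry is replaced by the sum of its components. With \<open>S = {0}\<close> this extends
  identities from valid words to all lists.\<close>

lemma tensors_induct:
  assumes "xs \<in> tensors V n"
    and hom: "\<And>w. valid V w \<Longrightarrow> length w = n \<Longrightarrow> f (map snd w) \<in> S"
    and add: "\<And>us x y vs. us @ x # vs \<in> tensors V n \<Longrightarrow> y \<in> total_space V
      \<Longrightarrow> f (us @ (x + y) # vs) = f (us @ x # vs) + f (us @ y # vs)"
    and S: "0 \<in> S" "\<And>x y. x \<in> S \<Longrightarrow> y \<in> S \<Longrightarrow> x + y \<in> S"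
  shows "(f xs :: 'b::ab_group_add) \<in> S"
proof -
  have "f (map snd w @ vs) \<in> S" if "valid V w" "map snd w @ vs \<in> tensors V n" for w vs
    using that
  proof (induction vs arbitrary: w)
    case Nil
    then show ?case using hom[of w] by (simp add: tensors_iff)
  next
    case (Cons x vs)
    have tot: "x \<in> total_space V" using Cons.prems(2) by (simp add: tensors_iff)
    have mem: "f (map snd w @ y # vs) \<in> S" if "y \<in> gr V k" for y k
      using Cons.IH[of "w @ [(k, y)]"] Cons.prems that gr_total[OF that] by (auto simp: tensors_iff)
    have zero: "f (map snd w @ 0 # vs) = 0"
      using add[of "map snd w" 0 vs 0] Cons.prems(2) by (auto simp: tensors_iff total_0)
    have "f (map snd w @ (\<Sum>k\<in>T. component V k x) # vs) \<in> S" if "finite T" for T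
      using that
    proof (induction T)
      case empty
      then show ?case by (simp add: zero S)
    next
      case (insert k T)
      have "(\<Sum>k\<in>T. component V k x) \<in> total_space V"
        by (rule subspace_sum[OF total_subspace]) (rule gr_total, rule component_gr[OF tot])
      moreover have "map snd w @ component V k x # vs \<in> tensors V n"
        using Cons.prems(2) gr_total[OF component_gr[OF tot]] by (auto simp: tensors_iff)
      ultimately show ?case
        using insert add[of "map snd w" "component V k x" vs] mem[OF component_gr[OF tot]] S(2) by simp
    qed
    from this[OF finite_component[OF tot]] show ?case by (simp only: sum_component[OF tot])
  qed
  from this[of "[]" xs] assms(1) show ?thesis by simp
qed

end

lemma sh_valid:
  assumes "\<And>w. valid V w \<Longrightarrow> length w = length x + length y \<Longrightarrow> F w = K w" "valid V x" "valid V y"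
  shows "sh F x y = sh K x y"
  using assms
proof (induction F x y arbitrary: K rule: sh.induct)
  case (3 F a x b y)
  have "sh (\<lambda>w. F (a # w)) x (b # y) = sh (\<lambda>w. K (a # w)) x (b # y)"
    by (rule "3.IH") (use "3.prems" in auto)
  moreover have "sh (\<lambda>w. F (b # w)) (a # x) y = sh (\<lambda>w. K (b # w)) (a # x) y"
    by (rule "3.IH") (use "3.prems" in auto)
  ultimately show ?case by simp
qed auto

section \<open>Multilinear maps on lists and on words\<close>

locale graded_pair = V: graded_space V + W: graded_space W
  for V :: "('k::field, 'a::ab_group_add, 'm) gspace_data_scheme"
    and W :: "('k, 'b::ab_group_add, 'n) gspace_data_scheme"
begin

lemma hoch_mapsI:
  assumes "\<And>xs. xs \<notin> tensors V p \<Longrightarrow> f xs = 0"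
    and add: "\<And>us x y vs. us @ x # vs \<in> tensors V p \<Longrightarrow> y \<in> total_space V
      \<Longrightarrow> f (us @ (x + y) # vs) = f (us @ x # vs) + f (us @ y # vs)"
    and scale: "\<And>us x c vs. us @ x # vs \<in> tensors V p
      \<Longrightarrow> f (us @ smul V c x # vs) = smul W c (f (us @ x # vs))"
    and "\<And>w. valid V w \<Longrightarrow> length w = p \<Longrightarrow> f (map snd w) \<in> gr W (sum_list (map fst w) + q)"
  shows "f \<in> hoch_maps V W p q"
proof -
  have upd: "xs[i := z] = take i xs @ z # drop (Suc i) xs" "take i xs @ z # drop (Suc i) xs \<in> tensors V p"
    if "xs \<in> tensors V p" "i < p" "z \<in> total_space V" for xs i z
    using that by (auto simp: V.tensors_iff upd_conv_take_nth_drop dest: in_set_takeD in_set_dropD)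
  have upd': "xs[i := z] = take i xs @ z # drop (Suc i) xs" if "xs \<in> tensors V p" "i < p" for xs i z
    using that by (auto simp: V.tensors_iff upd_conv_take_nth_drop)
  show ?thesis
    unfolding hoch_maps_def mem_Collect_eq list_all2_valid
  proof (intro conjI allI ballI impI)
    fix xs i x y assume xs: "xs \<in> tensors V p" "i < p" and x: "x \<in> total_space V" and y: "y \<in> total_space V"
    show "f (xs[i := x + y]) = f (xs[i := x]) + f (xs[i := y])"
      unfolding upd'[OF xs] by (rule add[OF upd(2)[OF xs x] y])
  next
    fix xs i c x assume xs: "xs \<in> tensors V p" "i < p" and x: "x \<in> total_space V"
    show "f (xs[i := smul V c x]) = smul W c (f (xs[i := x]))"
      unfolding upd'[OF xs] by (rule scale[OF upd(2)[OF xs x]])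
  qed (use assms in auto)
qed

lemma hoch_zero: "f \<in> hoch_maps V W p q \<Longrightarrow> xs \<notin> tensors V p \<Longrightarrow> f xs = 0"
  by (simp add: hoch_maps_def)

lemma hoch_add:
  assumes "f \<in> hoch_maps V W p q" "us @ x # vs \<in> tensors V p" "y \<in> total_space V"
  shows "f (us @ (x + y) # vs) = f (us @ x # vs) + f (us @ y # vs)"
proof -
  have i: "length us < p" and x: "x \<in> total_space V" using assms(2) by (auto simp: V.tensors_iff)
  have "f ((us @ x # vs)[length us := x + y])
      = f ((us @ x # vs)[length us := x]) + f ((us @ x # vs)[length us := y])"
    using assms i x by (simp only: hoch_maps_def mem_Collect_eq)
  then show ?thesis by simp
qed

lemma hoch_scale:
  assumes "f \<in> hoch_maps V W p q" "us @ x # vs \<in> tensors V p"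
  shows "f (us @ smul V c x # vs) = smul W c (f (us @ x # vs))"
proof -
  have i: "length us < p" and x: "x \<in> total_space V" using assms(2) by (auto simp: V.tensors_iff)
  have "f ((us @ x # vs)[length us := smul V c x]) = smul W c (f ((us @ x # vs)[length us := x]))"
    using assms i x by (simp only: hoch_maps_def mem_Collect_eq)
  then show ?thesis by simp
qed

lemma hoch_gr:
  assumes "f \<in> hoch_maps V W p q" "valid V w" "length w = p" "k = sum_list (map fst w) + q"
  shows "f (map snd w) \<in> gr W k"
proof -
  have "length (map fst w) = p \<and> list_all2 (\<lambda>k x. x \<in> gr V k) (map fst w) (map snd w)"
    using assms(2,3) list_all2_valid by auto
  then show ?thesis using assms(1) unfolding hoch_maps_def mem_Collect_eq assms(4) by blast
qed

lemma hoch_sg: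
  assumes "f \<in> hoch_maps V W p q" "us @ x # vs \<in> tensors V p"
  shows "f (us @ sg n x # vs) = sg n (f (us @ x # vs))"
  using hoch_scale[OF assms, of "-1"] by (cases "even n") (simp_all add: sg_odd)

lemma hoch_total:
  assumes "f \<in> hoch_maps V W p q" shows "f xs \<in> total_space W"
proof (cases "xs \<in> tensors V p")
  case True
  then show ?thesis
    by (rule V.tensors_induct[where f = f])
      (use W.gr_total[OF hoch_gr[OF assms]] hoch_add[OF assms] in \<open>auto intro: W.total_0 W.total_add\<close>)
qed (simp add: hoch_zero[OF assms] W.total_0)

lemma hoch_0: "(\<lambda>xs. 0) \<in> hoch_maps V W p q"
  by (rule hoch_mapsI) (auto intro: W.gr_0)

end

text \<open>
  The sign exponent \<open>(n - 1) k\<^sub>1 + (n - 2) k\<^sub>2 + \<dots>\<close> of the suspension isomorphism between multilinear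
  maps and functions on words, in which letters carry the shifted degree \<open>k - 1\<close>.
\<close>

primrec del :: "(int \<times> 'a) list \<Rightarrow> int" where
  "del [] = 0"
| "del (a # w) = int (length w) * fst a + del w"

abbreviation (input) tdeg :: "(int \<times> 'a) list \<Rightarrow> int" where
  "tdeg w \<equiv> sum_list (map fst w)"

lemma tdeg: "tdeg w = deg w + int (length w)"
  by (induction w) auto

lemma del_append: "del (u @ v) = del u + int (length v) * tdeg u + del v"
  by (induction u) (auto simp: algebra_simps)

text \<open>The suspension of a family of maps, indexed by arity. Projecting each letter to its
  stored degree makes the result multilinear on all words; on valid words the projections
  disappear.\<close>

definition hat :: "('k::field, 'a::ab_group_add, 'm) gspace_data_scheme \<Rightarrow> (nat \<Rightarrow> 'a list \<Rightarrow> 'b::ab_group_add)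
    \<Rightarrow> (int \<times> 'a) list \<Rightarrow> 'b" where
  "hat V f w = sg (del w) (f (length w) (map (\<lambda>(k, x). prj V k x) w))"

text \<open>The way back from words to lists: every argument is expanded into homogeneous
  components, each labelled by its degree.\<close>

primrec ext :: "('k::field, 'a::ab_group_add, 'm) gspace_data_scheme \<Rightarrow> ((int \<times> 'a) list \<Rightarrow> 'b::ab_group_add)
    \<Rightarrow> 'a list \<Rightarrow> 'b" where
  "ext V F [] = F []"
| "ext V F (x # xs) =
     (\<Sum>k | component V k x \<noteq> 0. ext V (\<lambda>w. F ((k, component V k x) # w)) xs)"

definition unhat :: "('k::field, 'a::ab_group_add, 'm) gspace_data_scheme \<Rightarrow> ((int \<times> 'a) list \<Rightarrow> 'b::ab_group_add)
    \<Rightarrow> nat \<Rightarrow> 'a list \<Rightarrow> 'b" where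
  "unhat V F n = on_tensors V n (ext V (\<lambda>w. sg (del w) (F w)))"

context graded_pair
begin

lemma hat_valid: "valid V w \<Longrightarrow> hat V f w = sg (del w) (f (length w) (map snd w))"
  by (simp add: hat_def V.map_prj)

lemma hat_gr:
  assumes "\<And>n. f n \<in> hoch_maps V W n (c - int n)"
  shows "hat V f w \<in> gr W (deg w + c)"
proof -
  let ?w = "map (\<lambda>(k, x). (k, prj V k x)) w"
  have m: "map snd ?w = map (\<lambda>(k, x). prj V k x) w" "map fst ?w = map fst w"
    by (induction w) auto
  have "f (length w) (map snd ?w) \<in> gr W (deg w + c)"
  proof (rule hoch_gr[OF assms V.valid_prj])
    show "deg w + c = tdeg ?w + (c - int (length w))" by (simp add: m(2) tdeg del: map_map)
  qed simp
  then show ?thesis unfolding m hat_def by (rule W.gr_sg)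
qed

lemma hat_mlin:
  assumes "\<And>n. f n \<in> hoch_maps V W n (c n)"
  shows "mlin (smul V) (smul W) (hat V f)"
proof (rule mlinI)
  let ?p = "map (\<lambda>(k, x). prj V k x)"
  have T: "?p u @ prj V k x # ?p v \<in> tensors V (Suc (length u + length v))" for u k x v
    using V.gr_total[OF V.prj(2)] by (auto simp: V.tensors_iff)
  have del: "del (u @ (k, x) # v) = del (u @ (k, y) # v)" for u k v x y
    by (simp add: del_append)
  fix u k v x y c
  show "hat V f (u @ (k, x + y) # v) = hat V f (u @ (k, x) # v) + hat V f (u @ (k, y) # v)"
    using hoch_add[OF assms T V.gr_total[OF V.prj(2)]]
    by (simp add: hat_def linear_add_gen[OF V.prj(1)] sg_add del_append)
  show "hat V f (u @ (k, smul V c x) # v) = smul W c (hat V f (u @ (k, x) # v))"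
    using hoch_scale[OF assms T]
    by (simp add: hat_def linear_scale_gen[OF V.prj(1)] W.smul_sg del_append)
qed

lemma ext_zero: "(\<And>w. F w = 0) \<Longrightarrow> ext V F xs = 0"
  by (induction xs arbitrary: F) auto

lemma ext_fun_add: "ext V (\<lambda>w. F w + G w) xs = ext V F xs + ext V G xs"
  by (induction xs arbitrary: F G) (auto simp: sum.distrib)

lemma ext_fun_smul: "ext V (\<lambda>w. smul W c (F w)) xs = smul W c (ext V F xs)"
  by (induction xs arbitrary: F) (auto simp: W.scale_sum_right)

lemma ext_Cons:
  assumes F: "mlin (smul V) (smul W) F" and "finite S" "\<And>k. k \<notin> S \<Longrightarrow> component V k x = 0"
  shows "ext V F (x # xs) = (\<Sum>k\<in>S. ext V (\<lambda>w. F ((k, component V k x) # w)) xs)"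
  unfolding ext.simps
  by (rule sum.mono_neutral_left[OF assms(2)])
    (use assms(3) in \<open>auto intro!: ext_zero simp: mlin_zero_hd[OF F]\<close>)

lemma ext_add:
  assumes "mlin (smul V) (smul W) F" "x \<in> total_space V" "y \<in> total_space V"
  shows "ext V F (us @ (x + y) # vs) = ext V F (us @ x # vs) + ext V F (us @ y # vs)"
  using assms(1)
proof (induction us arbitrary: F)
  case Nil
  let ?S = "{k. component V k x \<noteq> 0} \<union> {k. component V k y \<noteq> 0}"
  have "finite ?S" using assms by (simp add: V.finite_component)
  then have fin: "finite ?S" .
  have "ext V F (x # vs) = (\<Sum>k\<in>?S. ext V (\<lambda>w. F ((k, component V k x) # w)) vs)"
    by (rule ext_Cons[OF Nil fin]) simp
  moreover have "ext V F (y # vs) = (\<Sum>k\<in>?S. ext V (\<lambda>w. F ((k, component V k y) # w)) vs)"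
    by (rule ext_Cons[OF Nil fin]) simp
  moreover have "ext V F ((x + y) # vs) = (\<Sum>k\<in>?S. ext V (\<lambda>w. F ((k, component V k (x + y)) # w)) vs)"
    by (rule ext_Cons[OF Nil fin]) (simp add: V.component_add assms(2,3))
  ultimately show ?case
    by (simp only: append_Nil V.component_add[OF assms(2,3)] mlin_add_hd[OF Nil] ext_fun_add sum.distrib)
next
  case (Cons u us)
  then show ?case by (simp add: mlin_Cons sum.distrib)
qed

lemma ext_smul:
  assumes "mlin (smul V) (smul W) F" "x \<in> total_space V"
  shows "ext V F (us @ smul V c x # vs) = smul W c (ext V F (us @ x # vs))"
  using assms(1)
proof (induction us arbitrary: F)
  case Nil
  let ?S = "{k. component V k x \<noteq> 0}"
  have "finite ?S" using assms by (simp add: V.finite_component)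
  then have fin: "finite ?S" .
  have "ext V F (x # vs) = (\<Sum>k\<in>?S. ext V (\<lambda>w. F ((k, component V k x) # w)) vs)"
    by (rule ext_Cons[OF Nil fin]) simp
  moreover have "ext V F (smul V c x # vs)
      = (\<Sum>k\<in>?S. ext V (\<lambda>w. F ((k, component V k (smul V c x)) # w)) vs)"
    by (rule ext_Cons[OF Nil fin]) (simp add: V.component_smul assms(2))
  ultimately show ?case
    by (simp only: append_Nil V.component_smul[OF assms(2)] mlin_scale_hd[OF Nil] ext_fun_smul
      W.scale_sum_right)
next
  case (Cons u us)
  then show ?case by (simp add: mlin_Cons W.scale_sum_right)
qed

lemma ext_valid:
  assumes "mlin (smul V) (smul W) F" "valid V w"
  shows "ext V F (map snd w) = F w"
  using assms
proof (induction w arbitrary: F)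
  case (Cons a w)
  have "ext V F (snd a # map snd w)
      = (\<Sum>k\<in>{fst a}. ext V (\<lambda>w. F ((k, component V k (snd a)) # w)) (map snd w))"
    by (rule ext_Cons[OF Cons.prems(1)]) (use Cons.prems in \<open>auto simp: V.component_homogeneous\<close>)
  then show ?case
    using Cons V.component_homogeneous[of "snd a" "fst a"] by (simp add: mlin_Cons)
qed simp

lemma mlin_del:
  assumes "mlin (smul V) (smul W) F" shows "mlin (smul V) (smul W) (\<lambda>w. sg (del w) (F w))"
  by (rule mlinI) (simp_all add: mlin_add[OF assms] mlin_scale[OF assms] sg_add W.smul_sg del_append)

lemma unhat_valid:
  assumes "mlin (smul V) (smul W) F" "valid V w" "n = length w"
  shows "unhat V F n (map snd w) = sg (del w) (F w)"
  using ext_valid[OF mlin_del[OF assms(1)] assms(2)] V.valid_tensors[OF assms(2,3)]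
  by (simp add: unhat_def on_tensors_def)

lemma hat_unhat:
  assumes "mlin (smul V) (smul W) F" "valid V w"
  shows "hat V (unhat V F) w = F w"
  by (simp add: hat_valid[OF assms(2)] unhat_valid[OF assms])

lemma unhat_hoch:
  assumes F: "mlin (smul V) (smul W) F" "\<And>w. F w \<in> gr W (deg w + c)"
  shows "unhat V F n \<in> hoch_maps V W n (c - int n)"
proof (rule hoch_mapsI)
  fix xs assume "xs \<notin> tensors V n"
  then show "unhat V F n xs = 0" by (simp add: unhat_def on_tensors_def)
next
  fix us x y vs assume "us @ x # vs \<in> tensors V n" "y \<in> total_space V"
  moreover from this have "us @ (x + y) # vs \<in> tensors V n" "us @ y # vs \<in> tensors V n"
    by (auto simp: V.tensors_iff intro: V.total_add)
  ultimately show "unhat V F n (us @ (x + y) # vs) = unhat V F n (us @ x # vs) + unhat V F n (us @ y # vs)"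
    by (simp add: unhat_def on_tensors_def) (rule ext_add[OF mlin_del[OF F(1)]], auto simp: V.tensors_iff)
next
  fix us x a vs assume "us @ x # vs \<in> tensors V n"
  moreover from this have "us @ smul V a x # vs \<in> tensors V n"
    by (auto simp: V.tensors_iff intro: V.total_smul)
  ultimately show "unhat V F n (us @ smul V a x # vs) = smul W a (unhat V F n (us @ x # vs))"
    by (simp add: unhat_def on_tensors_def) (rule ext_smul[OF mlin_del[OF F(1)]], auto simp: V.tensors_iff)
next
  fix w :: "(int \<times> 'a) list" assume "valid V w" "length w = n"
  then show "unhat V F n (map snd w) \<in> gr W (tdeg w + (c - int n))"
    using F(2)[of w] tdeg[of w] by (simp add: unhat_valid[OF F(1)] W.gr_sg)
qed

end

section \<open>Shuffles of lists and of words\<close>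

lemma prod_list_shuffles:
  fixes c :: "'x \<Rightarrow> 'k::comm_monoid_mult"
  shows "l \<in> shuffles xs ys \<Longrightarrow> (\<Prod>i\<leftarrow>l. c i) = (\<Prod>i\<leftarrow>xs. c i) * (\<Prod>i\<leftarrow>ys. c i)"
  by (induction xs ys arbitrary: l rule: shuffles.induct) (auto simp: mult_ac)

lemma shuffle_sign_Cons:
  "(shuffle_sign ks (j # js) :: 'k::field) =
     (\<Prod>i\<leftarrow>js. if i < j then (-1) powi (1 + ks ! j * ks ! i) else 1) * shuffle_sign ks js"
proof -
  let ?c = "\<lambda>(r, s). (-1 :: 'k) powi (1 + ks ! ((j # js) ! r) * ks ! ((j # js) ! s))"
  let ?I = "\<lambda>js. {(r, s). r < s \<and> s < length js \<and> js ! s < js ! (r::nat)}"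
  let ?A = "(\<lambda>s. (0, Suc s)) ` {s. s < length js \<and> js ! s < j}"
  let ?B = "map_prod Suc Suc ` ?I js"
  have split: "?I (j # js) = ?A \<union> ?B"
  proof (intro set_eqI iffI)
    fix p assume "p \<in> ?I (j # js)"
    then obtain r s where p: "p = (r, s)" "r < s" "s < Suc (length js)" "(j # js) ! s < (j # js) ! r" by auto
    then obtain s' where s': "s = Suc s'" by (cases s) auto
    show "p \<in> ?A \<union> ?B"
    proof (cases r)
      case 0
      then show ?thesis using p s' by auto
    next
      case (Suc r')
      then have "(r', s') \<in> ?I js" using p s' by auto
      then show ?thesis using p s' Suc by (auto intro!: image_eqI[of _ _ "(r', s')"])
    qed
  qed auto
  have fin: "finite (?I js)"
    by (rule finite_subset[of _ "{..<length js} \<times> {..<length js}"]) auto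
  have "(\<Prod>p\<in>?I (j # js). ?c p) = (\<Prod>p\<in>?A. ?c p) * (\<Prod>p\<in>?B. ?c p)"
    unfolding split by (rule prod.union_disjoint) (use fin in auto)
  also have "(\<Prod>p\<in>?A. ?c p) = (\<Prod>s | s < length js \<and> js ! s < j. (-1) powi (1 + ks ! j * ks ! (js ! s)))"
    by (subst prod.reindex) (auto simp: inj_on_def)
  also have "\<dots> = (\<Prod>s<length js. if js ! s < j then (-1) powi (1 + ks ! j * ks ! (js ! s)) else 1)"
    by (rule prod.mono_neutral_cong_left) auto
  also have "\<dots> = (\<Prod>i\<leftarrow>js. if i < j then (-1) powi (1 + ks ! j * ks ! i) else 1)"
    by (simp add: prod.list_conv_set_nth atLeast0LessThan)
  also have "(\<Prod>p\<in>?B. ?c p) = shuffle_sign ks js"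
    unfolding shuffle_sign_def by (subst prod.reindex) (auto simp: inj_on_def intro!: prod.cong)
  finally show ?thesis by (simp add: shuffle_sign_def)
qed

text \<open>Here the shuffle signs are those of the unshifted degrees.\<close>

fun ush :: "((int \<times> 'h) list \<Rightarrow> 'b::ab_group_add) \<Rightarrow> (int \<times> 'h) list \<Rightarrow> (int \<times> 'h) list \<Rightarrow> 'b" where
  "ush F [] y = F y"
| "ush F (a # x) [] = F (a # x)"
| "ush F (a # x) (b # y) = ush (\<lambda>w. F (a # w)) x (b # y)
     + sg (int (length (a # x)) + fst b * tdeg (a # x)) (ush (\<lambda>w. F (b # w)) (a # x) y)"

text \<open>Exchanging adjacent letters of degrees k and l changes \<open>del\<close> by k + l
  modulo 2, and (k - 1)(l - 1) has the parity of k l + 1 + k + l. So suspension absorbs the sign of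
  the permutation into the shifted Koszul sign.\<close>

lemma sh_ush:
  fixes F :: "(int \<times> 'h) list \<Rightarrow> 'b::ab_group_add"
  shows "sh (\<lambda>w. sg (del w) (F w)) x y = sg (del (x @ y)) (ush F x y)"
proof (induction F x y rule: ush.induct)
  case (3 F a x b y)
  have "sh (\<lambda>w. sg (del (a # w)) (F (a # w))) x (b # y)
      = sh (\<lambda>w. sg (int (length (x @ b # y)) * fst a) (sg (del w) (F (a # w)))) x (b # y)"
    by (rule sh_cong) simp
  also have "\<dots> = sg (int (length (x @ b # y)) * fst a) (sh (\<lambda>w. sg (del w) (F (a # w))) x (b # y))"
    by (rule sh_sg)
  also have "sh (\<lambda>w. sg (del w) (F (a # w))) x (b # y) = sg (del (x @ b # y)) (ush (\<lambda>w. F (a # w)) x (b # y))"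
    by (rule "3.IH"(1))
  finally have 1: "sh (\<lambda>w. sg (del (a # w)) (F (a # w))) x (b # y)
      = sg (del (a # x @ b # y)) (ush (\<lambda>w. F (a # w)) x (b # y))"
    by simp
  have "sh (\<lambda>w. sg (del (b # w)) (F (b # w))) (a # x) y
      = sh (\<lambda>w. sg (int (length (a # x @ y)) * fst b) (sg (del w) (F (b # w)))) (a # x) y"
    by (rule sh_cong) simp
  also have "\<dots> = sg (int (length (a # x @ y)) * fst b) (sh (\<lambda>w. sg (del w) (F (b # w))) (a # x) y)"
    by (rule sh_sg)
  also have "sh (\<lambda>w. sg (del w) (F (b # w))) (a # x) y = sg (del ((a # x) @ y)) (ush (\<lambda>w. F (b # w)) (a # x) y)"
    by (rule "3.IH"(2))
  finally have 2: "sh (\<lambda>w. sg (del (b # w)) (F (b # w))) (a # x) y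
      = sg (int (length (a # x @ y)) * fst b + del ((a # x) @ y)) (ush (\<lambda>w. F (b # w)) (a # x) y)"
    by (simp only: sg_sg)
  have "even ((fst b - 1) * deg X + (int (length (X @ y)) * fst b + del (X @ y)))
      = even (del (X @ b # y) + (int (length X) + fst b * tdeg X))" for X :: "(int \<times> 'h) list"
    by (simp add: del_append tdeg) auto
  from sg_cong[OF this[of "a # x"]]
  have "sg ((fst b - 1) * deg (a # x) + (int (length (a # x @ y)) * fst b + del ((a # x) @ y))) z
      = sg (del ((a # x) @ b # y) + (int (length (a # x)) + fst b * tdeg (a # x))) z" for z :: 'b
    by (simp only: append_Cons)
  then show ?case
    unfolding sh.simps ush.simps 1 2 sg_add sg_sg by simp
qed auto

text \<open>Put in front, \<open>j\<close> forms an inversion with exactly the entries of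
  \<open>is\<close>, each contributing one transposition and one Koszul sign.\<close>

lemma shuffle_sign_shuffles:
  assumes "l \<in> shuffles is js" "\<And>i. i \<in> set is \<Longrightarrow> i < j" "\<And>i. i \<in> set js \<Longrightarrow> j < i"
  shows "(shuffle_sign ks (j # l) :: 'k::field) =
    (-1) powi (int (length is) + ks ! j * (\<Sum>i\<leftarrow>is. ks ! i)) * shuffle_sign ks l"
proof -
  let ?c = "\<lambda>i. if i < j then (-1 :: 'k) powi (1 + ks ! j * ks ! i) else 1"
  have "(\<Prod>i\<leftarrow>is. ?c i) = (-1) powi (int (length is) + ks ! j * (\<Sum>i\<leftarrow>is. ks ! i))"
    using assms(2) by (induction "is") (simp_all add: power_int_add[symmetric] algebra_simps)
  moreover have "\<forall>i\<in>set js. j < i \<Longrightarrow> (\<Prod>i\<leftarrow>js. ?c i) = 1"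
    by (induction js) auto
  ultimately show ?thesis
    using assms(3) by (simp add: shuffle_sign_Cons prod_list_shuffles[OF assms(1)])
qed

lemma shuffle_sign_sorted: "sorted_wrt (<) l \<Longrightarrow> (shuffle_sign ks l :: 'k::field) = 1"
proof (induction l)
  case (Cons j l)
  then show ?case using shuffle_sign_shuffles[of l "[]" l j ks, where 'k = 'k] by simp
qed (simp add: shuffle_sign_def)

text \<open>The indices in \<open>is\<close> lie below those in \<open>js\<close>, so the two
  families of shuffles, sorted by first entry, are disjoint and every inversion pairs an index of
  \<open>js\<close> with a later one of \<open>is\<close>.\<close>

lemma ush_shuffles:
  fixes F :: "(int \<times> 'h) list \<Rightarrow> 'b::ab_group_add" and sc :: "'k::field \<Rightarrow> 'b \<Rightarrow> 'b"
  assumes "vector_space sc"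
    and "sorted_wrt (<) is" "sorted_wrt (<) js" "\<And>i j. i \<in> set is \<Longrightarrow> j \<in> set js \<Longrightarrow> i < j"
    and "\<And>i. i \<in> set is \<union> set js \<Longrightarrow> ks ! i = fst (w ! i)"
  shows "(\<Sum>l\<in>shuffles is js. sc (shuffle_sign ks l) (F (map ((!) w) l)))
    = ush F (map ((!) w) is) (map ((!) w) js)"
  using assms(2-)
proof (induction "is" js arbitrary: F rule: shuffles.induct)
  case (1 js)
  interpret vector_space sc by (rule assms(1))
  show ?case using 1 by (simp add: shuffle_sign_sorted)
next
  case (2 "is")
  interpret vector_space sc by (rule assms(1))
  show ?case using 2 by (cases "is") (simp_all add: shuffle_sign_sorted)
next
  case (3 i "is" j js)
  interpret vector_space sc by (rule assms(1))
  have ij: "i < j" using 3 by simp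
  let ?T = "\<lambda>l. sc (shuffle_sign ks l) (F (map ((!) w) l))"
  have "(\<Sum>l\<in>shuffles (i # is) (j # js). ?T l)
      = (\<Sum>l\<in>(#) i ` shuffles is (j # js). ?T l) + (\<Sum>l\<in>(#) j ` shuffles (i # is) js. ?T l)"
    unfolding shuffles.simps by (rule sum.union_disjoint) (use ij in auto)
  also have "(\<Sum>l\<in>(#) i ` shuffles is (j # js). ?T l)
      = (\<Sum>l\<in>shuffles is (j # js). sc (shuffle_sign ks l) (F (w ! i # map ((!) w) l)))"
  proof (subst sum.reindex, simp, rule sum.cong[OF refl])
    fix l assume l: "l \<in> shuffles is (j # js)"
    then have "i < k" if "k \<in> set l" for k
      using that set_shuffles[OF l] "3.prems"(1,3) by auto
    then have "(shuffle_sign ks (i # l) :: 'k) = shuffle_sign ks l"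
      using shuffle_sign_shuffles[of l "[]" l i ks, where 'k = 'k] by simp
    then show "(?T \<circ> (#) i) l = sc (shuffle_sign ks l) (F (w ! i # map ((!) w) l))" by simp
  qed
  also have "\<dots> = ush (\<lambda>v. F (w ! i # v)) (map ((!) w) is) (map ((!) w) (j # js))"
    by (rule "3.IH"(1)) (use "3.prems" in auto)
  also have "(\<Sum>l\<in>(#) j ` shuffles (i # is) js. ?T l)
      = (\<Sum>l\<in>shuffles (i # is) js.
          sg (int (length (i # is)) + ks ! j * (\<Sum>i\<leftarrow>i # is. ks ! i))
            (sc (shuffle_sign ks l) (F (w ! j # map ((!) w) l))))"
  proof (subst sum.reindex, simp, rule sum.cong[OF refl])
    fix l assume l: "l \<in> shuffles (i # is) js"
    show "(?T \<circ> (#) j) l = sg (int (length (i # is)) + ks ! j * (\<Sum>i\<leftarrow>i # is. ks ! i))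
            (sc (shuffle_sign ks l) (F (w ! j # map ((!) w) l)))"
    proof -
      have e: "(shuffle_sign ks (j # l) :: 'k) =
          (-1) powi (int (length (i # is)) + ks ! j * (\<Sum>i\<leftarrow>i # is. ks ! i)) * shuffle_sign ks l"
        by (rule shuffle_sign_shuffles[OF l]) (use "3.prems"(2,3) in auto)
      show ?thesis by (simp only: o_apply list.map e scale_scale[symmetric] scale_powi_sign)
    qed
  qed
  also have "\<dots> = sg (int (length (i # is)) + ks ! j * (\<Sum>i\<leftarrow>i # is. ks ! i))
      (ush (\<lambda>v. F (w ! j # v)) (map ((!) w) (i # is)) (map ((!) w) js))"
    unfolding sg_sum[symmetric]
    by (rule arg_cong[of _ _ "sg _"], rule "3.IH"(2)) (use "3.prems" in auto)
  also have "int (length (i # is)) + ks ! j * (\<Sum>i\<leftarrow>i # is. ks ! i)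
      = int (length (map ((!) w) (i # is))) + fst (w ! j) * tdeg (map ((!) w) (i # is))"
  proof -
    have "map ((!) ks) (i # is) = map (\<lambda>i. fst (w ! i)) (i # is)"
      by (rule map_cong[OF refl]) (use "3.prems"(4) in auto)
    then have "(\<Sum>i\<leftarrow>i # is. ks ! i) = tdeg (map ((!) w) (i # is))"
      by (simp only: map_map o_def)
    moreover have "ks ! j = fst (w ! j)" by (rule "3.prems"(4)) simp
    ultimately show ?thesis by (simp only: length_map)
  qed
  finally show ?case by simp
qed

context graded_pair
begin

text \<open>The Harrison condition is primitivity.\<close>

lemma shuffle_sum_hat:
  assumes "valid V w" "i \<le> length w"
  shows "(\<Sum>js \<in> shuffles [0..<i] [i..<length w].
      smul W (shuffle_sign (map fst w) js) (f (length w) (map (\<lambda>j. map snd w ! j) js)))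
    = sg (del w) (sh (hat V f) (take i w) (drop i w))"
proof -
  let ?F = "\<lambda>v. f (length w) (map snd v)"
  have "(\<Sum>js \<in> shuffles [0..<i] [i..<length w].
      smul W (shuffle_sign (map fst w) js) (f (length w) (map (\<lambda>j. map snd w ! j) js)))
    = (\<Sum>js \<in> shuffles [0..<i] [i..<length w].
      smul W (shuffle_sign (map fst w) js) (?F (map ((!) w) js)))"
  proof (rule sum.cong[OF refl])
    fix js assume "js \<in> shuffles [0..<i] [i..<length w]"
    then have "set js \<subseteq> {..<length w}" using assms(2) by (auto dest!: set_shuffles)
    then have "map (\<lambda>j. map snd w ! j) js = map snd (map ((!) w) js)" by auto
    then show "smul W (shuffle_sign (map fst w) js) (f (length w) (map (\<lambda>j. map snd w ! j) js))
      = smul W (shuffle_sign (map fst w) js) (?F (map ((!) w) js))" by (simp only:)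
  qed
  also have "\<dots> = ush ?F (map ((!) w) [0..<i]) (map ((!) w) [i..<length w])"
    by (rule ush_shuffles[OF W.vs]) (use assms(2) in auto)
  also have "map ((!) w) [0..<i] = take i w"
    using assms(2) by (auto intro: nth_equalityI)
  also have "map ((!) w) [i..<length w] = drop i w"
    using assms(2) by (auto intro: nth_equalityI)
  also have "ush ?F (take i w) (drop i w)
      = sg (del w) (sh (\<lambda>v. sg (del v) (?F v)) (take i w) (drop i w))"
    by (simp add: sh_ush)
  also have "sh (\<lambda>v. sg (del v) (?F v)) (take i w) (drop i w) = sh (hat V f) (take i w) (drop i w)"
  proof (rule sh_valid)
    fix v assume "valid V v" "length v = length (take i w) + length (drop i w)"
    then show "sg (del v) (?F v) = hat V f v" using assms(2) by (simp add: hat_valid)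
  qed (use assms(1) in \<open>auto simp: valid_def dest: in_set_takeD in_set_dropD\<close>)
  finally show ?thesis .
qed

end

section \<open>Operations on lists as operations on words\<close>

lemma Dop_sum:
  assumes "\<And>w. length w < 2 \<Longrightarrow> b w = 0" "mlin s t F"
  shows "Dop b F w = (\<Sum>s=2..length w. \<Sum>r=0..length w - s.
    sg (deg (take r w)) (F (take r w @ lt 2 b (take s (drop r w)) # drop (r + s) w)))"
proof -
  let ?n = "length w"
  let ?T = "\<lambda>r s. sg (deg (take r w)) (F (take r w @ lt 2 b (take s (drop r w)) # drop (r + s) w))"
  have T0: "?T r s = 0" if "s < 2" for r s
    using that assms(1)[of "take s (drop r w)"] by (simp add: lt_def mlin_zero[OF assms(2)])
  have "Dop b F w = (\<Sum>r\<le>?n. \<Sum>s\<le>?n - r. ?T r s)"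
    by (simp add: Dop_def ins_dec dec_sum add.commute)
  also have "\<dots> = (\<Sum>r\<le>?n. \<Sum>s | s \<in> {..?n} \<and> r + s \<le> ?n. ?T r s)"
    by (intro sum.cong refl) auto
  also have "\<dots> = (\<Sum>s\<le>?n. \<Sum>r | r \<in> {..?n} \<and> r + s \<le> ?n. ?T r s)"
    by (rule sum.swap_restrict) auto
  also have "\<dots> = (\<Sum>s\<le>?n. \<Sum>r=0..?n - s. ?T r s)"
    by (intro sum.cong refl) auto
  also have "\<dots> = (\<Sum>s=2..?n. \<Sum>r=0..?n - s. ?T r s)"
    by (rule sum.mono_neutral_right) (auto intro!: sum.neutral T0)
  finally show ?thesis .
qed

context graded_pair
begin

lemma hoch_koszul:
  assumes f: "f \<in> hoch_maps V W p q'" and "valid V u" "us @ map snd u @ vs \<in> tensors V p"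
  shows "f (us @ map (koszul V q) (map snd u) @ vs) = sg (q * tdeg u) (f (us @ map snd u @ vs))"
  using assms(2,3)
proof (induction u arbitrary: us)
  case (Cons a u)
  have k: "koszul V q (snd a) = sg (q * fst a) (snd a)"
    using Cons.prems by (auto intro: V.koszul_homogeneous)
  have "us @ koszul V q (snd a) # map snd u @ vs \<in> tensors V p"
    using Cons.prems by (auto simp: V.tensors_iff intro: V.koszul_total)
  then have "f (us @ koszul V q (snd a) # map (koszul V q) (map snd u) @ vs)
      = sg (q * tdeg u) (f (us @ koszul V q (snd a) # map snd u @ vs))"
    using Cons.IH[of "us @ [koszul V q (snd a)]"] Cons.prems by simp
  also have "f (us @ koszul V q (snd a) # map snd u @ vs) = sg (q * fst a) (f (us @ snd a # map snd u @ vs))"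
    unfolding k by (rule hoch_sg[OF f]) (use Cons.prems in simp)
  finally show ?case by (simp add: algebra_simps)
qed simp

text \<open>After suspension, the factor \<open>(-1) ^ (r + s * t)\<close> and the Koszul sign of an
  operation of degree \<open>2 - s\<close> combine into the sign of an odd operator passing
  \<open>u\<close>. This identifies the sum of insertions with a coderivation.\<close>

lemma insert_op_word:
  assumes f: "\<And>n. f n \<in> hoch_maps V W n (c - int n)" and m: "\<And>n. m n \<in> hoch_maps V V n (2 - int n)"
    and w: "valid V u" "valid V v" "valid V z"
  shows "insert_op V W f m (length u) (length v) (map snd (u @ v @ z)) =
    sg (del (u @ v @ z)) (sg (deg u) (hat V f (u @ lt 2 (hat V m) v # z)))"
proof -
  interpret VV: graded_pair V V ..
  let ?r = "length u" and ?s = "length v" and ?t = "length z"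
  let ?p = "?r + 1 + ?t"
  let ?x = "m ?s (map snd v)"
  have x: "?x \<in> total_space V" by (rule VV.hoch_total[OF m])
  have T: "map snd u @ ?x # map snd z \<in> tensors V ?p"
    using w x V.valid_total by (auto simp: V.tensors_iff)
  have b: "hat V m v \<in> gr V (deg v + 2)" by (rule VV.hat_gr[OF m])
  have bx: "hat V m v = sg (del v) ?x" by (rule VV.hat_valid[OF w(2)])
  have "insert_op V W f m ?r ?s (map snd (u @ v @ z))
      = sg (int (?r + ?s * ?t)) (f ?p (map (koszul V (2 - int ?s)) (map snd u) @ ?x # map snd z))"
    by (simp add: insert_op_def Let_def W.scale_power_sign)
  also have "f ?p (map (koszul V (2 - int ?s)) (map snd u) @ ?x # map snd z)
      = sg ((2 - int ?s) * tdeg u) (f ?p (map snd u @ ?x # map snd z))"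
    using hoch_koszul[OF f w(1), of "[]" "?x # map snd z" ?p] T by simp
  finally have L: "insert_op V W f m ?r ?s (map snd (u @ v @ z))
      = sg (int (?r + ?s * ?t) + (2 - int ?s) * tdeg u) (f ?p (map snd u @ ?x # map snd z))" by simp
  have "hat V f (u @ lt 2 (hat V m) v # z)
      = sg (del (u @ lt 2 (hat V m) v # z)) (f ?p (map snd u @ sg (del v) ?x # map snd z))"
    using w b by (subst hat_valid) (simp_all add: lt_def bx)
  also have "f ?p (map snd u @ sg (del v) ?x # map snd z) = sg (del v) (f ?p (map snd u @ ?x # map snd z))"
    by (rule hoch_sg[OF f T])
  finally have R: "hat V f (u @ lt 2 (hat V m) v # z)
      = sg (del (u @ lt 2 (hat V m) v # z) + del v) (f ?p (map snd u @ ?x # map snd z))" by simp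
  show ?thesis
    unfolding L R sg_sg by (rule sg_cong) (simp add: del_append tdeg; auto)
qed

lemma insert_op_add:
  assumes f: "\<And>n. f n \<in> hoch_maps V W n (c n)" and m: "\<And>n. m n \<in> hoch_maps V V n (c' n)"
    and T: "us @ x # vs \<in> tensors V n" and y: "y \<in> total_space V" and rs: "r + s \<le> n"
  shows "insert_op V W f m r s (us @ (x + y) # vs) =
    insert_op V W f m r s (us @ x # vs) + insert_op V W f m r s (us @ y # vs)"
proof -
  interpret VV: graded_pair V V ..
  let ?k = "koszul V (2 - int s)"
  let ?p = "r + 1 + (n - r - s)"
  let ?F = "\<lambda>xs. f ?p (map ?k (take r xs) @ [m s (take s (drop r xs))] @ drop (r + s) xs)"
  have n: "n = length us + Suc (length vs)" and tot: "set us \<subseteq> total_space V" "set vs \<subseteq> total_space V"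
    and x: "x \<in> total_space V"
    using T by (auto simp: V.tensors_iff)
  note mt = VV.hoch_total[OF m]
  have sub: "set (take i zs) \<subseteq> total_space V" "set (drop i zs) \<subseteq> total_space V"
    if "set zs \<subseteq> total_space V" for i zs
    using that set_take_subset[of i zs] set_drop_subset[of i zs] by auto
  have kt: "set (map ?k zs) \<subseteq> total_space V" if "set zs \<subseteq> total_space V" for zs
    using that V.koszul_total by auto
  have "?F (us @ (x + y) # vs) = ?F (us @ x # vs) + ?F (us @ y # vs)"
  proof -
    \<comment> \<open>The varied argument stands before, inside or behind the inserted
      operation.\<close>
    consider "length us < r" | "r \<le> length us" "length us < r + s" | "r + s \<le> length us" by linarith
    then show ?thesis
    proof cases
      case 1
      let ?i = "r - Suc (length us)"
      have e: "take r (us @ z # vs) = us @ z # take ?i vs"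
        "drop r (us @ z # vs) = drop ?i vs" "drop (r + s) (us @ z # vs) = drop (?i + s) vs" for z
        using 1 by (simp_all add: take_Cons' drop_Cons')
      let ?vs = "map ?k (take ?i vs) @ [m s (take s (drop ?i vs))] @ drop (?i + s) vs"
      have "map ?k us @ ?k x # ?vs \<in> tensors V ?p"
        using 1 rs n kt[OF tot(1)] kt[OF sub(1)[OF tot(2)]] sub(2)[OF tot(2)] mt V.koszul_total[OF x]
        by (auto simp: tensors_def)
      from hoch_add[OF f this V.koszul_total[OF y]] show ?thesis
        unfolding e by (simp add: V.koszul_add[OF x y])
    next
      case 2
      let ?i = "r + s - Suc (length us)"
      have e: "take r (us @ z # vs) = take r us"
        "take s (drop r (us @ z # vs)) = drop r us @ z # take ?i vs" "drop (r + s) (us @ z # vs) = drop ?i vs" for z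
        using 2 by (simp_all add: take_Cons' drop_Cons' add.commute)
      have "drop r us @ x # take ?i vs \<in> tensors V s"
        using 2 rs n x sub[OF tot(1)] sub[OF tot(2)] by (auto simp: tensors_def)
      note a = VV.hoch_add[OF m this y]
      have "map ?k (take r us) @ m s (drop r us @ x # take ?i vs) # drop ?i vs \<in> tensors V ?p"
        using 2 rs n kt[OF sub(1)[OF tot(1)]] sub(2)[OF tot(2)] mt by (auto simp: tensors_def)
      from hoch_add[OF f this mt[of s "drop r us @ y # take ?i vs"]] show ?thesis
        unfolding e by (simp add: a)
    next
      case 3
      have e: "take r (us @ z # vs) = take r us"
        "take s (drop r (us @ z # vs)) = take s (drop r us)" "drop (r + s) (us @ z # vs) = drop (r + s) us @ z # vs" for z
        using 3 by simp_all
      have "(map ?k (take r us) @ m s (take s (drop r us)) # drop (r + s) us) @ x # vs \<in> tensors V ?p"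
        using 3 rs n x kt[OF sub(1)[OF tot(1)]] sub(2)[OF tot(1)] tot(2) mt by (auto simp: tensors_def)
      from hoch_add[OF f this y] show ?thesis
        unfolding e by simp
    qed
  qed
  then show ?thesis
    using n by (simp add: insert_op_def Let_def W.scale_right_distrib)
qed

lemma length_tensor_apply [simp]: "length (tensor_apply V \<phi> js xs) = length js"
  by (induction js arbitrary: xs) auto

end

text \<open>The sign collected when the blocks of \<open>tensor_apply\<close> are rewritten through
  \<open>hat\<close>: Koszul signs of the maps further right together with the suspension signs of
  the blocks.\<close>

fun tensor_sign :: "nat list \<Rightarrow> (int \<times> 'a) list \<Rightarrow> int" where
  "tensor_sign [] w = 0"
| "tensor_sign (i # js) w = (\<Sum>j\<leftarrow>js. 1 - int j) * tdeg (take i w) + del (take i w) + tensor_sign js (drop i w)"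

lemma sum_list_one_minus: "(\<Sum>j\<leftarrow>js. 1 - int j) = int (length js) - int (sum_list js)"
  by (induction js) auto

text \<open>This explains the exponent in the morphism equation: \<open>block_exponent\<close> is
  what remains of the block signs once the suspension signs of the word and of its image are taken
  off.\<close>

lemma tensor_sign_parity:
  assumes "sum_list js = length w" "0 \<notin> set js"
  shows "even (tensor_sign js w + del (blocks \<phi> js w)) = even (del w + int (block_exponent js))"
  using assms
proof (induction js arbitrary: w)
  case (Cons i js)
  define u v where "u = take i w" and "v = drop i w"
  have w: "w = u @ v" by (simp add: u_def v_def)
  have l: "length u = i" "length v = sum_list js" using Cons.prems by (simp_all add: u_def v_def)
  obtain i' where i: "i = Suc i'" using Cons.prems by (cases i) auto
  have IH: "even (tensor_sign js v + del (blocks \<phi> js v)) = even (del v + int (block_exponent js))"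
    by (rule Cons.IH) (use Cons.prems l in auto)
  have "even ((int (length js) - int (length v)) * (deg u + int i) + del u + int (length js) * (deg u + 1))
      = even (del u + int (length v) * (deg u + int i) + int (length js * i'))"
    unfolding i by (simp, argo)
  moreover have "take i w = u" "drop i w = v" by (simp_all add: u_def v_def)
  ultimately show ?case
    using IH l i by (simp add: sum_list_one_minus del_append w tdeg algebra_simps) argo
qed simp

context graded_pair
begin

lemma tensor_apply_word:
  fixes U :: "('k, 'c::ab_group_add, 'q) gspace_data_scheme"
  assumes U: "graded_space U" and \<phi>: "\<And>n. \<phi> n \<in> hoch_maps V W n (1 - int n)"
    and f: "f \<in> hoch_maps W U p q"
    and "valid V w" "sum_list js = length w" "length us + length js = p" "set us \<subseteq> total_space W"
  shows "f (us @ tensor_apply V \<phi> js (map snd w))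
    = sg (tensor_sign js w) (f (us @ map snd (blocks (hat V \<phi>) js w)))"
  using assms(4-)
proof (induction js arbitrary: us w)
  case (Cons i js)
  interpret WU: graded_pair W U using U by (simp add: graded_pair_def W.graded_space_axioms)
  define u v where "u = take i w" and "v = drop i w"
  have w: "w = u @ v" by (simp add: u_def v_def)
  have l: "length u = i" "length v = sum_list js" using Cons.prems by (simp_all add: u_def v_def)
  have val: "valid V u" "valid V v" using Cons.prems(1) by (simp_all add: w)
  let ?c = "\<Sum>j\<leftarrow>js. 1 - int j"
  let ?x = "hat V \<phi> u"
  let ?ys = "tensor_apply V \<phi> js (map snd v)"
  have x: "?x = sg (del u) (\<phi> i (map snd u))" using hat_valid[OF val(1)] l by simp
  have tot: "\<phi> j xs \<in> total_space W" for j xs by (rule hoch_total[OF \<phi>])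
  then have xt: "?x \<in> total_space W" by (simp add: x W.total_sg)
  have ys: "set (tensor_apply V \<phi> js xs) \<subseteq> total_space W" for xs
    by (induction js arbitrary: xs) (auto simp: tot)
  have k: "\<phi> i (map (koszul V ?c) (map snd u)) = sg (?c * tdeg u) (\<phi> i (map snd u))"
    using hoch_koszul[OF \<phi> val(1), of "[]" "[]" i ?c] V.valid_tensors[OF val(1)] l by simp
  also have "\<dots> = sg (?c * tdeg u + del u) ?x" unfolding x sg_sg by (rule sg_cong) simp
  finally have "f (us @ tensor_apply V \<phi> (i # js) (map snd w))
      = f (us @ sg (?c * tdeg u + del u) ?x # ?ys)"
    using l by (simp add: w)
  also have "\<dots> = sg (?c * tdeg u + del u) (f (us @ ?x # ?ys))"
    by (rule WU.hoch_sg[OF f]) (use Cons.prems xt ys in \<open>auto simp: tensors_def\<close>)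
  also have "f (us @ ?x # ?ys) = sg (tensor_sign js v) (f (us @ ?x # map snd (blocks (hat V \<phi>) js v)))"
    using Cons.IH[of v "us @ [?x]"] val l Cons.prems(3,4) xt by simp
  finally show ?case using l by (simp add: w)
qed simp

lemma tensor_apply_add:
  fixes U :: "('k, 'c::ab_group_add, 'q) gspace_data_scheme"
  assumes U: "graded_space U" and \<phi>: "\<And>n. \<phi> n \<in> hoch_maps V W n (c n)"
    and f: "f \<in> hoch_maps W U p q"
    and "us @ x # vs \<in> tensors V n" "y \<in> total_space V" "sum_list js = n"
    and "length ws + length js = p" "set ws \<subseteq> total_space W"
  shows "f (ws @ tensor_apply V \<phi> js (us @ (x + y) # vs))
    = f (ws @ tensor_apply V \<phi> js (us @ x # vs)) + f (ws @ tensor_apply V \<phi> js (us @ y # vs))"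
  using assms(4-)
proof (induction js arbitrary: us ws n)
  case Nil
  then show ?case by (auto simp: tensors_def)
next
  case (Cons i js)
  interpret WU: graded_pair W U using U by (simp add: graded_pair_def W.graded_space_axioms)
  let ?k = "koszul V (\<Sum>j\<leftarrow>js. 1 - int j)"
  have n: "n = length us + Suc (length vs)" and tot: "set us \<subseteq> total_space V" "set vs \<subseteq> total_space V"
    and x: "x \<in> total_space V"
    using Cons.prems by (auto simp: V.tensors_iff)
  have \<phi>t: "\<phi> j xs \<in> total_space W" for j xs by (rule hoch_total[OF \<phi>])
  have ys: "set (tensor_apply V \<phi> js xs) \<subseteq> total_space W" for xs
    by (induction js arbitrary: xs) (auto simp: \<phi>t)
  show ?case
  proof (cases "i \<le> length us")
    case True
    have T: "drop i us @ x # vs \<in> tensors V (n - i)"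
      using True n tot x by (auto simp: tensors_def dest: in_set_dropD)
    show ?thesis
      using Cons.IH[OF T Cons.prems(2), of "ws @ [\<phi> i (map ?k (take i us))]"] True Cons.prems(3-) \<phi>t
      by simp
  next
    case False
    let ?j = "i - Suc (length us)"
    have e: "take i (us @ z # vs) = us @ z # take ?j vs" "drop i (us @ z # vs) = drop ?j vs" for z
      using False by (simp_all add: take_Cons' drop_Cons')
    have "map ?k us @ ?k x # map ?k (take ?j vs) \<in> tensors V i"
      using False n tot V.koszul_total x Cons.prems(3) by (auto simp: tensors_def dest!: in_set_takeD)
    from hoch_add[OF \<phi> this V.koszul_total[OF Cons.prems(2)]] have a: "\<phi> i (map ?k (us @ (x + y) # take ?j vs))
        = \<phi> i (map ?k (us @ x # take ?j vs)) + \<phi> i (map ?k (us @ y # take ?j vs))"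
      using Cons.prems by (simp add: V.koszul_add[OF x])
    show ?thesis
      unfolding tensor_apply.simps e a
      by (rule WU.hoch_add[OF f]) (use Cons.prems ys \<phi>t in \<open>auto simp: tensors_def\<close>)
  qed
qed

end

section \<open>C-infinity relations and morphism equations as equations on words\<close>

lemma sh_map:
  assumes "\<And>a. fst (g a) = fst a"
  shows "sh (\<lambda>w. F (map g w)) x y = sh F (map g x) (map g y)"
proof -
  have d: "deg (map g w) = deg w" for w by (induction w) (simp_all add: assms)
  show ?thesis
  proof (induction "\<lambda>w. F (map g w)" x y arbitrary: F rule: sh.induct)
    case (3 a x b y)
    have "sh (\<lambda>w. F (map g (a # w))) x (b # y) = sh (\<lambda>w. F (g a # w)) (map g x) (map g (b # y))"
      using 3(1)[of "\<lambda>w. F (g a # w)"] by simp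
    moreover have "sh (\<lambda>w. F (map g (b # w))) (a # x) y = sh (\<lambda>w. F (g b # w)) (map g (a # x)) (map g y)"
      using 3(2)[of "\<lambda>w. F (g b # w)"] by simp
    ultimately show ?case by (simp add: assms d)
  qed auto
qed

lemma Dop_valid_cong:
  assumes "valid V w" "\<And>v. valid V v \<Longrightarrow> b v \<in> gr V (deg v + 2)" "\<And>v. valid V v \<Longrightarrow> F v = K v"
  shows "Dop b F w = Dop b K w"
  unfolding Dop_def ins_dec
  by (intro dec_cong arg_cong[of _ _ "sg _"] assms(3)) (use assms(1,2) in auto, simp add: lt_def)

context graded_pair
begin

lemma harr_hoch: "f \<in> harr_maps V W p q \<Longrightarrow> f \<in> hoch_maps V W p q"
  by (simp add: harr_maps_def)

lemma harr_shuffle: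
  assumes "f \<in> harr_maps V W p q" "valid V w" "length w = p" "0 < i" "i < p"
  shows "(\<Sum>js \<in> shuffles [0..<i] [i..<p].
      smul W (shuffle_sign (map fst w) js) (f (map (\<lambda>j. map snd w ! j) js))) = 0"
proof (rule assms(1)[unfolded harr_maps_def mem_Collect_eq, THEN conjunct2, THEN spec[of _ i],
      THEN spec[of _ "map fst w"], THEN spec[of _ "map snd w"], THEN mp])
  have "list_all2 (\<lambda>k x. x \<in> gr V k) (map fst w) (map snd w)"
    unfolding list_all2_valid using assms(2) by blast
  then show "0 < i \<and> i < p \<and> length (map fst w) = p \<and>
      list_all2 (\<lambda>k x. x \<in> gr V k) (map fst w) (map snd w)"
    using assms by simp
qed

text \<open>Only the projected letters enter, so an identity between such functions that is known on
  valid words extends to all words.\<close>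

lemma hat_map_prj: "hat V f (map (\<lambda>(k, x). (k, prj V k x)) w) = hat V f w"
proof -
  have d: "del (map (\<lambda>(k, x). (k, prj V k x)) w) = del w" by (induction w) auto
  have "map (\<lambda>(k, x). prj V k x) (map (\<lambda>(k, x). (k, prj V k x)) w) = map (\<lambda>(k, x). prj V k x) w"
    by (induction w) (auto simp: V.prj)
  then show ?thesis by (simp only: hat_def d length_map)
qed

lemma prim_hat:
  assumes "\<And>n. n \<ge> 1 \<Longrightarrow> f n \<in> harr_maps V W n (c n)" "f 0 = (\<lambda>_. 0)"
  shows "prim (hat V f)"
  unfolding prim_def
proof (intro conjI allI impI)
  show "hat V f [] = 0" by (simp add: hat_def assms(2))
  fix x y :: "(int \<times> 'a) list" assume xy: "x \<noteq> []" "y \<noteq> []"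
  let ?p = "map (\<lambda>(k, x). (k, prj V k x))"
  let ?w = "?p x @ ?p y"
  have v: "valid V ?w" using V.valid_prj by auto
  have "length ?w \<ge> 1" using xy by (cases x) auto
  then have "f (length ?w) \<in> harr_maps V W (length ?w) (c (length ?w))" by (rule assms(1))
  then have "(\<Sum>js \<in> shuffles [0..<length x] [length x..<length ?w].
      smul W (shuffle_sign (map fst ?w) js) (f (length ?w) (map (\<lambda>j. map snd ?w ! j) js))) = 0"
    by (rule harr_shuffle[OF _ v]) (use xy in auto)
  then have "sh (hat V f) (?p x) (?p y) = 0"
    using shuffle_sum_hat[OF v, of "length x" f] by simp
  moreover have "sh (\<lambda>w. hat V f (?p w)) x y = sh (hat V f) (?p x) (?p y)"
    by (rule sh_map) auto
  ultimately show "sh (hat V f) x y = 0" by (simp add: hat_map_prj)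
qed

lemma harr_mapsI:
  assumes "f n \<in> hoch_maps V W n q"
    and "\<And>x y. valid V x \<Longrightarrow> valid V y \<Longrightarrow> x \<noteq> [] \<Longrightarrow> y \<noteq> [] \<Longrightarrow> length x + length y = n
      \<Longrightarrow> sh (hat V f) x y = 0"
  shows "f n \<in> harr_maps V W n q"
  unfolding harr_maps_def list_all2_valid mem_Collect_eq
proof (intro conjI assms(1) allI impI)
  fix i ks xs
  assume *: "0 < i \<and> i < n \<and> length ks = n \<and> (\<exists>w. valid V w \<and> ks = map fst w \<and> xs = map snd w)"
  then obtain w where w: "valid V w" "ks = map fst w" "xs = map snd w" "0 < i" "i < n" "n = length w"
    by auto
  have "valid V (take i w)" "valid V (drop i w)"
    using w(1) by (metis append_take_drop_id valid_simps(3))+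
  then have "sh (hat V f) (take i w) (drop i w) = 0"
    using w by (intro assms(2)) auto
  then show "(\<Sum>js\<in>shuffles [0..<i] [i..<n]. smul W (shuffle_sign ks js) (f n (map ((!) xs) js))) = 0"
    using shuffle_sum_hat[OF w(1), of i f] w by simp
qed

lemma sum_insert_op:
  assumes f: "\<And>n. f n \<in> hoch_maps V W n (c - int n)" and m: "\<And>n. m n \<in> hoch_maps V V n (2 - int n)"
    and m0: "\<And>n. n < 2 \<Longrightarrow> m n = (\<lambda>_. 0)" and w: "valid V w"
  shows "(\<Sum>s=2..length w. \<Sum>r=0..length w - s. insert_op V W f m r s (map snd w))
    = sg (del w) (Dop (hat V m) (hat V f) w)"
proof -
  have "insert_op V W f m r s (map snd w) = sg (del w) (sg (deg (take r w))
      (hat V f (take r w @ lt 2 (hat V m) (take s (drop r w)) # drop (r + s) w)))"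
    if "r + s \<le> length w" for r s
  proof -
    define u v z where "u = take r w" and "v = take s (drop r w)" and "z = drop (r + s) w"
    have uvz: "w = u @ v @ z"
      unfolding u_def v_def z_def by (metis add.commute append_take_drop_id drop_drop)
    have l: "length u = r" "length v = s" using that by (simp_all add: u_def v_def)
    have "valid V u" "valid V v" "valid V z" using w by (simp_all add: uvz)
    from insert_op_word[OF f m this]
    show ?thesis unfolding l by (simp only: uvz[symmetric] u_def[symmetric] v_def[symmetric] z_def[symmetric])
  qed
  moreover have "hat V m w = 0" if "length w < 2" for w
    using m0[OF that] by (simp add: hat_def)
  ultimately show ?thesis
    by (subst Dop_sum[OF _ hat_mlin[OF f]]) (auto simp: sg_sum intro!: sum.cong)
qed

end

context graded_space
begin

interpretation VV: graded_pair V V ..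

lemma cinf_algebraI:
  assumes m: "\<And>n. n \<ge> 2 \<Longrightarrow> m n \<in> harr_maps V V n (2 - int n)" and m0: "\<And>n. n < 2 \<Longrightarrow> m n = (\<lambda>_. 0)"
    and D: "\<And>w. valid V w \<Longrightarrow> Dop (hat V m) (hat V m) w = 0"
  shows "cinf_algebra V m"
  unfolding cinf_algebra_def
proof (intro conjI allI impI ballI m)
  have mh: "m n \<in> hoch_maps V V n (2 - int n)" for n
    using VV.harr_hoch[OF m, of n] VV.hoch_0[of n "2 - int n"] m0[of n] by (cases "n < 2") auto
  fix n :: nat and xs assume n: "3 \<le> n" and xs: "xs \<in> tensors V n"
  let ?f = "\<lambda>xs. \<Sum>s=2..n - 1. \<Sum>r=0..n - s. insert_op V V m m r s xs"
  from xs have "?f xs \<in> {0}"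
  proof (rule tensors_induct)
    fix w :: "(int \<times> 'a) list" assume w: "valid V w" "length w = n"
    have "(\<Sum>s=2..n. \<Sum>r=0..n - s. insert_op V V m m r s (map snd w)) = 0"
      using VV.sum_insert_op[OF mh mh m0 w(1)] D[OF w(1)] w(2) by simp
    moreover have "{2..n} = insert n {2..n - 1}" using n by auto
    \<comment> \<open>The coderivation also replaces the whole word by one letter. This term applies
      \<open>m 1\<close>, which is zero, and is absent from the relations, whose sum stops at
      \<open>n - 1\<close>.\<close>
    moreover have "insert_op V V m m 0 n (map snd w) = 0"
      using w(2) m0[of 1] by (simp add: insert_op_def Let_def)
    ultimately show "?f (map snd w) \<in> {0}" using n by simp
  next
    fix us x vs y assume "us @ x # vs \<in> tensors V n" "y \<in> total_space V"
    then show "?f (us @ (x + y) # vs) = ?f (us @ x # vs) + ?f (us @ y # vs)"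
      unfolding sum.distrib[symmetric]
      by (intro sum.cong refl VV.insert_op_add[OF mh mh]) auto
  qed auto
  then show "?f xs = 0" by simp
qed

end

context graded_pair
begin

lemma sum_tensor_apply:
  assumes \<phi>: "\<And>n. \<phi> n \<in> hoch_maps V W n (1 - int n)" and m': "\<And>n. m' n \<in> hoch_maps W W n (2 - int n)"
    and m'0: "\<And>n. n < 2 \<Longrightarrow> m' n = (\<lambda>_. 0)" and w: "valid V w"
  shows "(\<Sum>js | sum_list js = length w \<and> 0 \<notin> set js \<and> 2 \<le> length js.
      smul W ((-1) ^ block_exponent js) (m' (length js) (tensor_apply V \<phi> js (map snd w))))
    = sg (del w) (Pop (hat V \<phi>) (hat W m') w)"
proof -
  interpret WW: graded_pair W W ..
  let ?T = "\<lambda>js. smul W ((-1) ^ block_exponent js) (m' (length js) (tensor_apply V \<phi> js (map snd w)))"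
  have "(\<Sum>js | sum_list js = length w \<and> 0 \<notin> set js \<and> 2 \<le> length js. ?T js)
      = (\<Sum>js\<in>comps (length w). ?T js)"
  proof (rule sum.mono_neutral_left[OF finite_comps])
    \<comment> \<open>The morphism equation omits compositions with fewer than two blocks; in the
      sum over all compositions they contribute operations \<open>m'\<close> of arity below two,
      which are zero.\<close>
    show "\<forall>js\<in>comps (length w) - {js. sum_list js = length w \<and> 0 \<notin> set js \<and> 2 \<le> length js}. ?T js = 0"
    proof
      fix js assume "js \<in> comps (length w) - {js. sum_list js = length w \<and> 0 \<notin> set js \<and> 2 \<le> length js}"
      then have "length js < 2" by (auto simp: comps_def)
      then show "?T js = 0" by (simp add: m'0)
    qed
  qed (auto simp: comps_def)
  also have "\<dots> = (\<Sum>js\<in>comps (length w). sg (del w) (hat W m' (blocks (hat V \<phi>) js w)))"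
  proof (rule sum.cong[OF refl])
    fix js assume js: "js \<in> comps (length w)"
    then have s: "sum_list js = length w" "0 \<notin> set js" by (auto simp: comps_def)
    let ?B = "blocks (hat V \<phi>) js w"
    have "valid W (blocks (hat V \<phi>) js w)" for w
      by (induction js arbitrary: w) (auto intro: hat_gr[OF \<phi>])
    then have B: "hat W m' ?B = sg (del ?B) (m' (length js) (map snd ?B))"
      by (subst WW.hat_valid) simp_all
    have "?T js = sg (int (block_exponent js) + tensor_sign js w) (m' (length js) (map snd ?B))"
      using tensor_apply_word[OF W.graded_space_axioms \<phi> m' w s(1), of "[]" "length js"]
      by (simp add: W.scale_power_sign)
    also have "\<dots> = sg (del w) (hat W m' ?B)"
      unfolding B sg_sg using tensor_sign_parity[OF s, of "hat V \<phi>"] by (intro sg_cong) (simp, argo)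
    finally show "?T js = sg (del w) (hat W m' ?B)" .
  qed
  finally show ?thesis by (simp add: Pop_def sg_sum)
qed

lemma cinf_morphismI:
  assumes \<phi>: "\<And>n. n \<ge> 1 \<Longrightarrow> \<phi> n \<in> harr_maps V W n (1 - int n)" and \<phi>0: "\<phi> 0 = (\<lambda>_. 0)"
    and m: "\<And>n. m n \<in> hoch_maps V V n (2 - int n)" and m0: "\<And>n. n < 2 \<Longrightarrow> m n = (\<lambda>_. 0)"
    and m': "\<And>n. m' n \<in> hoch_maps W W n (2 - int n)" and m'0: "\<And>n. n < 2 \<Longrightarrow> m' n = (\<lambda>_. 0)"
    and eq: "\<And>w. valid V w \<Longrightarrow> Dop (hat V m) (hat V \<phi>) w = Pop (hat V \<phi>) (hat W m') w"
  shows "cinf_morphism V m W m' \<phi>"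
  unfolding cinf_morphism_def
proof (intro conjI allI impI ballI \<phi>)
  have \<phi>h: "\<phi> n \<in> hoch_maps V W n (1 - int n)" for n
    using harr_hoch[OF \<phi>, of n] hoch_0[of n "1 - int n"] \<phi>0 by (cases "n = 0") auto
  fix n :: nat and xs assume n: "2 \<le> n" and xs: "xs \<in> tensors V n"
  let ?J = "{js. sum_list js = n \<and> 0 \<notin> set js \<and> 2 \<le> length js}"
  let ?L = "\<lambda>xs. \<Sum>s=2..n. \<Sum>r=0..n - s. insert_op V W \<phi> m r s xs"
  let ?R = "\<lambda>xs. \<Sum>js\<in>?J. smul W ((-1) ^ block_exponent js) (m' (length js) (tensor_apply V \<phi> js xs))"
  from xs have "?L xs - ?R xs \<in> {0}"
  proof (rule V.tensors_induct)
    fix w :: "(int \<times> 'a) list" assume w: "valid V w" "length w = n"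
    show "?L (map snd w) - ?R (map snd w) \<in> {0}"
      using sum_insert_op[OF \<phi>h m m0 w(1)] sum_tensor_apply[OF \<phi>h m' m'0 w(1)] eq[OF w(1)] w(2) by simp
  next
    fix us x vs y assume T: "us @ x # vs \<in> tensors V n" "y \<in> total_space V"
    have "?L (us @ (x + y) # vs) = ?L (us @ x # vs) + ?L (us @ y # vs)"
      unfolding sum.distrib[symmetric]
      by (intro sum.cong refl insert_op_add[OF \<phi>h m T]) auto
    moreover have "?R (us @ (x + y) # vs) = ?R (us @ x # vs) + ?R (us @ y # vs)"
      unfolding sum.distrib[symmetric]
    proof (rule sum.cong[OF refl])
      fix js assume "js \<in> ?J"
      then show "smul W ((-1) ^ block_exponent js) (m' (length js) (tensor_apply V \<phi> js (us @ (x + y) # vs))) =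
          smul W ((-1) ^ block_exponent js) (m' (length js) (tensor_apply V \<phi> js (us @ x # vs))) +
          smul W ((-1) ^ block_exponent js) (m' (length js) (tensor_apply V \<phi> js (us @ y # vs)))"
        using tensor_apply_add[OF W.graded_space_axioms \<phi>h m' T, of js "[]"]
        by (simp add: W.scale_right_distrib)
    qed
    ultimately show "?L (us @ (x + y) # vs) - ?R (us @ (x + y) # vs) =
        (?L (us @ x # vs) - ?R (us @ x # vs)) + (?L (us @ y # vs) - ?R (us @ y # vs))" by simp
  qed auto
  then show "?L xs = ?R xs" by simp
qed

end

section \<open>Differential graded algebras\<close>

text \<open>Extension of the product to the ambient type, so that the laws collected in
  \<open>galg\<close> hold without membership conditions; \<open>tdif\<close> does the same for the
  differential.\<close>

definition tmul :: "('k::field, 'a::ab_group_add, 'm) gca_data_scheme \<Rightarrow> 'a \<Rightarrow> 'a \<Rightarrow> 'a" where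
  "tmul B x y = gmul B (tproj B x) (tproj B y)"

definition tdif :: "('k::field, 'a::ab_group_add, 'm) dgca_data_scheme \<Rightarrow> 'a \<Rightarrow> 'a" where
  "tdif A x = dif A (tproj A x)"

context graded_space
begin

lemma total_induct [consumes 1]:
  assumes "x \<in> total_space V" "\<And>k x. x \<in> gr V k \<Longrightarrow> P x"
    "\<And>x y. x \<in> total_space V \<Longrightarrow> y \<in> total_space V \<Longrightarrow> P x \<Longrightarrow> P y \<Longrightarrow> P (x + y)"
  shows "P x"
proof -
  have "(\<Sum>k\<in>S. component V k x) \<in> total_space V \<and> P (\<Sum>k\<in>S. component V k x)" if "finite S" for S
    using that
  proof (induction S)
    case empty
    then show ?case using assms(2)[OF gr_0] by (simp add: total_0)
  next
    case (insert k S)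
    then show ?case
      using assms(2,3) component_gr[OF assms(1), of k] gr_total total_add by simp
  qed
  from this[OF finite_component[OF assms(1)]] show ?thesis by (simp add: sum_component[OF assms(1)])
qed

lemma sum_total: "(\<And>i. i \<in> S \<Longrightarrow> f i \<in> total_space V) \<Longrightarrow> sum f S \<in> total_space V"
  by (rule subspace_sum[OF total_subspace])

end

lemma (in graded_pair) graded_linear_total:
  assumes "graded_linear V W q f" "x \<in> total_space V"
  shows "f x \<in> total_space W"
  using assms(2)
proof (induction rule: V.total_induct)
  case (1 k x)
  then have "f x \<in> gr W (k + q)" using assms(1) by (simp add: graded_linear_def)
  then show ?case by (rule W.gr_total)
next
  case (2 x y)
  then show ?case using assms(1) by (auto simp: graded_linear_def intro: W.total_add)
qed

lemma (in graded_pair) component_graded_linear: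
  assumes f: "graded_linear V W q f" and x: "x \<in> total_space V"
  shows "component W (k + q) (f x) = f (component V k x)"
proof -
  have add: "f (x + y) = f x + f y" if "x \<in> total_space V" "y \<in> total_space V" for x y
    using f that by (simp add: graded_linear_def)
  have f0: "f 0 = 0" using add[OF V.total_0 V.total_0] by simp
  have sum: "f (\<Sum>k\<in>S. component V k x) = (\<Sum>k\<in>S. f (component V k x))" if "finite S" for S
    using that
  proof (induction S)
    case (insert k S)
    have "(\<Sum>k\<in>S. component V k x) \<in> total_space V"
      by (rule V.sum_total) (rule V.gr_total[OF V.component_gr[OF x]])
    then show ?case using insert add[OF V.gr_total[OF V.component_gr[OF x]]] by simp
  qed (simp add: f0)
  let ?S = "{k. component V k x \<noteq> 0}"
  have "W.decomposes (\<lambda>i. f (component V (i - q) x)) (f x)"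
  proof (rule W.decomposesI)
    show "f (component V (i - q) x) \<in> gr W i" for i
      using f V.component_gr[OF x, of "i - q"] by (force simp: graded_linear_def)
    show "finite ((\<lambda>k. k + q) ` ?S)" using V.finite_component[OF x] by simp
    show "f (component V (i - q) x) = 0" if "i \<notin> (\<lambda>k. k + q) ` ?S" for i
      using that imageI[of "i - q" ?S "\<lambda>k. k + q"] by (cases "component V (i - q) x = 0") (simp_all add: f0)
    have "(\<Sum>i\<in>(\<lambda>k. k + q) ` ?S. f (component V (i - q) x)) = (\<Sum>k\<in>?S. f (component V k x))"
      by (subst sum.reindex) (auto simp: inj_on_def)
    also have "\<dots> = f x"
      using sum[OF V.finite_component[OF x]] V.sum_component[OF x] by simp
    finally show "(\<Sum>i\<in>(\<lambda>k. k + q) ` ?S. f (component V (i - q) x)) = f x" .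
  qed
  from W.component_eq[OF this, of "k + q"] show ?thesis by simp
qed

context gca
begin

lemma gmul_total: "x \<in> total_space B \<Longrightarrow> y \<in> total_space B \<Longrightarrow> gmul B x y \<in> total_space B"
proof (induction x rule: total_induct)
  case (1 i x)
  from \<open>y \<in> total_space B\<close> 1 show ?case
  proof (induction y rule: total_induct)
    case (1 k y)
    then show ?case using mul_gr gr_total by blast
  next
    case (2 y z)
    then show ?case using gr_total by (simp add: mul_add_right total_add)
  qed
next
  case (2 x z)
  then show ?case by (simp add: mul_add_left total_add)
qed

lemma tmul_total [simp]: "x \<in> total_space B \<Longrightarrow> y \<in> total_space B \<Longrightarrow> tmul B x y = gmul B x y"
  by (simp add: tmul_def tproj)

lemma tmul_gr [simp]: "x \<in> gr B i \<Longrightarrow> y \<in> gr B j \<Longrightarrow> tmul B x y = gmul B x y"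
  by (simp add: gr_total)

end

context dgca
begin

lemma dif_gr: "x \<in> gr A k \<Longrightarrow> dif A x \<in> gr A (k + 1)"
  and dif_add: "x \<in> total_space A \<Longrightarrow> y \<in> total_space A \<Longrightarrow> dif A (x + y) = dif A x + dif A y"
  and dif_smul: "x \<in> total_space A \<Longrightarrow> dif A (smul A c x) = smul A c (dif A x)"
  using dif_linear by (auto simp: graded_linear_def)

interpretation AA: graded_pair A A ..

lemma dif_total: "x \<in> total_space A \<Longrightarrow> dif A x \<in> total_space A"
  by (rule AA.graded_linear_total[OF dif_linear])

lemma tdif_total [simp]: "x \<in> total_space A \<Longrightarrow> tdif A x = dif A x"
  by (simp add: tdif_def tproj)

lemma tdif_gr [simp]: "x \<in> gr A k \<Longrightarrow> tdif A x = dif A x"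
  by (simp add: gr_total)

lemma component_dif: "x \<in> total_space A \<Longrightarrow> component A (k + 1) (dif A x) = dif A (component A k x)"
  by (rule AA.component_graded_linear[OF dif_linear])

lemma coboundaries_gr:
  assumes "x \<in> coboundaries A" "x \<in> gr A k"
  shows "\<exists>y\<in>gr A (k - 1). x = dif A y"
proof -
  obtain y where y: "y \<in> total_space A" "x = dif A y" using assms(1) by (auto simp: coboundaries_def)
  have "x = dif A (component A (k - 1) y)"
    using component_dif[OF y(1), of "k - 1"] component_homogeneous[OF assms(2), of k] y(2) by simp
  then show ?thesis using component_gr[OF y(1)] by blast
qed

lemma coboundaries_add: "x \<in> coboundaries A \<Longrightarrow> y \<in> coboundaries A \<Longrightarrow> x + y \<in> coboundaries A"
proof -
  assume "x \<in> coboundaries A" "y \<in> coboundaries A"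
  then obtain u v where "u \<in> total_space A" "v \<in> total_space A" "x = dif A u" "y = dif A v"
    by (auto simp: coboundaries_def)
  then show ?thesis
    unfolding coboundaries_def by (intro image_eqI[of _ _ "u + v"]) (simp_all add: dif_add total_add)
qed

lemma coboundaries_minus: "x \<in> coboundaries A \<Longrightarrow> - x \<in> coboundaries A"
proof -
  assume "x \<in> coboundaries A"
  then obtain u where u: "u \<in> total_space A" "x = dif A u"
    by (auto simp: coboundaries_def)
  have "dif A (- u) = - dif A u" using dif_smul[OF u(1), of "-1"] by simp
  with u show ?thesis
    unfolding coboundaries_def by (intro image_eqI[of _ _ "- u"]) (simp_all add: total_minus)
qed

lemma coboundariesI: "x \<in> total_space A \<Longrightarrow> dif A x \<in> coboundaries A"
  by (auto simp: coboundaries_def)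

end

lemma dgca_galg:
  fixes A :: "('k::field_char_0, 'a::ab_group_add, 'm) dgca_data_scheme"
  assumes "dgca A"
  shows "galg (smul A) (gr A) (tmul A) (gone A) (tdif A)"
proof -
  interpret dgca A by (rule assms)
  note P = tproj(2)
  note add = linear_add_gen[OF tproj(1)] and sc = linear_scale_gen[OF tproj(1)]
  show ?thesis
  proof (intro galg.intro galg_axioms.intro vs gr_subspace)
    show "tmul A (x + y) z = tmul A x z + tmul A y z" "tmul A z (x + y) = tmul A z x + tmul A z y" for x y z
      by (simp_all add: tmul_def add mul_add_left mul_add_right P)
    show "tmul A (smul A c x) y = smul A c (tmul A x y)" "tmul A x (smul A c y) = smul A c (tmul A x y)" for c x y
      by (simp_all add: tmul_def sc mul_smul_left mul_smul_right P)
    show "tmul A (tmul A x y) z = tmul A x (tmul A y z)" for x y z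
      by (simp add: tmul_def tproj(3)[OF gmul_total[OF P P]] mul_assoc P)
    show "tmul A x y \<in> gr A (i + j)" if "x \<in> gr A i" "y \<in> gr A j" for x y i j
      using that by (simp add: mul_gr)
    show "tmul A x y = sg (i * j) (tmul A y x)" if "x \<in> gr A i" "y \<in> gr A j" for x y i j
      using mul_comm[OF that] that by (simp add: scale_powi_sign)
    show "tmul A (gone A) x = x" "tmul A x (gone A) = x" if "x \<in> gr A k" for x k
      using that one_gr by (simp_all add: mul_one_left mul_one_right gr_total)
    show "gone A \<in> gr A 0" by (rule one_gr)
    show "Vector_Spaces.linear (smul A) (smul A) (tdif A)"
      by (simp add: Vector_Spaces.linear_iff vs tdif_def add sc dif_add dif_smul P)
    show "tdif A x \<in> gr A (k + 1)" if "x \<in> gr A k" for x k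
      using that by (simp add: dif_gr)
    show "tdif A (tdif A x) = 0" for x
      by (simp add: tdif_def tproj(3)[OF dif_total[OF P]] dif_dif P)
    show "tdif A (tmul A x y) = tmul A (tdif A x) y + sg i (tmul A x (tdif A y))" if "x \<in> gr A i" for x y i
    proof -
      have "x \<in> total_space A" using that by (rule gr_total)
      then have "tdif A (tmul A x y) = dif A (gmul A x (tproj A y))"
        by (simp add: tmul_def tdif_def tproj(3) gmul_total P)
      also have "\<dots> = gmul A (dif A x) (tproj A y) + sg i (gmul A x (dif A (tproj A y)))"
        using leibniz[OF that P] by (simp add: scale_powi_sign)
      also have "\<dots> = tmul A (tdif A x) y + sg i (tmul A x (tdif A y))"
        using \<open>x \<in> total_space A\<close> by (simp add: tmul_def tdif_def tproj(3) dif_total P)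
      finally show ?thesis .
    qed
  qed
qed

text \<open>
  A Maurer-Cartan element representing a \<open>C\<^bsub>\<infinity>\<^esub>\<close> quasi-isomorphism from \<open>H\<close>,
  with operations \<open>b\<close>, to the DGCA \<open>C\<close>.
\<close>

definition model :: "('k::field_char_0, 'h::ab_group_add, 'm) gspace_data_scheme \<Rightarrow> ((int \<times> 'h) list \<Rightarrow> 'h)
    \<Rightarrow> ('k, 'c::ab_group_add) dgca_data \<Rightarrow> ((int \<times> 'h) list \<Rightarrow> 'c) \<Rightarrow> bool" where
  "model H b C \<tau> \<longleftrightarrow> mc_words.MC (smul C) (gr C) (tmul C) (tdif C) (smul H) b \<tau> \<and>
     (\<forall>k. \<forall>x\<in>gr H k. \<tau> [(k, x)] \<in> coboundaries C \<longrightarrow> x = 0) \<and>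
     (\<forall>k. \<forall>z\<in>gr C k. dif C z = 0 \<longrightarrow> (\<exists>x\<in>gr H k. z - \<tau> [(k, x)] \<in> coboundaries C))"

section \<open>Transport of models along zig-zags of quasi-isomorphisms\<close>

locale word_coalgebra = graded_space H
  for H :: "('k::field_char_0, 'h::ab_group_add, 'm) gspace_data_scheme" +
  fixes b :: "(int \<times> 'h) list \<Rightarrow> 'h"
  assumes b_mlin: "mlin (smul H) (smul H) b" and b_short: "length w < 2 \<Longrightarrow> b w = 0"
    and b_prim: "prim b" and b_square: "Dop b b w = 0"
begin

lemma dgca_mc_words:
  assumes "dgca C"
  shows "mc_words (smul C) (gr C) (tmul C) (gone C) (tdif C) (smul H) b"
  using dgca_galg[OF assms] vs b_mlin b_short b_prim b_square
  by (simp add: mc_words_def mc_words_axioms_def galg_words_def galg_words_axioms_def)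

lemma mc_closed:
  assumes C: "dgca C" and \<tau>: "mc_words.MC (smul C) (gr C) (tmul C) (tdif C) (smul H) b \<tau>"
  shows "\<tau> [(k, x)] \<in> gr C k" "dif C (\<tau> [(k, x)]) = 0"
proof -
  interpret C: dgca C by (rule C)
  interpret mc_words "smul C" "gr C" "tmul C" "gone C" "tdif C" "smul H" b
    by (rule dgca_mc_words[OF C])
  have h: "hom 1 \<tau>" and p: "prim \<tau>" and c: "curv \<tau> [(k, x)] = 0" using \<tau> by (auto simp: MC_def)
  show g: "\<tau> [(k, x)] \<in> gr C k" using hom_G[OF h, of "[(k, x)]"] by simp
  have "Dop b \<tau> [(k, x)] = 0" by (rule Dop_short[OF hom_mlin[OF h]]) simp
  moreover have "cv 1 \<tau> \<tau> [(k, x)] = 0" by (rule cv_short) (simp_all add: prim_Nil[OF p])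
  ultimately show "dif C (\<tau> [(k, x)]) = 0" using c g by (simp add: curv_eq)
qed

text \<open>The definition of a quasi-isomorphism speaks of inhomogeneous cocycles. Taking
  components of a fixed degree commutes with \<open>f\<close> and shifts along the differentials,
  which yields the degreewise conditions on preimages.\<close>

lemma quasi_iso_mc:
  assumes f: "quasi_iso A B f"
  shows "mc_quasi_iso (smul B) (gr B) (tmul B) (gone B) (tdif B)
    (smul A) (gr A) (tmul A) (gone A) (tdif A) (smul H) b (\<lambda>x. f (tproj A x))"
proof -
  have dA: "dgca A" and dB: "dgca B" and lin: "graded_linear A B 0 f"
    and mul: "\<And>x y. x \<in> total_space A \<Longrightarrow> y \<in> total_space A \<Longrightarrow> f (gmul A x y) = gmul B (f x) (f y)"
    and dif: "\<And>x. x \<in> total_space A \<Longrightarrow> f (dif A x) = dif B (f x)"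
    and inj: "\<And>x. x \<in> cocycles A \<Longrightarrow> f x \<in> coboundaries B \<Longrightarrow> x \<in> coboundaries A"
    and surj: "\<And>y. y \<in> cocycles B \<Longrightarrow> \<exists>x\<in>cocycles A. y - f x \<in> coboundaries B"
    using f by (auto simp: quasi_iso_def)
  interpret A: dgca A by (rule dA)
  interpret B: dgca B by (rule dB)
  interpret AB: graded_pair A B ..
  have fgr: "f x \<in> gr B k" if "x \<in> gr A k" for x k
    using lin that by (force simp: graded_linear_def)
  have ftot: "f x \<in> total_space B" if "x \<in> total_space A" for x
    by (rule AB.graded_linear_total[OF lin that])
  have fg: "f (tproj A x) = f x" if "x \<in> gr A k" for x k
    using that by (simp add: A.tproj A.gr_total)
  show ?thesis
  proof (intro mc_quasi_iso.intro mc_map.intro mc_quasi_iso_axioms.intro mc_map_axioms.intro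
      dgca_mc_words dA dB)
    show "Vector_Spaces.linear (smul A) (smul B) (\<lambda>x. f (tproj A x))"
      using lin by (simp add: Vector_Spaces.linear_iff A.vs B.vs graded_linear_def A.tproj(2)
        linear_add_gen[OF A.tproj(1)] linear_scale_gen[OF A.tproj(1)])
    show "f (tproj A x) \<in> gr B k" if "x \<in> gr A k" for x k
      using that by (simp add: fg fgr)
    show "f (tproj A (tmul A x y)) = tmul B (f (tproj A x)) (f (tproj A y))"
      if "x \<in> gr A i" "y \<in> gr A j" for x y i j
      using that fg[OF A.mul_gr[OF that]] by (simp add: fg mul A.gr_total B.gr_total[OF fgr])
    show "f (tproj A (tdif A x)) = tdif B (f (tproj A x))" if "x \<in> gr A k" for x k
      using that fg[OF A.dif_gr[OF that]] by (simp add: fg dif A.gr_total B.gr_total[OF fgr])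
    show "\<exists>y\<in>gr A (k - 1). x = tdif A y"
      if "x \<in> gr A k" "tdif A x = 0" "z \<in> gr B (k - 1)" "f (tproj A x) = tdif B z" for x k z
    proof -
      have "x \<in> cocycles A" using that(1,2) by (simp add: cocycles_def A.gr_total)
      moreover have "f x \<in> coboundaries B"
        using that(3,4) fg[OF that(1)] B.coboundariesI[OF B.gr_total[OF that(3)]] by simp
      ultimately have "x \<in> coboundaries A" by (rule inj)
      from A.coboundaries_gr[OF this that(1)] obtain y where "y \<in> gr A (k - 1)" "x = dif A y" ..
      then show ?thesis by (intro bexI[of _ y]) simp_all
    qed
    show "\<exists>x\<in>gr A k. \<exists>z\<in>gr B (k - 1). tdif A x = 0 \<and> y = f (tproj A x) + tdif B z"
      if "y \<in> gr B k" "tdif B y = 0" for y k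
    proof -
      have "y \<in> cocycles B" using that by (simp add: cocycles_def B.gr_total)
      then obtain x where x: "x \<in> cocycles A" "y - f x \<in> coboundaries B" using surj by blast
      then obtain z where z: "z \<in> total_space B" "y - f x = dif B z" by (auto simp: coboundaries_def)
      have xt: "x \<in> total_space A" and dx: "dif A x = 0" using x(1) by (auto simp: cocycles_def)
      let ?x = "component A k x" and ?z = "component B (k - 1) z"
      have xg: "?x \<in> gr A k" and zg: "?z \<in> gr B (k - 1)"
        by (rule A.component_gr[OF xt], rule B.component_gr[OF z(1)])
      have "y = f x + dif B z" using z(2) by (simp add: algebra_simps)
      then have "component B k y = component B k (f x) + component B k (dif B z)"
        by (simp add: B.component_add ftot xt B.dif_total z(1))
      also have "component B k (f x) = f ?x"
        using AB.component_graded_linear[OF lin xt, of k] by simp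
      also have "component B k (dif B z) = dif B ?z"
        using B.component_dif[OF z(1), of "k - 1"] by simp
      finally have y: "y = f ?x + dif B ?z" using B.component_homogeneous[OF that(1), of k] by simp
      have "dif A ?x = component A (k + 1) (dif A x)" by (rule A.component_dif[OF xt, symmetric])
      also have "\<dots> = 0" by (simp add: dx A.component_homogeneous[OF A.gr_0[of k]])
      finally have "dif A ?x = 0" .
      then show ?thesis using xg zg y fg[OF xg] by (intro bexI[of _ ?x] bexI[of _ ?z]) simp_all
    qed
  qed
qed

lemma model_push:
  assumes f: "quasi_iso A B f" and \<tau>: "model H b A \<tau>"
  shows "\<exists>\<tau>'. model H b B \<tau>'"
proof -
  interpret q: mc_quasi_iso "smul B" "gr B" "tmul B" "gone B" "tdif B"
    "smul A" "gr A" "tmul A" "gone A" "tdif A" "smul H" b "\<lambda>x. f (tproj A x)"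
    by (rule quasi_iso_mc[OF f])
  interpret A: dgca A using f by (simp add: quasi_iso_def)
  interpret B: dgca B using f by (simp add: quasi_iso_def)
  have MC: "q.B.MC \<tau>" using \<tau> by (simp add: model_def)
  note \<tau>1 = mc_closed[OF A.dgca_axioms MC]
  have inj: "\<And>x. x \<in> cocycles A \<Longrightarrow> f x \<in> coboundaries B \<Longrightarrow> x \<in> coboundaries A"
    and dif: "\<And>x. x \<in> total_space A \<Longrightarrow> f (dif A x) = dif B (f x)"
    and lin: "graded_linear A B 0 f"
    using f by (auto simp: quasi_iso_def)
  have fg: "f (tproj A x) = f x" if "x \<in> gr A k" for x k
    using that by (simp add: A.tproj A.gr_total)
  have fgr: "f x \<in> gr B k" if "x \<in> gr A k" for x k
    using lin that by (force simp: graded_linear_def)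
  have "model H b B (\<lambda>w. f (tproj A (\<tau> w)))"
    unfolding model_def
  proof (intro conjI allI ballI impI)
    show "q.A.MC (\<lambda>w. f (tproj A (\<tau> w)))" by (rule q.MC_g[OF MC])
    fix k x assume x: "x \<in> gr H k" "f (tproj A (\<tau> [(k, x)])) \<in> coboundaries B"
    have "\<tau> [(k, x)] \<in> cocycles A" using \<tau>1[of k x] by (simp add: cocycles_def A.gr_total)
    then have "\<tau> [(k, x)] \<in> coboundaries A" using inj x(2) fg[OF \<tau>1(1)[of k x]] by simp
    then show "x = 0" using \<tau> x(1) by (auto simp: model_def)
  next
    fix k z assume z: "z \<in> gr B k" "dif B z = 0"
    then obtain x' z' where x': "x' \<in> gr A k" "z' \<in> gr B (k - 1)" "tdif A x' = 0"
      "z = f (tproj A x') + tdif B z'" using q.g_surj[of z k] by auto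
    then have "dif A x' = 0" by simp
    then obtain x where x: "x \<in> gr H k" "x' - \<tau> [(k, x)] \<in> coboundaries A"
      using \<tau> x'(1) unfolding model_def by blast
    then obtain y where y: "y \<in> total_space A" "x' - \<tau> [(k, x)] = dif A y" by (auto simp: coboundaries_def)
    have "f (tproj A (x' - \<tau> [(k, x)])) = f (tproj A x') - f (tproj A (\<tau> [(k, x)]))"
      by (rule q.g_diff)
    moreover have "f (tproj A (x' - \<tau> [(k, x)])) = dif B (f y)"
      using y by (simp add: A.tproj(3) A.dif_total dif)
    ultimately have "z - f (tproj A (\<tau> [(k, x)])) = dif B (f y) + dif B z'"
      using x'(2,4) by simp
    moreover interpret AB: graded_pair A B ..
    have "f y \<in> total_space B" by (rule AB.graded_linear_total[OF lin y(1)])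
    ultimately have "z - f (tproj A (\<tau> [(k, x)])) \<in> coboundaries B"
      using B.gr_total[OF x'(2)] by (simp add: B.coboundaries_add B.coboundariesI)
    then show "\<exists>x\<in>gr H k. z - f (tproj A (\<tau> [(k, x)])) \<in> coboundaries B" using x(1) by blast
  qed
  then show ?thesis by - (rule exI)
qed

text \<open>The lift reproduces \<alpha> only up to gauge, but on single letters the discrepancy is
  a coboundary. Hence the induced map on cohomology is unchanged, and both conditions of
  \<open>model\<close> pass through the isomorphism induced by \<open>f\<close>.\<close>

lemma model_lift:
  assumes f: "quasi_iso A B f" and \<alpha>: "model H b B \<alpha>"
  shows "\<exists>\<beta>. model H b A \<beta>"
proof -
  interpret q: mc_quasi_iso "smul B" "gr B" "tmul B" "gone B" "tdif B"
    "smul A" "gr A" "tmul A" "gone A" "tdif A" "smul H" b "\<lambda>x. f (tproj A x)"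
    by (rule quasi_iso_mc[OF f])
  interpret A: dgca A using f by (simp add: quasi_iso_def)
  interpret B: dgca B using f by (simp add: quasi_iso_def)
  interpret AB: graded_pair A B ..
  have inj: "\<And>x. x \<in> cocycles A \<Longrightarrow> f x \<in> coboundaries B \<Longrightarrow> x \<in> coboundaries A"
    and dif: "\<And>x. x \<in> total_space A \<Longrightarrow> f (dif A x) = dif B (f x)"
    and lin: "graded_linear A B 0 f"
    using f by (auto simp: quasi_iso_def)
  have ftot: "f x \<in> total_space B" if "x \<in> total_space A" for x
    by (rule AB.graded_linear_total[OF lin that])
  have "q.A.MC \<alpha>" using \<alpha> by (simp add: model_def)
  then obtain \<beta> where \<beta>: "q.B.MC \<beta>"
    and rel: "\<And>a. \<exists>z\<in>gr B (fst a - 1). \<alpha> [a] = f (tproj A (\<beta> [a])) + tdif B z"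
    by (rule q.MC_lift) blast
  note \<beta>1 = mc_closed[OF A.dgca_axioms \<beta>]
  have cob: "\<alpha> [a] - f (\<beta> [a]) \<in> coboundaries B" for a
  proof -
    obtain z where z: "z \<in> gr B (fst a - 1)" "\<alpha> [a] = f (tproj A (\<beta> [a])) + tdif B z"
      using rel[of a] by blast
    have "\<beta> [a] \<in> total_space A" using \<beta>1(1)[of "fst a" "snd a"] by (simp add: A.gr_total)
    with z show ?thesis by (simp add: A.tproj(3) B.coboundariesI B.gr_total)
  qed
  have "model H b A \<beta>"
    unfolding model_def
  proof (intro conjI allI ballI impI \<beta>)
    fix k x assume x: "x \<in> gr H k" "\<beta> [(k, x)] \<in> coboundaries A"
    then obtain y where y: "y \<in> total_space A" "\<beta> [(k, x)] = dif A y" by (auto simp: coboundaries_def)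
    then have "f (\<beta> [(k, x)]) \<in> coboundaries B" by (simp add: dif B.coboundariesI ftot)
    then have "\<alpha> [(k, x)] \<in> coboundaries B" using B.coboundaries_add[OF cob[of "(k, x)"]] by fastforce
    then show "x = 0" using \<alpha> x(1) by (auto simp: model_def)
  next
    fix k z assume z: "z \<in> gr A k" "dif A z = 0"
    have zt: "z \<in> total_space A" by (rule A.gr_total[OF z(1)])
    have "f z \<in> gr B k" using lin z(1) by (force simp: graded_linear_def)
    moreover have "dif B (f z) = 0"
    proof -
      have "f 0 = 0" using q.g_0 by (simp add: A.tproj(3) A.total_0)
      then show ?thesis using dif[OF zt] z(2) by simp
    qed
    ultimately obtain x where x: "x \<in> gr H k" "f z - \<alpha> [(k, x)] \<in> coboundaries B"
      using \<alpha> unfolding model_def by blast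
    have \<beta>t: "\<beta> [(k, x)] \<in> total_space A" by (rule A.gr_total[OF \<beta>1(1)])
    have "f (tproj A (z - \<beta> [(k, x)])) = f (tproj A z) - f (tproj A (\<beta> [(k, x)]))" by (rule q.g_diff)
    then have "f (z - \<beta> [(k, x)]) = (f z - \<alpha> [(k, x)]) + (\<alpha> [(k, x)] - f (\<beta> [(k, x)]))"
      using zt \<beta>t by (simp add: A.tproj(3) A.total_diff)
    also have "\<dots> \<in> coboundaries B"
      by (rule B.coboundaries_add[OF x(2) cob])
    finally have "f (z - \<beta> [(k, x)]) \<in> coboundaries B" .
    moreover have "z - \<beta> [(k, x)] \<in> cocycles A"
    proof -
      have "dif A (z - \<beta> [(k, x)]) = tdif A (z - \<beta> [(k, x)])" using zt \<beta>t by (simp add: A.total_diff)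
      also have "\<dots> = tdif A z - tdif A (\<beta> [(k, x)])" by (rule q.B.d_diff)
      also have "\<dots> = 0" using z zt \<beta>t \<beta>1(2) by simp
      finally show ?thesis using zt \<beta>t by (simp add: cocycles_def A.total_diff)
    qed
    ultimately show "\<exists>x\<in>gr H k. z - \<beta> [(k, x)] \<in> coboundaries A" using inj x(1) by blast
  qed
  then show ?thesis by - (rule exI)
qed

lemma model_link: "qi_link A B \<Longrightarrow> (\<exists>\<tau>. model H b A \<tau>) \<Longrightarrow> (\<exists>\<tau>. model H b B \<tau>)"
  unfolding qi_link_def using model_push model_lift by blast

lemma model_links: "qi_link\<^sup>*\<^sup>* A B \<Longrightarrow> (\<exists>\<tau>. model H b A \<tau>) \<Longrightarrow> (\<exists>\<tau>. model H b B \<tau>)"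
  by (induction rule: rtranclp_induct) (auto intro: model_link)

end

section \<open>Sums, composites and products of multilinear maps\<close>

context graded_pair
begin

lemma hoch_sum:
  "(\<And>i. i \<in> S \<Longrightarrow> f i \<in> hoch_maps V W p q) \<Longrightarrow> (\<lambda>xs. \<Sum>i\<in>S. f i xs) \<in> hoch_maps V W p q"
proof (induction S rule: infinite_finite_induct)
  case (insert i S)
  then have i: "f i \<in> hoch_maps V W p q" and S: "(\<lambda>xs. \<Sum>i\<in>S. f i xs) \<in> hoch_maps V W p q" by auto
  have "(\<lambda>xs. f i xs + (\<Sum>i\<in>S. f i xs)) \<in> hoch_maps V W p q"
  proof (rule hoch_mapsI)
    show "f i xs + (\<Sum>i\<in>S. f i xs) = 0" if "xs \<notin> tensors V p" for xs
      using hoch_zero[OF i that] hoch_zero[OF S that] by simp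
    show "f i (us @ (x + y) # vs) + (\<Sum>i\<in>S. f i (us @ (x + y) # vs)) =
        f i (us @ x # vs) + (\<Sum>i\<in>S. f i (us @ x # vs)) + (f i (us @ y # vs) + (\<Sum>i\<in>S. f i (us @ y # vs)))"
      if "us @ x # vs \<in> tensors V p" "y \<in> total_space V" for us x y vs
      using hoch_add[OF i that] hoch_add[OF S that] by simp
    show "f i (us @ smul V c x # vs) + (\<Sum>i\<in>S. f i (us @ smul V c x # vs)) =
        smul W c (f i (us @ x # vs) + (\<Sum>i\<in>S. f i (us @ x # vs)))"
      if "us @ x # vs \<in> tensors V p" for us x c vs
      using hoch_scale[OF i that] hoch_scale[OF S that] by (simp add: W.scale_right_distrib)
    show "f i (map snd w) + (\<Sum>i\<in>S. f i (map snd w)) \<in> gr W (tdeg w + q)"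
      if "valid V w" "length w = p" for w
      using hoch_gr[OF i that refl] hoch_gr[OF S that refl] by (rule W.gr_add)
  qed
  then show ?case using insert by simp
qed (auto intro: hoch_0)

lemma hoch_comp:
  fixes U :: "('k, 'c::ab_group_add, 'q) gspace_data_scheme"
  assumes f: "f \<in> hoch_maps V W p q" and g: "graded_linear W U q' g" "g 0 = 0"
  shows "(\<lambda>xs. g (f xs)) \<in> hoch_maps V U p (q + q')"
proof -
  note t = hoch_total[OF f]
  show ?thesis
    unfolding hoch_maps_def mem_Collect_eq
  proof (intro conjI allI impI ballI)
    show "g (f xs) = 0" if "xs \<notin> tensors V p" for xs using hoch_zero[OF f that] g(2) by simp
  next
    fix xs i x y assume "xs \<in> tensors V p" "i < p" "x \<in> total_space V" "y \<in> total_space V"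
    then have "f (xs[i := x + y]) = f (xs[i := x]) + f (xs[i := y])"
      using f by (simp add: hoch_maps_def)
    then show "g (f (xs[i := x + y])) = g (f (xs[i := x])) + g (f (xs[i := y]))"
      using g(1) t by (simp add: graded_linear_def)
  next
    fix xs i c x assume "xs \<in> tensors V p" "i < p" "x \<in> total_space V"
    then have "f (xs[i := smul V c x]) = smul W c (f (xs[i := x]))"
      using f by (simp add: hoch_maps_def)
    then show "g (f (xs[i := smul V c x])) = smul U c (g (f (xs[i := x])))"
      using g(1) t by (simp add: graded_linear_def)
  next
    fix ks xs assume "length ks = p \<and> list_all2 (\<lambda>k x. x \<in> gr V k) ks xs"
    then have "f xs \<in> gr W (sum_list ks + q)" using f by (simp add: hoch_maps_def)
    then have "g (f xs) \<in> gr U (sum_list ks + q + q')" using g(1) by (simp add: graded_linear_def)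
    then show "g (f xs) \<in> gr U (sum_list ks + (q + q'))" by (simp add: add.assoc)
  qed
qed

lemma hoch_sg_fun:
  assumes "f \<in> hoch_maps V W p q" shows "(\<lambda>xs. sg n (f xs)) \<in> hoch_maps V W p q"
proof -
  have "graded_linear W W 0 (sg n)"
    by (simp add: graded_linear_def sg_add W.smul_sg W.gr_sg)
  from hoch_comp[OF assms this] show ?thesis by simp
qed

end

locale graded_pair_gca = graded_pair V W + W: gca W
  for V :: "('k::field, 'a::ab_group_add, 'm) gspace_data_scheme"
    and W :: "('k, 'b::ab_group_add, 'n) gca_data_scheme"
begin

lemma hoch_mul:
  assumes f: "f \<in> hoch_maps V W p q" and g: "g \<in> hoch_maps V W p' q'"
    and r: "r = p + p'" "e = q + q'"
  shows "on_tensors V r (\<lambda>xs. gmul W (f (map (koszul V c) (take p xs))) (g (drop p xs))) \<in> hoch_maps V W r e"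
proof -
  let ?F = "\<lambda>xs. gmul W (f (map (koszul V c) (take p xs))) (g (drop p xs))"
  note ft = hoch_total[OF f] and gt = hoch_total[OF g]
  \<comment> \<open>The varied argument belongs to the second or to the first factor. Either way the
    expression is linear in a single slot of a single factor, which serves additivity and scaling
    alike.\<close>
  have split: "(\<exists>us'. length us = p + length us' \<and> us' = drop p us \<and>
        (\<forall>z. ?F (us @ z # vs) = gmul W (f (map (koszul V c) (take p us))) (g (us' @ z # vs))) \<and>
        us' @ x # vs \<in> tensors V p') \<or>
      (\<exists>us' vs'. (\<forall>z. ?F (us @ z # vs) = gmul W (f (us' @ koszul V c z # vs')) (g (drop (p - Suc (length us)) vs))) \<and>
        us' @ koszul V c x # vs' \<in> tensors V p)"
    if T: "us @ x # vs \<in> tensors V r" for us x vs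
  proof (cases "p \<le> length us")
    case True
    then show ?thesis using T r by (intro disjI1 exI[of _ "drop p us"]) (auto simp: V.tensors_iff dest: in_set_dropD)
  next
    case False
    let ?i = "p - Suc (length us)"
    have e: "take p (us @ z # vs) = us @ z # take ?i vs" "drop p (us @ z # vs) = drop ?i vs" for z
      using False by (simp_all add: take_Cons' drop_Cons')
    show ?thesis
      unfolding e using False T r
      by (intro disjI2 exI[of _ "map (koszul V c) us"] exI[of _ "map (koszul V c) (take ?i vs)"])
        (auto simp: V.tensors_iff intro!: V.koszul_total dest: in_set_takeD)
  qed
  have in_r: "us @ z # vs \<in> tensors V r" if "us @ x # vs \<in> tensors V r" "z \<in> total_space V" for us x z vs
    using that by (auto simp: V.tensors_iff)
  show ?thesis
  proof (rule hoch_mapsI)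
    show "on_tensors V r ?F xs = 0" if "xs \<notin> tensors V r" for xs using that by (simp add: on_tensors_def)
  next
    fix us x y vs assume T: "us @ x # vs \<in> tensors V r" and y: "y \<in> total_space V"
    have x: "x \<in> total_space V" using T by (auto simp: V.tensors_iff)
    have "?F (us @ (x + y) # vs) = ?F (us @ x # vs) + ?F (us @ y # vs)"
      using split[OF T]
    proof (elim disjE exE conjE)
      fix us' assume "\<forall>z. ?F (us @ z # vs) = gmul W (f (map (koszul V c) (take p us))) (g (us' @ z # vs))"
        "us' @ x # vs \<in> tensors V p'"
      then show ?thesis by (simp only: hoch_add[OF g _ y] W.mul_add_right[OF ft gt gt])
    next
      fix us' vs' assume *: "\<forall>z. ?F (us @ z # vs) = gmul W (f (us' @ koszul V c z # vs')) (g (drop (p - Suc (length us)) vs))"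
        "us' @ koszul V c x # vs' \<in> tensors V p"
      show ?thesis
        by (simp only: *(1) V.koszul_add[OF x y] hoch_add[OF f *(2) V.koszul_total[OF y]] W.mul_add_left[OF ft ft gt])
    qed
    then show "on_tensors V r ?F (us @ (x + y) # vs) = on_tensors V r ?F (us @ x # vs) + on_tensors V r ?F (us @ y # vs)"
      using in_r[OF T] T x y by (simp add: on_tensors_def V.total_add)
  next
    fix us x a vs assume T: "us @ x # vs \<in> tensors V r"
    have x: "x \<in> total_space V" using T by (auto simp: V.tensors_iff)
    have "?F (us @ smul V a x # vs) = smul W a (?F (us @ x # vs))"
      using split[OF T]
    proof (elim disjE exE conjE)
      fix us' assume "\<forall>z. ?F (us @ z # vs) = gmul W (f (map (koszul V c) (take p us))) (g (us' @ z # vs))"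
        "us' @ x # vs \<in> tensors V p'"
      then show ?thesis by (simp only: hoch_scale[OF g] W.mul_smul_right[OF ft gt])
    next
      fix us' vs' assume *: "\<forall>z. ?F (us @ z # vs) = gmul W (f (us' @ koszul V c z # vs')) (g (drop (p - Suc (length us)) vs))"
        "us' @ koszul V c x # vs' \<in> tensors V p"
      show ?thesis
        by (simp only: *(1) V.koszul_smul[OF x] hoch_scale[OF f *(2)] W.mul_smul_left[OF ft gt])
    qed
    then show "on_tensors V r ?F (us @ smul V a x # vs) = smul W a (on_tensors V r ?F (us @ x # vs))"
      using in_r[OF T V.total_smul[OF x]] T by (simp add: on_tensors_def)
  next
    fix w :: "(int \<times> 'a) list" assume w: "valid V w" "length w = r"
    define u v where "u = take p w" and "v = drop p w"
    have uv: "w = u @ v" "length u = p" "length v = p'" using w r by (auto simp: u_def v_def)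
    then have val: "valid V u" "valid V v" using w by simp_all
    have "?F (map snd w) = gmul W (sg (c * tdeg u) (f (map snd u))) (g (map snd v))"
      using hoch_koszul[OF f val(1), of "[]" "[]" c] V.valid_tensors[OF val(1)] uv by simp
    moreover have "\<dots> \<in> gr W ((tdeg u + q) + (tdeg v + q'))"
      using uv val by (intro W.mul_gr W.gr_sg hoch_gr[OF f] hoch_gr[OF g]) auto
    ultimately show "on_tensors V r ?F (map snd w) \<in> gr W (tdeg w + e)"
      using V.valid_tensors[OF w(1), of r] w(2) r by (simp add: on_tensors_def uv(1) algebra_simps)
  qed
qed

end

section \<open>The transferred operations\<close>

text \<open>The condition \<open>h_one\<close> makes the unit harmonic, so that
  \<open>\<iota>\<close> preserves units and trees with a unit among their leaves can be
  evaluated.\<close>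

locale hodge_dgca = cohomology A H cls
  for A :: "('k::field_char_0, 'a::ab_group_add) dgca_data"
    and H :: "('k, 'h::ab_group_add) gca_data" and cls :: "'a \<Rightarrow> 'h" +
  fixes h :: "'a \<Rightarrow> 'a"
  assumes h_linear: "graded_linear A A (-1) h"
    and h_h: "x \<in> total_space A \<Longrightarrow> h (h x) = 0"
    and h_d_h: "x \<in> total_space A \<Longrightarrow> h (dif A (h x)) = h x"
    and d_h_d: "x \<in> total_space A \<Longrightarrow> dif A (h (dif A x)) = dif A x"
    and h_one: "h (gone A) = 0"
begin

sublocale AA: graded_pair A A ..
sublocale HA: graded_pair_gca H A ..
sublocale HH: graded_pair_gca H H ..

abbreviation "\<pi> \<equiv> harm_proj A h"
abbreviation "\<iota> \<equiv> harm_rep A cls h"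

lemma h_total: "x \<in> total_space A \<Longrightarrow> h x \<in> total_space A"
  by (rule AA.graded_linear_total[OF h_linear])

lemma h_add: "x \<in> total_space A \<Longrightarrow> y \<in> total_space A \<Longrightarrow> h (x + y) = h x + h y"
  and h_smul: "x \<in> total_space A \<Longrightarrow> h (smul A c x) = smul A c (h x)"
  and h_gr: "x \<in> gr A k \<Longrightarrow> h x \<in> gr A (k - 1)"
  using h_linear by (auto simp: graded_linear_def)

lemma h_0 [simp]: "h 0 = 0"
  using h_add[OF total_0 total_0] by simp

lemma d_0 [simp]: "dif A 0 = 0"
  using dif_add[OF total_0 total_0] by simp

lemma h_minus: "x \<in> total_space A \<Longrightarrow> h (- x) = - h x"
  using h_smul[of x "-1"] by simp

lemma d_minus: "x \<in> total_space A \<Longrightarrow> dif A (- x) = - dif A x"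
  using dif_smul[of x "-1"] by simp

lemma h_diff: "x \<in> total_space A \<Longrightarrow> y \<in> total_space A \<Longrightarrow> h (x - y) = h x - h y"
  using h_add[of x "- y"] by (simp add: h_minus total_minus)

lemma d_diff: "x \<in> total_space A \<Longrightarrow> y \<in> total_space A \<Longrightarrow> dif A (x - y) = dif A x - dif A y"
  using dif_add[of x "- y"] by (simp add: d_minus total_minus)

lemma \<pi>_linear: "graded_linear A A 0 \<pi>"
proof -
  have "\<pi> x \<in> gr A k" if "x \<in> gr A k" for x k
    using dif_gr[OF h_gr[OF that]] h_gr[OF dif_gr[OF that]] that by (simp add: harm_proj_def gr_add gr_diff)
  then show ?thesis
    by (auto simp: graded_linear_def harm_proj_def h_add h_smul dif_add dif_smul h_total dif_total
      scale_right_distrib scale_right_diff_distrib algebra_simps)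
qed

lemma \<pi>_0 [simp]: "\<pi> 0 = 0"
  by (simp add: harm_proj_def)

lemma \<pi>_total: "x \<in> total_space A \<Longrightarrow> \<pi> x \<in> total_space A"
  by (rule AA.graded_linear_total[OF \<pi>_linear])

lemma d_\<pi>: "x \<in> total_space A \<Longrightarrow> dif A (\<pi> x) = 0"
  by (simp add: harm_proj_def d_diff dif_add h_total dif_total total_add dif_dif d_h_d)

lemma h_\<pi>: "x \<in> total_space A \<Longrightarrow> h (\<pi> x) = 0"
  by (simp add: harm_proj_def h_diff h_add h_total dif_total total_add h_h h_d_h)

lemma \<pi>_h: "x \<in> total_space A \<Longrightarrow> \<pi> (h x) = 0"
  by (simp add: harm_proj_def h_h h_d_h)

lemma \<pi>_cocycle: "x \<in> total_space A \<Longrightarrow> \<pi> x \<in> cocycles A"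
  by (simp add: cocycles_def \<pi>_total d_\<pi>)

lemma \<pi>_harmonic: "x \<in> total_space A \<Longrightarrow> \<pi> x \<in> harmonic A h"
  by (simp add: harmonic_def)

lemma harmonicD: "x \<in> harmonic A h \<Longrightarrow> x \<in> total_space A \<and> dif A x = 0 \<and> h x = 0 \<and> \<pi> x = x"
  by (auto simp: harmonic_def \<pi>_total d_\<pi> h_\<pi>) (simp add: harm_proj_def[of A h "\<pi> _"] d_\<pi> h_\<pi>)

lemma harmonic_add: "x \<in> harmonic A h \<Longrightarrow> y \<in> harmonic A h \<Longrightarrow> x + y \<in> harmonic A h"
  and harmonic_smul: "x \<in> harmonic A h \<Longrightarrow> smul A c x \<in> harmonic A h"
proof -
  assume x: "x \<in> harmonic A h"
  have "\<pi> (smul A c x) = smul A c x" using \<pi>_linear harmonicD[OF x] by (simp add: graded_linear_def)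
  then show "smul A c x \<in> harmonic A h" using harmonicD[OF x] by (metis \<pi>_harmonic total_smul)
  assume y: "y \<in> harmonic A h"
  have "\<pi> (x + y) = x + y" using \<pi>_linear harmonicD[OF x] harmonicD[OF y] by (simp add: graded_linear_def)
  then show "x + y \<in> harmonic A h" using harmonicD[OF x] harmonicD[OF y] by (metis \<pi>_harmonic total_add)
qed

lemma harmonic_cocycle: "x \<in> harmonic A h \<Longrightarrow> x \<in> cocycles A"
  using harmonicD[of x] by (simp add: cocycles_def)

lemma cocycles_add: "x \<in> cocycles A \<Longrightarrow> y \<in> cocycles A \<Longrightarrow> x + y \<in> cocycles A"
  and cocycles_minus: "x \<in> cocycles A \<Longrightarrow> - x \<in> cocycles A"
  and cocycles_diff: "x \<in> cocycles A \<Longrightarrow> y \<in> cocycles A \<Longrightarrow> x - y \<in> cocycles A"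
  by (simp_all add: cocycles_def dif_add d_minus d_diff total_add total_minus total_diff)

lemma cls_minus: "x \<in> cocycles A \<Longrightarrow> cls (- x) = - cls x"
  using cls_smul[of x "-1"] by simp

lemma cls_diff: "x \<in> cocycles A \<Longrightarrow> y \<in> cocycles A \<Longrightarrow> cls (x - y) = cls x - cls y"
  using cls_add[of x "- y"] by (simp add: cocycles_minus cls_minus)

lemma cls_0 [simp]: "cls 0 = 0"
proof -
  have "0 \<in> cocycles A" by (simp add: cocycles_def total_0)
  then show ?thesis using cls_add[of 0 0] by simp
qed

lemma cls_total: "x \<in> cocycles A \<Longrightarrow> cls x \<in> total_space H"
proof -
  assume x: "x \<in> cocycles A"
  then have xt: "x \<in> total_space A" and dx: "dif A x = 0" by (auto simp: cocycles_def)
  have c: "component A k x \<in> cocycles A" for k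
    using component_dif[OF xt, of k] gr_total[OF component_gr[OF xt]] component_homogeneous[OF gr_0[of k]]
    by (simp add: dx cocycles_def)
  have "(\<Sum>k\<in>S. component A k x) \<in> cocycles A \<and> cls (\<Sum>k\<in>S. component A k x) \<in> total_space H" if "finite S" for S
    using that
  proof (induction S)
    case empty
    show ?case by (simp add: cocycles_def total_0 H.total_0)
  next
    case (insert k S)
    have "cls (component A k x) \<in> gr H k" using c component_gr[OF xt] cls_gr[of k] by blast
    then show ?case using insert c by (simp add: cocycles_add cls_add H.total_add H.gr_total)
  qed
  from this[OF finite_component[OF xt]] show ?thesis by (simp add: sum_component[OF xt])
qed

text \<open>A harmonic coboundary is zero: the harmonic projection fixes it because it is harmonic
  and kills it because it is exact.\<close>

lemma cls_inj:
  assumes "x \<in> harmonic A h" "y \<in> harmonic A h" "cls x = cls y"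
  shows "x = y"
proof -
  have c: "x \<in> cocycles A" "y \<in> cocycles A" using assms harmonic_cocycle by auto
  have "x - y \<in> coboundaries A"
    using cls_kernel[OF cocycles_diff[OF c]] assms(3) by (simp add: cls_diff c)
  then obtain z where z: "z \<in> total_space A" "x - y = dif A z" by (auto simp: coboundaries_def)
  have "x - y \<in> harmonic A h"
    using harmonic_add[OF assms(1) harmonic_smul[OF assms(2), of "-1"]] by simp
  then have "\<pi> (dif A z) = dif A z" using harmonicD z(2) by simp
  moreover have "\<pi> (dif A z) = 0" using z(1) by (simp add: harm_proj_def d_h_d dif_dif)
  ultimately show ?thesis using z(2) by simp
qed

lemma cls_\<pi>: "x \<in> cocycles A \<Longrightarrow> cls (\<pi> x) = cls x"
proof -
  assume x: "x \<in> cocycles A"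
  then have xt: "x \<in> total_space A" "dif A x = 0" by (auto simp: cocycles_def)
  have d: "dif A (h x) \<in> coboundaries A" "dif A (h x) \<in> cocycles A"
    using coboundariesI[OF h_total[OF xt(1)]] by (simp_all add: cocycles_def dif_total h_total xt dif_dif)
  have "\<pi> x = x - dif A (h x)" using xt by (simp add: harm_proj_def)
  then show ?thesis using d cls_kernel by (simp add: cls_diff x)
qed

lemma cls_surj_gr:
  assumes "a \<in> gr H k" obtains x where "x \<in> harmonic A h" "x \<in> gr A k" "cls x = a"
proof -
  have "a \<in> cls ` (cocycles A \<inter> gr A k)" using assms by (simp only: cls_gr)
  then obtain x where x: "x \<in> cocycles A" "x \<in> gr A k" "cls x = a" by (elim imageE IntE) simp
  have xt: "x \<in> total_space A" by (rule gr_total[OF x(2)])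
  have "\<pi> x \<in> gr A (k + 0)" using \<pi>_linear x(2) unfolding graded_linear_def by blast
  then show ?thesis using that[OF \<pi>_harmonic[OF xt]] x by (simp add: cls_\<pi>)
qed

lemma cls_surj: "a \<in> total_space H \<Longrightarrow> a \<in> cls ` harmonic A h"
proof (induction rule: H.total_induct)
  case (1 k x)
  then show ?case by (metis cls_surj_gr image_eqI)
next
  case (2 x y)
  then obtain u v where "u \<in> harmonic A h" "v \<in> harmonic A h" "x = cls u" "y = cls v" by blast
  then show ?case by (intro image_eqI[of _ _ "u + v"]) (simp_all add: cls_add harmonic_cocycle harmonic_add)
qed

lemma \<iota>_harmonic: "a \<in> total_space H \<Longrightarrow> \<iota> a \<in> harmonic A h"
  unfolding harm_rep_def by (rule inv_into_into) (rule cls_surj)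

lemma cls_\<iota>: "a \<in> total_space H \<Longrightarrow> cls (\<iota> a) = a"
  unfolding harm_rep_def by (rule f_inv_into_f) (rule cls_surj)

lemma \<iota>_cls: "x \<in> harmonic A h \<Longrightarrow> \<iota> (cls x) = x"
  by (rule cls_inj) (simp_all add: \<iota>_harmonic cls_\<iota> cls_total harmonic_cocycle)

lemma \<iota>_linear: "graded_linear H A 0 \<iota>"
  unfolding graded_linear_def
proof (intro conjI allI ballI)
  fix a b assume ab: "a \<in> total_space H" "b \<in> total_space H"
  have "\<iota> (cls (\<iota> a + \<iota> b)) = \<iota> a + \<iota> b" by (rule \<iota>_cls) (intro harmonic_add \<iota>_harmonic ab)
  then show "\<iota> (a + b) = \<iota> a + \<iota> b" using ab by (simp add: cls_add cls_\<iota> \<iota>_harmonic harmonic_cocycle)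
next
  fix c a assume a: "a \<in> total_space H"
  have "\<iota> (cls (smul A c (\<iota> a))) = smul A c (\<iota> a)" by (rule \<iota>_cls) (intro harmonic_smul \<iota>_harmonic a)
  then show "\<iota> (smul H c a) = smul A c (\<iota> a)" using a by (simp add: cls_smul cls_\<iota> \<iota>_harmonic harmonic_cocycle)
next
  fix k a assume "a \<in> gr H k"
  then obtain x where "x \<in> harmonic A h" "x \<in> gr A k" "cls x = a" by (rule cls_surj_gr)
  then show "\<iota> a \<in> gr A (k + 0)" using \<iota>_cls by auto
qed

lemma \<iota>_total: "a \<in> total_space H \<Longrightarrow> \<iota> a \<in> total_space A"
  using harmonicD[OF \<iota>_harmonic] by blast

lemma cls_\<pi>_linear: "graded_linear A H 0 (\<lambda>x. cls (\<pi> x))"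
proof -
  have "cls (\<pi> x) \<in> gr H k" if "x \<in> gr A k" for x k
  proof -
    have "\<pi> x \<in> gr A (k + 0)" using \<pi>_linear that unfolding graded_linear_def by blast
    then show ?thesis using \<pi>_cocycle[OF gr_total[OF that]] cls_gr[of k] by auto
  qed
  then show ?thesis
    using \<pi>_linear by (simp add: graded_linear_def cls_add cls_smul \<pi>_cocycle)
qed

text \<open>In arity zero \<open>transfer_q\<close> would return a representative of an undefined
  head. The value zero there makes the cuts at the two ends of a word vanish in
  convolutions.\<close>

definition tq :: "nat \<Rightarrow> 'h list \<Rightarrow> 'a" where
  "tq n = (if n = 0 then (\<lambda>_. 0) else on_tensors H n (transfer_q A H cls h))"

definition tp :: "nat \<Rightarrow> 'h list \<Rightarrow> 'a" where
  "tp n = on_tensors H n (transfer_p A H cls h)"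

lemma tp_eq:
  "tp n = (\<lambda>xs. \<Sum>k=1..<n. sg (int (k - 1)) (on_tensors H n (\<lambda>xs.
      gmul A (tq k (map (koszul H (1 - int (n - k))) (take k xs))) (tq (n - k) (drop k xs))) xs))"
proof
  fix xs
  show "tp n xs = (\<Sum>k=1..<n. sg (int (k - 1)) (on_tensors H n (\<lambda>xs.
      gmul A (tq k (map (koszul H (1 - int (n - k))) (take k xs))) (tq (n - k) (drop k xs))) xs))"
  proof (cases "xs \<in> tensors H n")
    case True
    then have n: "length xs = n" by (simp add: H.tensors_iff)
    have "map (koszul H c) (take k xs) \<in> tensors H k" "drop k xs \<in> tensors H (n - k)" if "k < n" for k c
      using True that by (auto simp: H.tensors_iff intro!: H.koszul_total dest: in_set_takeD in_set_dropD)
    with True n show ?thesis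
      by (simp add: tp_def on_tensors_def transfer_p_def tq_def scale_power_sign)
  qed (simp add: tp_def on_tensors_def)
qed

lemma tq_rec: "n \<ge> 2 \<Longrightarrow> tq n xs = - h (tp n xs)"
proof (cases "xs \<in> tensors H n")
  case True
  assume "n \<ge> 2"
  with True show ?thesis
    by (simp add: tq_def tp_def on_tensors_def H.tensors_iff transfer_q.simps[of A H cls h xs] transfer_p_def)
qed (simp add: tq_def tp_def on_tensors_def)

lemma tp_hoch_step:
  assumes "\<And>k. k < n \<Longrightarrow> tq k \<in> hoch_maps H A k (1 - int k)"
  shows "tp n \<in> hoch_maps H A n (2 - int n)"
  unfolding tp_eq
  by (intro HA.hoch_sum HA.hoch_sg_fun HA.hoch_mul[OF assms assms]) auto

lemma tq_hoch: "tq n \<in> hoch_maps H A n (1 - int n)"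
proof (induction n rule: less_induct)
  case (less n)
  consider "n = 0" | "n = 1" | "n \<ge> 2" by linarith
  then show ?case
  proof cases
    case 1
    then show ?thesis using HA.hoch_0 by (simp add: tq_def)
  next
    case 2
    have q: "tq (Suc 0) xs = (if xs \<in> tensors H (Suc 0) then \<iota> (hd xs) else 0)" for xs
      by (simp add: tq_def on_tensors_def H.tensors_iff transfer_q.simps[of A H cls h xs])
    have "tq 1 \<in> hoch_maps H A 1 0"
    proof (rule HA.hoch_mapsI)
      fix us x y vs assume "us @ x # vs \<in> tensors H 1" "y \<in> total_space H"
      then show "tq 1 (us @ (x + y) # vs) = tq 1 (us @ x # vs) + tq 1 (us @ y # vs)"
        using \<iota>_linear by (simp add: q H.tensors_iff H.total_add graded_linear_def)
    next
      fix us x c vs assume "us @ x # vs \<in> tensors H 1"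
      then show "tq 1 (us @ smul H c x # vs) = smul A c (tq 1 (us @ x # vs))"
        using \<iota>_linear by (simp add: q H.tensors_iff H.total_smul graded_linear_def)
    next
      fix w :: "(int \<times> 'h) list" assume w: "valid H w" "length w = 1"
      then obtain a where a: "w = [a]" by (cases w) auto
      have "\<iota> (snd a) \<in> gr A (fst a + 0)" using \<iota>_linear w unfolding a graded_linear_def by auto
      then show "tq 1 (map snd w) \<in> gr A (tdeg w + 0)"
        using w by (simp add: q a H.tensors_iff H.gr_total)
    qed (simp add: q)
    with 2 show ?thesis by simp
  next
    case 3
    have "(\<lambda>xs. sg 1 (h (tp n xs))) \<in> hoch_maps H A n ((2 - int n) + (-1))"
      by (intro HA.hoch_sg_fun HA.hoch_comp[OF tp_hoch_step[OF less] h_linear h_0])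
    moreover have "tq n = (\<lambda>xs. sg 1 (h (tp n xs)))"
      by (rule ext) (simp add: tq_rec[OF 3])
    ultimately show ?thesis by simp
  qed
qed

lemma tp_hoch: "tp n \<in> hoch_maps H A n (2 - int n)"
  by (rule tp_hoch_step) (rule tq_hoch)

abbreviation "\<mu> \<equiv> transferred A H cls h"

lemma \<mu>_eq: "\<mu> n = (\<lambda>xs. cls (\<pi> (tp n xs)))"
  by (auto simp: transferred_def tp_def on_tensors_def)

lemma \<mu>_hoch: "\<mu> n \<in> hoch_maps H H n (2 - int n)"
  using HA.hoch_comp[OF tp_hoch cls_\<pi>_linear] by (simp add: \<mu>_eq)

lemma \<mu>_short: "n < 2 \<Longrightarrow> \<mu> n = (\<lambda>_. 0)"
  by (auto simp: \<mu>_eq tp_eq)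

end

section \<open>The Maurer-Cartan element of the transfer\<close>

context hodge_dgca
begin

text \<open>The suspended root product \<open>hat H tp\<close> is minus the convolution square of
  \<open>mc\<close>. With the sign chosen here, the tree recursion \<open>tq = - h tp\<close>
  therefore takes the form of the fixed-point equation of the abstract transfer.\<close>

definition mc :: "(int \<times> 'h) list \<Rightarrow> 'a" where
  "mc w = - hat H tq w"

abbreviation "\<beta> \<equiv> hat H \<mu>"

lemma \<beta>_mlin: "mlin (smul H) (smul H) \<beta>"
  by (rule HH.hat_mlin) (rule \<mu>_hoch)

lemma \<beta>_gr: "\<beta> w \<in> gr H (deg w + 2)"
  by (rule HH.hat_gr) (rule \<mu>_hoch)

lemma \<beta>_short: "length w < 2 \<Longrightarrow> \<beta> w = 0"
  by (simp add: hat_def \<mu>_short)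

sublocale G: galg_words "smul A" "gr A" "tmul A" "gone A" "tdif A" "smul H" \<beta>
  using dgca_galg[OF dgca_axioms] H.vs \<beta>_mlin \<beta>_short
  by (simp add: galg_words_def galg_words_axioms_def)

lemma mc_hom: "G.hom 1 mc"
  using G.hom_minus[of 1 "hat H tq"] HA.hat_mlin[of tq, OF tq_hoch] HA.hat_gr[of tq, OF tq_hoch]
  by (simp add: G.hom_def mc_def[abs_def])

lemma mc_Nil: "mc [] = 0"
  by (simp add: mc_def hat_def tq_def)

lemma mc_single: "x \<in> gr H k \<Longrightarrow> mc [(k, x)] = - \<iota> x"
  by (simp add: mc_def hat_def H.prj(3) tq_def on_tensors_def H.tensors_iff H.gr_total transfer_q.simps[of A H cls h "[x]"])

lemma mc_single': "mc [a] = - \<iota> (prj H (fst a) (snd a))"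
  using mc_single[OF H.prj(2)[of "fst a" "snd a"]]
  by (simp add: mc_def hat_def H.prj(3)[OF H.prj(2)] case_prod_unfold)

lemma mc_map_prj: "mc (map (\<lambda>(k, x). (k, prj H k x)) w) = mc w"
  by (simp add: mc_def HA.hat_map_prj)

lemma cv_map_prj: "G.cv 1 mc mc (map (\<lambda>(k, x). (k, prj H k x)) w) = G.cv 1 mc mc w"
proof -
  let ?p = "map (\<lambda>(k, x). (k, prj H k x))"
  have d: "deg (?p w) = deg w" for w by (induction w) auto
  show ?thesis
    by (simp add: G.cv_def dec_sum take_map drop_map d mc_map_prj)
qed

text \<open>The tree whose left subtree has \<open>k\<close> leaves corresponds to the cut after
  \<open>k\<close> letters; the content is the agreement of signs. The extreme cuts vanish because
  \<open>mc []\<close> is zero.\<close>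

lemma hat_tp_valid:
  assumes w: "valid H w" shows "hat H tp w = - G.cv 1 mc mc w"
proof -
  let ?n = "length w"
  let ?m = "\<lambda>k. sg (deg (take k w)) (tmul A (mc (take k w)) (mc (drop k w)))"
  have "sg (del w) (sg (int (k - 1)) (on_tensors H ?n (\<lambda>xs.
      gmul A (tq k (map (koszul H (1 - int (?n - k))) (take k xs))) (tq (?n - k) (drop k xs))) (map snd w)))
      = - ?m k" if k: "1 \<le> k" "k < ?n" for k
  proof -
    define u v where "u = take k w" and "v = drop k w"
    have uv: "w = u @ v" "length u = k" "length v = ?n - k" using k by (simp_all add: u_def v_def)
    have val: "valid H u" "valid H v" using w by (simp_all add: uv(1))
    have mu: "mc u = sg (del u + 1) (tq k (map snd u))" and mv: "mc v = sg (del v + 1) (tq (?n - k) (map snd v))"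
      using HA.hat_valid[OF val(1), of tq] HA.hat_valid[OF val(2), of tq] uv(2,3) by (simp_all add: mc_def sg_plus1)
    have t: "tq k xs \<in> total_space A" for k xs by (rule HA.hoch_total[OF tq_hoch])
    have "tq k (map (koszul H (1 - int (?n - k))) (map snd u)) = sg ((1 - int (?n - k)) * tdeg u) (tq k (map snd u))"
      using HA.hoch_koszul[OF tq_hoch val(1), of "[]" "[]" k] H.valid_tensors[OF val(1)] uv(2) by simp
    then have "on_tensors H ?n (\<lambda>xs.
      gmul A (tq k (map (koszul H (1 - int (?n - k))) (take k xs))) (tq (?n - k) (drop k xs))) (map snd w)
      = sg ((1 - int (?n - k)) * tdeg u) (tmul A (tq k (map snd u)) (tq (?n - k) (map snd v)))"
      using H.valid_tensors[OF w refl] t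
      by (simp add: on_tensors_def take_map drop_map u_def[symmetric] v_def[symmetric] G.mul_sg_l total_sg
        tmul_total[symmetric] del: tmul_total)
    moreover have "?m k = sg (deg u + (del u + 1) + (del v + 1)) (tmul A (tq k (map snd u)) (tq (?n - k) (map snd v)))"
      by (simp add: u_def[symmetric] v_def[symmetric] mu mv G.mul_sg_l G.mul_sg_r algebra_simps)
    moreover have "even (del w + (int (k - 1) + (1 - int (?n - k)) * tdeg u)) = even (deg u + (del u + 1) + (del v + 1) + 1)"
      using k(1) uv by (simp add: uv(1) del_append tdeg of_nat_diff) (auto simp: algebra_simps)
    ultimately show ?thesis
      by (simp only: sg_sg sg_plus1[symmetric]) (rule sg_cong)
  qed
  then have "hat H tp w = (\<Sum>k=1..<?n. - ?m k)"
    by (simp add: HA.hat_valid[OF w] tp_eq sg_sum)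
  also have "\<dots> = - (\<Sum>k\<le>?n. ?m k)"
    unfolding sum_negf
    by (intro arg_cong[of _ _ uminus] sum.mono_neutral_left) (auto simp: mc_Nil not_le Suc_le_eq)
  finally show ?thesis by (simp add: G.cv_def dec_sum)
qed

lemma hat_tp: "hat H tp w = - G.cv 1 mc mc w"
  using hat_tp_valid[OF H.valid_prj, of w] by (simp only: HA.hat_map_prj cv_map_prj)

lemma hat_tp_gr: "hat H tp w \<in> gr A (deg w + 2)"
  by (rule HA.hat_gr) (rule tp_hoch)

lemma \<pi>_sg: "x \<in> total_space A \<Longrightarrow> \<pi> (sg n x) = sg n (\<pi> x)"
  and h_sg: "x \<in> total_space A \<Longrightarrow> h (sg n x) = sg n (h x)"
proof -
  assume x: "x \<in> total_space A"
  have "\<pi> (- x) = - \<pi> x"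
    using x by (simp add: harm_proj_def h_minus d_minus h_total dif_total)
  then show "\<pi> (sg n x) = sg n (\<pi> x)" by (simp add: sg_def)
  show "h (sg n x) = sg n (h x)" using x by (simp add: sg_def h_minus)
qed

lemma \<beta>_eq: "\<beta> w = cls (\<pi> (hat H tp w))"
proof -
  have t: "tp n xs \<in> total_space A" for n xs by (rule HA.hoch_total[OF tp_hoch])
  then have "\<pi> (hat H tp w) = sg (del w) (\<pi> (tp (length w) (map (\<lambda>(k, x). prj H k x) w)))"
    by (simp add: hat_def \<pi>_sg)
  moreover have "cls (sg n x) = sg n (cls x)" if "x \<in> cocycles A" for n x
    using that by (simp add: sg_def cls_minus)
  ultimately show ?thesis using \<pi>_cocycle[OF t] by (simp add: hat_def \<mu>_eq)
qed

text \<open>The hypotheses of the abstract transfer, with the homotopy and the differential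
  precomposed with the projection onto the total space.\<close>

lemma transfer_facts:
  shows "H.subspace (gr H k)" and "mc [(k, x)] = 0 \<Longrightarrow> x \<in> gr H k \<Longrightarrow> x = 0"
    and "tdif A (mc [a]) = 0"
    and "Vector_Spaces.linear (smul A) (smul A) (\<lambda>x. h (tproj A x))"
    and "2 \<le> length w \<Longrightarrow> mc w = - h (tproj A (G.cv 1 mc mc w))"
    and "2 \<le> length w \<Longrightarrow> G.cv 1 mc mc w - (tdif A (h (tproj A (G.cv 1 mc mc w)))
      + h (tproj A (tdif A (G.cv 1 mc mc w)))) = mc [(deg w + 2, \<beta> w)]"
proof -
  show "H.subspace (gr H k)" by (rule H.gr_subspace)
  show "x = 0" if "mc [(k, x)] = 0" "x \<in> gr H k"
    using that mc_single[OF that(2)] cls_\<iota>[OF H.gr_total[OF that(2)]] by simp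
  show "tdif A (mc [a]) = 0"
  proof -
    have "prj H (fst a) (snd a) \<in> total_space H" by (rule H.gr_total[OF H.prj(2)])
    from harmonicD[OF \<iota>_harmonic[OF this]] show ?thesis
      by (simp add: mc_single' total_minus d_minus)
  qed
  show "Vector_Spaces.linear (smul A) (smul A) (\<lambda>x. h (tproj A x))"
    by (simp add: Vector_Spaces.linear_iff vs h_add h_smul tproj(2)
      linear_add_gen[OF tproj(1)] linear_scale_gen[OF tproj(1)])
  have ht: "hat H tp w \<in> total_space A" by (rule gr_total[OF hat_tp_gr])
  have cv: "G.cv 1 mc mc w = - hat H tp w" by (simp add: hat_tp)
  have t: "tp n xs \<in> total_space A" for n xs by (rule HA.hoch_total[OF tp_hoch])
  show "mc w = - h (tproj A (G.cv 1 mc mc w))" if "2 \<le> length w"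
    using that t ht by (simp add: cv tproj(3) total_minus h_minus) (simp add: mc_def hat_def tq_rec h_sg sg_minus)
  show "G.cv 1 mc mc w - (tdif A (h (tproj A (G.cv 1 mc mc w)))
      + h (tproj A (tdif A (G.cv 1 mc mc w)))) = mc [(deg w + 2, \<beta> w)]" if "2 \<le> length w"
  proof -
    have c: "G.cv 1 mc mc w \<in> total_space A" using ht by (simp add: cv total_minus)
    then have "G.cv 1 mc mc w - (tdif A (h (tproj A (G.cv 1 mc mc w)))
      + h (tproj A (tdif A (G.cv 1 mc mc w)))) = \<pi> (G.cv 1 mc mc w)"
      by (simp add: harm_proj_def tproj(3) h_total dif_total)
    also have "\<dots> = - \<pi> (hat H tp w)" using \<pi>_sg[OF ht, of 1] by (simp add: cv)
    also have "\<dots> = - \<iota> (\<beta> w)" by (simp add: \<beta>_eq \<iota>_cls \<pi>_harmonic ht)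
    also have "\<dots> = mc [(deg w + 2, \<beta> w)]" by (rule mc_single[OF \<beta>_gr, symmetric])
    finally show ?thesis .
  qed
qed

lemma mc_curv: "G.curv mc w = 0"
  and \<beta>_square: "Dop \<beta> \<beta> w = 0"
  and mc_prim: "prim mc"
  and \<beta>_prim: "prim \<beta>"
proof -
  note T = transfer_facts(1) \<beta>_gr mc_hom mc_Nil transfer_facts(3) transfer_facts(2)[rotated] transfer_facts(4-6)
  show "G.curv mc w = 0"
    by (rule G.transfer_curv[where GH = "gr H" and h = "\<lambda>x. h (tproj A x)"]; (rule T; assumption?))
  show "Dop \<beta> \<beta> w = 0"
    by (rule G.transfer_square[where GH = "gr H" and h = "\<lambda>x. h (tproj A x)" and \<tau> = mc]; (rule T; assumption?))
  show "prim mc"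
    by (rule G.transfer_prim[where GH = "gr H" and h = "\<lambda>x. h (tproj A x)"]; (rule T; assumption?))
  show "prim \<beta>"
    by (rule G.transfer_b_prim[where GH = "gr H" and h = "\<lambda>x. h (tproj A x)" and \<tau> = mc]; (rule T; assumption?))
qed

sublocale word_coalgebra H \<beta>
  by unfold_locales (rule \<beta>_mlin \<beta>_short \<beta>_prim \<beta>_square; assumption?)+

text \<open>On a homogeneous letter \<open>mc\<close> is \<open>- \<iota>\<close>, and harmonic
  representatives identify classes with cocycles modulo coboundaries.\<close>

lemma mc_model: "model H \<beta> A mc"
  unfolding model_def
proof (intro conjI allI ballI impI)
  interpret mc_words "smul A" "gr A" "tmul A" "gone A" "tdif A" "smul H" \<beta>
    by (rule dgca_mc_words[OF dgca_axioms])
  show "MC mc" by (simp add: MC_def mc_hom mc_prim mc_curv)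
next
  fix k x assume x: "x \<in> gr H k" "mc [(k, x)] \<in> coboundaries A"
  have "\<iota> x \<in> coboundaries A" using coboundaries_minus[OF x(2)] by (simp add: mc_single[OF x(1)])
  then have "cls (\<iota> x) = 0"
    using cls_kernel[OF harmonic_cocycle[OF \<iota>_harmonic[OF H.gr_total[OF x(1)]]]] by simp
  then show "x = 0" by (simp add: cls_\<iota>[OF H.gr_total[OF x(1)]])
next
  fix k z assume z: "z \<in> gr A k" "dif A z = 0"
  have c: "z \<in> cocycles A" using z by (simp add: cocycles_def gr_total)
  then have "cls z \<in> gr H k" using cls_gr[of k] z(1) by blast
  then have g: "- cls z \<in> gr H k" by (rule H.gr_minus)
  note gt = H.gr_total[OF g]
  have m: "\<iota> (- cls z) \<in> cocycles A" by (rule harmonic_cocycle[OF \<iota>_harmonic[OF gt]])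
  have e: "z - mc [(k, - cls z)] = z + \<iota> (- cls z)" by (simp add: mc_single[OF g])
  have "cls (z + \<iota> (- cls z)) = 0" by (simp add: cls_add c m cls_\<iota>[OF gt])
  then have "z - mc [(k, - cls z)] \<in> coboundaries A"
    unfolding e using cls_kernel[OF cocycles_add[OF c m]] by simp
  then show "\<exists>x\<in>gr H k. z - mc [(k, x)] \<in> coboundaries A" using g by blast
qed

lemma \<mu>_harr: "n \<ge> 2 \<Longrightarrow> \<mu> n \<in> harr_maps H H n (2 - int n)"
  by (rule HH.harr_mapsI) (use \<mu>_hoch \<beta>_prim in \<open>auto simp: prim_def\<close>)

lemma \<mu>_cinf: "cinf_algebra H \<mu>"
  by (rule H.cinf_algebraI) (simp_all add: \<mu>_harr \<mu>_short \<beta>_square)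

section \<open>Units, and the operations of arity two and three\<close>

lemma gmul_0: "x \<in> total_space A \<Longrightarrow> gmul A 0 x = 0" "x \<in> total_space A \<Longrightarrow> gmul A x 0 = 0"
  using tmul_total[OF total_0, of x] tmul_total[OF _ total_0, of x] by simp_all

lemma \<iota>_one: "\<iota> (gone H) = gone A"
proof -
  have g: "gone A \<in> total_space A" by (rule gr_total[OF one_gr])
  have "dif A (gone A) = 0" using G.d_one unfolding tdif_total[OF g] .
  then have "\<pi> (gone A) = gone A" by (simp add: harm_proj_def h_one)
  then have "gone A \<in> harmonic A h" using \<pi>_harmonic[OF g] by simp
  then show ?thesis using \<iota>_cls cls_one by metis
qed

lemma koszul_one: "koszul H q (gone H) = gone H"
  using H.koszul_homogeneous[OF H.one_gr] by simp

lemma tq_single: "x \<in> total_space H \<Longrightarrow> tq (Suc 0) [x] = \<iota> x"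
  by (simp add: tq_def on_tensors_def H.tensors_iff transfer_q.simps[of A H cls h "[x]"])

text \<open>
  In a sum over planar trees with a unit among the leaves, only the terms multiplying the unit with
  a complete subtree survive, and these lie in the image of \<open>h\<close>.
\<close>

lemma transfer_unit:
  assumes "gone H \<in> set xs"
  shows "n \<ge> 2 \<Longrightarrow> tq n xs = 0" and "n \<ge> 3 \<Longrightarrow> tp n xs \<in> h ` total_space A"
proof -
  have "(n \<ge> 2 \<longrightarrow> tq n xs = 0) \<and> (n \<ge> 3 \<longrightarrow> tp n xs \<in> h ` total_space A)"
    using assms
  proof (induction n arbitrary: xs rule: less_induct)
    case (less n)
    have sing: "ys = [a]" if "length ys = 1" "a \<in> set ys" for ys and a :: 'h
      using that by (cases ys) auto
    have im0: "0 \<in> h ` total_space A" using total_0 by (intro image_eqI[of _ _ 0]) simp_all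
    have imq: "tq k ys \<in> h ` total_space A" if "k \<ge> 2" for k ys
      using tq_rec[OF that, of ys] HA.hoch_total[OF tp_hoch, of k ys]
      by (intro image_eqI[of _ _ "- tp k ys"]) (simp_all add: h_minus total_minus)
    have qt: "tq k ys \<in> total_space A" for k ys by (rule HA.hoch_total[OF tq_hoch])
    have ims: "sum f S \<in> h ` total_space A" if "\<And>i. i \<in> S \<Longrightarrow> f i \<in> h ` total_space A" for f and S :: "nat set"
      using that
    proof (induction S rule: infinite_finite_induct)
      case (insert i S)
      have "f i \<in> h ` total_space A" "sum f S \<in> h ` total_space A"
        by (rule insert.prems, simp) (rule insert.IH, rule insert.prems, simp)
      then obtain x y where "x \<in> total_space A" "y \<in> total_space A" "f i = h x" "sum f S = h y"
        by (elim imageE)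
      with insert show ?case by (intro image_eqI[of _ _ "x + y"]) (simp_all add: h_add total_add)
    qed (simp_all add: im0)
    have p: "tp n xs \<in> h ` total_space A" if n: "n \<ge> 3"
      unfolding tp_eq
    proof (rule ims)
      fix k assume k: "k \<in> {1..<n}"
      let ?u = "map (koszul H (1 - int (n - k))) (take k xs)" and ?v = "drop k xs"
      have "gmul A (tq k ?u) (tq (n - k) ?v) \<in> h ` total_space A" if T: "xs \<in> tensors H n"
      proof -
        have l: "length ?u = k" "length ?v = n - k" using T k by (auto simp: H.tensors_iff)
        have "gone H \<in> set (take k xs) \<union> set ?v"
          using less.prems by (metis append_take_drop_id set_append)
        then consider "gone H \<in> set ?u" | "gone H \<in> set ?v" using koszul_one by (auto simp: image_iff) metis
        then show ?thesis
        proof cases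
          case 1
          show ?thesis
          proof (cases "k = 1")
            case True
            have "?u = [gone H]" by (rule sing[OF _ 1]) (rule trans[OF l(1) True])
            then have "tq k ?u = gone A" by (simp add: True tq_single H.gr_total[OF H.one_gr] \<iota>_one)
            then show ?thesis using imq[of "n - k" ?v] qt True n by (simp add: mul_one_left)
          next
            case False
            then have "tq k ?u = 0" using less.IH[of k ?u] 1 k by auto
            then show ?thesis using im0 qt by (simp add: gmul_0)
          qed
        next
          case 2
          show ?thesis
          proof (cases "n - k = 1")
            case True
            have "?v = [gone H]" by (rule sing[OF _ 2]) (rule trans[OF l(2) True])
            then have "tq (n - k) ?v = gone A" by (simp add: True tq_single H.gr_total[OF H.one_gr] \<iota>_one)
            moreover have "k \<ge> 2" using True n by simp
            ultimately show ?thesis using imq[of k ?u] qt by (simp add: mul_one_right)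
          next
            case False
            then have "tq (n - k) ?v = 0" using less.IH[of "n - k" ?v] 2 k by auto
            then show ?thesis using im0 qt by (simp add: gmul_0)
          qed
        qed
      qed
      then have "on_tensors H n (\<lambda>xs. gmul A (tq k (map (koszul H (1 - int (n - k))) (take k xs)))
          (tq (n - k) (drop k xs))) xs \<in> h ` total_space A"
        using im0 by (simp add: on_tensors_def)
      then obtain y where "y \<in> total_space A" "on_tensors H n (\<lambda>xs. gmul A (tq k (map (koszul H (1 - int (n - k)))
          (take k xs))) (tq (n - k) (drop k xs))) xs = h y" by auto
      then show "sg (int (k - 1)) (on_tensors H n (\<lambda>xs. gmul A (tq k (map (koszul H (1 - int (n - k)))
          (take k xs))) (tq (n - k) (drop k xs))) xs) \<in> h ` total_space A"
        by (intro image_eqI[of _ _ "sg (int (k - 1)) y"]) (simp_all add: h_sg total_sg)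
    qed
    \<comment> \<open>From arity three on, the root product lies in the image of \<open>h\<close>
      and is killed by the next \<open>h\<close>. In arity two a unit leaves just one harmonic
      representative, which \<open>h\<close> kills as well.\<close>
    have q: "tq n xs = 0" if n: "n \<ge> 2"
    proof -
      have "h (tp n xs) = 0"
      proof (cases "n = 2")
        case False
        then show ?thesis using p n h_h by auto
      next
        case True
        show ?thesis
        proof (cases "xs \<in> tensors H 2")
          case T: True
          then obtain x y where xs: "xs = [x, y]" by (auto simp: H.tensors_iff length_Suc_conv numeral_2_eq_2)
          have xy: "x \<in> total_space H" "y \<in> total_space H" using T by (auto simp: xs H.tensors_iff)
          have "tp 2 xs = gmul A (\<iota> x) (\<iota> y)"
            using T xy by (simp add: tp_eq on_tensors_def xs numeral_2_eq_2 tq_single H.koszul_even)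
          moreover have "h (\<iota> x) = 0" "h (\<iota> y) = 0" using harmonicD[OF \<iota>_harmonic] xy by blast+
          ultimately show ?thesis
            using less.prems \<iota>_total xy True by (auto simp: xs \<iota>_one mul_one_left mul_one_right)
        qed (simp add: True tp_def on_tensors_def)
      qed
      then show ?thesis by (simp add: tq_rec[OF n])
    qed
    show ?case using p q by blast
  qed
  then show "n \<ge> 2 \<Longrightarrow> tq n xs = 0" "n \<ge> 3 \<Longrightarrow> tp n xs \<in> h ` total_space A" by auto
qed

lemma tp_2: "x \<in> total_space H \<Longrightarrow> y \<in> total_space H \<Longrightarrow> tp 2 [x, y] = gmul A (\<iota> x) (\<iota> y)"
  by (simp add: tp_eq on_tensors_def H.tensors_iff numeral_2_eq_2 tq_single H.koszul_even)

text \<open>A product of harmonic elements need not be harmonic, but it is a cocycle, and the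
  harmonic projection does not change its class.\<close>

lemma \<mu>_2: "\<mu> 2 = mul_cochain H"
proof
  fix xs
  show "\<mu> 2 xs = mul_cochain H xs"
  proof (cases "xs \<in> tensors H 2")
    case True
    then obtain x y where xs: "xs = [x, y]" by (auto simp: H.tensors_iff length_Suc_conv numeral_2_eq_2)
    have xy: "x \<in> total_space H" "y \<in> total_space H" using True by (auto simp: xs H.tensors_iff)
    have c: "\<iota> x \<in> cocycles A" "\<iota> y \<in> cocycles A" by (intro harmonic_cocycle \<iota>_harmonic xy)+
    have t: "gmul A (\<iota> x) (\<iota> y) \<in> total_space A" by (intro gmul_total \<iota>_total xy)
    have "dif A (gmul A (\<iota> x) (\<iota> y)) = 0"
    proof -
      have "dif A (gmul A a (\<iota> y)) = gmul A (dif A a) (\<iota> y)" if "a \<in> total_space A" for a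
        using that
      proof (induction rule: total_induct)
        case (1 k a)
        have "gmul A a 0 = 0" using 1 by (simp add: gmul_0 gr_total)
        then show ?case using leibniz[OF 1 \<iota>_total[OF xy(2)]] c(2) by (simp add: cocycles_def)
      next
        case (2 a a')
        then show ?case
          by (simp add: mul_add_left \<iota>_total xy dif_add gmul_total dif_total)
      qed
      from this[OF \<iota>_total[OF xy(1)]] show ?thesis
        using c(1) \<iota>_total[OF xy(2)] by (simp add: cocycles_def gmul_0)
    qed
    then have "gmul A (\<iota> x) (\<iota> y) \<in> cocycles A" using t by (simp add: cocycles_def)
    then show ?thesis
      using True xy c by (simp add: \<mu>_eq xs tp_2 cls_\<pi> cls_mul cls_\<iota> mul_cochain_def on_tensors_def)
  qed (simp add: transferred_def mul_cochain_def on_tensors_def)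
qed

text \<open>There are two planar trees with three leaves. The minus sign on their internal edge
  reverses the signs of the root product and yields those of \<open>mu3\<close>.\<close>

lemma \<mu>_3: "\<mu> 3 = mu3 A H cls h"
proof
  fix xs
  show "\<mu> 3 xs = mu3 A H cls h xs"
  proof (cases "xs \<in> tensors H 3")
    case True
    then obtain x y z where xs: "xs = [x, y, z]" by (auto simp: H.tensors_iff length_Suc_conv numeral_3_eq_3)
    have xyz: "x \<in> total_space H" "y \<in> total_space H" "z \<in> total_space H"
      using True by (auto simp: xs H.tensors_iff)
    \<comment> \<open>In the tree sum the right subtree has degree -1, while \<open>mu3\<close> is
      written with degree 1; a Koszul sign sees only the parity.\<close>
    have k: "koszul H (- 1) x = koszul H 1 x" by (rule H.koszul_parity) simp
    have q2: "tq 2 [a, b] = - h (gmul A (\<iota> a) (\<iota> b))" if "a \<in> total_space H" "b \<in> total_space H" for a b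
      using that by (simp add: tq_rec tp_2)
    have I: "{Suc 0..<3} = {1, 2}" by auto
    have g: "gmul A (\<iota> a) (\<iota> b) \<in> total_space A" if "a \<in> total_space H" "b \<in> total_space H" for a b
      using that by (simp add: gmul_total \<iota>_total)
    have "tp 3 xs = gmul A (\<iota> (koszul H 1 x)) (tq 2 [y, z]) - gmul A (tq 2 [x, y]) (\<iota> z)"
      using True xyz k by (simp add: tp_eq on_tensors_def xs I tq_single H.koszul_even H.koszul_total sg_odd)
    also have "\<dots> = gmul A (h (gmul A (\<iota> x) (\<iota> y))) (\<iota> z) - gmul A (\<iota> (koszul H 1 x)) (h (gmul A (\<iota> y) (\<iota> z)))"
      using xyz G.mul_minus_r[of "\<iota> (koszul H 1 x)" "h (gmul A (\<iota> y) (\<iota> z))"]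
        G.mul_minus_l[of "h (gmul A (\<iota> x) (\<iota> y))" "\<iota> z"]
      by (simp add: q2 g h_total total_minus \<iota>_total H.koszul_total)
    finally show ?thesis
      using True by (simp add: \<mu>_eq mu3_def on_tensors_def xs Let_def numeral_2_eq_2)
  qed (simp add: transferred_def mu3_def on_tensors_def)
qed

lemma \<mu>_unital: "cinf_unital H \<mu>"
  unfolding cinf_unital_def
proof (intro conjI ballI allI impI)
  fix x assume x: "x \<in> total_space H"
  have g: "gone H \<in> total_space H" by (rule H.gr_total[OF H.one_gr])
  show "\<mu> 2 [gone H, x] = x" "\<mu> 2 [x, gone H] = x"
    using x g by (simp_all add: \<mu>_2 mul_cochain_def on_tensors_def H.tensors_iff H.mul_one_left H.mul_one_right)
next
  fix n :: nat and xs assume "3 \<le> n" "xs \<in> tensors H n" "gone H \<in> set xs"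
  then obtain y where "y \<in> total_space A" "tp n xs = h y" using transfer_unit(2) by blast
  then show "\<mu> n xs = 0" by (simp add: \<mu>_eq \<pi>_h)
qed

end

section \<open>Low arities\<close>

lemma comps_small:
  "comps (Suc 0) = {[1]}" "comps 2 = {[1, 1], [2]}" "comps 3 = {[1, 1, 1], [1, 2], [2, 1], [3]}"
proof -
  have I: "{Suc 0..2} = {Suc 0, 2}" "{Suc 0..3} = {Suc 0, 2, 3}" by auto
  show 1: "comps (Suc 0) = {[1]}" by (subst comps_pos) simp_all
  show 2: "comps 2 = {[1, 1], [2]}" by (subst comps_pos) (simp_all add: I 1 insert_commute)
  show "comps 3 = {[1, 1, 1], [1, 2], [2, 1], [3]}"
    by (subst comps_pos) (simp_all add: I 1 2 insert_commute)
qed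

lemma comps_2: "{js. sum_list js = 2 \<and> 0 \<notin> set js \<and> 2 \<le> length js} = {[1, 1 :: nat]}"
proof -
  have "{js. sum_list js = 2 \<and> 0 \<notin> set js \<and> 2 \<le> length js} = {js \<in> comps 2. 2 \<le> length js}"
    by (simp only: comps_def mem_Collect_eq conj_assoc)
  also have "\<dots> = {[1, 1]}" unfolding comps_small by auto
  finally show ?thesis .
qed

lemma comps_3: "{js. sum_list js = 3 \<and> 0 \<notin> set js \<and> 2 \<le> length js} = {[1, 2], [2, 1], [1, 1, 1 :: nat]}"
proof -
  have "{js. sum_list js = 3 \<and> 0 \<notin> set js \<and> 2 \<le> length js} = {js \<in> comps 3. 2 \<le> length js}"
    by (simp only: comps_def mem_Collect_eq conj_assoc)
  also have "\<dots> = {[1, 2], [2, 1], [1, 1, 1]}" unfolding comps_small by auto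
  finally show ?thesis .
qed

context graded_pair
begin

lemma harr_comp:
  fixes U :: "('k, 'c::ab_group_add, 'q) gspace_data_scheme"
  assumes f: "f \<in> harr_maps V W p q" and g: "graded_linear W U q' g" "g 0 = 0"
  shows "(\<lambda>xs. g (f xs)) \<in> harr_maps V U p (q + q')"
proof -
  note fh = harr_hoch[OF f]
  have sum: "g (sum F S) = (\<Sum>i\<in>S. g (F i))" if "\<And>i. i \<in> S \<Longrightarrow> F i \<in> total_space W" for F and S :: "nat list set"
    using that
  proof (induction S rule: infinite_finite_induct)
    case (insert i S)
    then have "sum F S \<in> total_space W" by (intro W.sum_total) auto
    with insert g(1) show ?case by (simp add: graded_linear_def)
  qed (simp_all add: g(2))
  have "(\<Sum>js\<in>shuffles [0..<i] [i..<p]. smul U (shuffle_sign ks js) (g (f (map ((!) xs) js)))) = 0"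
    if "0 < i \<and> i < p \<and> length ks = p \<and> list_all2 (\<lambda>k x. x \<in> gr V k) ks xs" for i ks xs
  proof -
    have "(\<Sum>js\<in>shuffles [0..<i] [i..<p]. smul U (shuffle_sign ks js) (g (f (map ((!) xs) js))))
        = (\<Sum>js\<in>shuffles [0..<i] [i..<p]. g (smul W (shuffle_sign ks js) (f (map ((!) xs) js))))"
      using g(1) hoch_total[OF fh] by (intro sum.cong refl) (simp add: graded_linear_def)
    also have "\<dots> = g (\<Sum>js\<in>shuffles [0..<i] [i..<p]. smul W (shuffle_sign ks js) (f (map ((!) xs) js)))"
      by (rule sum[symmetric]) (intro W.total_smul hoch_total[OF fh])
    also have "(\<Sum>js\<in>shuffles [0..<i] [i..<p]. smul W (shuffle_sign ks js) (f (map ((!) xs) js))) = 0"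
      using f that unfolding harr_maps_def by blast
    finally show ?thesis by (simp add: g(2))
  qed
  then show ?thesis using hoch_comp[OF fh g] by (auto simp: harr_maps_def)
qed

end

context gca
begin

interpretation BB: graded_pair_gca B B ..

lemma mul_cochain_eq: "x \<in> total_space B \<Longrightarrow> y \<in> total_space B \<Longrightarrow> mul_cochain B [x, y] = gmul B x y"
  by (simp add: mul_cochain_def on_tensors_def tensors_iff)

lemma morphism_2:
  assumes "cinf_morphism B m B m' \<phi>" "x \<in> total_space B" "y \<in> total_space B"
  shows "\<phi> 1 [m 2 [x, y]] = m' 2 [\<phi> 1 [x], \<phi> 1 [y]]"
proof -
  have "[x, y] \<in> tensors B 2" using assms by (simp add: tensors_iff)
  then have "(\<Sum>s=2..2. \<Sum>r=0..2-s. insert_op B B \<phi> m r s [x, y]) =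
        (\<Sum>js | sum_list js = 2 \<and> 0 \<notin> set js \<and> 2 \<le> length js.
           smul B ((-1) ^ block_exponent js) (m' (length js) (tensor_apply B \<phi> js [x, y])))"
    using assms(1)[unfolded cinf_morphism_def, THEN conjunct2, THEN spec[of _ 2], THEN mp, THEN bspec] by simp
  then show ?thesis
    using assms(2,3) unfolding comps_2
    by (simp add: insert_op_def Let_def koszul_even numeral_2_eq_2)
qed

lemma morphism_3:
  assumes "cinf_morphism B m B m' \<phi>" "x \<in> total_space B" "y \<in> total_space B" "z \<in> total_space B"
  shows "\<phi> 2 [m 2 [x, y], z] - \<phi> 2 [x, m 2 [y, z]] + \<phi> 1 [m 3 [x, y, z]] =
    m' 2 [\<phi> 1 [koszul B (-1) x], \<phi> 2 [y, z]] - m' 2 [\<phi> 2 [x, y], \<phi> 1 [z]]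
    + m' 3 [\<phi> 1 [x], \<phi> 1 [y], \<phi> 1 [z]]"
proof -
  have "[x, y, z] \<in> tensors B 3" using assms by (simp add: tensors_iff)
  then have eq: "(\<Sum>s=2..3. \<Sum>r=0..3-s. insert_op B B \<phi> m r s [x, y, z]) =
        (\<Sum>js | sum_list js = 3 \<and> 0 \<notin> set js \<and> 2 \<le> length js.
           smul B ((-1) ^ block_exponent js) (m' (length js) (tensor_apply B \<phi> js [x, y, z])))"
    using assms(1)[unfolded cinf_morphism_def, THEN conjunct2, THEN spec[of _ 3], THEN mp, THEN bspec] by simp
  have I: "{2..3::nat} = {2, 3}" "{0..1::nat} = {0, 1}" by auto
  have "(\<Sum>s=2..3. \<Sum>r=0..3-s. insert_op B B \<phi> m r s [x, y, z])
      = \<phi> 2 [m 2 [x, y], z] - \<phi> 2 [x, m 2 [y, z]] + \<phi> 1 [m 3 [x, y, z]]"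
    using assms(2-4) unfolding I
    by (simp add: I insert_op_def Let_def koszul_even numeral_2_eq_2 numeral_3_eq_3)
  moreover have "(\<Sum>js | sum_list js = 3 \<and> 0 \<notin> set js \<and> 2 \<le> length js.
           smul B ((-1) ^ block_exponent js) (m' (length js) (tensor_apply B \<phi> js [x, y, z])))
    = m' 2 [\<phi> 1 [koszul B (-1) x], \<phi> 2 [y, z]] - m' 2 [\<phi> 2 [x, y], \<phi> 1 [z]]
    + m' 3 [\<phi> 1 [x], \<phi> 1 [y], \<phi> 1 [z]]"
    using assms(2-4) unfolding comps_3
    by (simp add: koszul_even numeral_2_eq_2 numeral_3_eq_3)
  ultimately show ?thesis using eq by simp
qed

lemma hoch_d_2:
  assumes "x \<in> total_space B" "y \<in> total_space B" "z \<in> total_space B"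
  shows "hoch_d B 2 q f [x, y, z] = gmul B (koszul B q x) (f [y, z]) - f [gmul B x y, z]
    + f [x, gmul B y z] - gmul B (f [x, y]) z"
proof -
  have I: "{1..2::nat} = {1, 2}" by auto
  show ?thesis
    using assms by (simp add: hoch_d_def on_tensors_def tensors_iff I numeral_2_eq_2 numeral_3_eq_3)
qed

lemma hoch_d_3:
  assumes "x \<in> total_space B" "y \<in> total_space B" "z \<in> total_space B" "w \<in> total_space B"
  shows "hoch_d B 3 q f [x, y, z, w] = gmul B (koszul B q x) (f [y, z, w]) - f [gmul B x y, z, w]
    + f [x, gmul B y z, w] - f [x, y, gmul B z w] + gmul B (f [x, y, z]) w"
proof -
  have I: "{1..3::nat} = {1, 2, 3}" by auto
  show ?thesis
    using assms by (simp add: hoch_d_def on_tensors_def tensors_iff I numeral_2_eq_2 numeral_3_eq_3 eval_nat_numeral)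
qed

lemma hoch_d_outside: "xs \<notin> tensors B (p + 1) \<Longrightarrow> hoch_d B p q f xs = 0"
  by (simp add: hoch_d_def on_tensors_def)

lemma tensors_3E:
  assumes "xs \<in> tensors B 3"
  obtains x y z where "xs = [x, y, z]" "x \<in> total_space B" "y \<in> total_space B" "z \<in> total_space B"
  using assms by (auto simp: tensors_iff length_Suc_conv numeral_3_eq_3)

lemma hoch_d_2_eqI:
  assumes "\<And>xs. xs \<notin> tensors B 3 \<Longrightarrow> g xs = 0"
    and "\<And>x y z. x \<in> total_space B \<Longrightarrow> y \<in> total_space B \<Longrightarrow> z \<in> total_space B \<Longrightarrow>
      gmul B (koszul B q x) (f [y, z]) - f [gmul B x y, z] + f [x, gmul B y z] - gmul B (f [x, y]) z = g [x, y, z]"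
  shows "hoch_d B 2 q f = g"
proof
  fix xs show "hoch_d B 2 q f xs = g xs"
  proof (cases "xs \<in> tensors B 3")
    case True
    then show ?thesis by (elim tensors_3E) (simp add: hoch_d_2 assms(2))
  next
    case False
    then show ?thesis using assms(1) hoch_d_outside[of xs 2 q f] by simp
  qed
qed

text \<open>With the product as binary operation, the left-hand side of the arity-four relation is
  minus the Hochschild coboundary of \<open>m 3\<close>.\<close>

lemma cinf_cocycle:
  assumes m: "cinf_algebra B m" "m 2 = mul_cochain B"
  shows "m 3 \<in> harr_cocycles B 3 (-1)"
proof -
  have h: "m 3 \<in> CHarr B 3 (2 - int 3)" using m(1)[unfolded cinf_algebra_def, THEN conjunct1, THEN spec[of _ 3]] by simp
  have t: "m 3 xs \<in> total_space B" for xs by (rule BB.hoch_total[OF BB.harr_hoch[OF h]])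
  have "hoch_d B 3 (-1) (m 3) xs = 0" for xs
  proof (cases "xs \<in> tensors B 4")
    case True
    then obtain x y z w where xs: "xs = [x, y, z, w]" and tot: "x \<in> total_space B" "y \<in> total_space B"
      "z \<in> total_space B" "w \<in> total_space B"
      by (auto simp: tensors_iff length_Suc_conv eval_nat_numeral)
    have I: "{2..3::nat} = {2, 3}" "{0..2::nat} = {0, 1, 2}" "{0..1::nat} = {0, 1}" by auto
    have "(\<Sum>s=2..4-1. \<Sum>r=0..4-s. insert_op B B m m r s xs) = 0"
      using m(1)[unfolded cinf_algebra_def, THEN conjunct2, THEN spec[of _ 4], THEN mp, THEN bspec, OF _ True] by simp
    then have "(\<Sum>s\<in>{2,3}. \<Sum>r=0..4-s. insert_op B B m m r s xs) = 0"
      by (simp add: I)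
    then have E: "m 3 [gmul B x y, z, w] - m 3 [x, gmul B y z, w] + m 3 [x, y, gmul B z w]
        - gmul B (m 3 [x, y, z]) w - gmul B (koszul B (-1) x) (m 3 [y, z, w]) = 0"
      using tot t koszul_total[OF tot(1)]
      by (simp add: I insert_op_def Let_def koszul_even xs eval_nat_numeral m(2)[unfolded numeral_2_eq_2] mul_cochain_eq)
        (simp add: algebra_simps)
    have "hoch_d B 3 (-1) (m 3) xs = - (m 3 [gmul B x y, z, w] - m 3 [x, gmul B y z, w]
        + m 3 [x, y, gmul B z w] - gmul B (m 3 [x, y, z]) w - gmul B (koszul B (-1) x) (m 3 [y, z, w]))"
      unfolding xs hoch_d_3[OF tot] by simp
    then show ?thesis unfolding E by simp
  next
    case False
    then show ?thesis using hoch_d_outside[of xs 3] by simp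
  qed
  with h show ?thesis by (simp add: harr_cocycles_def fun_eq_iff)
qed

lemma hoch_d_diff:
  assumes "f \<in> CHarr B 2 q" "g \<in> CHarr B 2 q"
  shows "(\<lambda>xs. f xs - g xs) \<in> CHarr B 2 q"
    and "hoch_d B 2 q (\<lambda>xs. f xs - g xs) = (\<lambda>xs. hoch_d B 2 q f xs - hoch_d B 2 q g xs)"
proof -
  have fh: "f \<in> hoch_maps B B 2 q" and gh: "g \<in> hoch_maps B B 2 q" using assms BB.harr_hoch by auto
  show "(\<lambda>xs. f xs - g xs) \<in> CHarr B 2 q"
  proof -
    have "(\<lambda>xs. \<Sum>i\<in>{True, False}. if i then f xs else sg 1 (g xs)) \<in> hoch_maps B B 2 q"
    proof (rule BB.hoch_sum)
      show "(\<lambda>xs. if i then f xs else sg 1 (g xs)) \<in> hoch_maps B B 2 q" for i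
        using fh BB.hoch_sg_fun[OF gh, of 1] by (cases i) simp_all
    qed
    then have "(\<lambda>xs. f xs - g xs) \<in> hoch_maps B B 2 q" by simp
    then show ?thesis
      using assms by (simp add: harr_maps_def scale_right_diff_distrib sum_subtractf)
  qed
  note ft = BB.hoch_total[OF fh] and gt = BB.hoch_total[OF gh]
  have r: "gmul B a (b - c) = gmul B a b - gmul B a c" and l: "gmul B (b - c) a = gmul B b a - gmul B c a"
    if "a \<in> total_space B" "b \<in> total_space B" "c \<in> total_space B" for a b c
    using mul_add_right[of a "b - c" c] mul_add_left[of "b - c" c a] that by (simp_all add: total_diff)
  show "hoch_d B 2 q (\<lambda>xs. f xs - g xs) = (\<lambda>xs. hoch_d B 2 q f xs - hoch_d B 2 q g xs)"
    by (rule hoch_d_2_eqI) (simp_all add: hoch_d_outside hoch_d_2 r l ft gt koszul_total)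
qed

lemma harr_0: "(\<lambda>_. 0) \<in> CHarr B p q"
  using BB.hoch_0[of p q] by (simp add: harr_maps_def)

lemma hoch_d_zero: "hoch_d B p q (\<lambda>_. 0) = (\<lambda>_. 0)"
proof -
  have z: "gmul B 0 y = 0" "gmul B y 0 = 0" if "y \<in> total_space B" for y
    using mul_add_left[OF total_0 total_0 that] mul_add_right[OF that total_0 total_0] by simp_all
  show ?thesis
  proof
    fix xs show "hoch_d B p q (\<lambda>_. 0) xs = 0"
    proof (cases "xs \<in> tensors B (p + 1)")
      case True
      then have "hd xs \<in> total_space B" "last xs \<in> total_space B" by (cases xs; auto simp: tensors_iff)+
      then show ?thesis by (simp add: hoch_d_def on_tensors_def z koszul_total)
    qed (simp add: hoch_d_outside)
  qed
qed

lemma harr_class_zero_iff: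
  assumes f: "f \<in> harr_cocycles B 3 q"
  shows "harr_class B 3 q f = harr_class B 3 q (\<lambda>_. 0) \<longleftrightarrow> (\<exists>\<psi>\<in>CHarr B 2 q. hoch_d B 2 q \<psi> = f)"
proof -
  have cob: "harr_coboundaries B 3 q = hoch_d B 2 q ` CHarr B 2 q" by (simp add: harr_coboundaries_def)
  have zc: "(\<lambda>_. 0) \<in> harr_cocycles B 3 q" by (simp add: harr_cocycles_def harr_0 hoch_d_zero)
  have zb: "(\<lambda>_. 0) \<in> hoch_d B 2 q ` CHarr B 2 q"
    using harr_0[of 2 q] hoch_d_zero[of 2 q] by (intro image_eqI[of _ _ "\<lambda>_. 0"]) simp_all
  have mem: "g \<in> harr_class B 3 q f \<longleftrightarrow> f \<in> harr_cocycles B 3 q \<and> g \<in> harr_cocycles B 3 q \<and>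
      (\<lambda>xs. f xs - g xs) \<in> hoch_d B 2 q ` CHarr B 2 q" for f g
    by (simp add: harr_class_def harr_rel_def cob)
  show ?thesis
  proof
    assume "harr_class B 3 q f = harr_class B 3 q (\<lambda>_. 0)"
    moreover have "(\<lambda>_. 0) \<in> harr_class B 3 q (\<lambda>_. 0)" using zc zb by (simp add: mem)
    ultimately have "(\<lambda>_. 0) \<in> harr_class B 3 q f" by simp
    then show "\<exists>\<psi>\<in>CHarr B 2 q. hoch_d B 2 q \<psi> = f" by (auto simp: mem)
  next
    assume "\<exists>\<psi>\<in>CHarr B 2 q. hoch_d B 2 q \<psi> = f"
    then obtain \<psi> where \<psi>: "\<psi> \<in> CHarr B 2 q" "hoch_d B 2 q \<psi> = f" by blast
    have "(\<lambda>xs. f xs - g xs) \<in> hoch_d B 2 q ` CHarr B 2 q \<longleftrightarrow> (\<lambda>xs. 0 - g xs) \<in> hoch_d B 2 q ` CHarr B 2 q" for g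
    proof
      assume "(\<lambda>xs. f xs - g xs) \<in> hoch_d B 2 q ` CHarr B 2 q"
      then obtain \<chi> where \<chi>: "\<chi> \<in> CHarr B 2 q" "hoch_d B 2 q \<chi> = (\<lambda>xs. f xs - g xs)" by (auto dest: sym)
      show "(\<lambda>xs. 0 - g xs) \<in> hoch_d B 2 q ` CHarr B 2 q"
        using hoch_d_diff[OF \<chi>(1) \<psi>(1)] \<chi>(2) \<psi>(2)
        by (intro image_eqI[of _ _ "\<lambda>xs. \<chi> xs - \<psi> xs"]) (auto simp: fun_eq_iff)
    next
      assume "(\<lambda>xs. 0 - g xs) \<in> hoch_d B 2 q ` CHarr B 2 q"
      then obtain \<chi> where \<chi>: "\<chi> \<in> CHarr B 2 q" "hoch_d B 2 q \<chi> = (\<lambda>xs. 0 - g xs)" by (auto dest: sym)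
      note n = hoch_d_diff[OF harr_0 \<chi>(1)]
      show "(\<lambda>xs. f xs - g xs) \<in> hoch_d B 2 q ` CHarr B 2 q"
        using hoch_d_diff[OF \<psi>(1) n(1)] n(2) \<chi>(2) \<psi>(2) hoch_d_zero[of 2 q]
        by (intro image_eqI[of _ _ "\<lambda>xs. \<psi> xs - (0 - \<chi> xs)"]) (auto simp: fun_eq_iff)
    qed
    then show "harr_class B 3 q f = harr_class B 3 q (\<lambda>_. 0)"
      using f zc by (intro set_eqI) (simp add: mem)
  qed
qed

text \<open>
  An isomorphism with linear part \<open>\<phi>\<^sub>1\<close> to a structure without ternary operation exhibits the
  ternary operation as the coboundary of \<open>\<phi>\<^sub>1\<^sup>-\<^sup>1 \<circ> \<phi>\<^sub>2\<close>.
\<close>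

lemma isomorphism_coboundary:
  assumes iso: "cinf_isomorphism B m B m' \<phi>"
    and m: "m 2 = mul_cochain B" "m' 2 = mul_cochain B" "m' 3 = (\<lambda>_. 0)"
    and m3: "m 3 \<in> CHarr B 3 (-1)"
  shows "\<exists>\<psi>\<in>CHarr B 2 (-1). hoch_d B 2 (-1) \<psi> = m 3"
    and "(\<forall>x\<in>total_space B. \<phi> 1 [x] = x) \<Longrightarrow> \<phi> 2 \<in> CHarr B 2 (-1) \<and> hoch_d B 2 (-1) (\<phi> 2) = m 3"
proof -
  have mor: "cinf_morphism B m B m' \<phi>" and bij: "bij_betw (\<lambda>x. \<phi> 1 [x]) (total_space B) (total_space B)"
    using iso by (simp_all add: cinf_isomorphism_def)
  have harr: "\<phi> 1 \<in> CHarr B 1 (1 - int 1)" "\<phi> 2 \<in> CHarr B 2 (1 - int 2)"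
    using mor[unfolded cinf_morphism_def, THEN conjunct1, THEN spec[of _ 1]]
      mor[unfolded cinf_morphism_def, THEN conjunct1, THEN spec[of _ 2]] by simp_all
  then have h1: "\<phi> 1 \<in> hoch_maps B B 1 0" and h2: "\<phi> 2 \<in> CHarr B 2 (-1)" using BB.harr_hoch by auto
  note t1 = BB.hoch_total[OF h1] and t2 = BB.hoch_total[OF BB.harr_hoch[OF h2]]
    and t3 = BB.hoch_total[OF BB.harr_hoch[OF m3]]
  have out: "m 3 xs = 0" if "xs \<notin> tensors B 3" for xs
    by (rule BB.hoch_zero[OF BB.harr_hoch[OF m3] that])
  let ?p = "\<lambda>x. \<phi> 1 [x]"
  have lin: "graded_linear B B 0 ?p"
    unfolding graded_linear_def
  proof (intro conjI allI ballI)
    show "\<phi> 1 [x + y] = \<phi> 1 [x] + \<phi> 1 [y]" if "x \<in> total_space B" "y \<in> total_space B" for x y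
      using BB.hoch_add[OF h1, of "[]" x "[]" y] that by (simp add: tensors_iff)
    show "\<phi> 1 [smul B c x] = smul B c (\<phi> 1 [x])" if "x \<in> total_space B" for c x
      using BB.hoch_scale[OF h1, of "[]" x "[]" c] that by (simp add: tensors_iff)
    show "\<phi> 1 [x] \<in> gr B (k + 0)" if "x \<in> gr B k" for k x
      using BB.hoch_gr[OF h1, of "[(k, x)]" k] that by simp
  qed
  \<comment> \<open>The arity-two equation makes the linear part an algebra automorphism. This is
    what allows its inverse to be moved through the coboundary formula at the end.\<close>
  have mult: "?p (gmul B x y) = gmul B (?p x) (?p y)" if "x \<in> total_space B" "y \<in> total_space B" for x y
    using morphism_2[OF mor that] that t1 by (simp add: m mul_cochain_eq)
  have eq: "?p (m 3 [x, y, z]) = gmul B (?p (koszul B (-1) x)) (\<phi> 2 [y, z]) - \<phi> 2 [gmul B x y, z]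
      + \<phi> 2 [x, gmul B y z] - gmul B (\<phi> 2 [x, y]) (?p z)"
    if "x \<in> total_space B" "y \<in> total_space B" "z \<in> total_space B" for x y z
    using morphism_3[OF mor that] that t1 t2 by (simp add: m mul_cochain_eq koszul_total algebra_simps)
  show "\<phi> 2 \<in> CHarr B 2 (-1) \<and> hoch_d B 2 (-1) (\<phi> 2) = m 3" if id: "\<forall>x\<in>total_space B. \<phi> 1 [x] = x"
  proof (intro conjI h2 hoch_d_2_eqI out)
    fix x y z assume "x \<in> total_space B" "y \<in> total_space B" "z \<in> total_space B"
    with eq[OF this] id t3 show "gmul B (koszul B (-1) x) (\<phi> 2 [y, z]) - \<phi> 2 [gmul B x y, z]
      + \<phi> 2 [x, gmul B y z] - gmul B (\<phi> 2 [x, y]) z = m 3 [x, y, z]" by (simp add: koszul_total)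
  qed
  define g where "g = inv_into (total_space B) ?p"
  have gp: "g (?p x) = x" if "x \<in> total_space B" for x
    using bij_betw_inv_into_left[OF bij that] by (simp add: g_def)
  have pg: "?p (g y) = y" and gt: "g y \<in> total_space B" if "y \<in> total_space B" for y
    using that bij_betw_inv_into_right[OF bij that] bij_betw_apply[OF bij_betw_inv_into[OF bij] that]
    by (simp_all add: g_def)
  note One_nat_def [simp del]
  have padd: "?p (x + y) = ?p x + ?p y" and psc: "?p (smul B c x) = smul B c (?p x)"
    if "x \<in> total_space B" "y \<in> total_space B" for x y c
    using lin that by (auto simp: graded_linear_def)
  have glin: "graded_linear B B 0 g"
    unfolding graded_linear_def
  proof (intro conjI allI ballI)
    show "g (x + y) = g x + g y" if "x \<in> total_space B" "y \<in> total_space B" for x y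
      using gp[of "g x + g y"] that by (simp add: padd pg gt total_add)
    show "g (smul B c x) = smul B c (g x)" if "x \<in> total_space B" for c x
      using gp[of "smul B c (g x)"] that by (simp add: psc pg gt total_smul)
    \<comment> \<open>Bijectivity concerns total spaces only. Degrees are recovered by comparing
      \<open>g y\<close> with its component of degree \<open>k\<close>, which has the same image
      under the linear part.\<close>
    show "g y \<in> gr B (k + 0)" if y: "y \<in> gr B k" for k y
    proof -
      have yt: "y \<in> total_space B" by (rule gr_total[OF y])
      have "component B (k + 0) (?p (g y)) = ?p (component B k (g y))"
        by (rule BB.component_graded_linear[OF lin gt[OF yt]])
      then have "?p (component B k (g y)) = y"
        using component_homogeneous[OF y, of k] by (simp add: pg yt)
      then have "g y = component B k (g y)"
        using gp[OF gr_total[OF component_gr[OF gt[OF yt]]], of k] by simp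
      then show ?thesis using component_gr[OF gt[OF yt], of k] by simp
    qed
  qed
  have g0: "g 0 = 0" using glin total_0 by (simp add: graded_linear_def) (metis add_cancel_left_right total_0)
  let ?\<psi> = "\<lambda>xs. g (\<phi> 2 xs)"
  have "?\<psi> \<in> CHarr B 2 (-1)" using BB.harr_comp[OF h2 glin g0] by simp
  moreover have "hoch_d B 2 (-1) ?\<psi> = m 3"
  proof (rule hoch_d_2_eqI[OF out])
    fix x y z assume xyz: "x \<in> total_space B" "y \<in> total_space B" "z \<in> total_space B"
    let ?e = "gmul B (koszul B (-1) x) (?\<psi> [y, z]) - ?\<psi> [gmul B x y, z]
      + ?\<psi> [x, gmul B y z] - gmul B (?\<psi> [x, y]) z"
    note mem = gmul_total[OF koszul_total[OF xyz(1)] gt[OF t2]] gt[OF t2] gmul_total[OF gt[OF t2] xyz(3)]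
    have pm: "?p (- a) = - ?p a" if "a \<in> total_space B" for a
      using psc[OF that that, of "-1"] by simp
    have pd: "?p (a - b) = ?p a - ?p b" if "a \<in> total_space B" "b \<in> total_space B" for a b
      using padd[of a "- b"] pm that by (simp add: total_minus)
    have "?p ?e = gmul B (?p (koszul B (-1) x)) (\<phi> 2 [y, z]) - \<phi> 2 [gmul B x y, z]
      + \<phi> 2 [x, gmul B y z] - gmul B (\<phi> 2 [x, y]) (?p z)"
      using mem xyz t2 by (simp add: pd padd mult pg gt total_add total_diff koszul_total)
    also have "\<dots> = ?p (m 3 [x, y, z])" by (rule eq[OF xyz, symmetric])
    finally have "?p ?e = ?p (m 3 [x, y, z])" .
    moreover have "?e \<in> total_space B" using mem by (intro total_diff total_add)
    ultimately show "?e = m 3 [x, y, z]" using gp t3 by metis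
  qed
  ultimately show "\<exists>\<psi>\<in>CHarr B 2 (-1). hoch_d B 2 (-1) \<psi> = m 3" by blast
qed

end

section \<open>Primitive coderivation terms, valid words, and morphisms into unary or binary
  operations\<close>

lemma prim_Dop:
  fixes F :: "(int \<times> 'h::ab_group_add) list \<Rightarrow> 'b::ab_group_add"
  assumes "mlin s t F" "prim F" "prim b"
  shows "prim (Dop b F)"
  unfolding prim_def
proof (intro conjI allI impI)
  show "Dop b F [] = 0" by (simp add: Dop_Nil lt_def prim_Nil[OF assms(3)] mlin_zero_hd[OF assms(1)])
  fix x y :: "(int \<times> 'h) list" assume xy: "x \<noteq> []" "y \<noteq> []"
  have "Dop b (\<lambda>x'. sh F x' y) x = Dop b (\<lambda>x'. 0) x"
    by (rule Dop_cong) (simp add: prim_sh[OF assms(2)] xy)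
  moreover have "Dop b (\<lambda>y'. sh F x y') y = Dop b (\<lambda>y'. 0) y"
    by (rule Dop_cong) (simp add: prim_sh[OF assms(2)] xy)
  ultimately show "sh (Dop b F) x y = 0"
    by (simp add: sh_Dop[OF assms(1,3)])
qed

lemma Dop_valid_cong2:
  assumes "valid V w" "\<And>v. valid V v \<Longrightarrow> b v \<in> gr V (deg v + 2)" "\<And>v. valid V v \<Longrightarrow> b v = b' v"
    "\<And>v. valid V v \<Longrightarrow> F v = K v"
  shows "Dop b F w = Dop b' K w"
proof -
  have "Dop b F w = Dop b K w" by (rule Dop_valid_cong[OF assms(1,2,4)])
  also have "\<dots> = Dop b' K w"
    unfolding Dop_def ins_dec by (intro dec_cong) (use assms(1,3) in \<open>auto simp: lt_def\<close>)
  finally show ?thesis .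
qed

lemma Pop_valid_cong:
  assumes "valid V w" "\<And>u. valid V u \<Longrightarrow> \<phi> u = \<psi> u" "\<And>u. valid V u \<Longrightarrow> \<phi> u \<in> gr W (deg u + 1)"
    "\<And>z. valid W z \<Longrightarrow> G z = K z"
  shows "Pop \<phi> G w = Pop \<psi> K w"
proof -
  have t: "valid V (take i u)" "valid V (drop i u)" if "valid V u" for i u
    using that by (metis append_take_drop_id valid_simps(3))+
  have "blocks \<phi> js u = blocks \<psi> js u \<and> valid W (blocks \<phi> js u)" if "valid V u" for js u
    using that
  proof (induction js arbitrary: u)
    case (Cons i js)
    note u = t(1)[OF Cons.prems, of i]
    show ?case using Cons.IH[OF t(2)[OF Cons.prems, of i]] assms(2)[OF u] assms(3)[OF u] by auto
  qed simp
  then show ?thesis unfolding Pop_def using assms(1,4) by (intro sum.cong refl) metis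
qed

lemma Pop_unary:
  assumes "\<And>z. length z \<noteq> 1 \<Longrightarrow> G z = 0"
  shows "Pop \<phi> G w = (if w = [] then 0 else G [(deg w + 1, \<phi> w)])"
proof (cases "w = []")
  case False
  have "Pop \<phi> (\<lambda>z. G (a # z)) v = 0" if "v \<noteq> []" for a v
  proof -
    have "Pop \<phi> (\<lambda>z. G (a # z)) v = Pop \<phi> (\<lambda>z. 0) v"
      by (rule Pop_cong) (use that in \<open>auto intro: assms\<close>)
    then show ?thesis by (simp add: Pop_def)
  qed
  then have "dec (\<lambda>u v. if v = [] then 0 else if u = [] then 0 else
      Pop \<phi> (\<lambda>z. G ((deg u + 1, \<phi> u) # z)) v) w = 0"
    by (intro dec_0I) auto
  then show ?thesis
    using False by (simp add: Pop_rec dec_split_last[of "\<lambda>u v. if u = [] then 0 else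
      Pop \<phi> (\<lambda>z. G ((deg u + 1, \<phi> u) # z)) v" w])
qed (simp add: assms)

text \<open>Followed by a binary operation, a coalgebra morphism only sees cuts into two nonempty
  blocks. So the strict structure leads to a convolution square.\<close>

lemma Pop_binary:
  assumes "\<And>z. length z \<noteq> 2 \<Longrightarrow> G z = 0"
  shows "Pop \<phi> G w = dec (\<lambda>u v. if u = [] \<or> v = [] then 0 else G [(deg u + 1, \<phi> u), (deg v + 1, \<phi> v)]) w"
proof (cases "w = []")
  case False
  have 1: "Pop \<phi> (\<lambda>z. G (a # z)) v = (if v = [] then 0 else G [a, (deg v + 1, \<phi> v)])" for a v
    by (rule Pop_unary) (auto intro: assms)
  show ?thesis
    unfolding Pop_rec[OF False] by (rule dec_cong) (simp add: 1 assms)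
qed (simp add: assms)

context gca
begin

interpretation BB: graded_pair_gca B B ..

lemma bij_betw_graded:
  assumes p: "graded_linear B B 0 p"
    and inj: "\<And>k x. x \<in> gr B k \<Longrightarrow> p x = 0 \<Longrightarrow> x = 0"
    and surj: "\<And>k y. y \<in> gr B k \<Longrightarrow> \<exists>x\<in>gr B k. p x = y"
  shows "bij_betw p (total_space B) (total_space B)"
proof -
  have add: "p (x + y) = p x + p y" and sc: "p (smul B c x) = smul B c (p x)"
    if "x \<in> total_space B" "y \<in> total_space B" for x y c
    using p that by (auto simp: graded_linear_def)
  have ker: "x = 0" if x: "x \<in> total_space B" "p x = 0" for x
  proof -
    have "component B k x = 0" for k
    proof (rule inj[OF component_gr[OF x(1)]])
      have "component B (k + 0) (p x) = p (component B k x)"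
        by (rule BB.component_graded_linear[OF p x(1)])
      then show "p (component B k x) = 0"
        using component_homogeneous[OF gr_0[of k], of k] by (simp add: x(2))
    qed
    then show ?thesis using sum_component[OF x(1)] by simp
  qed
  have "inj_on p (total_space B)"
  proof (rule inj_onI)
    fix x y assume xy: "x \<in> total_space B" "y \<in> total_space B" "p x = p y"
    have "p (x + smul B (-1) y) = p x + p (smul B (-1) y)"
      by (intro add total_smul xy)
    also have "p (smul B (-1) y) = smul B (-1) (p y)" by (rule sc[OF xy(2,2)])
    finally have "p (x - y) = 0" using xy(3) by simp
    with ker[OF total_diff[OF xy(1,2)]] show "x = y" by simp
  qed
  moreover have "y \<in> p ` total_space B" if "y \<in> total_space B" for y
    using that
  proof (induction rule: total_induct)
    case (1 k y)
    then obtain x where "x \<in> gr B k" "p x = y" using surj by blast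
    then show ?case using gr_total by blast
  next
    case (2 x y)
    then obtain u v where "u \<in> total_space B" "v \<in> total_space B" "x = p u" "y = p v" by blast
    then show ?case by (intro image_eqI[of _ _ "u + v"]) (simp_all add: add total_add)
  qed
  ultimately show ?thesis
    using BB.graded_linear_total[OF p] by (auto simp: bij_betw_def)
qed

lemma graded_linear_hoch_1:
  assumes "f \<in> hoch_maps B B (Suc 0) 0"
  shows "graded_linear B B 0 (\<lambda>x. f [x])"
  unfolding graded_linear_def
proof (intro conjI allI ballI)
  show "f [x + y] = f [x] + f [y]" if "x \<in> total_space B" "y \<in> total_space B" for x y
    using BB.hoch_add[OF assms, of "[]" x "[]" y] that by (simp add: tensors_iff)
  show "f [smul B c x] = smul B c (f [x])" if "x \<in> total_space B" for c x
    using BB.hoch_scale[OF assms, of "[]" x "[]" c] that by (simp add: tensors_iff)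
  show "f [x] \<in> gr B (k + 0)" if "x \<in> gr B k" for k x
    using BB.hoch_gr[OF assms, of "[(k, x)]" k] that by simp
qed

lemma identity_hoch: "on_tensors B (Suc 0) hd \<in> hoch_maps B B (Suc 0) 0"
proof (rule BB.hoch_mapsI)
  fix us x y vs assume "us @ x # vs \<in> tensors B (Suc 0)" "y \<in> total_space B"
  then show "on_tensors B (Suc 0) hd (us @ (x + y) # vs)
      = on_tensors B (Suc 0) hd (us @ x # vs) + on_tensors B (Suc 0) hd (us @ y # vs)"
    by (simp add: on_tensors_def tensors_iff total_add)
next
  fix us x c vs assume "us @ x # vs \<in> tensors B (Suc 0)"
  then show "on_tensors B (Suc 0) hd (us @ smul B c x # vs) = smul B c (on_tensors B (Suc 0) hd (us @ x # vs))"
    by (simp add: on_tensors_def tensors_iff total_smul)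
next
  fix w :: "(int \<times> 'a) list" assume w: "valid B w" "length w = Suc 0"
  then obtain a where "w = [a]" by (cases w) auto
  with w show "on_tensors B (Suc 0) hd (map snd w) \<in> gr B (tdeg w + 0)"
    by (simp add: on_tensors_def tensors_iff gr_total)
qed (simp add: on_tensors_def)

end

context hodge_dgca
begin

section \<open>The secondary structure\<close>

text \<open>The new components \<open>b'\<close> must satisfy
  \<open>Dop \<beta> \<Phi> = Pop \<Phi> b'\<close>. By unitriangularity the right-hand side is
  \<open>b' w\<close> plus values on shorter words, so the equation is a recursion for
  \<open>b'\<close>. Every property of \<open>b'\<close> is then obtained by pulling it back through
  \<open>Pop \<Phi>\<close>, without inverting the automorphism.\<close>

lemma secondary_structure:
  assumes \<phi>2: "\<phi>\<^sub>2 \<in> CHarr H 2 (-1)" and d: "hoch_d H 2 (-1) \<phi>\<^sub>2 = \<mu> 3"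
  shows "\<exists>m \<phi>. cinf_algebra H m \<and> m 2 = mul_cochain H \<and> m 3 = (\<lambda>_. 0) \<and>
    cinf_isomorphism H \<mu> H m \<phi> \<and> (\<forall>x\<in>total_space H. \<phi> 1 [x] = x) \<and> \<phi> 2 = \<phi>\<^sub>2"
proof -
  define \<phi> where "\<phi> n = (if n = 1 then on_tensors H 1 hd else if n = 2 then \<phi>\<^sub>2 else (\<lambda>_. 0))" for n :: nat
  have \<phi>harr: "\<phi> n \<in> harr_maps H H n (1 - int n)" for n
  proof -
    have "on_tensors H (Suc 0) hd \<in> harr_maps H H (Suc 0) 0"
      using H.identity_hoch by (simp add: harr_maps_def)
    then show ?thesis using \<phi>2 H.harr_0 by (simp add: \<phi>_def)
  qed
  then have \<phi>h: "\<phi> n \<in> hoch_maps H H n (1 - int n)" for n by (rule HH.harr_hoch)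
  have \<phi>0: "\<phi> 0 = (\<lambda>_. 0)" by (simp add: \<phi>_def)
  have id: "\<phi> 1 [x] = x" if "x \<in> total_space H" for x
    using that by (simp add: \<phi>_def on_tensors_def H.tensors_iff)
  \<comment> \<open>On single letters \<open>hat H \<phi>\<close> is the projection to the stored
    degree. Replacing it there by the identity gives unitriangularity on all words and changes
    nothing on valid ones.\<close>
  define \<Phi> where "\<Phi> w = (if length w = 1 then snd (hd w) else hat H \<phi> w)" for w
  have \<Phi>1: "\<Phi> [a] = snd a" for a by (simp add: \<Phi>_def)
  have \<Phi>valid: "hat H \<phi> w = \<Phi> w" if "valid H w" for w
  proof (cases "length w = 1")
    case True
    then obtain a where w: "w = [a]" by (cases w) auto
    then show ?thesis
      using that id[OF H.gr_total] HH.hat_valid[OF that, of \<phi>] by (simp add: \<Phi>_def)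
  qed (simp add: \<Phi>_def)
  have hm: "mlin (smul H) (smul H) (hat H \<phi>)" by (rule HH.hat_mlin[OF \<phi>h])
  have \<Phi>m: "mlin (smul H) (smul H) \<Phi>"
  proof (rule mlinI)
    show "\<Phi> (u @ (k, x + y) # v) = \<Phi> (u @ (k, x) # v) + \<Phi> (u @ (k, y) # v)" for u k v x y
      using mlin_add[OF hm] by (cases "u = [] \<and> v = []") (auto simp: \<Phi>_def)
    show "\<Phi> (u @ (k, smul H c x) # v) = smul H c (\<Phi> (u @ (k, x) # v))" for u k v c x
      using mlin_scale[OF hm] by (cases "u = [] \<and> v = []") (auto simp: \<Phi>_def)
  qed
  have \<Phi>p: "prim \<Phi>"
  proof -
    have p: "prim (hat H \<phi>)" by (rule HH.prim_hat[OF \<phi>harr \<phi>0])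
    have "sh \<Phi> x y = 0" if xy: "x \<noteq> []" "y \<noteq> []" for x y
    proof -
      have "length x + length y \<noteq> 1" using xy by (cases x; cases y) auto
      then have "sh \<Phi> x y = sh (hat H \<phi>) x y" by (intro sh_cong) (simp add: \<Phi>_def)
      then show ?thesis using p xy by (simp add: prim_def)
    qed
    then show ?thesis using prim_Nil[OF p] by (simp add: prim_def \<Phi>_def)
  qed
  let ?C = "\<lambda>w. comps (length w) - {replicate (length w) 1}"
  let ?\<Psi> = "\<lambda>F w. Dop \<beta> \<Phi> w - (\<Sum>js\<in>?C w. F (blocks \<Phi> js w))"
  let ?P = "\<lambda>F. mlin (smul H) (smul H) F \<and> (\<forall>w. F w \<in> gr H (deg w + 2))"
  have D\<Phi>: "Dop \<beta> \<Phi> w \<in> gr H (deg w + 2)" for w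
    unfolding Dop_def ins_dec
  proof (intro dec_mem H.gr_add H.gr_sg; assumption?)
    fix u w' v z assume "w = u @ w'" "w' = v @ z"
    moreover have "hat H \<phi> (u @ lt 2 \<beta> v # z) \<in> gr H (deg (u @ lt 2 \<beta> v # z) + 1)"
      by (rule HH.hat_gr[OF \<phi>h])
    ultimately show "\<Phi> (u @ lt 2 \<beta> v # z) \<in> gr H (deg w + 2)"
      using \<beta>_gr[of v] by (cases "u = [] \<and> z = []") (auto simp: \<Phi>_def lt_def algebra_simps)
  qed
  have cb: "sum_list js = length w" "length (blocks \<Phi> js w) < length w" if "js \<in> ?C w" for js w
    using that comps_length[of js "length w"] by (auto simp: comps_def)
  have "\<exists>F. ?P F \<and> (\<forall>w. F w = ?\<Psi> F w)"
  proof (rule word_recursion)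
    fix F F' :: "(int \<times> 'h) list \<Rightarrow> 'h" and w :: "(int \<times> 'h) list"
    assume "\<And>v. length v < length w \<Longrightarrow> F v = F' v"
    then have "(\<Sum>js\<in>?C w. F (blocks \<Phi> js w)) = (\<Sum>js\<in>?C w. F' (blocks \<Phi> js w))"
      using cb by (intro sum.cong refl) blast
    then show "?\<Psi> F w = ?\<Psi> F' w" by simp
  next
    show "?P (\<lambda>w. 0)" by (simp add: mlin_0[OF H.vs] H.gr_0)
  next
    fix F assume F: "?P F"
    have "mlin (smul H) (smul H) (\<lambda>w. \<Sum>js\<in>?C w. F (blocks \<Phi> js w))"
    proof (rule mlinI)
      fix u v :: "(int \<times> 'h) list" and k x y c
      let ?l = "length u + Suc (length v)"
      have s: "sum_list js = length u + length v + 1" if "js \<in> comps ?l - {replicate ?l 1}" for js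
        using that by (auto simp: comps_def)
      note m = mlin_blocks[OF H.vs conjunct1[OF F] \<Phi>m s]
      show "(\<Sum>js\<in>?C (u @ (k, x + y) # v). F (blocks \<Phi> js (u @ (k, x + y) # v))) =
        (\<Sum>js\<in>?C (u @ (k, x) # v). F (blocks \<Phi> js (u @ (k, x) # v))) +
        (\<Sum>js\<in>?C (u @ (k, y) # v). F (blocks \<Phi> js (u @ (k, y) # v)))"
        unfolding length_append list.size sum.distrib[symmetric]
        by (rule sum.cong) (simp_all add: m(1))
      show "(\<Sum>js\<in>?C (u @ (k, smul H c x) # v). F (blocks \<Phi> js (u @ (k, smul H c x) # v))) =
        smul H c (\<Sum>js\<in>?C (u @ (k, x) # v). F (blocks \<Phi> js (u @ (k, x) # v)))"
        unfolding length_append list.size H.scale_sum_right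
        by (rule sum.cong) (simp_all add: m(2))
    qed
    moreover have "(\<Sum>js\<in>?C w. F (blocks \<Phi> js w)) \<in> gr H (deg w + 2)" for w
    proof (rule H.subspace_sum[OF H.gr_subspace])
      fix js assume "js \<in> ?C w"
      from deg_blocks[OF cb(1)[OF this], of \<Phi>] conjunct2[OF F, THEN spec, of "blocks \<Phi> js w"]
      show "F (blocks \<Phi> js w) \<in> gr H (deg w + 2)" by simp
    qed
    ultimately show "?P (?\<Psi> F)"
      using mlin_Dop[OF H.vs \<Phi>m \<beta>_mlin] D\<Phi> by (intro conjI allI mlin_diff[OF H.vs] H.gr_diff) auto
  next
    fix n and F :: "(int \<times> 'h) list \<Rightarrow> 'h" assume "?P F"
    then show "?P (trunc n F)"
      using mlin_length[OF H.vs, of "smul H" F "\<lambda>l. l < n"] by (auto simp: trunc_def[abs_def] H.gr_0)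
  next
    fix F :: "(int \<times> 'h) list \<Rightarrow> 'h" assume F: "\<And>n. ?P (trunc n F)"
    have "F w \<in> gr H (deg w + 2)" for w
      using conjunct2[OF F[of "Suc (length w)"], THEN spec, of w] by (simp add: trunc_def)
    then show "?P F" using F by (blast intro: mlin_limit)
  qed
  then obtain b' where b'm: "mlin (smul H) (smul H) b'" and b'g: "\<And>w. b' w \<in> gr H (deg w + 2)"
    and rec: "\<And>w. b' w = ?\<Psi> b' w" by blast
  have eq: "Dop \<beta> \<Phi> w = Pop \<Phi> b' w" for w
    using rec[of w] Pop_top[OF \<Phi>1, of b' w] by simp
  have b'short: "b' w = 0" if "length w < 2" for w
  proof -
    have "Dop \<beta> \<Phi> w = Dop \<beta> (\<lambda>w. 0) w"
    proof (rule Dop_cong_short[OF \<beta>_short \<Phi>m mlin_0[OF H.vs]])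
      fix w' :: "(int \<times> 'h) list" assume "length w' < length w" "w' \<noteq> []"
      with that show "\<Phi> w' = 0" by (cases w') auto
    qed
    moreover have "?C w = {}"
      using that by (cases w; cases "tl w") (auto simp: comps_small)
    ultimately show ?thesis by (subst rec) (simp only: Dop_0 sum.empty diff_0_right)
  qed
  \<comment> \<open>Through \<open>Pop \<Phi>\<close> the square of the new coderivation becomes
    that of the old one, which is zero; \<open>Pop \<Phi>\<close> is injective.\<close>
  have b'sq: "Dop b' b' w = 0" for w
  proof (rule Pop_eq_0[of \<Phi> "Dop b' b'", OF \<Phi>1])
    fix w
    have "Pop \<Phi> (Dop b' b') w = Dop \<beta> (Pop \<Phi> b') w" by (rule Pop_Dop[OF b'm eq])
    also have "\<dots> = Dop \<beta> (Dop \<beta> \<Phi>) w" by (simp add: eq[abs_def])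
    also have "\<dots> = ins 0 (lt 3 (Dop \<beta> \<beta>)) \<Phi> w" by (rule Dop_Dop[OF \<Phi>m])
    also have "\<dots> = 0" by (simp add: ins_dec lt_def \<beta>_square mlin_zero[OF \<Phi>m])
    finally show "Pop \<Phi> (Dop b' b') w = 0" .
  qed
  have b'p: "prim b'"
  proof (rule prim_if_Pop[OF \<Phi>1])
    show "b' [] = 0" by (simp add: b'short)
    fix x y :: "(int \<times> 'h) list" assume xy: "x \<noteq> []" "y \<noteq> []"
    have "Pop \<Phi> (\<lambda>x'. Pop \<Phi> (sh b' x') y) x = sh (Pop \<Phi> b') x y"
      by (rule sh_Pop[OF b'm \<Phi>p, symmetric])
    also have "\<dots> = sh (Dop \<beta> \<Phi>) x y" by (simp add: eq[abs_def])
    also have "\<dots> = 0" using prim_Dop[OF \<Phi>m \<Phi>p \<beta>_prim] xy by (simp add: prim_def)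
    finally show "Pop \<Phi> (\<lambda>x'. Pop \<Phi> (sh b' x') y) x = 0" .
  qed
  define m where "m n = (if n < 2 then (\<lambda>_. 0) else unhat H b' n)" for n
  have m0: "m n = (\<lambda>_. 0)" if "n < 2" for n using that by (simp add: m_def)
  have mh: "m n \<in> hoch_maps H H n (2 - int n)" for n
    using HH.unhat_hoch[OF b'm b'g, of n] HH.hoch_0 by (simp add: m_def)
  have hat_m: "hat H m w = b' w" if "valid H w" for w
  proof (cases "length w < 2")
    case True
    then show ?thesis by (simp add: HH.hat_valid[OF that] m0 b'short)
  next
    case False
    then show ?thesis by (simp add: HH.hat_valid[OF that] m_def HH.unhat_valid[OF b'm that])
  qed
  have mharr: "m n \<in> harr_maps H H n (2 - int n)" for n
  proof (rule HH.harr_mapsI[OF mh])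
    fix x y :: "(int \<times> 'h) list" assume xy: "valid H x" "valid H y" "x \<noteq> []" "y \<noteq> []"
    have "sh (hat H m) x y = sh b' x y" by (rule sh_valid[OF _ xy(1,2)]) (rule hat_m)
    then show "sh (hat H m) x y = 0" using b'p xy by (simp add: prim_def)
  qed
  have alg: "cinf_algebra H m"
  proof (rule H.cinf_algebraI[OF mharr m0])
    fix w :: "(int \<times> 'h) list" assume w: "valid H w"
    have "Dop b' b' w = Dop (hat H m) (hat H m) w"
      by (rule Dop_valid_cong2[OF w]) (simp_all add: b'g hat_m)
    then show "Dop (hat H m) (hat H m) w = 0" by (simp add: b'sq)
  qed
  have mor: "cinf_morphism H \<mu> H m \<phi>"
  proof (rule HH.cinf_morphismI[OF \<phi>harr \<phi>0 \<mu>_hoch \<mu>_short mh m0])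
    fix w :: "(int \<times> 'h) list" assume w: "valid H w"
    have "Dop \<beta> (hat H \<phi>) w = Dop \<beta> \<Phi> w"
      by (rule Dop_valid_cong[OF w]) (simp_all add: \<beta>_gr \<Phi>valid)
    also have "\<dots> = Pop \<Phi> b' w" by (rule eq)
    also have "\<dots> = Pop (hat H \<phi>) (hat H m) w"
      by (rule Pop_valid_cong[OF w, where W = H, symmetric])
        (erule \<Phi>valid, rule HH.hat_gr[OF \<phi>h], erule hat_m)
    finally show "Dop \<beta> (hat H \<phi>) w = Pop (hat H \<phi>) (hat H m) w" .
  qed
  have iso: "cinf_isomorphism H \<mu> H m \<phi>"
    unfolding cinf_isomorphism_def
  proof (intro conjI mor)
    show "bij_betw (\<lambda>x. \<phi> 1 [x]) (total_space H) (total_space H)"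
      by (subst bij_betw_cong[of _ _ "\<lambda>x. x", OF id]) (simp_all add: bij_betw_def)
  qed
  have m2: "m 2 [x, y] = gmul H x y" if "x \<in> total_space H" "y \<in> total_space H" for x y
    using H.morphism_2[OF mor that] that
    by (simp only: id \<mu>_2 H.mul_cochain_eq H.gmul_total)
  have m2': "m 2 = mul_cochain H"
  proof
    fix xs show "m 2 xs = mul_cochain H xs"
    proof (cases "xs \<in> tensors H 2")
      case True
      then obtain x y where "xs = [x, y]" "x \<in> total_space H" "y \<in> total_space H"
        by (auto simp: H.tensors_iff length_Suc_conv numeral_2_eq_2)
      then show ?thesis by (simp add: m2 H.mul_cochain_eq)
    next
      case False
      then show ?thesis using HH.hoch_zero[OF mh False] by (simp add: mul_cochain_def on_tensors_def)
    qed
  qed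
  \<comment> \<open>With identity linear part, the arity-three morphism equation says that
    \<open>m 3\<close> is \<mu> 3 minus the coboundary of \<open>\<phi>\<^sub>2\<close>.\<close>
  have m3: "m 3 = (\<lambda>_. 0)"
  proof
    fix xs show "m 3 xs = 0"
    proof (cases "xs \<in> tensors H 3")
      case True
      then obtain x y z where xs: "xs = [x, y, z]"
        and xyz: "x \<in> total_space H" "y \<in> total_space H" "z \<in> total_space H"
        by (rule H.tensors_3E)
      have t: "\<phi>\<^sub>2 ys \<in> total_space H" "\<mu> 3 ys \<in> total_space H" for ys
        using HH.hoch_total[OF HH.harr_hoch[OF \<phi>2]] HH.hoch_total[OF \<mu>_hoch] by auto
      have p2: "\<phi> 2 = \<phi>\<^sub>2" by (simp add: \<phi>_def)
      have "\<mu> 3 [x, y, z] = gmul H (koszul H (-1) x) (\<phi>\<^sub>2 [y, z]) - \<phi>\<^sub>2 [gmul H x y, z]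
          + \<phi>\<^sub>2 [x, gmul H y z] - gmul H (\<phi>\<^sub>2 [x, y]) z"
        unfolding d[symmetric] by (rule H.hoch_d_2[OF xyz])
      moreover have "\<phi>\<^sub>2 [gmul H x y, z] - \<phi>\<^sub>2 [x, gmul H y z] + \<mu> 3 [x, y, z]
          = gmul H (koszul H (-1) x) (\<phi>\<^sub>2 [y, z]) - gmul H (\<phi>\<^sub>2 [x, y]) z + m 3 [x, y, z]"
        using H.morphism_3[OF mor xyz] xyz t
        by (simp only: id p2 \<mu>_2 m2 H.mul_cochain_eq H.koszul_total)
      ultimately show ?thesis by (simp add: xs)
    qed (rule HH.hoch_zero[OF mh])
  qed
  show ?thesis
    using alg m2' m3 iso id by (intro exI[of _ m] exI[of _ \<phi>]) (simp add: \<phi>_def)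
qed

section \<open>Formality\<close>

lemma zero_dif_simps [simp]:
  "smul (zero_dif H) = smul H" "gr (zero_dif H) = gr H" "gmul (zero_dif H) = gmul H"
  "gone (zero_dif H) = gone H" "dif (zero_dif H) = (\<lambda>_. 0)"
  "total_space (zero_dif H) = total_space H" "tproj (zero_dif H) = tproj H"
  "tmul (zero_dif H) = tmul H"
  by (auto simp: zero_dif_def total_space_def tproj_def tmul_def fun_eq_iff)

lemma tdif_zero_dif: "tdif (zero_dif H) x = 0"
  by (simp add: tdif_def)

text \<open>With zero differential the Maurer-Cartan equation equates the coderivation term of
  \<tau> with its convolution square, and for - \<tau> this is the equation of a morphism to the
  strict structure. Since zero is the only coboundary, the conditions of \<open>model\<close> on
  single letters say that the linear part is bijective.\<close>

lemma model_isomorphism: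
  assumes Z: "dgca (zero_dif H)" and \<tau>: "model H \<beta> (zero_dif H) \<tau>"
  shows "\<exists>\<phi>. cinf_isomorphism H \<mu> H (strict_cinf H) \<phi>"
proof -
  interpret Z: mc_words "smul H" "gr H" "tmul H" "gone H" "tdif (zero_dif H)" "smul H" \<beta>
    using dgca_mc_words[OF Z] by simp
  have "Z.MC \<tau>" using \<tau> by (simp add: model_def)
  then have \<tau>h: "Z.hom 1 \<tau>" and \<tau>p: "prim \<tau>" and curv: "\<And>w. Z.curv \<tau> w = 0"
    by (auto simp: Z.MC_def)
  have cob: "coboundaries (zero_dif H) = {0}" using H.total_0 by (auto simp: coboundaries_def)
  have inj: "x = 0" if "x \<in> gr H k" "\<tau> [(k, x)] = 0" for k x
    using \<tau>[unfolded model_def, THEN conjunct2, THEN conjunct1, THEN spec[of _ k], THEN bspec, OF that(1)]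
      that(2) by (simp add: cob)
  have surj: "\<exists>x\<in>gr H k. y = \<tau> [(k, x)]" if "y \<in> gr H k" for k y
    using \<tau>[unfolded model_def, THEN conjunct2, THEN conjunct2, THEN spec[of _ k], THEN bspec[of _ _ y]]
      that by (simp add: cob)
  define \<sigma> where "\<sigma> w = - \<tau> w" for w
  have \<sigma>m: "mlin (smul H) (smul H) \<sigma>" and \<sigma>g: "\<sigma> w \<in> gr H (deg w + 1)" for w
    using Z.hom_minus[OF \<tau>h] by (auto simp: Z.hom_def \<sigma>_def[abs_def])
  define \<phi> where "\<phi> = unhat H \<sigma>"
  have \<phi>h: "\<phi> n \<in> hoch_maps H H n (1 - int n)" for n
    unfolding \<phi>_def by (rule HH.unhat_hoch[OF \<sigma>m \<sigma>g])
  have hat\<phi>: "hat H \<phi> w = \<sigma> w" if "valid H w" for w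
    unfolding \<phi>_def by (rule HH.hat_unhat[OF \<sigma>m that])
  have \<phi>0: "\<phi> 0 = (\<lambda>_. 0)"
    by (auto simp: \<phi>_def unhat_def on_tensors_def H.tensors_iff \<sigma>_def prim_Nil[OF \<tau>p])
  have \<phi>harr: "\<phi> n \<in> harr_maps H H n (1 - int n)" for n
  proof (rule HH.harr_mapsI[OF \<phi>h])
    fix x y :: "(int \<times> 'h) list" assume xy: "valid H x" "valid H y" "x \<noteq> []" "y \<noteq> []"
    have "sh (hat H \<phi>) x y = sh \<sigma> x y" by (rule sh_valid[OF _ xy(1,2)]) (rule hat\<phi>)
    also have "\<dots> = - sh \<tau> x y" by (simp add: \<sigma>_def[abs_def] sh_minus)
    finally show "sh (hat H \<phi>) x y = 0" using \<tau>p xy by (simp add: prim_def)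
  qed
  have sh: "strict_cinf H n \<in> hoch_maps H H n (2 - int n)" for n
    using \<mu>_hoch[of 2] HH.hoch_0 by (simp add: strict_cinf_def \<mu>_2)
  have s0: "strict_cinf H n = (\<lambda>_. 0)" if "n < 2" for n
    using that by (simp add: strict_cinf_def)
  have mor: "cinf_morphism H \<mu> H (strict_cinf H) \<phi>"
  proof (rule HH.cinf_morphismI[OF \<phi>harr \<phi>0 \<mu>_hoch \<mu>_short sh s0])
    fix w :: "(int \<times> 'h) list" assume w: "valid H w"
    let ?G = "hat H (strict_cinf H)"
    have "Dop \<beta> (hat H \<phi>) w = Dop \<beta> \<sigma> w"
      by (rule Dop_valid_cong[OF w]) (simp_all add: \<beta>_gr hat\<phi>)
    also have "\<dots> = - Dop \<beta> \<tau> w" by (simp add: \<sigma>_def[abs_def] Dop_minus)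
    also have "\<dots> = - Z.cv 1 \<tau> \<tau> w"
      using curv[of w] by (simp add: Z.curv_eq tdif_zero_dif)
    also have "\<dots> = dec (\<lambda>u v. if u = [] \<or> v = [] then 0 else ?G [(deg u + 1, \<sigma> u), (deg v + 1, \<sigma> v)]) w"
      unfolding Z.cv_def dec_minus[symmetric]
    proof (rule dec_cong)
      fix u v
      have g: "\<sigma> u \<in> gr H (deg u + 1)" "\<sigma> v \<in> gr H (deg v + 1)" by (rule \<sigma>g)+
      \<comment> \<open>The exponent \<open>deg u + 1\<close> is the suspension sign of a word of
        two letters; its summand 1 supplies the minus sign in front of the convolution
        square.\<close>
      have "?G [(deg u + 1, \<sigma> u), (deg v + 1, \<sigma> v)] = sg (deg u + 1) (gmul H (\<sigma> u) (\<sigma> v))"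
        using g by (subst HH.hat_valid) (simp_all add: strict_cinf_def H.mul_cochain_eq H.gr_total)
      also have "gmul H (\<sigma> u) (\<sigma> v) = tmul H (\<tau> u) (\<tau> v)"
        using H.tmul_gr[OF g] by (simp add: \<sigma>_def Z.mul_minus_l Z.mul_minus_r)
      finally show "- sg (1 * deg u) (tmul H (\<tau> u) (\<tau> v))
          = (if u = [] \<or> v = [] then 0 else ?G [(deg u + 1, \<sigma> u), (deg v + 1, \<sigma> v)])"
        by (auto simp: sg_plus1 prim_Nil[OF \<tau>p])
    qed
    also have "\<dots> = Pop \<sigma> ?G w"
      by (rule Pop_binary[symmetric]) (simp add: hat_def strict_cinf_def)
    also have "\<dots> = Pop (hat H \<phi>) ?G w"
      by (rule Pop_valid_cong[OF w, where W = H]) (simp_all add: hat\<phi> \<sigma>g)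
    finally show "Dop \<beta> (hat H \<phi>) w = Pop (hat H \<phi>) ?G w" .
  qed
  have \<phi>1: "\<phi> 1 [x] = - \<tau> [(k, x)]" if "x \<in> gr H k" for x k
    using HH.unhat_valid[OF \<sigma>m, of "[(k, x)]" 1] that by (simp add: \<phi>_def \<sigma>_def)
  have "bij_betw (\<lambda>x. \<phi> 1 [x]) (total_space H) (total_space H)"
  proof (rule H.bij_betw_graded)
    show "graded_linear H H 0 (\<lambda>x. \<phi> 1 [x])"
      using H.graded_linear_hoch_1 \<phi>h[of 1] by simp
    show "x = 0" if "x \<in> gr H k" "\<phi> 1 [x] = 0" for k x
      using that inj by (simp only: \<phi>1 neg_equal_0_iff_equal)
    show "\<exists>x\<in>gr H k. \<phi> 1 [x] = y" if "y \<in> gr H k" for k y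
    proof -
      from surj[OF H.gr_minus[OF that]] obtain x where x: "x \<in> gr H k" "- y = \<tau> [(k, x)]" ..
      then have "\<phi> 1 [x] = y" using \<phi>1[OF x(1)] by (simp add: minus_equation_iff)
      then show ?thesis using x(1) ..
    qed
  qed
  with mor show ?thesis by (auto simp: cinf_isomorphism_def)
qed

lemma formal_isomorphism:
  assumes "formal TYPE('b::ab_group_add) A H"
  shows "\<exists>\<phi>. cinf_isomorphism H \<mu> H (strict_cinf H) \<phi>"
proof -
  obtain C D :: "('k, 'b) dgca_data" where CD: "qi_link A C" "qi_link\<^sup>*\<^sup>* C D" "qi_link D (zero_dif H)"
    using assms by (auto simp: formal_def)
  have "\<exists>\<tau>. model H \<beta> C \<tau>" by (rule model_link[OF CD(1)]) (use mc_model in blast)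
  then have "\<exists>\<tau>. model H \<beta> D \<tau>" by (rule model_links[OF CD(2)])
  then obtain \<tau> where "model H \<beta> (zero_dif H) \<tau>" using model_link[OF CD(3)] by blast
  moreover have "dgca (zero_dif H)" using CD(3) by (auto simp: qi_link_def quasi_iso_def)
  ultimately show ?thesis by (rule model_isomorphism[rotated])
qed

end

theorem lemma3p2:
  fixes n :: nat
    and A :: "('k::field_char_0, 'a::ab_group_add) dgca_data"
    and H :: "('k, 'h::ab_group_add) gca_data"
    and cls :: "'a \<Rightarrow> 'h"
    and I :: "'h \<Rightarrow> 'k"
    and h :: "'a \<Rightarrow> 'a"
  assumes "poincare_dgca n A H cls I"
    and "simply_connected H"
    and "hodge_homotopy n A cls I h"
  shows
    "cinf_algebra H (transferred A H cls h) \<and>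
     cinf_unital H (transferred A H cls h) \<and>
     transferred A H cls h 2 = mul_cochain H \<and>
     transferred A H cls h 3 = mu3 A H cls h \<and>
     mu3 A H cls h \<in> harr_cocycles H 3 (-1) \<and>
     harr_class H 3 (-1) (mu3 A H cls h) \<in> HHarr H 3 (-1) \<and>
     (formal TYPE('b::ab_group_add) A H \<longrightarrow>
       (\<exists>\<phi>. cinf_isomorphism H (transferred A H cls h) H (strict_cinf H) \<phi>) \<and>
       harr_class H 3 (-1) (mu3 A H cls h) = harr_class H 3 (-1) (\<lambda>_. 0)) \<and>
     (\<forall>\<phi>. cinf_isomorphism H (transferred A H cls h) H (strict_cinf H) \<phi> \<and>
         (\<forall>x\<in>total_space H. \<phi> 1 [x] = x) \<longrightarrow>
       \<phi> 2 \<in> CHarr H 2 (-1) \<and> hoch_d H 2 (-1) (\<phi> 2) = mu3 A H cls h) \<and>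
     (\<forall>\<phi>\<^sub>2\<in>CHarr H 2 (-1). hoch_d H 2 (-1) \<phi>\<^sub>2 = mu3 A H cls h \<longrightarrow>
       (\<exists>m \<phi>. cinf_algebra H m \<and> m 2 = mul_cochain H \<and> m 3 = (\<lambda>_. 0) \<and>
          cinf_isomorphism H (transferred A H cls h) H m \<phi> \<and>
          (\<forall>x\<in>total_space H. \<phi> 1 [x] = x) \<and> \<phi> 2 = \<phi>\<^sub>2)) \<and>
     (harr_class H 3 (-1) (mu3 A H cls h) = harr_class H 3 (-1) (\<lambda>_. 0) \<longleftrightarrow>
       (\<exists>m \<phi>. cinf_algebra H m \<and> m 2 = mul_cochain H \<and> m 3 = (\<lambda>_. 0) \<and>
          cinf_isomorphism H (transferred A H cls h) H m \<phi>))"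
proof -
  have "hodge_dgca A H cls h"
  proof -
    interpret P: poincare_dgca n A H cls I by (rule assms(1))
    \<comment> \<open>The image of the unit has degree -1, and a Poincare DGCA vanishes in negative
      degrees.\<close>
    have "h (gone A) \<in> gr A (0 + (-1))"
      using assms(3) P.one_gr unfolding hodge_homotopy_def graded_linear_def by blast
    then have "h (gone A) = 0" using P.degrees[of "-1"] by simp
    then show ?thesis
      using assms(3) by unfold_locales (auto simp: hodge_homotopy_def)
  qed
  then interpret hodge_dgca A H cls h .
  have coc: "mu3 A H cls h \<in> harr_cocycles H 3 (-1)"
    using H.cinf_cocycle[OF \<mu>_cinf \<mu>_2] by (simp add: \<mu>_3)
  then have \<mu>3: "\<mu> 3 \<in> CHarr H 3 (-1)" by (simp add: harr_cocycles_def \<mu>_3)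
  have cls: "harr_class H 3 (-1) (mu3 A H cls h) \<in> HHarr H 3 (-1)"
    using coc by (simp add: harr_class_def HHarr_def quotientI)
  have strict: "strict_cinf H 2 = mul_cochain H" "strict_cinf H 3 = (\<lambda>_. 0)"
    by (simp_all add: strict_cinf_def)
  note zero_iff = H.harr_class_zero_iff[OF coc]
  \<comment> \<open>An isomorphism obtained from a zig-zag need not have the identity as linear
    part, so the unnormalised form of \<open>isomorphism_coboundary\<close> is required.\<close>
  have sufficient: "harr_class H 3 (-1) (mu3 A H cls h) = harr_class H 3 (-1) (\<lambda>_. 0)"
    if "cinf_isomorphism H \<mu> H m \<phi>" "m 2 = mul_cochain H" "m 3 = (\<lambda>_. 0)" for m \<phi>
    using H.isomorphism_coboundary(1)[OF that(1) \<mu>_2 that(2,3) \<mu>3] by (simp add: zero_iff \<mu>_3)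
  have normalized: "\<phi> 2 \<in> CHarr H 2 (-1) \<and> hoch_d H 2 (-1) (\<phi> 2) = mu3 A H cls h"
    if "cinf_isomorphism H \<mu> H (strict_cinf H) \<phi>" "\<forall>x\<in>total_space H. \<phi> 1 [x] = x" for \<phi>
    using H.isomorphism_coboundary(2)[OF that(1) \<mu>_2 strict \<mu>3 that(2)] by (simp add: \<mu>_3)
  have secondary: "\<exists>m \<phi>. cinf_algebra H m \<and> m 2 = mul_cochain H \<and> m 3 = (\<lambda>_. 0) \<and>
      cinf_isomorphism H \<mu> H m \<phi> \<and> (\<forall>x\<in>total_space H. \<phi> 1 [x] = x) \<and> \<phi> 2 = \<phi>\<^sub>2"
    if "\<phi>\<^sub>2 \<in> CHarr H 2 (-1)" "hoch_d H 2 (-1) \<phi>\<^sub>2 = mu3 A H cls h" for \<phi>\<^sub>2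
    by (rule secondary_structure) (simp_all add: that \<mu>_3)
  have formality: "(\<exists>\<phi>. cinf_isomorphism H \<mu> H (strict_cinf H) \<phi>) \<and>
      harr_class H 3 (-1) (mu3 A H cls h) = harr_class H 3 (-1) (\<lambda>_. 0)"
    if "formal TYPE('b) A H"
    using formal_isomorphism[OF that] sufficient[OF _ strict] by blast
  have iff: "harr_class H 3 (-1) (mu3 A H cls h) = harr_class H 3 (-1) (\<lambda>_. 0) \<longleftrightarrow>
       (\<exists>m \<phi>. cinf_algebra H m \<and> m 2 = mul_cochain H \<and> m 3 = (\<lambda>_. 0) \<and> cinf_isomorphism H \<mu> H m \<phi>)"
    using sufficient secondary unfolding zero_iff by blast
  show ?thesis
    using \<mu>_cinf \<mu>_unital \<mu>_2 \<mu>_3 coc cls formality normalized secondary iff by blast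
qed

end
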